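(* Let $\mathcal{C}$ be the even part of the $3^{\mathbb{Z}/2\mathbb{Z}\times\mathbb{Z}/2\mathbb{Z}}$ subfactor, let $\mathcal{C}_2=\mathcal{C}\rtimes\mathbb{Z}/3\mathbb{Z}$, and let $\mathcal{C}_4$ be the dual category of $\mathcal{C}_2$ with respect to the algebra $1+\alpha_g\rho$, $g\neq0$. The category $\mathcal{C}_4$ (with the $\mathbb{Z}/3\mathbb{Z}$-grading inherited from $\mathcal{C}_2$) is a $\mathbb{Z}/3\mathbb{Z}$-graded extension of $\mathcal{C}$, and neither of its nontrivial homogeneous components contains an invertible object.
   Context: Fusion categories are over $\mathbb{C}$. A $K$-graded extension of a fusion category $\mathcal{C}$ ($K$ a finite group) is a fusion category with a faithful $K$-grading whose trivial component is equivalent to $\mathcal{C}$. The dual category of a fusion category with respect to a division algebra $A$ is the fusion category of $A$-$A$ bimodules; if $A$ lies in the trivial component of a $K$-graded fusion category, the category of $A$-$A$ bimodules inherits a $K$-grading. A Q-system in a unitary fusion category is an algebra whose multiplication map is a co-isometry. Let $G=\mathbb{Z}/2\mathbb{Z}\times\mathbb{Z}/2\mathbb{Z}$. $\mathcal{C}$ is the unitary fusion category with simple objects $\alpha_g,\ \alpha_g\rho$ ($g\in G$), where the $\alpha_g$ are the simple objects of a full tensor subcategory equivalent to $\mathrm{Vec}_G$, with $\alpha_g\rho\cong\rho\,\alpha_{g^{-1}}$ and $\rho\otimes\rho\cong 1\oplus\bigoplus_{g\in G}\alpha_g\rho$, and such that $1\oplus\rho$ admits a Q-system; the corresponding subfactor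 is the $3^G$ subfactor, known to be unique and self-dual, and each $1+\alpha_g\rho$ has a unique Q-system structure. $\mathcal{C}$ is realized inside the category $\mathrm{End}_0(M)$ of finite-index endomorphisms of a type III factor $M$, with $\alpha_g\alpha_h=\alpha_{gh}$ and $\alpha_g\rho=\rho\alpha_{g^{-1}}$ exactly. By a result of Izumi there is an order three automorphism $\gamma$ of $M$ commuting with $\rho$ and with $\gamma\alpha_g=\alpha_{\theta(g)}\gamma$, where $\theta$ cyclically permutes the nontrivial elements of $G$; conjugation by $\gamma$ gives an action of $\mathbb{Z}/3\mathbb{Z}$ on $\mathcal{C}$. $\mathcal{C}_2=\mathcal{C}\rtimes\mathbb{Z}/3\mathbb{Z}$ is the crossed product, i.e. the category generated by $\mathcal{C}$ and $\gamma$, a $\mathbb{Z}/3\mathbb{Z}$-graded extension of $\mathcal{C}$. $\mathcal{C}_4$ does not depend on the choice of $0\ne g\in G$, by conjugation by $\gamma$. *)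

theory Defs
  imports
    "HOL-Analysis.Analysis"
    "HOL-Algebra.Elementary_Groups"
    "HOL-Library.Z2"
    "HOL-Library.Product_Plus"
begin

section \<open>Linear monoidal categories\<close>

text \<open>
  Morphisms live in an ambient abelian group \<open>'m\<close>, and the \<open>Mor X Y\<close> are subgroups of it that may
  overlap. This is why the tensor product of two morphisms takes their sources and targets as
  arguments: \<open>TenM C X X' Y Y' f g\<close> is the tensor product of \<open>f : X \<rightarrow> X'\<close> and \<open>g : Y \<rightarrow> Y'\<close>.
  The associator \<open>Asc C X Y Z\<close> goes from \<open>(X \<otimes> Y) \<otimes> Z\<close> to \<open>X \<otimes> (Y \<otimes> Z)\<close>.
\<close>

record ('o, 'm) moncat =
  Ob :: "'o set"
  Mor :: "'o \<Rightarrow> 'o \<Rightarrow> 'm set"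
  Cmp :: "'m \<Rightarrow> 'm \<Rightarrow> 'm"  (infixr "\<cdot>\<index>" 75)
  Idm :: "'o \<Rightarrow> 'm"
  Scl :: "complex \<Rightarrow> 'm \<Rightarrow> 'm"
  TenO :: "'o \<Rightarrow> 'o \<Rightarrow> 'o"  (infixr "\<odot>\<index>" 80)
  TenM :: "'o \<Rightarrow> 'o \<Rightarrow> 'o \<Rightarrow> 'o \<Rightarrow> 'm \<Rightarrow> 'm \<Rightarrow> 'm"
  Unt :: "'o"
  Asc :: "'o \<Rightarrow> 'o \<Rightarrow> 'o \<Rightarrow> 'm"
  LUn :: "'o \<Rightarrow> 'm"
  RUn :: "'o \<Rightarrow> 'm"

definition is_inverse ::
    "('o, 'm, 'z) moncat_scheme \<Rightarrow> 'o \<Rightarrow> 'o \<Rightarrow> 'm \<Rightarrow> 'm \<Rightarrow> bool" where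
  "is_inverse C X Y f g \<longleftrightarrow>
     f \<in> Mor C X Y \<and> g \<in> Mor C Y X \<and> g \<cdot>\<^bsub>C\<^esub> f = Idm C X \<and> f \<cdot>\<^bsub>C\<^esub> g = Idm C Y"

definition is_iso :: "('o, 'm, 'z) moncat_scheme \<Rightarrow> 'o \<Rightarrow> 'o \<Rightarrow> 'm \<Rightarrow> bool" where
  "is_iso C X Y f \<longleftrightarrow> (\<exists>g. is_inverse C X Y f g)"

definition inv_mor :: "('o, 'm, 'z) moncat_scheme \<Rightarrow> 'o \<Rightarrow> 'o \<Rightarrow> 'm \<Rightarrow> 'm" where
  "inv_mor C X Y f = (THE g. is_inverse C X Y f g)"

definition isomorphic :: "('o, 'm, 'z) moncat_scheme \<Rightarrow> 'o \<Rightarrow> 'o \<Rightarrow> bool" where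
  "isomorphic C X Y \<longleftrightarrow> (\<exists>f. is_iso C X Y f)"

text \<open>Whiskering: \<open>id \<otimes> g\<close> and \<open>f \<otimes> id\<close>.\<close>

definition lwhisk :: "('o, 'm, 'z) moncat_scheme \<Rightarrow> 'o \<Rightarrow> 'o \<Rightarrow> 'o \<Rightarrow> 'm \<Rightarrow> 'm" where
  "lwhisk C X Y Y' g = TenM C X X Y Y' (Idm C X) g"

definition rwhisk :: "('o, 'm, 'z) moncat_scheme \<Rightarrow> 'o \<Rightarrow> 'o \<Rightarrow> 'o \<Rightarrow> 'm \<Rightarrow> 'm" where
  "rwhisk C X X' Y f = TenM C X X' Y Y f (Idm C Y)"

definition full_subcategory :: "('o, 'm) moncat \<Rightarrow> 'o set \<Rightarrow> ('o, 'm) moncat" where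
  "full_subcategory C S = C\<lparr>Ob := S\<rparr>"

locale linear_category =
  fixes C :: "('o, 'm::ab_group_add, 'z) moncat_scheme" (structure)
  assumes Idm_in: "X \<in> Ob C \<Longrightarrow> Idm C X \<in> Mor C X X"
    and Cmp_in: "\<lbrakk>X \<in> Ob C; Y \<in> Ob C; Z \<in> Ob C; f \<in> Mor C X Y; g \<in> Mor C Y Z\<rbrakk>
          \<Longrightarrow> g \<cdot> f \<in> Mor C X Z"
    and Cmp_assoc: "\<lbrakk>W \<in> Ob C; X \<in> Ob C; Y \<in> Ob C; Z \<in> Ob C;
            f \<in> Mor C W X; g \<in> Mor C X Y; h \<in> Mor C Y Z\<rbrakk> \<Longrightarrow> (h \<cdot> g) \<cdot> f = h \<cdot> g \<cdot> f"
    and Cmp_Idm_left: "\<lbrakk>X \<in> Ob C; Y \<in> Ob C; f \<in> Mor C X Y\<rbrakk> \<Longrightarrow> Idm C Y \<cdot> f = f"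
    and Cmp_Idm_right: "\<lbrakk>X \<in> Ob C; Y \<in> Ob C; f \<in> Mor C X Y\<rbrakk> \<Longrightarrow> f \<cdot> Idm C X = f"
    and zero_in: "\<lbrakk>X \<in> Ob C; Y \<in> Ob C\<rbrakk> \<Longrightarrow> 0 \<in> Mor C X Y"
    and add_in: "\<lbrakk>X \<in> Ob C; Y \<in> Ob C; f \<in> Mor C X Y; f' \<in> Mor C X Y\<rbrakk> \<Longrightarrow> f + f' \<in> Mor C X Y"
    and Scl_in: "\<lbrakk>X \<in> Ob C; Y \<in> Ob C; f \<in> Mor C X Y\<rbrakk> \<Longrightarrow> Scl C a f \<in> Mor C X Y"
    and Scl_one: "\<lbrakk>X \<in> Ob C; Y \<in> Ob C; f \<in> Mor C X Y\<rbrakk> \<Longrightarrow> Scl C 1 f = f"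
    and Scl_Scl: "\<lbrakk>X \<in> Ob C; Y \<in> Ob C; f \<in> Mor C X Y\<rbrakk> \<Longrightarrow> Scl C a (Scl C b f) = Scl C (a * b) f"
    and Scl_add_left: "\<lbrakk>X \<in> Ob C; Y \<in> Ob C; f \<in> Mor C X Y\<rbrakk>
          \<Longrightarrow> Scl C (a + b) f = Scl C a f + Scl C b f"
    and Scl_add_right: "\<lbrakk>X \<in> Ob C; Y \<in> Ob C; f \<in> Mor C X Y; f' \<in> Mor C X Y\<rbrakk>
          \<Longrightarrow> Scl C a (f + f') = Scl C a f + Scl C a f'"
    and Cmp_add_left: "\<lbrakk>X \<in> Ob C; Y \<in> Ob C; Z \<in> Ob C; f \<in> Mor C X Y; g \<in> Mor C Y Z; g' \<in> Mor C Y Z\<rbrakk>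
          \<Longrightarrow> (g + g') \<cdot> f = g \<cdot> f + g' \<cdot> f"
    and Cmp_add_right: "\<lbrakk>X \<in> Ob C; Y \<in> Ob C; Z \<in> Ob C; f \<in> Mor C X Y; f' \<in> Mor C X Y; g \<in> Mor C Y Z\<rbrakk>
          \<Longrightarrow> g \<cdot> (f + f') = g \<cdot> f + g \<cdot> f'"
    and Cmp_Scl_left: "\<lbrakk>X \<in> Ob C; Y \<in> Ob C; Z \<in> Ob C; f \<in> Mor C X Y; g \<in> Mor C Y Z\<rbrakk>
          \<Longrightarrow> Scl C a g \<cdot> f = Scl C a (g \<cdot> f)"
    and Cmp_Scl_right: "\<lbrakk>X \<in> Ob C; Y \<in> Ob C; Z \<in> Ob C; f \<in> Mor C X Y; g \<in> Mor C Y Z\<rbrakk>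
          \<Longrightarrow> g \<cdot> Scl C a f = Scl C a (g \<cdot> f)"

locale linear_monoidal_category = linear_category +
  assumes Unt_in: "Unt C \<in> Ob C"
    and TenO_in: "\<lbrakk>X \<in> Ob C; Y \<in> Ob C\<rbrakk> \<Longrightarrow> X \<odot> Y \<in> Ob C"
    and TenM_in: "\<lbrakk>X \<in> Ob C; X' \<in> Ob C; Y \<in> Ob C; Y' \<in> Ob C; f \<in> Mor C X X'; g \<in> Mor C Y Y'\<rbrakk>
          \<Longrightarrow> TenM C X X' Y Y' f g \<in> Mor C (X \<odot> Y) (X' \<odot> Y')"
    and TenM_Idm: "\<lbrakk>X \<in> Ob C; Y \<in> Ob C\<rbrakk> \<Longrightarrow> TenM C X X Y Y (Idm C X) (Idm C Y) = Idm C (X \<odot> Y)"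
    and TenM_Cmp: "\<lbrakk>X \<in> Ob C; X' \<in> Ob C; X'' \<in> Ob C; Y \<in> Ob C; Y' \<in> Ob C; Y'' \<in> Ob C;
            f \<in> Mor C X X'; f' \<in> Mor C X' X''; g \<in> Mor C Y Y'; g' \<in> Mor C Y' Y''\<rbrakk>
          \<Longrightarrow> TenM C X X'' Y Y'' (f' \<cdot> f) (g' \<cdot> g) = TenM C X' X'' Y' Y'' f' g' \<cdot> TenM C X X' Y Y' f g"
    and TenM_add_left: "\<lbrakk>X \<in> Ob C; X' \<in> Ob C; Y \<in> Ob C; Y' \<in> Ob C;
            f \<in> Mor C X X'; f' \<in> Mor C X X'; g \<in> Mor C Y Y'\<rbrakk>
          \<Longrightarrow> TenM C X X' Y Y' (f + f') g = TenM C X X' Y Y' f g + TenM C X X' Y Y' f' g"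
    and TenM_add_right: "\<lbrakk>X \<in> Ob C; X' \<in> Ob C; Y \<in> Ob C; Y' \<in> Ob C;
            f \<in> Mor C X X'; g \<in> Mor C Y Y'; g' \<in> Mor C Y Y'\<rbrakk>
          \<Longrightarrow> TenM C X X' Y Y' f (g + g') = TenM C X X' Y Y' f g + TenM C X X' Y Y' f g'"
    and TenM_Scl_left: "\<lbrakk>X \<in> Ob C; X' \<in> Ob C; Y \<in> Ob C; Y' \<in> Ob C; f \<in> Mor C X X'; g \<in> Mor C Y Y'\<rbrakk>
          \<Longrightarrow> TenM C X X' Y Y' (Scl C a f) g = Scl C a (TenM C X X' Y Y' f g)"
    and TenM_Scl_right: "\<lbrakk>X \<in> Ob C; X' \<in> Ob C; Y \<in> Ob C; Y' \<in> Ob C; f \<in> Mor C X X'; g \<in> Mor C Y Y'\<rbrakk>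
          \<Longrightarrow> TenM C X X' Y Y' f (Scl C a g) = Scl C a (TenM C X X' Y Y' f g)"
    and Asc_iso: "\<lbrakk>X \<in> Ob C; Y \<in> Ob C; Z \<in> Ob C\<rbrakk>
          \<Longrightarrow> is_iso C ((X \<odot> Y) \<odot> Z) (X \<odot> Y \<odot> Z) (Asc C X Y Z)"
    and Asc_natural: "\<lbrakk>X \<in> Ob C; X' \<in> Ob C; Y \<in> Ob C; Y' \<in> Ob C; Z \<in> Ob C; Z' \<in> Ob C;
            f \<in> Mor C X X'; g \<in> Mor C Y Y'; h \<in> Mor C Z Z'\<rbrakk>
          \<Longrightarrow> Asc C X' Y' Z' \<cdot> TenM C (X \<odot> Y) (X' \<odot> Y') Z Z' (TenM C X X' Y Y' f g) h
            = TenM C X X' (Y \<odot> Z) (Y' \<odot> Z') f (TenM C Y Y' Z Z' g h) \<cdot> Asc C X Y Z"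
    and LUn_iso: "X \<in> Ob C \<Longrightarrow> is_iso C (Unt C \<odot> X) X (LUn C X)"
    and LUn_natural: "\<lbrakk>X \<in> Ob C; X' \<in> Ob C; f \<in> Mor C X X'\<rbrakk>
          \<Longrightarrow> LUn C X' \<cdot> lwhisk C (Unt C) X X' f = f \<cdot> LUn C X"
    and RUn_iso: "X \<in> Ob C \<Longrightarrow> is_iso C (X \<odot> Unt C) X (RUn C X)"
    and RUn_natural: "\<lbrakk>X \<in> Ob C; X' \<in> Ob C; f \<in> Mor C X X'\<rbrakk>
          \<Longrightarrow> RUn C X' \<cdot> rwhisk C X X' (Unt C) f = f \<cdot> RUn C X"
    and pentagon: "\<lbrakk>W \<in> Ob C; X \<in> Ob C; Y \<in> Ob C; Z \<in> Ob C\<rbrakk>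
          \<Longrightarrow> Asc C W X (Y \<odot> Z) \<cdot> Asc C (W \<odot> X) Y Z
            = lwhisk C W ((X \<odot> Y) \<odot> Z) (X \<odot> Y \<odot> Z) (Asc C X Y Z) \<cdot> Asc C W (X \<odot> Y) Z
                \<cdot> rwhisk C ((W \<odot> X) \<odot> Y) (W \<odot> X \<odot> Y) Z (Asc C W X Y)"
    and triangle: "\<lbrakk>X \<in> Ob C; Y \<in> Ob C\<rbrakk>
          \<Longrightarrow> lwhisk C X (Unt C \<odot> Y) Y (LUn C Y) \<cdot> Asc C X (Unt C) Y
            = rwhisk C (X \<odot> Unt C) X Y (RUn C X)"


section \<open>Fusion categories, tensor equivalences and graded extensions\<close>

text \<open>For an empty list this says that \<open>Z\<close> is a zero object.\<close>

definition is_direct_sum :: "('o, 'm::ab_group_add, 'z) moncat_scheme \<Rightarrow> 'o \<Rightarrow> 'o list \<Rightarrow> bool" where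
  "is_direct_sum C Z Xs \<longleftrightarrow> (\<exists>i p.
     (\<forall>k<length Xs. i k \<in> Mor C (Xs ! k) Z \<and> p k \<in> Mor C Z (Xs ! k)) \<and>
     (\<forall>j<length Xs. \<forall>k<length Xs. p j \<cdot>\<^bsub>C\<^esub> i k = (if j = k then Idm C (Xs ! k) else 0)) \<and>
     (\<Sum>k<length Xs. i k \<cdot>\<^bsub>C\<^esub> p k) = Idm C Z)"

text \<open>In a semisimple category over the algebraically closed field of complex numbers, with
  finite-dimensional morphism spaces, an object is simple iff all its endomorphisms are scalar and
  it is nonzero.\<close>

definition simple_object :: "('o, 'm::ab_group_add, 'z) moncat_scheme \<Rightarrow> 'o \<Rightarrow> bool" where
  "simple_object C X \<longleftrightarrow> X \<in> Ob C \<and> Idm C X \<noteq> 0 \<and> Mor C X X = range (\<lambda>a. Scl C a (Idm C X))"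

text \<open>\<open>Y\<close> is a left dual of \<open>X\<close>, that is, \<open>X\<close> is a right dual of \<open>Y\<close>.\<close>

definition is_left_dual :: "('o, 'm, 'z) moncat_scheme \<Rightarrow> 'o \<Rightarrow> 'o \<Rightarrow> bool" where
  "is_left_dual C X Y \<longleftrightarrow> (\<exists>ev coev.
     ev \<in> Mor C (Y \<odot>\<^bsub>C\<^esub> X) (Unt C) \<and> coev \<in> Mor C (Unt C) (X \<odot>\<^bsub>C\<^esub> Y) \<and>
     RUn C X \<cdot>\<^bsub>C\<^esub> lwhisk C X (Y \<odot>\<^bsub>C\<^esub> X) (Unt C) ev \<cdot>\<^bsub>C\<^esub> Asc C X Y X
         \<cdot>\<^bsub>C\<^esub> rwhisk C (Unt C) (X \<odot>\<^bsub>C\<^esub> Y) X coev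
       = LUn C X \<and>
     LUn C Y \<cdot>\<^bsub>C\<^esub> rwhisk C (Y \<odot>\<^bsub>C\<^esub> X) (Unt C) Y ev
         \<cdot>\<^bsub>C\<^esub> inv_mor C ((Y \<odot>\<^bsub>C\<^esub> X) \<odot>\<^bsub>C\<^esub> Y) (Y \<odot>\<^bsub>C\<^esub> X \<odot>\<^bsub>C\<^esub> Y) (Asc C Y X Y)
         \<cdot>\<^bsub>C\<^esub> lwhisk C Y (Unt C) (X \<odot>\<^bsub>C\<^esub> Y) coev
       = RUn C Y)"

text \<open>\<open>additive\<close>, \<open>idempotents_split\<close> and \<open>semisimple\<close> together say that the category is abelian
  and semisimple, with finitely many simple objects up to isomorphism and finite-dimensional
  morphism spaces.\<close>

locale fusion_category = linear_monoidal_category +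
  assumes additive: "set Xs \<subseteq> Ob C \<Longrightarrow> \<exists>Z\<in>Ob C. is_direct_sum C Z Xs"
    and idempotents_split: "\<lbrakk>X \<in> Ob C; e \<in> Mor C X X; e \<cdot> e = e\<rbrakk>
          \<Longrightarrow> \<exists>Y\<in>Ob C. \<exists>r\<in>Mor C X Y. \<exists>s\<in>Mor C Y X. r \<cdot> s = Idm C Y \<and> s \<cdot> r = e"
    and semisimple: "\<exists>S. finite S \<and> (\<forall>X\<in>S. simple_object C X) \<and>
          (\<forall>X\<in>S. \<forall>Y\<in>S. X \<noteq> Y \<longrightarrow> Mor C X Y = {0}) \<and>
          (\<forall>X\<in>Ob C. \<exists>Xs. set Xs \<subseteq> S \<and> is_direct_sum C X Xs)"
    and simple_unit: "simple_object C (Unt C)"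
    and left_dual: "X \<in> Ob C \<Longrightarrow> \<exists>Y\<in>Ob C. is_left_dual C X Y"
    and right_dual: "X \<in> Ob C \<Longrightarrow> \<exists>Y\<in>Ob C. is_left_dual C Y X"

text \<open>A linear tensor functor \<open>(F, J, e)\<close>, with \<open>J X Y : F X \<otimes> F Y \<rightarrow> F (X \<otimes> Y)\<close> and
  \<open>e : 1 \<rightarrow> F 1\<close>, that is an equivalence of categories.\<close>

locale tensor_equivalence =
  fixes C :: "('o, 'm::ab_group_add) moncat" and D :: "('p, 'n::ab_group_add) moncat"
    and FO :: "'o \<Rightarrow> 'p" and FM :: "'o \<Rightarrow> 'o \<Rightarrow> 'm \<Rightarrow> 'n"
    and J :: "'o \<Rightarrow> 'o \<Rightarrow> 'n" and e :: 'n
  assumes FO_in: "X \<in> Ob C \<Longrightarrow> FO X \<in> Ob D"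
    and FM_bij: "\<lbrakk>X \<in> Ob C; Y \<in> Ob C\<rbrakk> \<Longrightarrow> bij_betw (FM X Y) (Mor C X Y) (Mor D (FO X) (FO Y))"
    and FM_Idm: "X \<in> Ob C \<Longrightarrow> FM X X (Idm C X) = Idm D (FO X)"
    and FM_Cmp: "\<lbrakk>X \<in> Ob C; Y \<in> Ob C; Z \<in> Ob C; f \<in> Mor C X Y; g \<in> Mor C Y Z\<rbrakk>
          \<Longrightarrow> FM X Z (g \<cdot>\<^bsub>C\<^esub> f) = FM Y Z g \<cdot>\<^bsub>D\<^esub> FM X Y f"
    and FM_add: "\<lbrakk>X \<in> Ob C; Y \<in> Ob C; f \<in> Mor C X Y; f' \<in> Mor C X Y\<rbrakk>
          \<Longrightarrow> FM X Y (f + f') = FM X Y f + FM X Y f'"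
    and FM_Scl: "\<lbrakk>X \<in> Ob C; Y \<in> Ob C; f \<in> Mor C X Y\<rbrakk> \<Longrightarrow> FM X Y (Scl C a f) = Scl D a (FM X Y f)"
    and essentially_surjective: "V \<in> Ob D \<Longrightarrow> \<exists>X\<in>Ob C. isomorphic D (FO X) V"
    and J_iso: "\<lbrakk>X \<in> Ob C; Y \<in> Ob C\<rbrakk>
          \<Longrightarrow> is_iso D (FO X \<odot>\<^bsub>D\<^esub> FO Y) (FO (X \<odot>\<^bsub>C\<^esub> Y)) (J X Y)"
    and J_natural: "\<lbrakk>X \<in> Ob C; X' \<in> Ob C; Y \<in> Ob C; Y' \<in> Ob C; f \<in> Mor C X X'; g \<in> Mor C Y Y'\<rbrakk>
          \<Longrightarrow> FM (X \<odot>\<^bsub>C\<^esub> Y) (X' \<odot>\<^bsub>C\<^esub> Y') (TenM C X X' Y Y' f g) \<cdot>\<^bsub>D\<^esub> J X Y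
            = J X' Y' \<cdot>\<^bsub>D\<^esub> TenM D (FO X) (FO X') (FO Y) (FO Y') (FM X X' f) (FM Y Y' g)"
    and J_assoc: "\<lbrakk>X \<in> Ob C; Y \<in> Ob C; Z \<in> Ob C\<rbrakk>
          \<Longrightarrow> FM ((X \<odot>\<^bsub>C\<^esub> Y) \<odot>\<^bsub>C\<^esub> Z) (X \<odot>\<^bsub>C\<^esub> Y \<odot>\<^bsub>C\<^esub> Z) (Asc C X Y Z) \<cdot>\<^bsub>D\<^esub> J (X \<odot>\<^bsub>C\<^esub> Y) Z
                \<cdot>\<^bsub>D\<^esub> rwhisk D (FO X \<odot>\<^bsub>D\<^esub> FO Y) (FO (X \<odot>\<^bsub>C\<^esub> Y)) (FO Z) (J X Y)
            = J X (Y \<odot>\<^bsub>C\<^esub> Z) \<cdot>\<^bsub>D\<^esub> lwhisk D (FO X) (FO Y \<odot>\<^bsub>D\<^esub> FO Z) (FO (Y \<odot>\<^bsub>C\<^esub> Z)) (J Y Z)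
                \<cdot>\<^bsub>D\<^esub> Asc D (FO X) (FO Y) (FO Z)"
    and e_iso: "is_iso D (Unt D) (FO (Unt C)) e"
    and e_left: "X \<in> Ob C \<Longrightarrow>
          FM (Unt C \<odot>\<^bsub>C\<^esub> X) X (LUn C X) \<cdot>\<^bsub>D\<^esub> J (Unt C) X
            \<cdot>\<^bsub>D\<^esub> rwhisk D (Unt D) (FO (Unt C)) (FO X) e = LUn D (FO X)"
    and e_right: "X \<in> Ob C \<Longrightarrow>
          FM (X \<odot>\<^bsub>C\<^esub> Unt C) X (RUn C X) \<cdot>\<^bsub>D\<^esub> J X (Unt C)
            \<cdot>\<^bsub>D\<^esub> lwhisk D (FO X) (Unt D) (FO (Unt C)) e = RUn D (FO X)"

definition tensor_equivalent ::
    "('o, 'm::ab_group_add) moncat \<Rightarrow> ('p, 'n::ab_group_add) moncat \<Rightarrow> bool" where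
  "tensor_equivalent C D \<longleftrightarrow> (\<exists>FO FM J e. tensor_equivalence C D FO FM J e)"

text \<open>The homogeneous components are given by their sets of objects. The condition
  \<open>component_sum\<close> makes them closed under isomorphism (lists of length one) and under direct sums;
  closure under direct summands follows from the other conditions.\<close>

locale faithful_grading =
  fixes K :: "('k, 'y) monoid_scheme" and D :: "('o, 'm::ab_group_add) moncat"
    and piece :: "'k \<Rightarrow> 'o set"
  assumes component_subset: "k \<in> carrier K \<Longrightarrow> piece k \<subseteq> Ob D"
    and component_sum: "\<lbrakk>k \<in> carrier K; set Xs \<subseteq> piece k; Z \<in> Ob D; is_direct_sum D Z Xs\<rbrakk>
          \<Longrightarrow> Z \<in> piece k"
    and decomposition: "X \<in> Ob D \<Longrightarrow>
          \<exists>Xs. set Xs \<subseteq> (\<Union>k\<in>carrier K. piece k) \<and> is_direct_sum D X Xs"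
    and orthogonal: "\<lbrakk>k \<in> carrier K; l \<in> carrier K; k \<noteq> l; X \<in> piece k; Y \<in> piece l\<rbrakk>
          \<Longrightarrow> Mor D X Y = {0}"
    and multiplicative: "\<lbrakk>k \<in> carrier K; l \<in> carrier K; X \<in> piece k; Y \<in> piece l\<rbrakk>
          \<Longrightarrow> X \<odot>\<^bsub>D\<^esub> Y \<in> piece (k \<otimes>\<^bsub>K\<^esub> l)"
    and faithful: "k \<in> carrier K \<Longrightarrow> \<exists>X\<in>piece k. Idm D X \<noteq> 0"

definition graded_extension ::
    "('k, 'y) monoid_scheme \<Rightarrow> ('o, 'm::ab_group_add) moncat \<Rightarrow> ('k \<Rightarrow> 'o set)
      \<Rightarrow> ('p, 'n::ab_group_add) moncat \<Rightarrow> bool" where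
  "graded_extension K D piece C \<longleftrightarrow>
     group K \<and> finite (carrier K) \<and> fusion_category D \<and> faithful_grading K D piece \<and>
     tensor_equivalent (full_subcategory D (piece \<one>\<^bsub>K\<^esub>)) C"

definition invertible_object :: "('o, 'm, 'z) moncat_scheme \<Rightarrow> 'o \<Rightarrow> bool" where
  "invertible_object C X \<longleftrightarrow> X \<in> Ob C \<and>
     (\<exists>Y\<in>Ob C. isomorphic C (X \<odot>\<^bsub>C\<^esub> Y) (Unt C) \<and> isomorphic C (Y \<odot>\<^bsub>C\<^esub> X) (Unt C))"


section \<open>Algebras and the dual category of bimodules\<close>

text \<open>An algebra is a triple of an object, a multiplication and a unit.\<close>

type_synonym ('o, 'm) alg = "'o \<times> 'm \<times> 'm"

fun is_algebra :: "('o, 'm) moncat \<Rightarrow> ('o, 'm) alg \<Rightarrow> bool" where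
  "is_algebra C (A, m, u) \<longleftrightarrow>
     A \<in> Ob C \<and> m \<in> Mor C (A \<odot>\<^bsub>C\<^esub> A) A \<and> u \<in> Mor C (Unt C) A \<and>
     m \<cdot>\<^bsub>C\<^esub> rwhisk C (A \<odot>\<^bsub>C\<^esub> A) A A m = m \<cdot>\<^bsub>C\<^esub> lwhisk C A (A \<odot>\<^bsub>C\<^esub> A) A m \<cdot>\<^bsub>C\<^esub> Asc C A A A \<and>
     m \<cdot>\<^bsub>C\<^esub> rwhisk C (Unt C) A A u = LUn C A \<and>
     m \<cdot>\<^bsub>C\<^esub> lwhisk C A (Unt C) A u = RUn C A"

text \<open>A bimodule is a triple of an object \<open>X\<close>, a left action \<open>l : A \<otimes> X \<rightarrow> X\<close> and a right action
  \<open>r : X \<otimes> A \<rightarrow> X\<close>.\<close>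

type_synonym ('o, 'm) bimod = "'o \<times> 'm \<times> 'm"

fun is_bimodule :: "('o, 'm) moncat \<Rightarrow> ('o, 'm) alg \<Rightarrow> ('o, 'm) bimod \<Rightarrow> bool" where
  "is_bimodule C (A, m, u) (X, l, r) \<longleftrightarrow>
     X \<in> Ob C \<and> l \<in> Mor C (A \<odot>\<^bsub>C\<^esub> X) X \<and> r \<in> Mor C (X \<odot>\<^bsub>C\<^esub> A) X \<and>
     l \<cdot>\<^bsub>C\<^esub> rwhisk C (A \<odot>\<^bsub>C\<^esub> A) A X m = l \<cdot>\<^bsub>C\<^esub> lwhisk C A (A \<odot>\<^bsub>C\<^esub> X) X l \<cdot>\<^bsub>C\<^esub> Asc C A A X \<and>
     l \<cdot>\<^bsub>C\<^esub> rwhisk C (Unt C) A X u = LUn C X \<and>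
     r \<cdot>\<^bsub>C\<^esub> rwhisk C (X \<odot>\<^bsub>C\<^esub> A) X A r = r \<cdot>\<^bsub>C\<^esub> lwhisk C X (A \<odot>\<^bsub>C\<^esub> A) A m \<cdot>\<^bsub>C\<^esub> Asc C X A A \<and>
     r \<cdot>\<^bsub>C\<^esub> lwhisk C X (Unt C) A u = RUn C X \<and>
     r \<cdot>\<^bsub>C\<^esub> rwhisk C (A \<odot>\<^bsub>C\<^esub> X) X A l = l \<cdot>\<^bsub>C\<^esub> lwhisk C A (X \<odot>\<^bsub>C\<^esub> A) X r \<cdot>\<^bsub>C\<^esub> Asc C A X A"

fun bimodule_maps ::
    "('o, 'm) moncat \<Rightarrow> ('o, 'm) alg \<Rightarrow> ('o, 'm) bimod \<Rightarrow> ('o, 'm) bimod \<Rightarrow> 'm set" where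
  "bimodule_maps C (A, m, u) (X, l, r) (X', l', r') =
     {f \<in> Mor C X X'. f \<cdot>\<^bsub>C\<^esub> l = l' \<cdot>\<^bsub>C\<^esub> lwhisk C A X X' f \<and> f \<cdot>\<^bsub>C\<^esub> r = r' \<cdot>\<^bsub>C\<^esub> rwhisk C X X' A f}"

definition is_coequalizer ::
    "('o, 'm) moncat \<Rightarrow> 'o \<Rightarrow> 'm \<Rightarrow> 'm \<Rightarrow> 'o \<Rightarrow> 'm \<Rightarrow> bool" where
  "is_coequalizer C Q f g Z q \<longleftrightarrow>
     Z \<in> Ob C \<and> q \<in> Mor C Q Z \<and> q \<cdot>\<^bsub>C\<^esub> f = q \<cdot>\<^bsub>C\<^esub> g \<and>
     (\<forall>W\<in>Ob C. \<forall>h\<in>Mor C Q W. h \<cdot>\<^bsub>C\<^esub> f = h \<cdot>\<^bsub>C\<^esub> g \<longrightarrow> (\<exists>!k. k \<in> Mor C Z W \<and> k \<cdot>\<^bsub>C\<^esub> q = h))"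

text \<open>A choice of the object underlying \<open>X \<otimes>\<^sub>A Y\<close> together with the projection from \<open>X \<otimes> Y\<close>, as
  the coequalizer of the two actions of \<open>A\<close> on \<open>(X \<otimes> A) \<otimes> Y\<close>.\<close>

fun rel_tensor ::
    "('o, 'm) moncat \<Rightarrow> ('o, 'm) alg \<Rightarrow> ('o, 'm) bimod \<Rightarrow> ('o, 'm) bimod \<Rightarrow> 'o \<times> 'm" where
  "rel_tensor C (A, m, u) (X, l, r) (Y, l', r') =
     (SOME (Z, q). is_coequalizer C (X \<odot>\<^bsub>C\<^esub> Y)
        (rwhisk C (X \<odot>\<^bsub>C\<^esub> A) X Y r)
        (lwhisk C X (A \<odot>\<^bsub>C\<^esub> Y) Y l' \<cdot>\<^bsub>C\<^esub> Asc C X A Y) Z q)"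

definition rel_ob where "rel_ob C AA XX YY = fst (rel_tensor C AA XX YY)"

definition rel_proj where "rel_proj C AA XX YY = snd (rel_tensor C AA XX YY)"

text \<open>The bimodule structure on \<open>X \<otimes>\<^sub>A Y\<close> is induced from the left action on \<open>X\<close> and the right
  action on \<open>Y\<close>.\<close>

fun bimod_tensor ::
    "('o, 'm) moncat \<Rightarrow> ('o, 'm) alg \<Rightarrow> ('o, 'm) bimod \<Rightarrow> ('o, 'm) bimod \<Rightarrow> ('o, 'm) bimod" where
  "bimod_tensor C (A, m, u) (X, l, r) (Y, l', r') =
     (let Z = rel_ob C (A, m, u) (X, l, r) (Y, l', r');
          q = rel_proj C (A, m, u) (X, l, r) (Y, l', r')
      in (Z,
          THE k. k \<in> Mor C (A \<odot>\<^bsub>C\<^esub> Z) Z \<and>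
            k \<cdot>\<^bsub>C\<^esub> lwhisk C A (X \<odot>\<^bsub>C\<^esub> Y) Z q =
              q \<cdot>\<^bsub>C\<^esub> rwhisk C (A \<odot>\<^bsub>C\<^esub> X) X Y l
                \<cdot>\<^bsub>C\<^esub> inv_mor C ((A \<odot>\<^bsub>C\<^esub> X) \<odot>\<^bsub>C\<^esub> Y) (A \<odot>\<^bsub>C\<^esub> X \<odot>\<^bsub>C\<^esub> Y) (Asc C A X Y),
          THE k. k \<in> Mor C (Z \<odot>\<^bsub>C\<^esub> A) Z \<and>
            k \<cdot>\<^bsub>C\<^esub> rwhisk C (X \<odot>\<^bsub>C\<^esub> Y) Z A q =
              q \<cdot>\<^bsub>C\<^esub> lwhisk C X (Y \<odot>\<^bsub>C\<^esub> A) Y r' \<cdot>\<^bsub>C\<^esub> Asc C X Y A))"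

text \<open>The dual category of \<open>C\<close> with respect to an algebra. The tensor product of morphisms, the
  associator and the unit constraints are the maps induced on the relative tensor products.\<close>

definition bimodule_category ::
    "('o, 'm) moncat \<Rightarrow> ('o, 'm) alg \<Rightarrow> (('o, 'm) bimod, 'm) moncat" where
  "bimodule_category C AA = \<lparr>
     Ob = {XX. is_bimodule C AA XX},
     Mor = bimodule_maps C AA,
     Cmp = Cmp C,
     Idm = (\<lambda>XX. Idm C (fst XX)),
     Scl = Scl C,
     TenO = bimod_tensor C AA,
     TenM = (\<lambda>XX XX' YY YY' f g.
       THE k. k \<in> Mor C (rel_ob C AA XX YY) (rel_ob C AA XX' YY') \<and>
         k \<cdot>\<^bsub>C\<^esub> rel_proj C AA XX YY =
           rel_proj C AA XX' YY' \<cdot>\<^bsub>C\<^esub> TenM C (fst XX) (fst XX') (fst YY) (fst YY') f g),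
     Unt = (fst AA, fst (snd AA), fst (snd AA)),
     Asc = (\<lambda>XX YY ZZ.
       let XY = bimod_tensor C AA XX YY; YZ = bimod_tensor C AA YY ZZ in
       THE k. k \<in> Mor C (rel_ob C AA XY ZZ) (rel_ob C AA XX YZ) \<and>
         k \<cdot>\<^bsub>C\<^esub> rel_proj C AA XY ZZ
             \<cdot>\<^bsub>C\<^esub> rwhisk C (fst XX \<odot>\<^bsub>C\<^esub> fst YY) (fst XY) (fst ZZ) (rel_proj C AA XX YY) =
           rel_proj C AA XX YZ
             \<cdot>\<^bsub>C\<^esub> lwhisk C (fst XX) (fst YY \<odot>\<^bsub>C\<^esub> fst ZZ) (fst YZ) (rel_proj C AA YY ZZ)
             \<cdot>\<^bsub>C\<^esub> Asc C (fst XX) (fst YY) (fst ZZ)),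
     LUn = (\<lambda>XX. let UU = (fst AA, fst (snd AA), fst (snd AA)) in
       THE k. k \<in> Mor C (rel_ob C AA UU XX) (fst XX) \<and>
         k \<cdot>\<^bsub>C\<^esub> rel_proj C AA UU XX = fst (snd XX)),
     RUn = (\<lambda>XX. let UU = (fst AA, fst (snd AA), fst (snd AA)) in
       THE k. k \<in> Mor C (rel_ob C AA XX UU) (fst XX) \<and>
         k \<cdot>\<^bsub>C\<^esub> rel_proj C AA XX UU = snd (snd XX)) \<rparr>"

text \<open>The grading inherited by the bimodules over an algebra in the trivial component.\<close>

definition bimodule_components ::
    "('o, 'm) moncat \<Rightarrow> ('o, 'm) alg \<Rightarrow> ('k \<Rightarrow> 'o set) \<Rightarrow> 'k \<Rightarrow> ('o, 'm) bimod set" where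
  "bimodule_components C AA piece k = {XX. is_bimodule C AA XX \<and> fst XX \<in> piece k}"


section \<open>Type III factors\<close>

class complex_hilbert_space = banach +
  fixes scaleC :: "complex \<Rightarrow> 'a \<Rightarrow> 'a"
    and cinner :: "'a \<Rightarrow> 'a \<Rightarrow> complex"
  assumes scaleC_add_right: "scaleC a (x + y) = scaleC a x + scaleC a y"
    and scaleC_add_left: "scaleC (a + b) x = scaleC a x + scaleC b x"
    and scaleC_scaleC: "scaleC a (scaleC b x) = scaleC (a * b) x"
    and scaleC_of_real: "scaleC (complex_of_real r) x = r *\<^sub>R x"
    and cinner_commute: "cinner x y = cnj (cinner y x)"
    and cinner_add_right: "cinner x (y + z) = cinner x y + cinner x z"
    and cinner_scaleC_right: "cinner x (scaleC a y) = a * cinner x y"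
    and cinner_self: "cinner x x = complex_of_real ((norm x)\<^sup>2)"

text \<open>The library only has real bounded linear maps, so complex linearity is a separate condition.\<close>

type_synonym 'h op = "'h \<Rightarrow>\<^sub>L 'h"

definition bounded_ops :: "'h::complex_hilbert_space op set" where
  "bounded_ops = {T. \<forall>c v. blinfun_apply T (scaleC c v) = scaleC c (blinfun_apply T v)}"

definition op_scale :: "complex \<Rightarrow> 'h::complex_hilbert_space op \<Rightarrow> 'h op" where
  "op_scale c T = Blinfun (\<lambda>v. scaleC c (blinfun_apply T v))"

definition cadj :: "'h::complex_hilbert_space op \<Rightarrow> 'h op" where
  "cadj T = (THE S. \<forall>v w. cinner (blinfun_apply S v) w = cinner v (blinfun_apply T w))"

definition commutant :: "'h::complex_hilbert_space op set \<Rightarrow> 'h op set" where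
  "commutant S = {T \<in> bounded_ops. \<forall>s\<in>S. T o\<^sub>L s = s o\<^sub>L T}"

definition von_neumann_algebra :: "'h::complex_hilbert_space op set \<Rightarrow> bool" where
  "von_neumann_algebra M \<longleftrightarrow>
     M \<subseteq> bounded_ops \<and> (\<forall>T\<in>M. cadj T \<in> M) \<and> commutant (commutant M) = M"

definition vn_factor :: "'h::complex_hilbert_space op set \<Rightarrow> bool" where
  "vn_factor M \<longleftrightarrow> von_neumann_algebra M \<and> id_blinfun \<noteq> (0 :: 'h op) \<and>
     M \<inter> commutant M = range (\<lambda>c. op_scale c id_blinfun)"

definition projections :: "'h::complex_hilbert_space op set \<Rightarrow> 'h op set" where
  "projections M = {p \<in> M. p o\<^sub>L p = p \<and> cadj p = p}"

text \<open>A projection \<open>p\<close> is infinite if it is equivalent to a proper subprojection.\<close>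

definition infinite_projection :: "'h::complex_hilbert_space op set \<Rightarrow> 'h op \<Rightarrow> bool" where
  "infinite_projection M p \<longleftrightarrow> (\<exists>v\<in>M. cadj v o\<^sub>L v = p \<and>
     p o\<^sub>L (v o\<^sub>L cadj v) = v o\<^sub>L cadj v \<and> v o\<^sub>L cadj v \<noteq> p)"

definition type_III_factor :: "'h::complex_hilbert_space op set \<Rightarrow> bool" where
  "type_III_factor M \<longleftrightarrow>
     vn_factor M \<and> (\<forall>p\<in>projections M. p \<noteq> 0 \<longrightarrow> infinite_projection M p)"

text \<open>The order on the self-adjoint part; an element of \<open>M\<close> is positive iff it is of the form
  \<open>z\<^sup>* z\<close> with \<open>z\<close> in \<open>M\<close>.\<close>

definition le_in :: "'h::complex_hilbert_space op set \<Rightarrow> 'h op \<Rightarrow> 'h op \<Rightarrow> bool" where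
  "le_in M S T \<longleftrightarrow> (\<exists>z\<in>M. T - S = cadj z o\<^sub>L z)"

definition is_lub_in :: "'h::complex_hilbert_space op set \<Rightarrow> 'h op set \<Rightarrow> 'h op \<Rightarrow> bool" where
  "is_lub_in M D s \<longleftrightarrow> s \<in> M \<and> (\<forall>x\<in>D. le_in M x s) \<and>
     (\<forall>t\<in>M. (\<forall>x\<in>D. le_in M x t) \<longrightarrow> le_in M s t)"

definition normal_map ::
    "'h::complex_hilbert_space op set \<Rightarrow> ('h op \<Rightarrow> 'h op) \<Rightarrow> bool" where
  "normal_map M \<phi> \<longleftrightarrow> (\<forall>D s. D \<noteq> {} \<and> D \<subseteq> {x \<in> M. cadj x = x} \<and>
     (\<forall>x\<in>D. \<forall>y\<in>D. \<exists>z\<in>D. le_in M x z \<and> le_in M y z) \<and> is_lub_in M D s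
     \<longrightarrow> is_lub_in M (\<phi> ` D) (\<phi> s))"


section \<open>Endomorphisms of a factor\<close>

text \<open>Unital normal *-endomorphisms. Only the values on \<open>M\<close> matter: functions with the same
  restriction to \<open>M\<close> are isomorphic objects of the category below, via the identity operator.\<close>

definition endomorphisms :: "'h::complex_hilbert_space op set \<Rightarrow> ('h op \<Rightarrow> 'h op) set" where
  "endomorphisms M = {\<sigma>. (\<forall>x\<in>M. \<sigma> x \<in> M) \<and>
     (\<forall>x\<in>M. \<forall>y\<in>M. \<sigma> (x + y) = \<sigma> x + \<sigma> y) \<and> (\<forall>c. \<forall>x\<in>M. \<sigma> (op_scale c x) = op_scale c (\<sigma> x)) \<and>
     (\<forall>x\<in>M. \<forall>y\<in>M. \<sigma> (x o\<^sub>L y) = \<sigma> x o\<^sub>L \<sigma> y) \<and> (\<forall>x\<in>M. \<sigma> (cadj x) = cadj (\<sigma> x)) \<and>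
     \<sigma> id_blinfun = id_blinfun \<and> normal_map M \<sigma>}"

text \<open>Finite index of \<open>\<sigma>(M) \<subseteq> M\<close>: there is a normal conditional expectation satisfying a
  Pimsner-Popa inequality.\<close>

definition conditional_expectation ::
    "'h::complex_hilbert_space op set \<Rightarrow> 'h op set \<Rightarrow> ('h op \<Rightarrow> 'h op) \<Rightarrow> bool" where
  "conditional_expectation M N E \<longleftrightarrow> (\<forall>x\<in>M. E x \<in> N) \<and> (\<forall>a\<in>N. E a = a) \<and>
     (\<forall>x\<in>M. \<forall>y\<in>M. E (x + y) = E x + E y) \<and> (\<forall>c. \<forall>x\<in>M. E (op_scale c x) = op_scale c (E x)) \<and>
     (\<forall>a\<in>N. \<forall>b\<in>N. \<forall>x\<in>M. E (a o\<^sub>L (x o\<^sub>L b)) = a o\<^sub>L (E x o\<^sub>L b)) \<and>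
     (\<forall>x\<in>M. le_in M 0 (E (cadj x o\<^sub>L x)))"

definition finite_index_endomorphisms ::
    "'h::complex_hilbert_space op set \<Rightarrow> ('h op \<Rightarrow> 'h op) set" where
  "finite_index_endomorphisms M = {\<sigma> \<in> endomorphisms M.
     \<exists>E. conditional_expectation M (\<sigma> ` M) E \<and> normal_map M E \<and>
       (\<exists>c>0. \<forall>x\<in>M. le_in M (c *\<^sub>R (cadj x o\<^sub>L x)) (E (cadj x o\<^sub>L x)))}"

definition automorphisms :: "'h::complex_hilbert_space op set \<Rightarrow> ('h op \<Rightarrow> 'h op) set" where
  "automorphisms M = {\<sigma> \<in> endomorphisms M. bij_betw \<sigma> M M}"

definition intertwiners ::
    "'h::complex_hilbert_space op set \<Rightarrow> ('h op \<Rightarrow> 'h op) \<Rightarrow> ('h op \<Rightarrow> 'h op) \<Rightarrow> 'h op set" where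
  "intertwiners M \<sigma> \<tau> = {t \<in> M. \<forall>x\<in>M. t o\<^sub>L \<sigma> x = \<tau> x o\<^sub>L t}"

text \<open>\<open>\<sigma>(x) = \<Sum>\<^sub>i s\<^sub>i \<sigma>\<^sub>i(x) s\<^sub>i\<^sup>*\<close> for isometries \<open>s\<^sub>i\<close> whose ranges sum up to the identity. For a list
  of length one this is unitary equivalence.\<close>

definition isometric_sum ::
    "'h::complex_hilbert_space op set \<Rightarrow> ('h op \<Rightarrow> 'h op) \<Rightarrow> ('h op \<Rightarrow> 'h op) list \<Rightarrow> bool" where
  "isometric_sum M \<sigma> \<sigma>s \<longleftrightarrow> (\<exists>s.
     (\<forall>i<length \<sigma>s. s i \<in> intertwiners M (\<sigma>s ! i) \<sigma> \<and> cadj (s i) o\<^sub>L s i = id_blinfun) \<and>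
     (\<Sum>i<length \<sigma>s. s i o\<^sub>L cadj (s i)) = id_blinfun)"

definition irreducible_endo ::
    "'h::complex_hilbert_space op set \<Rightarrow> ('h op \<Rightarrow> 'h op) \<Rightarrow> bool" where
  "irreducible_endo M \<sigma> \<longleftrightarrow> intertwiners M \<sigma> \<sigma> = range (\<lambda>c. op_scale c id_blinfun)"

text \<open>The full tensor subcategory of \<open>End(M)\<close> on a set \<open>S\<close> of endomorphisms closed under
  composition: \<open>\<sigma> \<otimes> \<tau> = \<sigma> \<circ> \<tau>\<close>, and \<open>t \<otimes> s = t \<sigma>(s)\<close> for \<open>t : \<sigma> \<rightarrow> \<sigma>'\<close>. As unital endomorphisms
  do not include a zero object, one is adjoined formally as \<open>None\<close>.\<close>

definition endo_id :: "('h::complex_hilbert_space op \<Rightarrow> 'h op) option \<Rightarrow> 'h op" where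
  "endo_id X = (case X of None \<Rightarrow> 0 | Some _ \<Rightarrow> id_blinfun)"

definition endo_comp ::
    "('h::complex_hilbert_space op \<Rightarrow> 'h op) option \<Rightarrow> ('h op \<Rightarrow> 'h op) option
      \<Rightarrow> ('h op \<Rightarrow> 'h op) option" where
  "endo_comp X Y = (case (X, Y) of (Some \<sigma>, Some \<tau>) \<Rightarrow> Some (\<sigma> \<circ> \<tau>) | _ \<Rightarrow> None)"

type_synonym 'h endo_moncat = "(('h op \<Rightarrow> 'h op) option, 'h op) moncat"

definition with_zero :: "'a set \<Rightarrow> 'a option set" where
  "with_zero S = insert None (Some ` S)"

definition endo_category ::
    "'h::complex_hilbert_space op set \<Rightarrow> ('h op \<Rightarrow> 'h op) set \<Rightarrow> 'h endo_moncat" where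
  "endo_category M S = \<lparr>
     Ob = with_zero S,
     Mor = (\<lambda>X Y. case (X, Y) of (Some \<sigma>, Some \<tau>) \<Rightarrow> intertwiners M \<sigma> \<tau> | _ \<Rightarrow> {0}),
     Cmp = (o\<^sub>L),
     Idm = endo_id,
     Scl = op_scale,
     TenO = endo_comp,
     TenM = (\<lambda>X X' Y Y' t s. case X of None \<Rightarrow> 0 | Some \<sigma> \<Rightarrow> t o\<^sub>L \<sigma> s),
     Unt = Some id,
     Asc = (\<lambda>X Y Z. endo_id (endo_comp X (endo_comp Y Z))),
     LUn = endo_id,
     RUn = endo_id \<rparr>"

text \<open>A Q-system is an algebra whose multiplication is a co-isometry.\<close>

fun q_system ::
    "'h::complex_hilbert_space endo_moncat \<Rightarrow> ('h op \<Rightarrow> 'h op) \<times> 'h op \<times> 'h op \<Rightarrow> bool" where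
  "q_system C (A, m, u) \<longleftrightarrow> is_algebra C (Some A, m, u) \<and> m o\<^sub>L cadj m = id_blinfun"

text \<open>The tensor category generated by a set of endomorphisms.\<close>

inductive_set generated ::
    "'h::complex_hilbert_space op set \<Rightarrow> ('h op \<Rightarrow> 'h op) set \<Rightarrow> ('h op \<Rightarrow> 'h op) set"
  for M S where
  base: "\<sigma> \<in> S \<Longrightarrow> \<sigma> \<in> generated M S"
| compose: "\<lbrakk>\<sigma> \<in> generated M S; \<tau> \<in> generated M S\<rbrakk> \<Longrightarrow> \<sigma> \<circ> \<tau> \<in> generated M S"
| sum: "\<lbrakk>\<sigma> \<in> endomorphisms M; \<forall>\<tau>\<in>set \<tau>s. \<tau> \<in> generated M S; isometric_sum M \<sigma> \<tau>s\<rbrakk>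
    \<Longrightarrow> \<sigma> \<in> generated M S"
| sub: "\<lbrakk>\<sigma> \<in> endomorphisms M; \<tau> \<in> generated M S; w \<in> intertwiners M \<sigma> \<tau>; cadj w o\<^sub>L w = id_blinfun\<rbrakk>
    \<Longrightarrow> \<sigma> \<in> generated M S"


section \<open>The \<open>3\<^sup>G\<close> subfactor\<close>

text \<open>The group \<open>G\<close> is written additively. The objects of the even part are the endomorphisms that
  are direct sums of the \<open>\<alpha>\<^sub>g\<close> and \<open>\<alpha>\<^sub>g \<rho>\<close>.\<close>

definition even_objects ::
    "'h::complex_hilbert_space op set \<Rightarrow> ('g \<Rightarrow> 'h op \<Rightarrow> 'h op) \<Rightarrow> ('h op \<Rightarrow> 'h op)
      \<Rightarrow> ('h op \<Rightarrow> 'h op) set" where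
  "even_objects M \<alpha> \<rho> = {\<sigma> \<in> endomorphisms M.
     \<exists>\<sigma>s. set \<sigma>s \<subseteq> range \<alpha> \<union> range (\<lambda>g. \<alpha> g \<circ> \<rho>) \<and> isometric_sum M \<sigma> \<sigma>s}"

definition even_part ::
    "'h::complex_hilbert_space op set \<Rightarrow> ('g \<Rightarrow> 'h op \<Rightarrow> 'h op) \<Rightarrow> ('h op \<Rightarrow> 'h op)
      \<Rightarrow> 'h endo_moncat" where
  "even_part M \<alpha> \<rho> = endo_category M (even_objects M \<alpha> \<rho>)"

text \<open>A realization of the \<open>3\<^sup>G\<close> subfactor in \<open>End\<^sub>0(M)\<close>. The relation \<open>\<alpha>\<^sub>g \<alpha>\<^sub>h = \<alpha>\<^sub>g\<^sub>h\<close> holds strictly,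
  so that the \<open>\<alpha>\<^sub>g\<close> generate a full tensor subcategory equivalent to \<open>Vec\<^sub>G\<close> (trivial associator).
  The list \<open>gs\<close> enumerates \<open>G\<close>, which is therefore finite.\<close>

locale subfactor_3G =
  fixes M :: "'h::complex_hilbert_space op set"
    and \<alpha> :: "'g::ab_group_add \<Rightarrow> 'h op \<Rightarrow> 'h op" and \<rho> :: "'h op \<Rightarrow> 'h op"
  assumes factor: "type_III_factor M"
    and alpha_aut: "\<alpha> g \<in> automorphisms M"
    and rho_endo: "\<rho> \<in> finite_index_endomorphisms M"
    and alpha_zero: "x \<in> M \<Longrightarrow> \<alpha> 0 x = x"
    and alpha_add: "x \<in> M \<Longrightarrow> \<alpha> (g + h) x = \<alpha> g (\<alpha> h x)"
    and alpha_rho: "x \<in> M \<Longrightarrow> \<alpha> g (\<rho> x) = \<rho> (\<alpha> (- g) x)"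
    and rho_irreducible: "irreducible_endo M (\<alpha> g \<circ> \<rho>)"
    and alpha_inequiv: "isometric_sum M (\<alpha> g) [\<alpha> h] \<Longrightarrow> g = h"
    and alpha_rho_inequiv: "isometric_sum M (\<alpha> g \<circ> \<rho>) [\<alpha> h \<circ> \<rho>] \<Longrightarrow> g = h"
    and alpha_not_rho: "\<not> isometric_sum M (\<alpha> g) [\<alpha> h \<circ> \<rho>]"
    and rho_square: "\<exists>gs. distinct gs \<and> set gs = UNIV \<and>
          isometric_sum M (\<rho> \<circ> \<rho>) (id # map (\<lambda>g. \<alpha> g \<circ> \<rho>) gs)"
    and fusion: "fusion_category (even_part M \<alpha> \<rho>)"
    and q_system_exists: "\<exists>A m u. q_system (even_part M \<alpha> \<rho>) (A, m, u) \<and> isometric_sum M A [id, \<rho>]"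

text \<open>The category generated by the even part and an automorphism \<open>\<gamma>\<close>, which is its crossed product
  by the group generated by \<open>\<gamma>\<close>, and its grading, where \<open>\<gamma>\<^sup>k\<close> has degree \<open>k \<in> {0, 1, 2}\<close>.\<close>

definition crossed_objects ::
    "'h::complex_hilbert_space op set \<Rightarrow> ('g \<Rightarrow> 'h op \<Rightarrow> 'h op) \<Rightarrow> ('h op \<Rightarrow> 'h op)
      \<Rightarrow> ('h op \<Rightarrow> 'h op) \<Rightarrow> ('h op \<Rightarrow> 'h op) set" where
  "crossed_objects M \<alpha> \<rho> \<gamma> = generated M (insert \<gamma> (even_objects M \<alpha> \<rho>))"

definition crossed_product ::
    "'h::complex_hilbert_space op set \<Rightarrow> ('g \<Rightarrow> 'h op \<Rightarrow> 'h op) \<Rightarrow> ('h op \<Rightarrow> 'h op)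
      \<Rightarrow> ('h op \<Rightarrow> 'h op) \<Rightarrow> 'h endo_moncat" where
  "crossed_product M \<alpha> \<rho> \<gamma> = endo_category M (crossed_objects M \<alpha> \<rho> \<gamma>)"

definition crossed_components ::
    "'h::complex_hilbert_space op set \<Rightarrow> ('g \<Rightarrow> 'h op \<Rightarrow> 'h op) \<Rightarrow> ('h op \<Rightarrow> 'h op)
      \<Rightarrow> ('h op \<Rightarrow> 'h op) \<Rightarrow> int \<Rightarrow> ('h op \<Rightarrow> 'h op) option set" where
  "crossed_components M \<alpha> \<rho> \<gamma> k = with_zero {\<sigma> \<in> crossed_objects M \<alpha> \<rho> \<gamma>.
     \<exists>\<tau>\<in>even_objects M \<alpha> \<rho>. isometric_sum M \<sigma> [\<tau> \<circ> (\<gamma> ^^ nat k)]}"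

end

theory Submission
 imports Defs "HOL-Computational_Algebra.Fundamental_Theorem_Algebra"
begin

text \<open>
 The object \<open>\<tau> = \<alpha>\<^sub>g \<rho>\<close> again generates a \<open>3\<^sup>G\<close> subfactor with even part \<open>C\<close>, so self-duality gives \<open>Bim\<^sub>C(A) \<simeq> C\<close>
 for \<open>A = 1 + \<tau>\<close>. Hence the multiplication of \<open>A\<close> splits as a bimodule map, and \<open>A\<close> is a separable Frobenius
 algebra. Its bimodules in \<open>C\<^sub>2\<close> form a fusion category, graded by the degrees of the underlying objects.

 Let \<open>X\<close> be an invertible bimodule of degree \<open>k \<noteq> 0\<close>. For left modules, \<open>Hom\<^sub>A(X \<pi>, X) = Hom(\<pi>, A)\<close>; so \<open>X\<close> is
 simple and \<open>Hom\<^sub>A(X \<alpha>\<^sub>j, X) = 0\<close> for \<open>j \<noteq> 0\<close>. If \<open>X\<close> contains \<open>\<alpha>\<^sub>h \<gamma>\<^sup>k\<close>, then \<open>X = A \<alpha>\<^sub>h \<gamma>\<^sup>k\<close> as a left module. As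
 \<open>\<theta>\<^sup>k g \<noteq> g\<close>, the right action of \<open>\<tau>\<close> kills \<open>\<alpha>\<^sub>h \<gamma>\<^sup>k\<close>, which makes the projection \<open>A \<rightarrow> 1\<close> an algebra map and
 contradicts the nondegeneracy of \<open>A\<close>. Otherwise \<open>A \<alpha>\<^sub>h \<rho> \<gamma>\<^sup>k = A \<alpha>\<^bsub>g-h\<^esub> \<gamma>\<^sup>k \<oplus> X\<close>, so \<open>X\<close> contains every \<open>\<alpha>\<^sub>i \<rho> \<gamma>\<^sup>k\<close>,
 and comparing these decompositions for \<open>h\<close> and for \<open>h - \<theta>\<^sup>k j\<close> yields a nonzero map \<open>X \<alpha>\<^sub>j \<rightarrow> X\<close>.
\<close>

section \<open>Adjoints\<close>

text \<open>The identity Hom_A(X \<pi>, X) = Hom(\<pi>, A) comes from tensoring with the inverse Y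
  of X: Y \<otimes>_A X \<pi> is A \<pi>, and left module maps A \<pi> -> A are maps \<pi> -> A. In
  the last step, \<alpha>_{h - \<theta>^k j} \<rho> \<gamma>^k equals \<alpha>_h \<rho> \<gamma>^k
  \<alpha>_j. So its free module is A \<alpha>_{g-h} \<gamma>^k \<alpha>_j \<oplus> X \<alpha>_j; it
  maps nontrivially to X, but its first summand does not. The proof takes j = g. Two obstacles shape
  the formal side. The tensor products over A are arbitrary choices, made independently in C and in
  C_2, so the equivalence supplied by self-duality must be transported to the component of degree
  zero. And direct sums must stay among the normal endomorphisms of M: the single instance id
  \<oplus> id, which additivity of C provides, yields all others. Decompositions are mostly handled
  without chosen isometries, by saying that an identity lies in the ideal of intertwiners that
  factor through given endomorphisms.\<close>

lemma cinner_add_left: "cinner (x + y) z = cinner x z + cinner y z" for x y z :: "'h::complex_hilbert_space" by (metis cinner_add_right cinner_commute complex_cnj_add)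

lemma cinner_scaleC_left: "cinner (scaleC a x) y = cnj a * cinner x y"
 for x y :: "'h::complex_hilbert_space" by (metis cinner_commute cinner_scaleC_right complex_cnj_mult)

lemma cinner_scaleR_right: "cinner x (r *\<^sub>R y) = of_real r * cinner x y" for x y :: "'h::complex_hilbert_space" by (metis cinner_scaleC_right scaleC_of_real)

lemma cinner_scaleR_left: "cinner (r *\<^sub>R x) y = of_real r * cinner x y"
 for x y :: "'h::complex_hilbert_space" by (metis cinner_scaleC_left scaleC_of_real complex_cnj_complex_of_real)

lemma cinner_minus_right: "cinner x (- y) = - cinner x y" for x y :: "'h::complex_hilbert_space" using cinner_scaleR_right[of x "-1" y] by simp

lemma cinner_diff_right: "cinner x (y - z) = cinner x y - cinner x z"
 for x y z :: "'h::complex_hilbert_space" using cinner_add_right[of x y "- z"] cinner_minus_right[of x z] by simp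

lemma cinner_diff_left: "cinner (y - z) x = cinner y x - cinner z x" for x y z :: "'h::complex_hilbert_space" by (metis cinner_commute cinner_diff_right complex_cnj_diff)

lemma cinner_zero_right [simp]: "cinner x 0 = 0" for x :: "'h::complex_hilbert_space" using cinner_diff_right[of x 0 0] by simp

lemma cinner_zero_left [simp]: "cinner 0 x = 0" for x :: "'h::complex_hilbert_space" using cinner_diff_left[of 0 0 x] by simp

lemma cinner_self_eq_0: "cinner x x = 0 \<longleftrightarrow> x = 0" for x :: "'h::complex_hilbert_space" by (simp add: cinner_self)

lemma norm_add_square: "(norm (x + y))\<^sup>2 = (norm x)\<^sup>2 + 2 * Re (cinner x y) + (norm y)\<^sup>2" for x y :: "'h::complex_hilbert_space"
proof -
 have "complex_of_real ((norm (x + y))\<^sup>2) = cinner x x + cinner y x + cinner x y + cinner y y"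
  unfolding cinner_self[symmetric] by (simp add: cinner_add_left cinner_add_right)
 hence "(norm (x + y))\<^sup>2 = Re (cinner x x) + Re (cinner y x) + Re (cinner x y) + Re (cinner y y)" by (metis Re_complex_of_real plus_complex.sel(1))
 moreover have "Re (cinner y x) = Re (cinner x y)" by (metis cinner_commute complex_cnj complex.sel(1) complex.exhaust_sel)
 ultimately show ?thesis by (simp add: cinner_self)
qed

lemma Re_cinner_bound: "\<bar>Re (cinner x y)\<bar> <= norm x * norm y" for x y :: "'h::complex_hilbert_space"
proof (cases "y = 0")
 case False
 \<comment> \<open>This value minimizes the norm of \<open>x + t *\<^sub>R y\<close>.\<close>
 define t where "t = - Re (cinner x y) / (norm y)\<^sup>2"
 have n: "(norm y)\<^sup>2 > 0" using False by simp
 have "0 <= (norm (x + t *\<^sub>R y))\<^sup>2" by simp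
 also have "... = (norm x)\<^sup>2 + 2 * t * Re (cinner x y) + t\<^sup>2 * (norm y)\<^sup>2" by (simp add: norm_add_square cinner_scaleR_right power_mult_distrib)
 also have "... = (norm x)\<^sup>2 - (Re (cinner x y))\<^sup>2 / (norm y)\<^sup>2" using n by (simp add: t_def power2_eq_square field_simps)
 finally have "(Re (cinner x y))\<^sup>2 <= (norm x * norm y)\<^sup>2" using n by (simp add: field_simps power_mult_distrib)
 thus ?thesis by (simp add: abs_le_square_iff[symmetric])
qed simp

text \<open>The real part is a definite real inner product. For this reason the Riesz theorem below
  is needed for real functionals only.\<close>

lemma Re_cinner_eqI: "y = y'" if "!!w. Re (cinner y w) = Re (cinner y' w)" for y y' :: "'h::complex_hilbert_space"
proof -
 have "Re (cinner (y - y') (y - y')) = 0" using that[of "y - y'"] by (simp add: cinner_diff_left)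
 thus ?thesis by (simp add: cinner_self)
qed

text \<open>The representing vector minimizes \<open>\<parallel>x\<parallel>\<^sup>2 - 2 f(x)\<close>; minimizing sequences are Cauchy by the
 parallelogram law.\<close>

lemma riesz_representation:
 fixes f :: "'h::complex_hilbert_space => real"
 assumes f: "bounded_linear f" shows "EX y. ALL w. Re (cinner y w) = f w"
proof -
 interpret f: bounded_linear f by fact
 obtain K where K: "!!x. norm (f x) <= norm x * K" using f.bounded by blast
 define J where "J x = (norm x)\<^sup>2 - 2 * f x" for x
 \<comment> \<open>Completing the square bounds \<open>J\<close> from below, so that its infimum
   \<open>I\<close> makes sense.\<close>
 have lower: "- K\<^sup>2 <= J x" for x
 proof -
  have "f x <= norm x * K" using K[of x] by simp
  moreover have "0 <= (norm x - K)\<^sup>2" by simp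
  ultimately show ?thesis unfolding J_def by (simp add: power2_eq_square algebra_simps)
 qed
 define I where "I = Inf (range J)"
 have bdd: "bdd_below (range J)" using lower by (auto simp: bdd_below_def)
 have I_le: "I <= J x" for x unfolding I_def using bdd by (simp add: cInf_lower)
 have "EX x. J x < I + 1 / real (Suc n)" for n using cInf_lessD[of "range J" "I + 1 / real (Suc n)"] unfolding I_def by auto
 then obtain x where x: "!!n. J (x n) < I + 1 / real (Suc n)" by metis
 have dist: "(norm (a - b))\<^sup>2 <= 2 * (J a - I) + 2 * (J b - I)" for a b
 proof -
  have 1: "(norm (a + b))\<^sup>2 + (norm (a - b))\<^sup>2 = 2 * (norm a)\<^sup>2 + 2 * (norm b)\<^sup>2"
   using norm_add_square[of a b] norm_add_square[of a "- b"] by (simp add: cinner_minus_right)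
  have "J ((1/2) *\<^sub>R (a + b)) = (norm (a + b))\<^sup>2 / 4 - f (a + b)" by (simp add: J_def f.scaleR power_divide)
  hence "I <= (norm (a + b))\<^sup>2 / 4 - (f a + f b)" using I_le[of "(1/2) *\<^sub>R (a + b)"] by (simp add: f.add)
  with 1 show ?thesis unfolding J_def by simp
 qed
 have "Cauchy x"
 proof (rule metric_CauchyI)
  fix e :: real assume e: "0 < e"
  hence "0 < e\<^sup>2 / 4" by simp
  then obtain N where N: "inverse (real (Suc N)) < e\<^sup>2 / 4" using reals_Archimedean by blast
  have small: "J (x n) - I < e\<^sup>2 / 4" if "n >= N" for n
  proof -
   have "1 / real (Suc n) <= 1 / real (Suc N)" using that by (simp add: frac_le)
   thus ?thesis using x[of n] N by (simp add: inverse_eq_divide)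
  qed
  show "EX N. ALL m>=N. ALL n>=N. dist (x m) (x n) < e"
  proof (intro exI allI impI)
   fix m n assume "N <= m" "N <= n"
   hence "(norm (x m - x n))\<^sup>2 < e\<^sup>2" using dist[of "x m" "x n"] small[of m] small[of n] by simp
   thus "dist (x m) (x n) < e" using e by (simp add: dist_norm power2_less_imp_less)
  qed
 qed
 then obtain y where y: "x \<longlonglongrightarrow> y" by (auto simp: Cauchy_convergent_iff convergent_def)
 have "(%n. J (x n)) \<longlonglongrightarrow> J y" unfolding J_def using y by (intro tendsto_intros f.tendsto)
 moreover have "(%n. I + 1 / real (Suc n)) \<longlonglongrightarrow> I + 0" using LIMSEQ_inverse_real_of_nat by (intro tendsto_intros) (simp add: inverse_eq_divide)
 ultimately have "J y <= I + 0" by (rule LIMSEQ_le) (use x less_imp_le in blast)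
 hence min: "J y <= J z" for z using I_le[of z] by simp
 have "Re (cinner y w) = f w" for w
 proof (rule ccontr)
  define d where "d = Re (cinner y w) - f w"
  assume "Re (cinner y w) ~= f w"
  hence d: "d ~= 0" by (simp add: d_def)
  have ineq: "0 <= 2 * t * d + t\<^sup>2 * (norm w)\<^sup>2" for t using min[of "y + t *\<^sub>R w"]
   by (simp add: J_def norm_add_square cinner_scaleR_right f.add f.scaleR d_def power_mult_distrib
     algebra_simps)
  have p: "(norm w)\<^sup>2 + 1 > 0" by (simp add: add_nonneg_pos)
  \<comment> \<open>The nonnegative quadratic in \<open>ineq\<close> has linear coefficient
    \<open>2 * d\<close>, so a small \<open>t\<close> of opposite sign makes it negative. The added
    1 keeps the denominator positive for \<open>w = 0\<close>.\<close>
  define t where "t = - d / ((norm w)\<^sup>2 + 1)"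
  have "2 * t * d + t\<^sup>2 * (norm w)\<^sup>2 <= 2 * t * d + t\<^sup>2 * ((norm w)\<^sup>2 + 1)" by (simp add: algebra_simps)
  also have "... = - (d\<^sup>2 / ((norm w)\<^sup>2 + 1))"
   unfolding t_def using nonzero_mult_div_cancel_right[of "(norm w)\<^sup>2 + 1" "d\<^sup>2 / ((norm w)\<^sup>2 + 1)"] p
   by (simp add: power_divide power2_eq_square[of "(norm w)\<^sup>2 + 1"] power2_eq_square[of d])
  also have "... < 0" using d p by simp
  finally show False using ineq[of t] by simp
 qed
 thus ?thesis by blast
qed

lemma bounded_opsD: "T : bounded_ops ==> T (scaleC c v) = scaleC c (T v)" by (simp add: bounded_ops_def)

lemma adjoint_exists:
 fixes T :: "'h::complex_hilbert_space op"
 assumes T: "T : bounded_ops" shows "EX S :: 'h op. ALL v w. cinner (S v) w = cinner v (T w)"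
proof -
 have "bounded_linear (%w. Re (cinner v (T w)))" for v
 proof (rule bounded_linear_intro)
  show "norm (Re (cinner v (T x))) <= norm x * (norm v * norm T)" for x
  proof -
   have "norm (Re (cinner v (T x))) <= norm v * norm (T x)" by (simp add: Re_cinner_bound)
   also have "... <= norm v * (norm T * norm x)" by (intro mult_left_mono norm_blinfun) simp
   finally show ?thesis by (simp add: mult_ac)
  qed
 qed (simp_all add: blinfun.add_right blinfun.scaleR_right cinner_add_right cinner_scaleR_right)
 hence "EX y. ALL w. Re (cinner y w) = Re (cinner v (T w))" for v by (rule riesz_representation)
 then obtain s where s: "!!v w. Re (cinner (s v) w) = Re (cinner v (T w))" by metis
 \<comment> \<open>Testing against \<open>scaleC \<i> w\<close> recovers the imaginary part; this is
   where complex linearity of \<open>T\<close> enters.\<close>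
 have full: "cinner (s v) w = cinner v (T w)" for v w using s[of v w] s[of v "scaleC \<i> w"] by (simp add: bounded_opsD[OF T] cinner_scaleC_right complex_eq_iff)
 have bl: "bounded_linear s"
 proof (rule bounded_linear_intro)
  show "s (x + y) = s x + s y" for x y by (rule Re_cinner_eqI) (simp add: cinner_add_left s)
  show "s (r *\<^sub>R x) = r *\<^sub>R s x" for r x by (rule Re_cinner_eqI) (simp add: cinner_scaleR_left s)
  show "norm (s x) <= norm x * norm T" for x
  proof (cases "s x = 0")
   case False
   have "norm (s x) * norm (s x) = Re (cinner (s x) (s x))" by (simp add: cinner_self power2_eq_square)
   also have "... <= norm x * norm (T (s x))" unfolding s using Re_cinner_bound[of x "T (s x)"] by simp
   also have "... <= norm x * (norm T * norm (s x))" by (intro mult_left_mono norm_blinfun) simp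
   finally show ?thesis using False by (simp add: mult.assoc[symmetric])
  qed simp
 qed
 show ?thesis by (rule exI[of _ "Blinfun s"]) (simp add: bounded_linear_Blinfun_apply[OF bl] full)
qed

lemma cinner_cadj_left: "cinner (cadj T v) w = cinner v (T w)" if "T : bounded_ops" for T :: "'h::complex_hilbert_space op"
proof -
 obtain S :: "'h op" where S: "ALL v w. cinner (S v) w = cinner v (T w)" using adjoint_exists[OF \<open>T \<in> bounded_ops\<close>] by blast
 have "cadj T = S" unfolding cadj_def
 proof (rule the_equality[where P = "%S :: 'h op. ALL v w. cinner (S v) w = cinner v (T w)", OF S])
  fix S' :: "'h op" assume "ALL v w. cinner (S' v) w = cinner v (T w)"
  thus "S' = S" using S by (intro blinfun_eqI Re_cinner_eqI) simp
 qed
 with S show ?thesis by simp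
qed

lemma cinner_cadj_right: "cinner v (cadj T w) = cinner (T v) w" if "T : bounded_ops"
 for T :: "'h::complex_hilbert_space op" by (metis cinner_cadj_left[OF that] cinner_commute)

lemma cinner_eqI_left: "x = y" if "!!w. cinner x w = cinner y w" for x y :: "'h::complex_hilbert_space" using that by (intro Re_cinner_eqI) simp

lemma cadjI: "cadj T = S" if "T : bounded_ops" "!!v w. cinner (S v) w = cinner v (T w)"
 for T S :: "'h::complex_hilbert_space op" using that by (intro blinfun_eqI cinner_eqI_left) (simp add: cinner_cadj_left)

text \<open>\<open>Blinfun\<close> is meaningful only for bounded maps. The class axioms give the
  norm of \<open>scaleC c y\<close> for real \<open>c\<close>; for complex \<open>c\<close> it has
  to be computed from the inner product.\<close>

lemma op_scale_apply: "op_scale c T v = scaleC c (T v)" for T :: "'h::complex_hilbert_space op"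
proof -
 have "bounded_linear (%v. scaleC c (T v))"
 proof (rule bounded_linear_intro)
  show "scaleC c (T (r *\<^sub>R x)) = r *\<^sub>R scaleC c (T x)" for r x by (metis blinfun.scaleR_right mult.commute scaleC_of_real scaleC_scaleC)
  have n: "norm (scaleC c y) = cmod c * norm y" for y :: 'h
  proof -
   have "complex_of_real ((norm (scaleC c y))\<^sup>2) = complex_of_real ((cmod c * norm y)\<^sup>2)"
    unfolding cinner_self[symmetric] power_mult_distrib of_real_mult complex_norm_square by (simp add: cinner_scaleC_left cinner_scaleC_right mult_ac)
   hence "(norm (scaleC c y))\<^sup>2 = (cmod c * norm y)\<^sup>2" using of_real_eq_iff by blast
   thus ?thesis by (rule power2_eq_imp_eq) auto
  qed
  show "norm (scaleC c (T x)) <= norm x * (cmod c * norm T)" for x using mult_left_mono[OF norm_blinfun[of T x], of "cmod c"] by (simp add: n mult_ac)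
 qed (simp add: blinfun.add_right scaleC_add_right)
 thus ?thesis by (simp add: op_scale_def bounded_linear_Blinfun_apply)
qed

lemma scaleC_1 [simp]: "scaleC 1 x = x" for x :: "'h::complex_hilbert_space" using scaleC_of_real[of 1 x] by simp

text \<open>Makes spans, independence and dimension over the complex numbers available; they enter
  with the endomorphism algebras of bimodules.\<close>

global_interpretation op_space: vector_space "op_scale :: complex => 'h::complex_hilbert_space op => 'h op" by unfold_locales
  (auto intro!: blinfun_eqI simp: op_scale_apply blinfun.add_left scaleC_add_right scaleC_add_left
   scaleC_scaleC)

lemma op_scale_1 [simp]: "op_scale 1 T = T" by simp

lemma op_scale_of_real: "op_scale (of_real r) T = r *\<^sub>R T" for T :: "'h::complex_hilbert_space op"
 by (auto intro!: blinfun_eqI simp: op_scale_apply scaleC_of_real blinfun.scaleR_left)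

type_synonym 'h endo = "'h op => 'h op"

text \<open>From here on, \<open>*\<close> is the composition of operators and \<open>\<^bold>*\<close> the multiplication of numbers.\<close>

no_notation times (infixl "*" 70)

notation times (infixl "\<^bold>*" 70) and blinfun_compose (infixr "*" 70)

abbreviation idb :: "'h::complex_hilbert_space op" where "idb \<equiv> id_blinfun"

abbreviation scl :: "complex => 'h::complex_hilbert_space op => 'h op" where "scl \<equiv> op_scale"

lemma scale_left: "scl c S * T = scl c (S * T)" for S T :: "'h::complex_hilbert_space op" by (auto intro!: blinfun_eqI simp: op_scale_apply)

lemma op_scale_compose_right: "S * scl c T = scl c (S * T)" if "S : bounded_ops"
 for S T :: "'h::complex_hilbert_space op" using that by (auto intro!: blinfun_eqI simp: op_scale_apply bounded_opsD)

lemma assoc: "(S * T) * U = S * (T * U)" for S :: "'c::real_normed_vector \<Rightarrow>\<^sub>L 'd::real_normed_vector" by (auto intro!: blinfun_eqI)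

lemma compose_id [simp]: "T * id_blinfun = T" "id_blinfun * T = T" by (auto intro!: blinfun_eqI)

lemmas add_left = bounded_bilinear.add_left[OF bounded_bilinear_blinfun_compose]
lemmas add_right = bounded_bilinear.add_right[OF bounded_bilinear_blinfun_compose]
lemmas diff_left = bounded_bilinear.diff_left[OF bounded_bilinear_blinfun_compose]
lemmas diff_right = bounded_bilinear.diff_right[OF bounded_bilinear_blinfun_compose]
lemmas compose_sum_left = bounded_bilinear.sum_left[OF bounded_bilinear_blinfun_compose]
lemmas compose_sum_right = bounded_bilinear.sum_right[OF bounded_bilinear_blinfun_compose]

text \<open>Composites are kept nested to the right. This turns an equation for a product of two
  factors into a rewrite rule that works in front of any remaining factors.\<close>

lemma eq_tail: "S * T = U ==> S * (T * V) = U * V" for S T :: "'h::real_normed_vector \<Rightarrow>\<^sub>L 'h" by (simp add: assoc[symmetric])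

section \<open>Von Neumann factors and intertwiners\<close>

locale factor =
 fixes M :: "'h::complex_hilbert_space op set"
 assumes vn_factor: "vn_factor M"
begin

abbreviation Aut :: "'h endo set" where "Aut \<equiv> automorphisms M"

abbreviation isum :: "'h endo => 'h endo list => bool" where "isum \<equiv> isometric_sum M"

abbreviation irr :: "'h endo => bool" where "irr \<equiv> irreducible_endo M"

abbreviation End :: "'h endo set" where "End \<equiv> endomorphisms M"

abbreviation Hom :: "'h endo => 'h endo => 'h op set" where "Hom \<equiv> intertwiners M"

section \<open>Closure properties of the factor\<close>

lemma M_bounded: "x : M ==> x : bounded_ops" using vn_factor by (auto simp: vn_factor_def von_neumann_algebra_def)

lemma M_cadj [simp]: "x : M ==> cadj x : M" using vn_factor by (auto simp: vn_factor_def von_neumann_algebra_def)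

lemma M_double_commutant: "M = commutant (commutant M)" using vn_factor by (auto simp: vn_factor_def von_neumann_algebra_def)

lemma id_not_0 [simp]: "(idb :: 'h op) ~= 0" "(0 :: 'h op) ~= idb" using vn_factor by (auto simp: vn_factor_def)

text \<open>By the double commutant property \<open>M\<close> is itself a commutant, so this yields
  its closure under the algebraic operations.\<close>

lemma commutant_closed:
 "idb : commutant S" "0 : commutant S"
 "x : commutant S ==> y : commutant S ==> x + y : commutant S"
 "x : commutant S ==> y : commutant S ==> x * y : commutant S"
 "x : commutant S ==> S <= bounded_ops ==> scl c x : commutant S" for S :: "'h op set"
proof -
 show "idb : commutant S" "0 : commutant S" by (auto simp: commutant_def bounded_ops_def) (metis add_cancel_right_left scaleC_add_right)
 assume x: "x : commutant S"
 { assume y: "y : commutant S"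
  from x y show "x + y : commutant S" by (auto simp: commutant_def bounded_ops_def blinfun.add_left scaleC_add_right add_left
     add_right)
  from x y show "x * y : commutant S" unfolding commutant_def bounded_ops_def by (auto simp: assoc) (simp add: assoc[symmetric]) }
 assume S: "S <= bounded_ops"
 from x have "scl c x : bounded_ops" by (auto simp: commutant_def bounded_ops_def op_scale_apply scaleC_scaleC mult.commute)
 with x S show "scl c x : commutant S" by (auto simp: commutant_def scale_left op_scale_compose_right subset_iff)
qed

lemma commutant_M_bounded: "commutant M <= bounded_ops" by (auto simp: commutant_def)

lemma M_id [simp]: "idb : M" and M_0 [simp]: "0 : M"
 and M_add [simp]: "x : M ==> y : M ==> x + y : M"
 and M_compose [simp]: "x : M ==> y : M ==> x * y : M"
 and M_scale [simp]: "x : M ==> scl c x : M" using commutant_closed[where S = "commutant M"] commutant_M_bounded unfolding M_double_commutant[symmetric] by blast+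

lemma M_uminus [simp]: "x : M ==> - x : M" using M_scale[of x "-1"] by simp

lemma M_diff [simp]: "x : M ==> y : M ==> x - y : M" using M_add[of x "- y"] by simp

lemma M_scaleR [simp]: "x : M ==> r *\<^sub>R x : M" using M_scale[of x "of_real r"] by (simp add: op_scale_of_real)

lemma M_sum: "(!!i. i : I ==> f i : M) ==> sum f I : M" by (induction I rule: infinite_finite_induct) auto

lemma scale_right: "x : M ==> x * scl c y = scl c (x * y)" by (simp add: op_scale_compose_right M_bounded)

lemma cadj_cadj [simp]: "x : M ==> cadj (cadj x) = x" by (intro cadjI M_bounded M_cadj) (simp_all add: cinner_cadj_right M_bounded)

lemma cadj_o: "x : M ==> y : M ==> cadj (x * y) = cadj y * cadj x" by (intro cadjI M_bounded M_compose) (simp_all add: cinner_cadj_left M_bounded)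

lemma cadj_add: "x : M ==> y : M ==> cadj (x + y) = cadj x + cadj y" by (intro cadjI M_bounded M_add)
  (simp_all add: cinner_cadj_left M_bounded blinfun.add_left cinner_add_left cinner_add_right)

lemma cadj_scale: "x : M ==> cadj (scl c x) = scl (cnj c) (cadj x)" by (intro cadjI M_bounded M_scale)
  (simp_all add: cinner_cadj_left M_bounded op_scale_apply cinner_scaleC_left cinner_scaleC_right)

lemma cadj_id [simp]: "cadj idb = (idb :: 'h op)" by (intro cadjI M_bounded M_id) simp

lemma cadj_0 [simp]: "cadj 0 = (0 :: 'h op)" by (intro cadjI M_bounded M_0) simp

lemma cadj_self_eq_0:
 assumes x: "x : M" and 0: "cadj x * x = 0" shows "x = 0"
proof (rule blinfun_eqI)
 fix v
 have "cinner v ((cadj x * x) v) = 0" by (simp only: 0) simp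
 hence "cinner (x v) (x v) = 0" using x by (simp add: cinner_cadj_right M_bounded)
 thus "blinfun_apply x v = blinfun_apply 0 v" by (simp add: cinner_self_eq_0)
qed

text \<open>The scalar is the quotient of the squared norms of \<open>x v\<close> and
  \<open>v\<close>. Being a nonnegative real, it has a square root, by which intertwiners are
  normalized to isometries.\<close>

lemma cadj_self_scalar:
 assumes x: "x : M" and c: "cadj x * x = scl c idb"
 obtains r where "r >= 0" "c = complex_of_real r"
proof -
 obtain v :: 'h where v: "v ~= 0" by (metis id_not_0(1) blinfun_eqI zero_blinfun.rep_eq blinfun_apply_id_blinfun)
 have "cinner (x v) (x v) = cinner v ((cadj x * x) v)" using x by (simp add: cinner_cadj_right M_bounded)
 also have "... = c \<^bold>* complex_of_real ((norm v)\<^sup>2)" by (simp add: c op_scale_apply cinner_scaleC_right cinner_self)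
 finally have "complex_of_real ((norm (x v))\<^sup>2) = c \<^bold>* complex_of_real ((norm v)\<^sup>2)" by (simp add: cinner_self)
 hence "c = complex_of_real ((norm (x v))\<^sup>2 / (norm v)\<^sup>2)" using v by (simp add: field_simps)
 thus ?thesis by (intro that[of "(norm (x v))\<^sup>2 / (norm v)\<^sup>2"]) auto
qed

lemma center: "x : M ==> (!!y. y : M ==> x * y = y * x) ==> EX c. x = scl c idb"
proof -
 assume "x : M" "!!y. y : M ==> x * y = y * x"
 hence "x : M \<inter> commutant M" using M_bounded by (auto simp: commutant_def)
 thus ?thesis using vn_factor by (auto simp: vn_factor_def)
qed

section \<open>Normal endomorphisms\<close>

lemma endo_in: "H : End ==> x : M ==> H x : M"
 and endo_add: "H : End ==> x : M ==> y : M ==> H (x + y) = H x + H y"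
 and endo_scale: "H : End ==> x : M ==> H (scl c x) = scl c (H x)"
 and endo_o: "H : End ==> x : M ==> y : M ==> H (x * y) = H x * H y"
 and endo_cadj: "H : End ==> x : M ==> H (cadj x) = cadj (H x)"
 and endo_id: "H : End ==> H idb = idb"
 and endo_normal: "H : End ==> normal_map M H" by (auto simp: endomorphisms_def)

lemma endo_0: "H : End ==> H 0 = 0" using endo_scale[of H 0 0] by simp

lemma endo_diff: "H : End ==> x : M ==> y : M ==> H (x - y) = H x - H y" using endo_add[of H x "scl (-1) y"] endo_scale[of H y "-1"] by simp

lemma le_in_endo: "H : End ==> x : M ==> y : M ==> le_in M x y ==> le_in M (H x) (H y)" unfolding le_in_def by (metis endo_diff endo_o endo_cadj endo_in M_cadj)

text \<open>Normality speaks of directed families of self-adjoint elements, so the inner map has to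
  preserve self-adjointness and order for the outer one to be applicable.\<close>

lemma normal_compose:
 assumes H: "H : End" and n: "normal_map M \<phi>"
  and \<phi>: "!!x. x : M ==> \<phi> x : M" "!!x. x : M ==> cadj x = x ==> cadj (\<phi> x) = \<phi> x"
   "!!x y. x : M ==> y : M ==> le_in M x y ==> le_in M (\<phi> x) (\<phi> y)" shows "normal_map M (%x. H (\<phi> x))" unfolding normal_map_def
proof (intro allI impI)
 fix D s
 assume D: "D ~= {} & D <= {x : M. cadj x = x} &
  (ALL x:D. ALL y:D. EX z:D. le_in M x z & le_in M y z) & is_lub_in M D s"
 hence 1: "is_lub_in M (\<phi> ` D) (\<phi> s)" using n unfolding normal_map_def by blast
 have sub: "\<phi> ` D ~= {} & \<phi> ` D <= {x : M. cadj x = x}" using D \<phi> by auto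
 have dir: "ALL x:\<phi> ` D. ALL y:\<phi> ` D. EX z:\<phi> ` D. le_in M x z & le_in M y z"
 proof (intro ballI)
  fix x y assume "x : \<phi> ` D" "y : \<phi> ` D"
  then obtain a b where ab: "a : D" "b : D" "x = \<phi> a" "y = \<phi> b" by blast
  then obtain c where "c : D" "le_in M a c" "le_in M b c" using D by blast
  thus "EX z:\<phi> ` D. le_in M x z & le_in M y z" using ab D \<phi>(3) by (intro bexI[of _ "\<phi> c"]) auto
 qed
 have "is_lub_in M (H ` \<phi> ` D) (H (\<phi> s))"
  by (rule endo_normal[OF H, unfolded normal_map_def, rule_format]) (intro conjI; fact sub[THEN conjunct1] sub[THEN conjunct2] dir 1)
 thus "is_lub_in M ((%x. H (\<phi> x)) ` D) (H (\<phi> s))" by (simp add: image_image)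
qed

lemma endo_comp [simp]:
 assumes "H : End" "L : End" shows "H o L : End"
proof -
 have "normal_map M (%x. H (L x))"
 proof (rule normal_compose[OF assms(1) endo_normal[OF assms(2)]])
  show "cadj (L x) = L x" if "x : M" "cadj x = x" for x using endo_cadj[OF assms(2) that(1)] that(2) by simp
 qed (use assms(2) endo_in le_in_endo in blast)+
 thus ?thesis unfolding endomorphisms_def comp_def mem_Collect_eq by (intro conjI ballI allI)
   (simp_all only: assms endo_in endo_add endo_scale endo_o endo_cadj endo_id)
qed

lemma id_endo [simp]: "id : End" by (auto simp: endomorphisms_def normal_map_def)

text \<open>Objects are functions on all operators, whereas identities between them hold on
  \<open>M\<close> only. Suprema in the sense of \<open>is_lub_in\<close> lie in \<open>M\<close>,
  so normality is not affected.\<close>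

lemma endo_cong:
 assumes "H : End" "!!x. x : M ==> H x = L x" shows "L : End"
proof -
 have "normal_map M L" unfolding normal_map_def
 proof (intro allI impI)
  fix D s
  assume D: "D ~= {} & D <= {x : M. cadj x = x} &
  (ALL x:D. ALL y:D. EX z:D. le_in M x z & le_in M y z) & is_lub_in M D s"
  hence "is_lub_in M (H ` D) (H s)" using endo_normal[OF assms(1)] unfolding normal_map_def by blast
  moreover have "H ` D = L ` D" using D assms(2) by (intro image_cong) auto
  moreover have "H s = L s" using D assms(2) by (auto simp: is_lub_in_def)
  ultimately show "is_lub_in M (L ` D) (L s)" by simp
 qed
 thus ?thesis unfolding endomorphisms_def mem_Collect_eq by (intro conjI ballI allI)
   (simp_all only: assms(2)[symmetric] endo_in[OF assms(1)] endo_add[OF assms(1)]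
    endo_scale[OF assms(1)] endo_o[OF assms(1)] endo_cadj[OF assms(1)] endo_id[OF assms(1)]
    M_add M_scale M_compose M_cadj M_id)
qed

section \<open>Spaces of intertwiners\<close>

lemma HomD: "t : Hom H L ==> t : M"
 "t : Hom H L ==> x : M ==> t * H x = L x * t" by (auto simp: intertwiners_def)

lemma Hom_cong:
 "(!!x. x : M ==> H x = H' x) ==> (!!x. x : M ==> L x = L' x)
  ==> Hom H L = Hom H' L'" by (auto simp: intertwiners_def)

lemma Hom_o:
 "s : Hom L N ==> t : Hom H L ==> s * t : Hom H N" unfolding intertwiners_def by (simp add: assoc) (simp add: assoc[symmetric])

lemma Hom_add: "s : Hom H L ==> t : Hom H L ==> s + t : Hom H L" unfolding intertwiners_def by (auto simp: add_left add_right)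

lemma intertwiners_0 [simp]: "0 : Hom H L" unfolding intertwiners_def by auto

lemma Hom_scale:
 assumes "L : End" "s : Hom H L" shows "scl c s : Hom H L" using assms unfolding intertwiners_def by (auto simp: scale_left scale_right endo_in)

lemma intertwiners_diff:
 "s : Hom H L ==> t : Hom H L ==> s - t : Hom H L" unfolding intertwiners_def by (auto simp: diff_left diff_right)

lemma intertwiners_id [simp]: "idb : Hom H H" unfolding intertwiners_def by auto

lemma Hom_cadj:
 assumes "H : End" "L : End" "t : Hom H L" shows "cadj t : Hom L H"
proof -
 have t: "t : M" using assms(3) by (rule HomD)
 have "cadj t * L x = H x * cadj t" if x: "x : M" for x
 proof -
  have "cadj (t * H (cadj x)) = cadj (L (cadj x) * t)" using assms(3) x by (simp add: HomD)
  thus ?thesis using assms(1,2) t x by (simp add: cadj_o endo_in endo_cadj)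
 qed
 thus ?thesis using t by (simp add: intertwiners_def)
qed

lemma intertwiners_whisker_right:
 "t : Hom H L ==> N : End ==> t : Hom (H o N) (L o N)" by (auto simp: intertwiners_def endo_in)

lemma intertwiners_whisker_left:
 assumes "t : Hom H L" "N : End" "H : End" "L : End" shows "N t : Hom (N o H) (N o L)" using assms(1) unfolding intertwiners_def
 by (simp add: endo_in[OF assms(2)] endo_in[OF assms(3)] endo_in[OF assms(4)] endo_o[OF assms(2), symmetric])

end

section \<open>Ideals of intertwiners that factor through given endomorphisms\<close>

text \<open>With \<open>H = L\<close>, membership of \<open>idb\<close> says that \<open>H\<close>
  is a finite direct sum of members of \<open>P\<close>, without a choice of isometries. In this
  form the property passes through composition, direct sums and retracts by plain ideal
  arithmetic.\<close>

inductive_set gideal ::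
  "'h::complex_hilbert_space op set => 'h endo set => 'h endo => 'h endo
   => 'h op set" for M P H L where
 zero: "0 : gideal M P H L"
| step: "[|x : gideal M P H L; Q : P; t : intertwiners M Q L; a : intertwiners M H Q|]
  ==> x + t * a : gideal M P H L"

definition sums_of ::
  "'h::complex_hilbert_space op set => 'h endo set => 'h endo set" where
 "sums_of M P = {H : endomorphisms M. EX Hs. set Hs <= P & isometric_sum M H Hs}"

text \<open>The pairs consist of the source and the isometry of an intertwiner into \<open>L\<close>.\<close>

primrec orthonormal ::
  "'h::complex_hilbert_space op set => 'h endo => ('h endo \<times> 'h op) list => bool" where
 "orthonormal M L [] \<longleftrightarrow> True"
| "orthonormal M L (p # ps) \<longleftrightarrow> snd p : intertwiners M (fst p) L & cadj (snd p) * snd p = idb &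
  (ALL q:set ps. cadj (snd p) * snd q = 0 & cadj (snd q) * snd p = 0) & orthonormal M L ps"

primrec rproj :: "('h::complex_hilbert_space endo \<times> 'h op) list => 'h op" where
 "rproj [] = 0"
| "rproj (p # ps) = snd p * cadj (snd p) + rproj ps"

context factor
begin

lemma gideal_intertwiners: "x : gideal M P H L ==> x : Hom H L" by (induction rule: gideal.induct) (blast intro: intertwiners_0 Hom_add Hom_o)+

lemma gen_idealI: "Q : P ==> t : Hom Q L ==> a : Hom H Q ==> t * a : gideal M P H L" using gideal.step[OF gideal.zero] by fastforce

lemma gideal_base: "Q : P ==> idb : gideal M P Q Q" using gen_idealI[of Q P idb Q idb Q] by simp

lemma gideal_add: "y : gideal M P H L ==> x : gideal M P H L ==> x + y : gideal M P H L"
 by (induction rule: gideal.induct) (auto simp: add.assoc[symmetric] intro: gideal.step)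

lemma gideal_sum: "(!!i. i : I ==> f i : gideal M P H L) ==> sum f I : gideal M P H L" by (induction I rule: infinite_finite_induct) (auto intro: gideal_add gideal.zero)

lemma gideal_left: "x : gideal M P H L ==> y : Hom L N ==> y * x : gideal M P H N"
proof (induction rule: gideal.induct)
 case (step x Q t a)
 thus ?case using gideal.step[of "y * x" M P H N Q "y * t" a] by (simp add: add_right assoc Hom_o)
qed (simp add: gideal.zero)

lemma gideal_right: "x : gideal M P H L ==> y : Hom N H ==> x * y : gideal M P N L"
proof (induction rule: gideal.induct)
 case (step x Q t a)
 thus ?case using gideal.step[of "x * y" M P N L Q t "a * y"] by (simp add: add_left assoc Hom_o)
qed (simp add: gideal.zero)

text \<open>Transitivity of being a direct sum: it allows the simple constituents to be replaced by
  their own decompositions.\<close>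

lemma gideal_trans:
 assumes "x : gideal M P H L" "!!Q. Q : P ==> idb : gideal M P' Q Q" shows "x : gideal M P' H L" using assms(1)
proof (induction rule: gideal.induct)
 case (step x Q t a)
 hence "t * (idb * a) : gideal M P' H L" by (intro gideal_left[OF gideal_right[OF assms(2)]])
 thus ?case using gideal_add step.IH by simp
qed (simp add: gideal.zero)

lemma gideal_mono: "x : gideal M P H L ==> P <= Q ==> x : gideal M Q H L" by (rule gideal_trans) (auto intro: gideal_base)

lemma gideal_cong:
 "(!!x. x : M ==> H x = H' x) ==> (!!x. x : M ==> L x = L' x) ==> x : gideal M P H L
  ==> x : gideal M P H' L'" using gideal_left[of "x * idb" P H' L idb L'] gideal_right[of x P H L idb H'] by (simp add: intertwiners_def)

text \<open>Any such composite is a sum of terms with a factor in some \<open>Hom Q Q'\<close>. This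
  later yields the orthogonality of different degrees.\<close>

lemma gideal_orth:
 assumes x: "x : gideal M P H L" and y: "y : gideal M P' L' N"
  and f: "f : Hom L L'"
  and 0: "!!Q Q'. Q : P ==> Q' : P' ==> Hom Q Q' <= {0}" shows "y * (f * x) = 0" using x
proof (induction rule: gideal.induct)
 case (step x Q t a)
 have "y * (f * t) = 0" using y
 proof (induction rule: gideal.induct)
  case (step y Q' s b)
  have "b * (f * t) : Hom Q Q'" using step.hyps f \<open>t \<in> _\<close> by (intro Hom_o)
  hence "b * (f * t) = 0" using 0[OF \<open>Q \<in> P\<close> \<open>Q' \<in> P'\<close>] by blast
  thus ?case using step.IH by (simp add: add_left assoc)
 qed simp
 hence "y * (f * (t * a)) = 0" by (metis assoc blinfun_compose_zero(1))
 thus ?case using step.IH by (simp add: add_right)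
qed simp

lemma gideal_whisker_right:
 assumes "x : gideal M P H L" "N : End" "!!Q. Q : P ==> Q o N : P'" shows "x : gideal M P' (H o N) (L o N)" using assms(1)
proof (induction rule: gideal.induct)
 case (step x Q t a)
 thus ?case using assms(2,3) by (intro gideal.step[where Q = "Q o N"]) (blast intro: intertwiners_whisker_right)+
qed (simp add: gideal.zero)

section \<open>Isometric sums and orthonormal families\<close>

lemma isometric_sum_gideal:
 assumes "isum H Hs" "H : End" "set Hs <= End" shows "idb : gideal M (set Hs) H H"
proof -
 obtain s where s: "ALL i<length Hs. s i : Hom (Hs ! i) H & cadj (s i) * s i = idb"
  and one: "(\<Sum>i<length Hs. s i * cadj (s i)) = idb" using assms(1) unfolding isometric_sum_def by blast
 have "(\<Sum>i<length Hs. s i * cadj (s i)) : gideal M (set Hs) H H"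
 proof (rule gideal_sum, rule gen_idealI)
  fix i assume "i : {..<length Hs}"
  hence i: "i < length Hs" by simp
  thus "Hs ! i : set Hs" "s i : Hom (Hs ! i) H" using s by auto
  thus "cadj (s i) : Hom H (Hs ! i)" using assms by (intro Hom_cadj) auto
 qed
 thus ?thesis by (simp add: one)
qed

lemma isometric_sum_cong:
 assumes "isum H Hs" "length Hs = length Ls" "!!x. x : M ==> H x = L x"
  "!!i x. i < length Hs ==> x : M ==> (Hs ! i) x = (Ls ! i) x" shows "isum L Ls"
proof -
 have "Hom (Hs ! i) H = Hom (Ls ! i) L" if "i < length Hs" for i using assms(3,4) that by (intro Hom_cong) auto
 thus ?thesis using assms(1) unfolding isometric_sum_def by (simp add: assms(2))
qed

lemma isometric_sum_unitary:
 "isum H [L] \<longleftrightarrow>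
  (EX s:Hom L H. cadj s * s = idb & s * cadj s = idb)"
proof -
 have "isum H [L] \<longleftrightarrow> (EX s :: nat => 'h op. s 0 : Hom L H &
   cadj (s 0) * s 0 = idb & s 0 * cadj (s 0) = idb)" unfolding isometric_sum_def by (simp add: lessThan_Suc)
 also have "... \<longleftrightarrow> (EX s:Hom L H. cadj s * s = idb & s * cadj s = idb)" by (rule iffI, blast, elim bexE, rule_tac x = "%_. s" in exI, simp)
 finally show ?thesis .
qed

lemma orthonormal_props:
 assumes "orthonormal M L ps" "p : set ps" shows "snd p : Hom (fst p) L" "snd p : M" "cadj (snd p) * snd p = idb"
  "rproj ps * snd p = snd p" "cadj (snd p) * rproj ps = cadj (snd p)"
proof -
 have *: "snd p : Hom (fst p) L & snd p : M & cadj (snd p) * snd p = idb &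
  rproj ps * snd p = snd p & cadj (snd p) * rproj ps = cadj (snd p)" if "p : set ps" for p using assms(1) that
 proof (induction ps arbitrary: p)
  case (Cons q qs)
  have orth: "rproj rs * snd q = 0 & cadj (snd q) * rproj rs = 0" if "set rs <= set qs" for rs using that Cons.prems(1)
  proof (induction rs)
   case (Cons r rs)
   hence "cadj (snd q) * snd r = 0" "cadj (snd r) * snd q = 0" by auto
   thus ?case using Cons by (simp add: add_left add_right assoc)
     (simp add: assoc[symmetric])
  qed simp
  show ?case
  proof (cases "p = q")
   case True
   thus ?thesis using Cons.prems orth[of qs] by (auto simp: add_left add_right assoc HomD(1))
     (simp add: assoc[symmetric])
  next
   case False
   hence p: "p : set qs" using Cons.prems by simp
   hence "cadj (snd q) * snd p = 0" "cadj (snd p) * snd q = 0" using Cons.prems by auto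
   thus ?thesis using Cons.IH[OF _ p] Cons.prems by (simp add: add_left add_right assoc)
     (simp add: assoc[symmetric])
  qed
 qed simp
 show "snd p : Hom (fst p) L" "snd p : M" "cadj (snd p) * snd p = idb"
  "rproj ps * snd p = snd p" "cadj (snd p) * rproj ps = cadj (snd p)" using *[OF assms(2)] by auto
qed

lemma rproj_props:
 assumes "orthonormal M L ps" "L : End" "fst ` set ps <= End" shows "rproj ps : Hom L L" "cadj (rproj ps) = rproj ps"
  "rproj ps * rproj ps = rproj ps"
proof -
 have "rproj ps : Hom L L & cadj (rproj ps) = rproj ps" using assms
 proof (induction ps)
  case (Cons p ps)
  hence p: "snd p : Hom (fst p) L" "cadj (snd p) : Hom L (fst p)" by (auto intro: Hom_cadj)
  have "snd p * cadj (snd p) : Hom L L" using p by (rule Hom_o)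
  thus ?case using Cons p by (auto simp: cadj_add cadj_o HomD(1) intro!: Hom_add)
 qed simp
 thus "rproj ps : Hom L L" "cadj (rproj ps) = rproj ps" by auto
 have "rproj ps * rproj qs = rproj qs" if "set qs <= set ps" for qs using that
 proof (induction qs)
  case (Cons q qs)
  hence "rproj ps * snd q = snd q" using orthonormal_props(4)[OF assms(1)] by simp
  thus ?case using Cons by (simp add: add_right assoc[symmetric])
 qed simp
 thus "rproj ps * rproj ps = rproj ps" by simp
qed

lemma orthonormal_isometric_sum:
 assumes "orthonormal M L ps" "rproj ps = idb" shows "isum L (map fst ps)"
proof -
 have "rproj ps = (\<Sum>p\<leftarrow>ps. snd p * cadj (snd p))" for ps :: "('h endo \<times> 'h op) list" by (induction ps) auto
 hence "(\<Sum>i<length ps. snd (ps ! i) * cadj (snd (ps ! i))) = idb" using assms(2) by (simp add: sum_list_sum_nth atLeast0LessThan)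
 moreover have "snd (ps ! i) : Hom (map fst ps ! i) L & cadj (snd (ps ! i)) * snd (ps ! i) = idb"
  if "i < length ps" for i using that orthonormal_props[OF assms(1), of "ps ! i"] by simp
 ultimately show ?thesis unfolding isometric_sum_def by (intro exI[of _ "%i. snd (ps ! i)"]) simp
qed

lemma irreducible_scalar:
 "irr Q ==> x : Hom Q Q ==> EX c. x = scl c idb" by (auto simp: irreducible_endo_def)

text \<open>Irreducibility of the sources makes every inner product a scalar, so the classical
  process runs. The factorization of each isometry through \<open>f\<close> is recorded on purpose:
  it gives regular inverses of \<open>f\<close>, and for an idempotent \<open>f\<close> it keeps the
  isometries inside its range.\<close>

lemma gram_schmidt:
 assumes P: "P <= End" "!!Q. Q : P ==> irr Q"
  and L: "L : End" and H: "H : End"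
  and f: "f : Hom H L" and x: "x : gideal M P H H"
 obtains ps where "orthonormal M L ps"
  "!!p. p : set ps ==> fst p : P & (EX g:Hom (fst p) H. snd p = f * g)"
  "rproj ps * (f * x) = f * x"
proof -
 have "EX ps. orthonormal M L ps &
  (ALL p:set ps. fst p : P & (EX g:Hom (fst p) H. snd p = f * g)) &
  rproj ps * (f * x) = f * x" using x
 proof (induction rule: gideal.induct)
  case zero
  show ?case by (rule exI[of _ "[]"]) simp
 next
  case (step x Q t a)
  then obtain ps where ps: "orthonormal M L ps"
   "ALL p:set ps. fst p : P & (EX g:Hom (fst p) H. snd p = f * g)"
   "rproj ps * (f * x) = f * x" by blast
  define p where "p = rproj ps"
  have fst_ps: "fst ` set ps <= End" using ps(2) P(1) by auto
  note pp = rproj_props[OF ps(1) L fst_ps, folded p_def]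
  have pM: "p : M" using pp(1) by (rule HomD)
  have Q: "Q : End" "irr Q" using step.hyps P by auto
  have ft: "f * t : Hom Q L" using f step.hyps by (blast intro: Hom_o)
  \<comment> \<open>The projection of \<open>f * t\<close> onto the previous isometries still
    factors through \<open>f\<close>, because they do.\<close>
  have "EX g:Hom Q H. rproj qs * (f * t) = f * g" if "set qs <= set ps" for qs using that
  proof (induction qs)
   case Nil
   show ?case by (rule bexI[of _ 0]) simp_all
  next
   case (Cons q qs)
   then obtain g where g: "g : Hom Q H" "rproj qs * (f * t) = f * g" by auto
   obtain h where h: "h : Hom (fst q) H" "snd q = f * h" using Cons.prems ps(2) by auto
   have "cadj (snd q) : Hom L (fst q)" using Cons.prems fst_ps L by (intro Hom_cadj orthonormal_props(1)[OF ps(1)]) auto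
   hence "h * (cadj (snd q) * (f * t)) + g : Hom Q H" using h g ft by (intro Hom_add Hom_o[OF h(1)] Hom_o[OF _ ft])
   moreover have "rproj (q # qs) * (f * t) = f * (h * (cadj (snd q) * (f * t)) + g)" by (simp add: add_left add_right assoc g(2)) (simp add: h(2) assoc)
   ultimately show ?case by blast
  qed
  then obtain g where g: "g : Hom Q H" "p * (f * t) = f * g" unfolding p_def by blast
  \<comment> \<open>The part of \<open>f * t\<close> orthogonal to the previous isometries, written
    so that it visibly factors through \<open>f\<close>.\<close>
  define w where "w = f * (t - g)"
  have w: "w : Hom Q L" unfolding w_def using f g(1) step.hyps by (intro Hom_o intertwiners_diff)
  have wM: "w : M" using w by (rule HomD)
  have w_eq: "w = f * t - p * (f * t)" by (simp add: w_def g(2) diff_right)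
  have pw: "p * w = 0" unfolding w_eq by (simp add: diff_right assoc[symmetric] pp(3))
  have "cadj w * w : Hom Q Q" using w L Q(1) by (blast intro: Hom_o Hom_cadj)
  then obtain c where c: "cadj w * w = scl c idb" using irreducible_scalar[OF Q(2)] by blast
  obtain r where r: "r >= 0" "c = complex_of_real r" using cadj_self_scalar[OF wM c] .
  show ?case
  proof (cases "r = 0")
   case True
   hence "w = 0" using c r(2) by (intro cadj_self_eq_0[OF wM]) simp
   hence "p * (f * t) = f * t" using w_eq by simp
   hence "p * (f * (x + t * a)) = f * (x + t * a)" using ps(3) unfolding p_def[symmetric] by (simp add: add_right) (metis assoc)
   thus ?thesis using ps unfolding p_def by blast
  next
   case False
   \<comment> \<open>\<open>cadj w * w\<close> is the positive scalar \<open>r\<close>, so this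
     factor turns \<open>w\<close> into an isometry.\<close>
   define k where "k = complex_of_real (1 / sqrt r)"
   define v where "v = scl k w"
   have sq: "k \<^bold>* (k \<^bold>* c) = 1" unfolding k_def r(2) using False r(1) by (simp flip: of_real_mult)
   have ck: "cnj k = k" by (simp add: k_def)
   have v: "v : Hom Q L" unfolding v_def using w L by (rule Hom_scale[rotated])
   have vM: "v : M" using v by (rule HomD)
   have cv: "cadj v = scl k (cadj w)" unfolding v_def by (simp add: cadj_scale wM ck)
   have vv: "cadj v * v = idb" unfolding cv unfolding v_def by (simp add: scale_left scale_right[OF M_cadj[OF wM]] c sq)
   have pv: "p * v = 0" unfolding v_def using pM by (simp add: scale_right pw)
   have vp: "cadj v * p = 0" using arg_cong[OF pv, of cadj] pM vM by (simp add: cadj_o pp(2))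
   have vvw: "v * (cadj v * w) = w" unfolding cv unfolding v_def by (simp add: scale_left scale_right[OF wM] c mult.assoc sq)
   have orth: "cadj v * snd q = 0 & cadj (snd q) * v = 0" if "q : set ps" for q
   proof -
    have q: "p * snd q = snd q" "cadj (snd q) * p = cadj (snd q)" using orthonormal_props[OF ps(1) that] by (auto simp: p_def)
    show ?thesis by (metis q assoc pv vp blinfun_compose_zero)
   qed
   have "orthonormal M L ((Q, v) # ps)" using v vv orth ps(1) by simp
   moreover have "EX g:Hom Q H. v = f * g" using f g(1) step.hyps H HomD(1)[OF f] by (intro bexI[of _ "scl k (t - g)"])
     (auto simp: v_def w_def scale_right intro: Hom_scale intertwiners_diff)
   moreover have "rproj ((Q, v) # ps) * (f * (x + t * a)) = f * (x + t * a)"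
   proof -
    have 1: "cadj v * (f * x) = 0" by (metis ps(3) p_def vp assoc blinfun_compose_zero(1))
    have "v * (cadj v * (f * t)) = v * (cadj v * (w + p * (f * t)))" by (simp add: w_eq)
    also have "... = w" by (simp add: add_right vvw) (metis vp assoc blinfun_compose_zero)
    finally have 2: "v * (cadj v * (f * t)) + p * (f * t) = f * t" by (simp add: w_eq)
    have "v * (cadj v * (f * (t * a))) + p * (f * (t * a)) = f * (t * a)" using arg_cong[OF 2, of "%z. z * a"] by (simp add: add_left assoc)
    thus ?thesis using 1 ps(3) by (simp add: add_left add_right assoc p_def[symmetric])
   qed
   ultimately show ?thesis using ps(2) step.hyps by (intro exI[of _ "(Q, v) # ps"]) auto
  qed
 qed
 thus ?thesis using that by blast
qed

text \<open>Gram-Schmidt for the identity recovers isometries from the ideal condition. Later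
  arguments pass freely between the two descriptions.\<close>

lemma sums_of_iff:
 assumes P: "P <= End" "!!Q. Q : P ==> irr Q" shows "H : sums_of M P \<longleftrightarrow> H : End & idb : gideal M P H H"
proof
 assume "H : sums_of M P"
 then obtain Hs where "H : End" "set Hs <= P" "isum H Hs" unfolding sums_of_def by blast
 thus "H : End & idb : gideal M P H H" using isometric_sum_gideal[of H Hs] P(1) gideal_mono by blast
next
 assume *: "H : End & idb : gideal M P H H"
 obtain ps where "orthonormal M H ps" "!!p. p : set ps ==> fst p : P" "rproj ps = idb" using gram_schmidt[OF P, of H H idb idb] * intertwiners_id compose_id(1) by metis
 thus "H : sums_of M P" unfolding sums_of_def using * orthonormal_isometric_sum[of H ps] by (auto intro!: exI[of _ "map fst ps"])
qed

text \<open>Gram-Schmidt produces a projection that fixes \<open>f\<close> and is built from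
  isometries factoring through \<open>f\<close>; it therefore has the form
  \<open>f * g\<close>.\<close>

lemma intertwiners_regular:
 assumes P: "P <= End" "!!Q. Q : P ==> irr Q"
  and H: "H : sums_of M P" and L: "L : End" and f: "f : Hom H L"
 obtains g where "g : Hom L H" "f * (g * f) = f"
proof -
 have H': "H : End" "idb : gideal M P H H" using H sums_of_iff[OF P] by auto
 obtain ps where ps: "orthonormal M L ps"
  "!!p. p : set ps ==> fst p : P & (EX g:Hom (fst p) H. snd p = f * g)"
  "rproj ps * f = f" using gram_schmidt[OF P L H'(1) f H'(2)] by (metis compose_id(1))
 have "EX g:Hom L H. rproj qs = f * g" if "set qs <= set ps" for qs using that
 proof (induction qs)
  case Nil
  show ?case by (rule bexI[of _ 0]) simp_all
 next
  case (Cons q qs)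
  then obtain g where g: "g : Hom L H" "rproj qs = f * g" by auto
  have "q : set ps" using Cons.prems by simp
  then obtain h where h: "h : Hom (fst q) H" "snd q = f * h" "fst q : P" using ps(2) by blast
  have "cadj (snd q) : Hom L (fst q)" using Cons.prems h P(1) L by (intro Hom_cadj orthonormal_props(1)[OF ps(1)]) auto
  hence "h * cadj (snd q) + g : Hom L H" using h g by (intro Hom_add Hom_o)
  moreover have "rproj (q # qs) = f * (h * cadj (snd q) + g)" by (simp add: g(2) add_right) (simp add: h(2) assoc)
  ultimately show ?case by blast
 qed
 then obtain g where "g : Hom L H" "rproj ps = f * g" by blast
 thus ?thesis using that ps(3) by (metis assoc)
qed

end

section \<open>Direct sums\<close>

text \<open>A pair of isometries as below, for which \<open>id \<oplus> id\<close> is a normal endomorphism, makes all direct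
 sums of normal endomorphisms normal. It also makes \<open>le_in M\<close> transitive without square roots:
 \<open>x\<^sup>*x + y\<^sup>*y = z\<^sup>*z\<close> for \<open>z = v\<^sub>1 x + v\<^sub>2 y\<close>.\<close>

locale cuntz_factor = factor M for M :: "'h::complex_hilbert_space op set" +
 fixes v1 v2 :: "'h::complex_hilbert_space op"
 assumes v_in [simp]: "v1 : M" "v2 : M"
  and v_iso: "cadj v1 * v1 = idb" "cadj v2 * v2 = idb"
  and v_sum: "v1 * cadj v1 + v2 * cadj v2 = idb"
  and v_normal: "normal_map M (%x. v1 * x * cadj v1 + v2 * x * cadj v2)"
begin

lemma v_orth: "cadj v1 * v2 = 0" "cadj v2 * v1 = 0"
proof -
 have "cadj v1 * (v1 * cadj v1 + v2 * cadj v2) = cadj v1" by (simp add: v_sum)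
 hence "cadj v1 * (v2 * cadj v2) = 0" by (simp add: add_right eq_tail[OF v_iso(1)])
 hence "(cadj v1 * (v2 * cadj v2)) * v2 = 0" by simp
 thus 1: "cadj v1 * v2 = 0" by (simp add: assoc v_iso)
 from arg_cong[OF this, of cadj] show "cadj v2 * v1 = 0" by (simp add: cadj_o)
qed

lemmas v_tail = eq_tail[OF v_iso(1)] eq_tail[OF v_iso(2)]
 eq_tail[OF v_orth(1)] eq_tail[OF v_orth(2)]

abbreviation pos :: "'h op => bool" where "pos x \<equiv> le_in M 0 x"

lemma le_in_pos: "le_in M x y \<longleftrightarrow> pos (y - x)" by (simp add: le_in_def)

lemma pos_add: assumes "pos x" "pos y" shows "pos (x + y)"
proof -
 obtain a b where "a : M" "x = cadj a * a" "b : M" "y = cadj b * b" using assms by (auto simp: le_in_def)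
 hence "v1 * a + v2 * b : M"
  "x + y = cadj (v1 * a + v2 * b) * (v1 * a + v2 * b)" by (simp_all add: cadj_add cadj_o add_left add_right assoc v_iso v_orth v_tail)
 thus ?thesis by (auto simp: le_in_def)
qed

definition endo_sum :: "'h endo => 'h endo => 'h op => 'h op" where
 "endo_sum H L x = v1 * H x * cadj v1 + v2 * L x * cadj v2"

lemma endo_sum_star_hom:
 assumes "H : End" "L : End" shows "x : M ==> endo_sum H L x : M"
  "x : M ==> y : M ==> endo_sum H L (x + y) = endo_sum H L x + endo_sum H L y"
  "x : M ==> y : M ==> endo_sum H L (x - y) = endo_sum H L x - endo_sum H L y"
  "x : M ==> y : M ==> endo_sum H L (x * y) = endo_sum H L x * endo_sum H L y"
  "x : M ==> endo_sum H L (cadj x) = cadj (endo_sum H L x)"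
  "x : M ==> endo_sum H L (scl c x) = scl c (endo_sum H L x)"
  "endo_sum H L idb = idb" using assms by (simp_all add: endo_sum_def endo_in endo_add endo_diff endo_o endo_cadj endo_scale endo_id v_sum
   add_left add_right diff_left diff_right assoc v_tail cadj_add
   cadj_o scale_left scale_right op_space.scale_right_distrib)

lemma endo_sum_id_endo: "endo_sum id id : End"
proof -
 have "endo_sum id id = (%x. v1 * x * cadj v1 + v2 * x * cadj v2)" by (auto simp: endo_sum_def)
 hence "normal_map M (endo_sum id id)" using v_normal by simp
 thus ?thesis unfolding endomorphisms_def mem_Collect_eq by (intro conjI ballI allI) (simp_all add: endo_sum_star_hom)
qed

text \<open>\<open>H \<oplus> H\<close> is the composite of \<open>id \<oplus> id\<close> with
  \<open>H\<close>. Sums with different summands are compared with this case.\<close>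

lemma endo_sum_same_normal: "H : End ==> normal_map M (endo_sum H H)"
proof -
 assume "H : End"
 hence "endo_sum id id o H : End" by (intro endo_comp endo_sum_id_endo)
 moreover have "endo_sum id id o H = endo_sum H H" by (auto simp: endo_sum_def)
 ultimately show ?thesis using endo_normal by metis
qed

lemma pos_conj: "pos x ==> v : M ==> pos (v * x * cadj v)"
proof -
 assume "pos x" "v : M"
 then obtain a where "a : M" "x = cadj a * a" by (auto simp: le_in_def)
 hence "a * cadj v : M" "v * x * cadj v = cadj (a * cadj v) * (a * cadj v)" using \<open>v \<in> M\<close> by (simp_all add: cadj_o assoc)
 thus ?thesis by (auto simp: le_in_def)
qed

text \<open>The infimum of \<open>v\<^sub>1 H(s - x) v\<^sub>1\<^sup>*\<close> over \<open>x\<close> is zero, because these elements lie below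
 \<open>(H \<oplus> H)(s - x)\<close>. Infima of decreasing families add up.\<close>

lemma endo_sum_endo [simp]:
 assumes H: "H : End" and L: "L : End" shows "endo_sum H L : End"
proof -
 have "normal_map M (endo_sum H L)" unfolding normal_map_def
 proof (intro allI impI)
  fix D s
  assume D: "D ~= {} & D <= {x : M. cadj x = x} &
  (ALL x:D. ALL y:D. EX z:D. le_in M x z & le_in M y z) & is_lub_in M D s"
  hence DM: "!!x. x : D ==> x : M" and sM: "s : M" and le_s: "!!x. x : D ==> pos (s - x)" by (auto simp: is_lub_in_def le_in_pos[symmetric])
  define A where "A x = v1 * H x * cadj v1" for x
  define B where "B x = v2 * L x * cadj v2" for x
  have AM: "A x : M" "B x : M" if "x : M" for x using that H L by (auto simp: A_def B_def endo_in)
  have pos_endo: "pos (N x)" if "N : End" "x : M" "pos x" for N x using le_in_endo[OF that(1), of 0 x] that by (simp add: endo_0)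
  have pos_A: "pos (A x)" "pos (B x)" if "x : M" "pos x" for x unfolding A_def B_def by (intro pos_conj pos_endo[OF H] pos_endo[OF L] v_in that)+
  have diff: "A (x - y) = A x - A y" "B (x - y) = B x - B y" if "x : M" "y : M" for x y unfolding A_def B_def using that H L
   by (simp_all add: endo_diff diff_left diff_right)
  have lub_same: "is_lub_in M (endo_sum N N ` D) (endo_sum N N s)" if "N : End" for N using endo_sum_same_normal[OF that] D unfolding normal_map_def by blast
  \<comment> \<open>The supremum of the values of \<open>N \<oplus> N\<close> on \<open>D\<close> is
    known, so its values on the differences \<open>s - x\<close> have infimum zero.
    \<open>inf_A\<close> and \<open>inf_B\<close> reduce to this by adding the missing positive
    summand.\<close>
  have inf_same: "pos U" if U: "U : M" and N: "N : End"
   and ge: "!!x. x : D ==> pos (U + endo_sum N N (s - x))" for U N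
  proof -
   have ub: "le_in M (endo_sum N N x) (U + endo_sum N N s)" if "x : D" for x using ge[OF that] endo_sum_star_hom(3)[OF N N sM DM[OF that]]
    by (simp add: le_in_def add_diff_eq)
   have "U + endo_sum N N s : M" using U sM endo_sum_star_hom(1)[OF N N] by simp
   hence "le_in M (endo_sum N N s) (U + endo_sum N N s)" using lub_same[OF N] ub unfolding is_lub_in_def by (metis (no_types, lifting) imageE)
   thus ?thesis by (simp add: le_in_def)
  qed
  have inf_A: "pos U" if U: "U : M" and ge: "!!x. x : D ==> pos (U + A (s - x))" for U
  proof (rule inf_same[OF U H])
   fix x assume x: "x : D"
   have "pos (v2 * H (s - x) * cadj v2)" by (intro pos_conj pos_endo[OF H] v_in M_diff sM DM[OF x] le_s[OF x])
   from pos_add[OF ge[OF x] this] show "pos (U + endo_sum H H (s - x))" by (simp add: endo_sum_def A_def add.assoc)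
  qed
  have inf_B: "pos U" if U: "U : M" and ge: "!!x. x : D ==> pos (U + B (s - x))" for U
  proof (rule inf_same[OF U L])
   fix x assume x: "x : D"
   have "pos (v1 * L (s - x) * cadj v1)" by (intro pos_conj pos_endo[OF L] v_in M_diff sM DM[OF x] le_s[OF x])
   from pos_add[OF ge[OF x] this] show "pos (U + endo_sum L L (s - x))" by (simp add: endo_sum_def B_def add.assoc add.commute[of "v1 * _"])
  qed
  have le: "le_in M (endo_sum H L x) (endo_sum H L s)" if "x : D" for x
  proof -
   have "pos (A (s - x) + B (s - x))" by (intro pos_add pos_A M_diff sM DM[OF that] le_s[OF that])
   thus ?thesis using that DM sM by (simp add: le_in_pos[of "endo_sum H L x"] endo_sum_star_hom(3)[OF H L, symmetric])
     (simp add: endo_sum_def A_def B_def)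
  qed
  have least: "le_in M (endo_sum H L s) t" if t: "t : M" and ub: "ALL x:D. le_in M (endo_sum H L x) t" for t
  proof -
   define T where "T = t - endo_sum H L s"
   have T: "T : M" unfolding T_def using t sM endo_sum_star_hom(1)[OF H L] by simp
   \<comment> \<open>Directedness of \<open>D\<close> allows independent indices in the two
     summands, by passing to a common upper bound. After that the infimum over each index is taken
     separately.\<close>
   have both: "pos (T + A (s - x) + B (s - y))" if xy: "x : D" "y : D" for x y
   proof -
    obtain z where z: "z : D" "le_in M x z" "le_in M y z" using D xy by blast
    have M: "x : M" "y : M" "z : M" using xy z DM by auto
    have "pos (t - endo_sum H L z)" using ub z(1) by (simp add: le_in_pos[symmetric])
    moreover have "pos (A (z - x))" "pos (B (z - y))" using pos_A z M by (auto simp: le_in_pos[symmetric])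
    ultimately have "pos ((t - endo_sum H L z) + (A (z - x) + B (z - y)))" by (intro pos_add)
    moreover have "(t - endo_sum H L z) + (A (z - x) + B (z - y)) = T + A (s - x) + B (s - y)" using M sM by (simp add: T_def diff) (simp add: endo_sum_def A_def B_def)
    ultimately show ?thesis by simp
   qed
   have "pos (T + B (s - y))" if y: "y : D" for y
   proof (rule inf_A)
    show "T + B (s - y) : M" by (intro M_add T AM(2) M_diff sM DM y)
    show "pos (T + B (s - y) + A (s - x))" if "x : D" for x using both[OF that y] by (simp only: add_ac)
   qed
   hence "pos T" by (intro inf_B[OF T])
   thus ?thesis by (simp add: T_def le_in_def)
  qed
  show "is_lub_in M (endo_sum H L ` D) (endo_sum H L s)" using le least sM endo_sum_star_hom(1)[OF H L] by (auto simp: is_lub_in_def)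
 qed
 thus ?thesis unfolding endomorphisms_def mem_Collect_eq by (intro conjI ballI allI) (simp_all add: endo_sum_star_hom H L)
qed

lemma v_intertwiners:
 assumes "H : End" "L : End" shows "v1 : Hom H (endo_sum H L)" "v2 : Hom L (endo_sum H L)"
  "cadj v1 : Hom (endo_sum H L) H" "cadj v2 : Hom (endo_sum H L) L" by (simp_all add: intertwiners_def endo_sum_def add_left add_right assoc v_iso v_orth v_tail)

text \<open>The family is bundled into one isometry out of the direct sum of its sources. It has to
  be nonempty, because a unital endomorphism is never a zero object.\<close>

lemma orthonormal_range:
 assumes "orthonormal M H ps" "ps ~= []" "fst ` set ps <= T"
  and T: "T <= End" "!!L N. L : T ==> N : T ==> endo_sum L N : T" shows "EX L:T. EX s:Hom L H. cadj s * s = idb & s * cadj s = rproj ps" using assms(1-3)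
proof (induction ps)
 case (Cons p ps)
 have p: "snd p : Hom (fst p) H" "cadj (snd p) * snd p = idb" "fst p : T" using Cons.prems by auto
 show ?case
 proof (cases "ps = []")
  case True
  thus ?thesis using p by (intro bexI[of _ "fst p"] bexI[of _ "snd p"]) auto
 next
  case False
  then obtain L s where L: "L : T" and s: "s : Hom L H"
   and ss: "cadj s * s = idb" "s * cadj s = rproj ps" using Cons by auto
  have e: "fst p : End" "L : End" using p L T by auto
  have M: "s : M" "snd p : M" using s p by (auto dest: HomD)
  have "cadj (snd p) * rproj qs = 0" if "set qs <= set ps" for qs using that Cons.prems(1)
  proof (induction qs)
   case (Cons q qs)
   hence "cadj (snd p) * snd q = 0" by auto
   thus ?case using Cons by (simp add: add_right assoc[symmetric])
  qed simp
  hence "cadj (snd p) * rproj ps = 0" by blast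
  hence "(cadj (snd p) * (s * cadj s)) * s = 0" by (simp add: ss(2))
  hence 1: "cadj (snd p) * s = 0" by (simp add: assoc ss(1))
  from arg_cong[OF this, of cadj] have 2: "cadj s * snd p = 0" using M by (simp add: cadj_o)
  \<comment> \<open>The sum of the two isometries, precomposed with the projections of the direct
    sum onto its summands.\<close>
  define w where "w = snd p * cadj v1 + s * cadj v2"
  have w: "w : Hom (endo_sum (fst p) L) H" unfolding w_def using v_intertwiners[OF e] p s by (intro Hom_add Hom_o)
  have cw: "cadj w = v1 * cadj (snd p) + v2 * cadj s" unfolding w_def using M by (simp add: cadj_add cadj_o)
  have "cadj w * w = idb" unfolding cw by (simp add: w_def add_left add_right assoc eq_tail[OF p(2)]
     eq_tail[OF 1] eq_tail[OF 2] eq_tail[OF ss(1)] v_sum)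
  moreover have "w * cadj w = rproj (p # ps)" unfolding cw by (simp add: w_def add_left add_right assoc v_tail ss(2)[symmetric])
  ultimately show ?thesis using w T(2)[OF p(3) L] by blast
 qed
qed simp

text \<open>Serves as an induction principle: a property of endomorphisms that holds on
  \<open>P\<close> and passes to direct sums holds for all sums up to unitary equivalence. The
  existence of duals is proved in this way.\<close>

lemma sums_of_closed:
 assumes P: "P <= End" "!!Q. Q : P ==> irr Q" and H: "H : sums_of M P"
  and T: "P <= T" "T <= End" "!!L N. L : T ==> N : T ==> endo_sum L N : T" shows "EX L:T. isum H [L]"
proof -
 have H': "H : End" "idb : gideal M P H H" using H sums_of_iff[OF P] by auto
 obtain ps where ps: "orthonormal M H ps" "!!p. p : set ps ==> fst p : P" "rproj ps = idb"
  using gram_schmidt[OF P H'(1) H'(1) intertwiners_id H'(2)] by (metis compose_id(1))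
 have "ps ~= []" using ps(3) by auto
 moreover have "fst ` set ps <= T" using ps(2) T(1) by blast
 ultimately show ?thesis using orthonormal_range[OF ps(1) _ _ T(2,3)] by (auto simp: isometric_sum_unitary ps(3))
qed

text \<open>The idempotent need not be self-adjoint. An isometry onto its range serves as the
  inclusion, and its adjoint composed with \<open>e\<close> as the retraction; \<open>e\<close> must
  be nonzero for the range to be an endomorphism.\<close>

lemma idempotent_splitting:
 assumes P: "P <= End" "!!Q. Q : P ==> irr Q"
  and H: "H : sums_of M P" and e: "e : Hom H H" "e * e = e" "e ~= 0"
 obtains L r s where "L : sums_of M P" "r : Hom H L" "s : Hom L H"
  "r * s = idb" "s * r = e"
proof -
 have H': "H : End" "idb : gideal M P H H" using H sums_of_iff[OF P] by auto
 obtain ps where ps: "orthonormal M H ps"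
  "!!p. p : set ps ==> fst p : P & (EX g:Hom (fst p) H. snd p = e * g)"
  "rproj ps * e = e" using gram_schmidt[OF P H'(1) H'(1) e(1) H'(2)] by (metis compose_id(1))
 have "ps ~= []" using ps(3) e(3) by auto
 then obtain L s where L: "L : End" and s: "s : Hom L H"
  and ss: "cadj s * s = idb" "s * cadj s = rproj ps" using orthonormal_range[OF ps(1), of "End"] ps(2) P(1) by fastforce
 have s': "cadj s : Hom H L" using L H'(1) s by (rule Hom_cadj)
 \<comment> \<open>Every isometry in \<open>ps\<close> factors through \<open>e\<close>, so
   \<open>e\<close> fixes it.\<close>
 have "e * rproj qs = rproj qs" if "set qs <= set ps" for qs using that
 proof (induction qs)
  case (Cons q qs)
  hence "q : set ps" by simp
  then obtain g where "snd q = e * g" using ps(2) by blast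
  hence "e * snd q = snd q" by (simp add: eq_tail[OF e(2)])
  thus ?case using Cons by (simp add: add_right assoc[symmetric])
 qed simp
 hence "e * rproj ps = rproj ps" by blast
 hence "(e * (s * cadj s)) * s = (s * cadj s) * s" by (simp add: ss(2))
 hence es: "e * s = s" by (simp add: assoc ss(1))
 have "cadj s * (idb * s) : gideal M P L L" using H'(2) s s' by (intro gideal_left gideal_right)
 hence "L : sums_of M P" using sums_of_iff[OF P] L ss(1) by simp
 moreover have "cadj s * e : Hom H L" using s' e(1) by (rule Hom_o)
 moreover have "(cadj s * e) * s = idb" by (simp add: assoc es ss(1))
 moreover have "s * (cadj s * e) = e" using ps(3) by (simp add: assoc[symmetric] ss(2))
 ultimately show ?thesis using that s by blast
qed

end

section \<open>Calculus in categories of endomorphisms\<close>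

abbreviation ec :: "'h::complex_hilbert_space endo option => 'h endo option => 'h endo option" where "ec \<equiv> endo_comp"

text \<open>An object acts on \<open>M\<close>; the zero object acts by zero. With this convention \<open>act X 1\<close> is the
 identity of \<open>X\<close>, left whiskering by \<open>X\<close> is \<open>act X\<close>, and right whiskering does not change operators.\<close>

definition act :: "'h::complex_hilbert_space endo option => 'h op => 'h op" where
 "act X = (case X of None => %_. 0 | Some H => H)"

lemma act_simps [simp]: "act None x = 0" "act (Some H) = H" by (simp_all add: act_def)

lemma endo_category_simps [simp]:
 "Ob (endo_category M S) = with_zero S" "Cmp (endo_category M S) = (*)"
 "Idm (endo_category M S) = endo_id" "Scl (endo_category M S) = scl"
 "TenO (endo_category M S) = ec" "Unt (endo_category M S) = Some id"
 "Asc (endo_category M S) X Y Z = endo_id (ec X (ec Y Z))"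
 "LUn (endo_category M S) = endo_id" "RUn (endo_category M S) = endo_id" by (simp_all add: endo_category_def)

locale endo_tensor = factor M for M :: "'h::complex_hilbert_space op set" +
 fixes S :: "'h::complex_hilbert_space endo set"
 assumes S_endo: "S <= End" and S_id [simp]: "id : S"
  and S_comp [simp]: "H : S ==> L : S ==> H o L : S"
begin

abbreviation CC :: "'h endo_moncat" where "CC \<equiv> endo_category M S"

abbreviation Obj :: "'h endo option set" where "Obj \<equiv> with_zero S"

lemma Obj_simps [simp]: "None : Obj" "Some H : Obj \<longleftrightarrow> H : S" by (auto simp: with_zero_def)

lemma S_endoD: "H : S ==> H : End" using S_endo by blast

lemma act_in [simp]: "X : Obj ==> x : M ==> act X x : M"
 and act_add: "X : Obj ==> x : M ==> y : M ==> act X (x + y) = act X x + act X y"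
 and act_scale: "X : Obj ==> x : M ==> act X (scl c x) = scl c (act X x)"
 and act_o: "X : Obj ==> x : M ==> y : M ==> act X (x * y) = act X x * act X y"
 and act_0 [simp]: "X : Obj ==> act X 0 = 0" by (cases X; simp add: endo_in endo_add endo_scale endo_o endo_0 S_endoD)+

lemma endo_comp_simps [simp]:
 "ec None Y = None" "ec X None = None" "ec (Some H) (Some L) = Some (H o L)" by (simp_all add: endo_comp_def split: option.split)

lemma endo_comp_Obj [simp]: "X : Obj ==> Y : Obj ==> ec X Y : Obj" by (cases X; cases Y) auto

lemma act_endo_comp [simp]: "X : Obj ==> Y : Obj ==> act (ec X Y) x = act X (act Y x)" by (cases X; cases Y) (auto simp: endo_0 S_endoD)

lemma endo_id_act: "X : Obj ==> Defs.endo_id X = act X idb" by (cases X) (auto simp: endo_id_def endo_id S_endoD)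

text \<open>The last two conditions are automatic for genuine endomorphisms and force
  \<open>t = 0\<close> when one object is zero. This spares the case distinctions on the formal zero
  object.\<close>

definition homs :: "'h endo option => 'h endo option => 'h op set" where
 "homs X Y = {t : M. (ALL x:M. t * act X x = act Y x * t) & t * act X idb = t & act Y idb * t = t}"

lemma Mor_CC: "X : Obj ==> Y : Obj ==> Mor CC X Y = homs X Y" by (cases X; cases Y)
  (auto simp: endo_category_def homs_def intertwiners_def endo_id S_endoD)

lemma hom_Some: "H : S ==> L : S ==> homs (Some H) (Some L) = Hom H L" by (auto simp: homs_def intertwiners_def endo_id S_endoD)

lemma hom_None: "homs None Y = {0}" "homs X None = {0}" by (auto simp: homs_def)

lemma homD: "t : homs X Y ==> t : M" "t : homs X Y ==> x : M ==> t * act X x = act Y x * t"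
 "t : homs X Y ==> t * act X idb = t" "t : homs X Y ==> act Y idb * t = t" by (auto simp: homs_def)

lemma hom_0 [simp]: "0 : homs X Y" by (auto simp: homs_def)

lemma hom_one: "X : Obj ==> act X idb : homs X X" by (auto simp: homs_def act_o[symmetric])

lemma hom_o: assumes "g : homs Y Z" "f : homs X Y" shows "g * f : homs X Z"
proof -
 have "(g * f) * act X x = act Z x * (g * f)" if "x : M" for x using homD(2)[OF assms(1) that] homD(2)[OF assms(2) that] by (metis assoc)
 moreover have "(g * f) * act X idb = g * f" using homD(3)[OF assms(2)] by (simp add: assoc)
 moreover have "act Z idb * (g * f) = g * f" using homD(4)[OF assms(1)] by (metis assoc)
 ultimately show ?thesis using homD(1)[OF assms(1)] homD(1)[OF assms(2)] by (simp add: homs_def)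
qed

lemma hom_add: "f : homs X Y ==> g : homs X Y ==> f + g : homs X Y" by (auto simp: homs_def add_left add_right)

lemma hom_scale: "Y : Obj ==> f : homs X Y ==> scl c f : homs X Y" by (auto simp: homs_def scale_left scale_right)

lemma hom_whisker_left:
 "f : homs X Y ==> X : Obj ==> Y : Obj ==> Z : Obj ==> act Z f : homs (ec Z X) (ec Z Y)" by (auto simp: homs_def act_o[symmetric])

lemma hom_ten:
 assumes f: "f : homs X X'" and g: "g : homs Y Y'"
  and o: "X : Obj" "X' : Obj" "Y : Obj" "Y' : Obj" shows "f * act X g : homs (ec X Y) (ec X' Y')"
proof -
 note M = homD(1)[OF f] homD(1)[OF g]
 have g': "act X g * act X (act Y x) = act X (act Y' x) * act X g" if "x : M" for x using that o M homD(2)[OF g that] by (simp add: act_o[symmetric])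
 have "(f * act X g) * act X (act Y x) = act X' (act Y' x) * (f * act X g)" if "x : M" for x using homD(2)[OF f, of "act Y' x"] that o g'[OF that]
  by (simp add: assoc) (simp add: assoc[symmetric])
 moreover have "(f * act X g) * act X (act Y idb) = f * act X g" using o M homD(3)[OF g] by (simp add: assoc act_o[symmetric])
 moreover have "act X' (act Y' idb) * (f * act X g) = f * act X g"
 proof -
  have "act X' (act Y' idb) * (f * act X g) = (f * act X (act Y' idb)) * act X g" using o homD(2)[OF f, of "act Y' idb"] by (simp add: assoc[symmetric])
  thus ?thesis using o M homD(4)[OF g] by (simp add: assoc act_o[symmetric])
 qed
 ultimately show ?thesis using o M by (simp add: homs_def)
qed

lemma whisk_simps: "lwhisk CC X Y Y' g = act X g" "rwhisk CC X X' Y f = f * act X (Defs.endo_id Y)"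
 "TenM CC X X' Y Y' f g = f * act X g" by (cases X; simp add: lwhisk_def rwhisk_def endo_category_def Defs.endo_id_def)+

lemma is_inverse_CC: "X : Obj ==> is_inverse CC X X (act X idb) g \<longleftrightarrow> g = act X idb"
 by (auto simp: is_inverse_def Mor_CC hom_one homD endo_id_act) (simp add: act_o[symmetric])+

lemma inv_mor_CC: "X : Obj ==> inv_mor CC X X (act X idb) = act X idb" by (simp add: inv_mor_def is_inverse_CC)

end

section \<open>Separable algebras and relative tensor products\<close>

type_synonym 'h bm = "('h endo option, 'h op) bimod"

locale endo_algebra = endo_tensor M S for M :: "'h::complex_hilbert_space op set" and S +
 fixes A :: "'h::complex_hilbert_space op => 'h op" and m u :: "'h op"
 assumes is_alg: "is_algebra (endo_category M S) (Some A, m, u)"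
begin

abbreviation AA where "AA \<equiv> (Some A, m, u)"

lemma A_S [simp]: "A : S" using is_alg by simp

lemma A_endo [simp]: "A : End" by (simp add: S_endoD)

lemma A_in [simp]: "x : M ==> A x : M"
 and A_add: "x : M ==> y : M ==> A (x + y) = A x + A y"
 and A_scale: "x : M ==> A (scl c x) = scl c (A x)"
 and A_o: "x : M ==> y : M ==> A (x * y) = A x * A y"
 and A_unital [simp]: "A idb = idb"
 and A_0 [simp]: "A 0 = 0" by (simp_all add: endo_in endo_add endo_scale endo_o endo_id endo_0)

lemma mu_hom: "m : homs (Some (A o A)) (Some A)" "u : homs (Some id) (Some A)" using is_alg by (simp_all add: Mor_CC)

lemma m_in [simp]: "m : M" and u_in [simp]: "u : M" using mu_hom by (auto dest: homD)

lemma m_comm: "x : M ==> m * A (A x) = A x * m" and u_comm: "x : M ==> u * x = A x * u" using homD(2)[OF mu_hom(1), of x] homD(2)[OF mu_hom(2), of x] by auto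

lemma m_assoc: "m * A m = m * m" and m_unit_left: "m * u = idb" and m_unit_right: "m * A u = idb" using is_alg by (simp_all add: whisk_simps endo_id_act)

abbreviation bim :: "'h bm => bool" where "bim \<equiv> is_bimodule CC AA"
abbreviation ob :: "'h bm => 'h endo option" where "ob X \<equiv> fst X"
abbreviation la :: "'h bm => 'h op" where "la X \<equiv> fst (snd X)"
abbreviation ra :: "'h bm => 'h op" where "ra X \<equiv> snd (snd X)"
abbreviation ac :: "'h bm => 'h op => 'h op" where "ac X \<equiv> act (ob X)"

text \<open>Associators and unit constraints of the strict category are identities, which the
  actions absorb. The bimodule axioms thus become equations between operators.\<close>

lemma bim_iff:
 "bim (X, l, r) \<longleftrightarrow> X : Obj & l : homs (ec (Some A) X) X & r : homs (ec X (Some A)) X &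
  l * m = l * A l & l * u = act X idb & r * r = r * act X m & r * act X u = act X idb & r * l = l * A r"
proof (cases "X : Obj & l : homs (ec (Some A) X) X & r : homs (ec X (Some A)) X")
 case True
 hence X: "X : Obj" and l: "l : M" "l * A (act X idb) = l"
  "!!x. x : M ==> l * A (act X x) = act X x * l"
  and r: "r : M" "r * act X idb = r" "!!x. x : M ==> r * act X (A x) = act X x * r" by (auto simp: homs_def)
 have one: "act X idb * act X x = act X x" "act X x * act X idb = act X x" if "x : M" for x using that X by (simp_all add: act_o[symmetric])
 have ids: "Defs.endo_id X = act X idb" "Defs.endo_id (ec X (Some A)) = act X (A idb)"
  "Defs.endo_id (ec (Some A) X) = A (act X idb)"
  "Defs.endo_id (ec (Some A) (ec (Some A) X)) = A (A (act X idb))"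
  "Defs.endo_id (ec X (Some (A o A))) = act X idb" "Defs.endo_id (Some A) = idb"
  "Defs.endo_id (ec (Some A) (ec X (Some A))) = A (act X (A idb))" using X by (simp_all add: endo_id_act)
 have "l * (m * A (A (act X idb))) = l * m" using X l by (simp add: m_comm assoc[symmetric])
 moreover have "l * (A l * A (A (act X idb))) = l * A l" using X l by (simp add: A_o[symmetric])
 moreover have "l * (u * act X idb) = l * u" using X l by (simp add: u_comm assoc[symmetric])
 moreover have "l * (A r * A (act X idb)) = l * A r" using X r by (simp add: A_o[symmetric])
 moreover have "r * (act X m * act X idb) = r * act X m" using one by simp
 moreover have "r * (l * A (act X idb)) = r * l" using l by simp
 moreover have Af: "(A r * A (act X idb)) = A r" "A l * A (A (act X idb)) = A l" using X l r by (simp_all add: A_o[symmetric])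
 ultimately show ?thesis using True X l(1) r(1) by (simp add: Mor_CC whisk_simps ids one r(2))
next
 case False
 thus ?thesis by (auto simp: Mor_CC)
qed

lemma bim_hom: assumes "bim X" shows "la X : homs (ec (Some A) (ob X)) (ob X)" "ra X : homs (ec (ob X) (Some A)) (ob X)"
 using assms bim_iff[of "ob X" "la X" "ra X"] by auto

lemma bimD:
 assumes "bim X" shows bim_ob [simp]: "ob X : Obj" and la_in [simp]: "la X : M" and ra_in [simp]: "ra X : M"
  and la_la: "la X * A (la X) = la X * m" and la_u: "la X * u = ac X idb"
  and ra_ra: "ra X * ra X = ra X * ac X m" and ra_u: "ra X * ac X u = ac X idb"
  and ra_la: "ra X * la X = la X * A (ra X)"
  and la_one: "ac X idb * la X = la X" and ra_one: "ac X idb * ra X = ra X"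
  and la_one': "la X * A (ac X idb) = la X" and ra_one': "ra X * ac X idb = ra X" using assms bim_iff[of "ob X" "la X" "ra X"] by (auto simp: homs_def)

lemma la_comm: "bim X ==> x : M ==> la X * A (ac X x) = ac X x * la X"
 and ra_comm: "bim X ==> x : M ==> ra X * ac X (A x) = ac X x * ra X" using bim_iff[of "ob X" "la X" "ra X"] by (auto simp: homs_def)

lemma ac_in: "bim X ==> x : M ==> ac X x : M"
 and ac_compose: "bim X ==> x : M ==> y : M ==> ac X (x * y) = ac X x * ac X y" by (simp_all add: act_o)

lemma ac_ones: "bim X ==> x : M ==> ac X idb * ac X x = ac X x"
 "bim X ==> x : M ==> ac X x * ac X idb = ac X x" by (simp_all add: act_o[symmetric])

lemma bimodule_maps_iff:
 assumes "bim X" "bim Y" shows "f : bimodule_maps CC AA X Y \<longleftrightarrow>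
  f : homs (ob X) (ob Y) & f * la X = la Y * A f & f * ra X = ra Y * f"
proof -
 have "f * ac X (Defs.endo_id (Some A)) = f" if "f : homs (ob X) (ob Y)" using homD(3)[OF that] by (simp add: Defs.endo_id_def)
 thus ?thesis using assms by (cases X; cases Y) (auto simp: Mor_CC whisk_simps)
qed

abbreviation UU :: "'h bm" where "UU \<equiv> (Some A, m, m)"

lemma UU_bim [simp]: "bim UU" using mu_hom by (simp add: bim_iff m_assoc m_unit_left m_unit_right del: is_bimodule.simps)

text \<open>The free bimodule \<open>A \<otimes> Q \<otimes> A\<close>. For \<open>Q = id\<close> it
  is the source of the multiplication regarded as a bimodule map.\<close>

definition free :: "'h endo => 'h bm" where
 "free Q = (Some (A o (Q o A)), m, A (Q m))"

lemma free_bim: assumes Q: "Q : S" shows "bim (free Q)"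
proof -
 have e: "Q : End" using Q by (rule S_endoD)
 note [simp] = endo_in[OF e] endo_id[OF e]
 have c: "Q x * Q y = Q (x * y)" if "x : M" "y : M" for x y using endo_o[OF e] that by simp
 show ?thesis unfolding free_def bim_iff
 proof (intro conjI)
  show "m : homs (ec (Some A) (Some (A o (Q o A)))) (Some (A o (Q o A)))" by (simp add: homs_def m_comm)
  show "A (Q m) : homs (ec (Some (A o (Q o A))) (Some A)) (Some (A o (Q o A)))" by (simp add: homs_def A_o[symmetric] c m_comm)
  show "A (Q m) * A (Q m) = A (Q m) * act (Some (A o (Q o A))) m" by (simp add: A_o[symmetric] c m_assoc)
  show "A (Q m) * act (Some (A o (Q o A))) u = act (Some (A o (Q o A))) idb" by (simp add: A_o[symmetric] c m_unit_right)
 qed (simp_all add: Q m_assoc m_unit_left m_comm)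
qed

end

text \<open>The element \<open>dl : 1 \<rightarrow> A \<otimes> A\<close> is a separability idempotent: \<open>m (a \<otimes> dl) = (dl \<otimes> a) m\<close> and \<open>m dl = u\<close>.\<close>

locale separable_algebra = endo_algebra M S A m u for M :: "'h::complex_hilbert_space op set" and S A m u +
 fixes dl :: "'h op"
 assumes dl_intertwiner: "dl : Hom id (A o A)"
  and dl_central: "m * A dl = A m * dl"
  and dl_section: "m * dl = u"
  and splitting: "[|H : S; e : Hom H H; e * e = e; e ~= 0|]
   ==> EX L:S. EX r:Hom H L. EX s:Hom L H. r * s = idb & s * r = e"
begin

lemma dl_in [simp]: "dl : M" and dl_comm: "x : M ==> dl * x = A (A x) * dl" using HomD(1,2)[OF dl_intertwiner] by auto

text \<open>The idempotent that projects \<open>X \<otimes> Y\<close> onto \<open>X \<otimes>\<^sub>A Y\<close>.\<close>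

definition bal :: "'h bm => 'h bm => 'h op" where
 "bal X Y = ra X * ac X (A (la Y) * dl)"

abbreviation balanced :: "'h bm => 'h bm => 'h op => bool" where
 "balanced X Y h \<equiv> h * ra X = h * ac X (la Y)"

lemma bal_hom:
 assumes X: "bim X" and Y: "bim Y" shows "bal X Y : homs (ec (ob X) (ob Y)) (ec (ob X) (ob Y))"
proof -
 have 1: "A (la Y) * dl * ac Y x = A (ac Y x) * A (la Y) * dl" if "x : M" for x
 proof -
  have "A (la Y) * dl * ac Y x = A (la Y * A (ac Y x)) * dl" using that Y by (simp add: dl_comm A_o assoc)
  also have "... = A (ac Y x) * A (la Y) * dl" using that Y by (simp add: la_comm A_o assoc)
  finally show ?thesis .
 qed
 have eq: "bal X Y * ac X (ac Y x) = ac X (ac Y x) * bal X Y" if "x : M" for x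
 proof -
  have "bal X Y * ac X (ac Y x) = ra X * ac X (A (la Y) * dl * ac Y x)" using that X Y by (simp add: bal_def act_o assoc)
  also have "... = (ra X * ac X (A (ac Y x))) * ac X (A (la Y) * dl)" using that X Y by (simp add: 1 act_o assoc)
  also have "... = ac X (ac Y x) * bal X Y" using that X Y by (simp add: ra_comm bal_def assoc)
  finally show ?thesis .
 qed
 have 2: "A (la Y) * dl * ac Y idb = A (la Y) * dl" using 1[of idb] Y by (simp add: assoc[symmetric] A_o[symmetric] la_one)
 have "bal X Y * ac X (ac Y idb) = bal X Y" using X Y 2 by (simp add: bal_def assoc act_o[symmetric])
 with eq[of idb] eq show ?thesis using X Y by (auto simp: homs_def bal_def)
qed

text \<open>Centrality of \<open>dl\<close> carries a factor of \<open>A\<close> from the right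
  action on \<open>X\<close> over to the left action on \<open>Y\<close>.\<close>

lemma bal_balanced:
 assumes X: "bim X" and Y: "bim Y" shows "balanced X Y (bal X Y)"
proof -
 have "bal X Y * ra X = ra X * ra X * ac X (A (A (la Y) * dl))" using X Y by (simp add: bal_def assoc ra_comm)
 also have "... = (ra X * ra X) * ac X (A (A (la Y) * dl))" by (simp add: assoc)
 also have "... = ra X * ac X ((m * A (A (la Y))) * A dl)" using X Y by (simp add: ra_ra act_o A_o assoc)
 also have "(m * A (A (la Y))) * A dl = A (la Y) * (m * A dl)" using Y by (simp add: m_comm assoc)
 also have "... = A (la Y * m) * dl" using Y by (simp add: dl_central A_o assoc)
 also have "... = A (la Y) * A (A (la Y)) * dl" using Y by (simp add: la_la[symmetric] A_o assoc)
 also have "... = (A (la Y) * dl) * la Y" using Y by (simp add: dl_comm assoc)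
 finally show ?thesis using X Y by (simp add: bal_def act_o assoc)
qed

text \<open>On a balanced map both actions of \<open>dl\<close> merge into
  \<open>m * dl = u\<close>. Together with the preceding lemma, the image of \<open>bal\<close> is
  the coequalizer.\<close>

lemma balanced_bal:
 assumes X: "bim X" and Y: "bim Y" and h: "h : homs (ec (ob X) (ob Y)) W" "balanced X Y h" shows "h * bal X Y = h"
proof -
 have "h * bal X Y = (h * ra X) * ac X (A (la Y) * dl)" by (simp add: bal_def assoc)
 also have "... = h * ac X ((la Y * A (la Y)) * dl)" using X Y h by (simp add: assoc act_o)
 also have "(la Y * A (la Y)) * dl = ac Y idb" using Y by (simp add: la_la assoc dl_section la_u)
 finally show ?thesis using homD(3)[OF h(1)] X Y by simp
qed

lemma splitting_Obj:
 assumes X: "X : Obj" and e: "e : homs X X" "e * e = e" shows "EX Y:Obj. EX r:homs X Y. EX s:homs Y X. r * s = act Y idb & s * r = e"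
proof (cases "e = 0")
 case True
 thus ?thesis by (intro bexI[of _ None] bexI[of _ 0]) simp_all
next
 case False
 then obtain H where H: "X = Some H" "H : S" using X e(1) by (cases X) (auto simp: hom_None)
 then obtain L r s where "L : S" "r : Hom H L" "s : Hom L H"
  "r * s = idb" "s * r = e" using splitting[of H e] e False by (auto simp: hom_Some)
 thus ?thesis using H by (intro bexI[of _ "Some L"] bexI[of _ r] bexI[of _ s]) (simp_all add: hom_Some endo_id S_endoD)
qed

abbreviation tob :: "'h bm => 'h bm => 'h endo option" where "tob \<equiv> rel_ob CC AA"
abbreviation tq :: "'h bm => 'h bm => 'h op" where "tq \<equiv> rel_proj CC AA"

lemma is_coequalizer_iff:
 assumes X: "bim X" and Y: "bim Y" shows "is_coequalizer CC (ec (ob X) (ob Y)) (rwhisk CC (ec (ob X) (Some A)) (ob X) (ob Y) (ra X))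
   (lwhisk CC (ob X) (ec (Some A) (ob Y)) (ob Y) (la Y) * Asc CC (ob X) (Some A) (ob Y)) Z q \<longleftrightarrow>
  Z : Obj & q : homs (ec (ob X) (ob Y)) Z & balanced X Y q &
  (ALL W:Obj. ALL h:homs (ec (ob X) (ob Y)) W. balanced X Y h --> (\<exists>!k. k : homs Z W & k * q = h))"
proof -
 have 1: "h * rwhisk CC (ec (ob X) (Some A)) (ob X) (ob Y) (ra X) = h * ra X" if h: "h : homs (ec (ob X) (ob Y)) W" for h W
 proof -
  have "h * rwhisk CC (ec (ob X) (Some A)) (ob X) (ob Y) (ra X) = h * ra X * ac X (A (ac Y idb))" using X Y by (simp add: whisk_simps endo_id_act)
  also have "... = (h * ac X (ac Y idb)) * ra X" using X Y by (simp add: ra_comm assoc)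
  finally show ?thesis using homD(3)[OF h] X Y by simp
 qed
 have 2: "lwhisk CC (ob X) (ec (Some A) (ob Y)) (ob Y) (la Y) *
   Defs.endo_id (ec (ob X) (ec (Some A) (ob Y))) = ac X (la Y)"
 proof -
  have "lwhisk CC (ob X) (ec (Some A) (ob Y)) (ob Y) (la Y) *
   Defs.endo_id (ec (ob X) (ec (Some A) (ob Y)))
   = ac X (la Y * A (ac Y idb))" using X Y by (simp add: whisk_simps endo_id_act act_o)
  thus ?thesis using Y by (simp add: la_one')
 qed
 show ?thesis unfolding is_coequalizer_def using X Y by (simp add: Mor_CC 1 2 cong: conj_cong ball_cong)
qed

text \<open>The chosen coequalizer is known only through its universal property. Some splitting of
  \<open>bal\<close> has this property too, and comparison shows that the chosen projection also
  splits \<open>bal\<close>.\<close>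

lemma rel_tensor_props:
 assumes X: "bim X" and Y: "bim Y" shows "EX s. tob X Y : Obj & tq X Y : homs (ec (ob X) (ob Y)) (tob X Y) &
  balanced X Y (tq X Y) & s : homs (tob X Y) (ec (ob X) (ob Y)) &
  tq X Y * s = act (tob X Y) idb & s * tq X Y = bal X Y"
proof -
 define P where "P Z q \<longleftrightarrow> Z : Obj & q : homs (ec (ob X) (ob Y)) Z & balanced X Y q &
  (ALL W:Obj. ALL h:homs (ec (ob X) (ob Y)) W. balanced X Y h --> (\<exists>!k. k : homs Z W & k * q = h))" for Z q
 let ?e = "bal X Y"
 have o: "ec (ob X) (ob Y) : Obj" using X Y by simp
 have e: "?e : homs (ec (ob X) (ob Y)) (ec (ob X) (ob Y))" "balanced X Y ?e" "?e * ?e = ?e" using bal_hom[OF X Y] bal_balanced[OF X Y] balanced_bal[OF X Y] by auto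
 obtain Z r s where Z: "Z : Obj" and r: "r : homs (ec (ob X) (ob Y)) Z"
  and s: "s : homs Z (ec (ob X) (ob Y))" and rs: "r * s = act Z idb" "s * r = ?e" using splitting_Obj[OF o e(1,3)] by blast
 have re: "r * ?e = r" using homD(4)[OF r] by (simp flip: rs assoc)
 have "P Z r" unfolding P_def
 proof (intro conjI ballI impI Z r)
  show "balanced X Y r" using arg_cong[OF e(2), of "%z. r * z"] by (simp flip: assoc add: re)
  fix W h assume W: "W : Obj" and h: "h : homs (ec (ob X) (ob Y)) W" "balanced X Y h"
  show "\<exists>!k. k : homs Z W & k * r = h"
  proof (rule ex1I[of _ "h * s"])
   show "h * s : homs Z W & (h * s) * r = h" using hom_o[OF h(1) s] balanced_bal[OF X Y h] by (simp add: assoc rs)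
   fix k assume k: "k : homs Z W & k * r = h"
   hence "k = k * r * s" using homD(3) rs by metis
   thus "k = h * s" using k by (metis assoc)
  qed
 qed
 hence ex: "EX Zq. case Zq of (Z, q) => P Z q" by blast
 have "rel_tensor CC AA X Y = (SOME (Z, q). P Z q)"
 proof -
  have "rel_tensor CC AA X Y = (SOME (Z, q). is_coequalizer CC (ec (ob X) (ob Y))
   (rwhisk CC (ec (ob X) (Some A)) (ob X) (ob Y) (ra X))
   (lwhisk CC (ob X) (ec (Some A) (ob Y)) (ob Y) (la Y) * Asc CC (ob X) (Some A) (ob Y)) Z q)" by (cases X; cases Y) simp
  thus ?thesis by (simp only: is_coequalizer_iff[OF X Y] P_def)
 qed
 hence "P (tob X Y) (tq X Y)" using someI_ex[OF ex] by (simp add: rel_ob_def rel_proj_def case_prod_unfold)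
 hence Z: "tob X Y : Obj" and q: "tq X Y : homs (ec (ob X) (ob Y)) (tob X Y)"
  and b: "balanced X Y (tq X Y)"
  and univ: "!!W h. W : Obj ==> h : homs (ec (ob X) (ob Y)) W ==> balanced X Y h
   ==> \<exists>!k. k : homs (tob X Y) W & k * tq X Y = h" unfolding P_def by blast+
 obtain k where k: "k : homs (tob X Y) (ec (ob X) (ob Y))" "k * tq X Y = ?e" using univ[OF o e(1,2)] by blast
 have "tq X Y * k = act (tob X Y) idb"
 proof -
  have 1: "(tq X Y * k) * tq X Y = tq X Y" using balanced_bal[OF X Y q b] by (simp add: assoc k(2))
  show ?thesis using univ[OF Z q b] 1 hom_o[OF q k(1)] hom_one[OF Z] homD(4)[OF q] by blast
 qed
 thus ?thesis using Z q b k by blast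
qed

definition ts :: "'h bm => 'h bm => 'h op" where
 "ts X Y = (SOME s. s : homs (tob X Y) (ec (ob X) (ob Y)) &
  tq X Y * s = act (tob X Y) idb & s * tq X Y = bal X Y)"

lemma tq_props:
 assumes "bim X" "bim Y" shows tob_Obj [simp]: "tob X Y : Obj" and tq_hom: "tq X Y : homs (ec (ob X) (ob Y)) (tob X Y)"
  and tq_balanced: "tq X Y * ra X = tq X Y * ac X (la Y)"
  and ts_hom: "ts X Y : homs (tob X Y) (ec (ob X) (ob Y))"
  and tq_ts: "tq X Y * ts X Y = act (tob X Y) idb"
  and ts_tq: "ts X Y * tq X Y = bal X Y"
  and tq_in [simp]: "tq X Y : M" and ts_in [simp]: "ts X Y : M"
proof -
 note p = rel_tensor_props[OF assms]
 thus 1: "tob X Y : Obj" "tq X Y : homs (ec (ob X) (ob Y)) (tob X Y)"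
  "tq X Y * ra X = tq X Y * ac X (la Y)" by blast+
 have "EX s. s : homs (tob X Y) (ec (ob X) (ob Y)) &
  tq X Y * s = act (tob X Y) idb & s * tq X Y = bal X Y" using p by blast
 from someI_ex[OF this, folded ts_def]
 show 2: "ts X Y : homs (tob X Y) (ec (ob X) (ob Y))"
  "tq X Y * ts X Y = act (tob X Y) idb" "ts X Y * tq X Y = bal X Y" by blast+
 show "tq X Y : M" "ts X Y : M" using 1 2 homD(1) by auto
qed

lemma tq_comm: "bim X ==> bim Y ==> x : M ==> tq X Y * ac X (ac Y x) = act (tob X Y) x * tq X Y" using homD(2)[OF tq_hom, of X Y x] by simp

lemma tq_one: "bim X ==> bim Y ==> act (tob X Y) idb * tq X Y = tq X Y" using homD(4)[OF tq_hom, of X Y] by simp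

lemma tq_bal: "bim X ==> bim Y ==> tq X Y * bal X Y = tq X Y" using balanced_bal[OF _ _ tq_hom tq_balanced] by simp

lemma tq_cancel:
 assumes "bim X" "bim Y" "k * tq X Y = k' * tq X Y"
  "k * act (tob X Y) idb = k" "k' * act (tob X Y) idb = k'" shows "k = k'"
proof -
 have "(k * tq X Y) * ts X Y = (k' * tq X Y) * ts X Y" using assms(3) by simp
 thus ?thesis using assms(4,5) by (simp add: assoc tq_ts[OF assms(1,2)])
qed

lemma factor_tq:
 assumes X: "bim X" and Y: "bim Y" and h: "h : homs (ec (ob X) (ob Y)) W" "balanced X Y h" shows "h * ts X Y : homs (tob X Y) W" "(h * ts X Y) * tq X Y = h"
 using hom_o[OF h(1) ts_hom[OF X Y]] balanced_bal[OF X Y h] by (simp_all add: assoc ts_tq[OF X Y])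

text \<open>Evaluates the definite descriptions in the definition of the bimodule category: the
  factorization through the projection is composition with its section.\<close>

lemma the_factor_tq:
 assumes X: "bim X" and Y: "bim Y" and h: "h : homs (ec (ob X) (ob Y)) W" "balanced X Y h"
  and W: "W : Obj" shows "(THE k. k : Mor CC (tob X Y) W & k * tq X Y = h) = h * ts X Y"
proof (rule the_equality)
 show "h * ts X Y : Mor CC (tob X Y) W & (h * ts X Y) * tq X Y = h" using factor_tq[OF X Y h] X Y W by (simp add: Mor_CC)
 fix k assume "k : Mor CC (tob X Y) W & k * tq X Y = h"
 hence k: "k : homs (tob X Y) W" "k * tq X Y = h" using X Y W by (simp_all add: Mor_CC)
 show "k = h * ts X Y" by (rule tq_cancel[OF X Y _ homD(3)[OF k(1)] homD(3)[OF factor_tq(1)[OF X Y h]]])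
   (simp add: factor_tq(2)[OF X Y h] k(2))
qed

end

section \<open>The monoidal category of bimodules\<close>

context separable_algebra
begin

abbreviation tens :: "'h bm => 'h bm => 'h bm" where "tens \<equiv> bimod_tensor CC AA"
abbreviation bmaps :: "'h bm => 'h bm => 'h op set" where "bmaps \<equiv> bimodule_maps CC AA"

lemma endo_comp_assoc: "ec (ec X Y) Z = ec X (ec Y Z)" by (cases X; cases Y; cases Z) (auto simp: comp_assoc)

lemma tq_unit: assumes X: "bim X" and Y: "bim Y" shows "tq X Y * ac X (ac Y idb) = tq X Y" "tq X Y * ac X idb = tq X Y"
proof -
 show 1: "tq X Y * ac X (ac Y idb) = tq X Y" using homD(3)[OF tq_hom[OF X Y]] X Y by simp
 have "tq X Y * ac X idb = tq X Y * (ac X (ac Y idb) * ac X idb)" by (simp add: 1 assoc[symmetric])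
 also have "... = tq X Y" using ac_ones(2)[OF X ac_in[OF Y M_id]] by (simp add: 1)
 finally show "tq X Y * ac X idb = tq X Y" .
qed

text \<open>Since \<open>bal\<close> commutes with the outer actions, here and in the next lemma,
  these descend to the relative tensor product.\<close>

lemma la_bal: assumes X: "bim X" and Y: "bim Y" shows "la X * A (bal X Y) = bal X Y * la X"
proof -
 have "bal X Y * la X = ra X * la X * A (ac X (A (la Y) * dl))" using X Y by (simp add: bal_def assoc la_comm)
 also have "... = (ra X * la X) * A (ac X (A (la Y) * dl))" by (simp add: assoc)
 also have "... = la X * A (bal X Y)" using X Y by (simp add: ra_la bal_def A_o assoc)
 finally show ?thesis by simp
qed

lemma ra_bal: assumes X: "bim X" and Y: "bim Y" shows "bal X Y * ac X (ra Y) = ac X (ra Y) * bal X Y"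
proof -
 have "bal X Y * ac X (ra Y) = ra X * ac X (A (la Y) * dl * ra Y)" using X Y by (simp add: bal_def assoc act_o)
 also have "A (la Y) * dl * ra Y = A (la Y * A (ra Y)) * dl" using X Y by (simp add: dl_comm A_o assoc)
 also have "... = A (ra Y) * A (la Y) * dl" using X Y by (simp add: ra_la[symmetric] A_o assoc)
 also have "ra X * ac X (A (ra Y) * A (la Y) * dl) = (ra X * ac X (A (ra Y))) * ac X (A (la Y) * dl)" using X Y by (simp add: act_o assoc)
 also have "... = ac X (ra Y) * bal X Y" using X Y by (simp add: ra_comm bal_def assoc)
 finally show ?thesis .
qed

lemma tq_cancel_A:
 assumes "bim X" "bim Y" "k * A (tq X Y) = k' * A (tq X Y)"
  "k * A (act (tob X Y) idb) = k" "k' * A (act (tob X Y) idb) = k'" shows "k = k'"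
proof -
 have "(k * A (tq X Y)) * A (ts X Y) = (k' * A (tq X Y)) * A (ts X Y)" using assms(3) by simp
 thus ?thesis using assms(1,2,4,5) by (simp add: assoc tq_ts[OF assms(1,2)] A_o[symmetric])
qed

section \<open>The bimodule structure of the relative tensor product\<close>

definition tens_la where "tens_la X Y = tq X Y * la X * A (ts X Y)"
definition tens_ra where "tens_ra X Y = tq X Y * ac X (ra Y) * ts X Y"

lemma tens_la_tq: assumes X: "bim X" and Y: "bim Y" shows "tens_la X Y * A (tq X Y) = tq X Y * la X"
proof -
 have "tens_la X Y * A (tq X Y) = tq X Y * la X * A (bal X Y)" using X Y by (simp add: tens_la_def assoc A_o[symmetric] ts_tq)
 also have "... = (tq X Y * bal X Y) * la X" using X Y by (simp add: la_bal assoc)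
 finally show ?thesis using X Y by (simp add: tq_bal)
qed

lemma tens_ra_tq: assumes X: "bim X" and Y: "bim Y" shows "tens_ra X Y * tq X Y = tq X Y * ac X (ra Y)"
proof -
 have "tens_ra X Y * tq X Y = tq X Y * ac X (ra Y) * bal X Y" using X Y by (simp add: tens_ra_def assoc ts_tq)
 also have "... = (tq X Y * bal X Y) * ac X (ra Y)" using X Y by (simp add: ra_bal[symmetric] assoc)
 finally show ?thesis using X Y by (simp add: tq_bal)
qed

lemma tq_la_hom: assumes X: "bim X" and Y: "bim Y" shows "tq X Y * la X : homs (ec (Some A) (ec (ob X) (ob Y))) (tob X Y)"
proof -
 have 1: "(tq X Y * la X) * A (ac X (ac Y x)) = act (tob X Y) x * (tq X Y * la X)" if "x : M" for x
  using that X Y by (simp add: assoc la_comm) (simp add: assoc[symmetric] tq_comm)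
 have 2: "act (tob X Y) idb * (tq X Y * la X) = tq X Y * la X" using X Y by (simp add: assoc[symmetric] tq_one)
 show ?thesis using X Y 1 2 1[OF M_id] by (simp add: homs_def)
qed

lemma tens_la_hom: assumes X: "bim X" and Y: "bim Y" shows "tens_la X Y : homs (ec (Some A) (tob X Y)) (tob X Y)"
 using hom_o[OF tq_la_hom[OF X Y] hom_whisker_left[OF ts_hom[OF X Y], of "Some A"]] X Y by (simp add: tens_la_def assoc)

lemma ra_whisker_hom: assumes X: "bim X" and Y: "bim Y" shows "ac X (ra Y) : homs (ec (ob X) (ec (ob Y) (Some A))) (ec (ob X) (ob Y))"
 using X Y bim_hom[OF Y] by (intro hom_whisker_left) auto

lemma hom_unit_whisker: "f : homs X Y ==> X : Obj ==> Y : Obj ==> f : homs (ec X (Some A)) (ec Y (Some A))" by (auto simp: homs_def)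

lemma tens_ra_hom: assumes X: "bim X" and Y: "bim Y" shows "tens_ra X Y : homs (ec (tob X Y) (Some A)) (tob X Y)"
proof -
 have "ts X Y : homs (ec (tob X Y) (Some A)) (ec (ob X) (ec (ob Y) (Some A)))" using hom_unit_whisker[OF ts_hom[OF X Y]] X Y by (simp add: endo_comp_assoc)
 thus ?thesis unfolding tens_ra_def by (intro hom_o[OF tq_hom[OF X Y]] hom_o[OF ra_whisker_hom[OF X Y]])
qed

text \<open>The structure morphisms inside the definite descriptions of \<open>bimod_tensor\<close>
  are identities that the projection absorbs. What remains has a unique solution, because
  \<open>tq\<close> is a split epimorphism.\<close>

lemma tens_eq: assumes X: "bim XX" and Y: "bim Y" shows "tens XX Y = (tob XX Y, tens_la XX Y, tens_ra XX Y)"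
proof -
 obtain X l r Y' l' r' where XY: "XX = (X, l, r)" "Y = (Y', l', r')" by (cases XX; cases Y) auto
 have o: "X : Obj" "Y' : Obj" using X Y bim_ob XY by fastforce+
 have ids: "Defs.endo_id (ec (Some A) (ec X Y')) = A (act X (act Y' idb))"
  "Defs.endo_id (ec X (ec Y' (Some A))) = act X (act Y' idb)" using o by (simp_all add: endo_id_act)
 have 1: "tq XX Y * rwhisk CC (ec (Some A) X) X Y' l *
   inv_mor CC (ec (ec (Some A) X) Y') (ec (Some A) (ec X Y')) (Asc CC (Some A) X Y')
  = tq XX Y * la XX"
 proof -
  have "inv_mor CC (ec (ec (Some A) X) Y') (ec (Some A) (ec X Y')) (Asc CC (Some A) X Y')
   = A (act X (act Y' idb))" unfolding endo_comp_assoc using o inv_mor_CC[of "ec (Some A) (ec X Y')"] by (simp add: endo_id_act)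
  thus ?thesis using homD(3)[OF tq_la_hom[OF X Y]] o by (simp add: whisk_simps endo_id_act XY assoc)
    (simp add: assoc[symmetric])
 qed
 have 2: "tq XX Y * lwhisk CC X (ec Y' (Some A)) Y' r' * Asc CC X Y' (Some A) = tq XX Y * ac XX (ra Y)"
  using X Y o homD(3)[OF ra_whisker_hom[OF X Y]] by (simp add: whisk_simps ids XY)
 have 3: "(THE k. k : Mor CC (ec (Some A) (tob XX Y)) (tob XX Y) &
   k * A (tq XX Y) = tq XX Y * la XX) = tens_la XX Y"
 proof (rule the_equality)
  show "tens_la XX Y : Mor CC (ec (Some A) (tob XX Y)) (tob XX Y) &
   tens_la XX Y * A (tq XX Y) = tq XX Y * la XX" using X Y tens_la_hom[OF X Y] tens_la_tq[OF X Y] by (simp add: Mor_CC)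
  fix k assume "k : Mor CC (ec (Some A) (tob XX Y)) (tob XX Y) & k * A (tq XX Y) = tq XX Y * la XX"
  hence k: "k : homs (ec (Some A) (tob XX Y)) (tob XX Y)" "k * A (tq XX Y) = tq XX Y * la XX" using X Y by (simp_all add: Mor_CC)
  have "k * A (act (tob XX Y) idb) = k" "tens_la XX Y * A (act (tob XX Y) idb) = tens_la XX Y" using homD(3)[OF k(1)] homD(3)[OF tens_la_hom[OF X Y]] X Y by simp_all
  thus "k = tens_la XX Y" by (rule tq_cancel_A[OF X Y, rotated]) (simp add: k(2) tens_la_tq[OF X Y])
 qed
 have 4: "(THE k. k : Mor CC (ec (tob XX Y) (Some A)) (tob XX Y) &
   k * tq XX Y = tq XX Y * ac XX (ra Y)) = tens_ra XX Y"
 proof (rule the_equality)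
  show "tens_ra XX Y : Mor CC (ec (tob XX Y) (Some A)) (tob XX Y) &
   tens_ra XX Y * tq XX Y = tq XX Y * ac XX (ra Y)" using X Y tens_ra_hom[OF X Y] tens_ra_tq[OF X Y] by (simp add: Mor_CC)
  fix k assume "k : Mor CC (ec (tob XX Y) (Some A)) (tob XX Y) & k * tq XX Y = tq XX Y * ac XX (ra Y)"
  hence k: "k : homs (ec (tob XX Y) (Some A)) (tob XX Y)" "k * tq XX Y = tq XX Y * ac XX (ra Y)" using X Y by (simp_all add: Mor_CC)
  have "k * act (tob XX Y) idb = k" "tens_ra XX Y * act (tob XX Y) idb = tens_ra XX Y" using homD(3)[OF k(1)] homD(3)[OF tens_ra_hom[OF X Y]] X Y by simp_all
  thus "k = tens_ra XX Y" by (rule tq_cancel[OF X Y, rotated]) (simp add: k(2) tens_ra_tq[OF X Y])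
 qed
 have lw: "lwhisk CC (Some A) (ec X Y') (tob XX Y) (tq XX Y) = A (tq XX Y)" by (simp add: whisk_simps)
 have rw: "k * rwhisk CC (ec X Y') (tob XX Y) (Some A) (tq XX Y) = k * tq XX Y" for k
  using o homD(3)[OF tq_hom[OF X Y]] X Y by (simp add: whisk_simps Defs.endo_id_def XY)
 show ?thesis using 1 2 3 4 unfolding XY bimod_tensor.simps Let_def by (simp only: lw[unfolded XY] rw[unfolded XY] endo_category_simps)
qed

lemma tens_simps:
 assumes "bim X" "bim Y" shows tens_ob: "ob (tens X Y) = tob X Y"
  and tens_la: "la (tens X Y) * A (tq X Y) = tq X Y * la X"
  and tens_ra: "ra (tens X Y) * tq X Y = tq X Y * ac X (ra Y)" using tens_eq[OF assms] tens_la_tq[OF assms] tens_ra_tq[OF assms] by simp_all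

lemma tens_bim [simp]:
 assumes X: "bim X" and Y: "bim Y" shows "bim (tens X Y)"
proof -
 let ?l = "tens_la X Y" and ?r = "tens_ra X Y" and ?Z = "tob X Y" and ?q = "tq X Y"
 note l = tens_la_hom[OF X Y] tens_la_tq[OF X Y] and r = tens_ra_hom[OF X Y] tens_ra_tq[OF X Y]
 have M: "?l : M" "?r : M" using l r homD(1) by auto
 have l1: "?l * A (act ?Z idb) = ?l" using homD(3)[OF l(1)] X Y by simp
 have r1: "?r * act ?Z idb = ?r" using homD(3)[OF r(1)] X Y by simp
 have lcomm: "?l * A (act ?Z x) = act ?Z x * ?l" if "x : M" for x using homD(2)[OF l(1) that] X Y by simp
 have rcomm: "?r * act ?Z (A x) = act ?Z x * ?r" if "x : M" for x using homD(2)[OF r(1) that] X Y by simp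
 note S = X Y M assoc eq_tail[OF l(2)] eq_tail[OF r(2)]
 have "?l * m = ?l * A ?l"
 proof -
  \<comment> \<open>The law of the left action lives on \<open>A A X Y\<close>, so it is compared
    after \<open>A (A ?q)\<close>, which is then cancelled by means of its section.\<close>
  have "(?l * m) * A (A ?q) = ?q * la X * m" using X Y M by (simp add: assoc m_comm) (simp add: assoc[symmetric] l(2))
  moreover have "(?l * A ?l) * A (A ?q) = ?q * la X * A (la X)" using X Y M by (simp add: assoc A_o[symmetric] l(2))
    (simp add: A_o assoc[symmetric] l(2))
  ultimately have "(?l * m) * A (A ?q) = (?l * A ?l) * A (A ?q)" using X by (simp add: la_la)
  hence "((?l * m) * A (A ?q)) * A (A (ts X Y)) = ((?l * A ?l) * A (A ?q)) * A (A (ts X Y))" by simp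
  hence "?l * (m * A (A (act ?Z idb))) = ?l * A (?l * A (act ?Z idb))" using X Y M by (simp add: assoc A_o[symmetric] tq_ts)
  hence "?l * A (act ?Z idb) * m = ?l * A ?l" using X Y by (simp add: m_comm l1)
  thus ?thesis using l1 by (metis assoc)
 qed
 moreover have "?l * u = act ?Z idb"
 proof (rule tq_cancel[OF X Y])
  have "(?l * u) * ?q = ?q * la X * u" using X Y M by (simp add: assoc u_comm) (simp add: assoc[symmetric] l(2))
  thus "(?l * u) * ?q = act ?Z idb * ?q" using X Y by (simp add: la_u tq_unit tq_one)
  show "(?l * u) * act ?Z idb = ?l * u" using X Y M by (simp add: assoc u_comm) (simp add: assoc[symmetric] l1)
  show "act ?Z idb * act ?Z idb = act ?Z idb" using X Y by (simp add: act_o[symmetric])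
 qed
 moreover have "?r * ?r = ?r * act ?Z m"
 proof (rule tq_cancel[OF X Y])
  have "(?r * ?r) * ?q = ?q * ac X (ra Y * ra Y)" using X Y M by (simp add: assoc r(2) act_o) (simp add: assoc[symmetric] r(2))
  moreover have "(?r * act ?Z m) * ?q = ?q * ac X (ra Y * ac Y m)" using X Y M by (simp add: assoc tq_comm[symmetric] act_o) (simp add: assoc[symmetric] r(2))
  ultimately show "(?r * ?r) * ?q = (?r * act ?Z m) * ?q" using Y by (simp add: ra_ra)
  show "(?r * ?r) * act ?Z idb = ?r * ?r" using r1 by (simp add: assoc)
  show "(?r * act ?Z m) * act ?Z idb = ?r * act ?Z m" using X Y by (simp add: assoc act_o[symmetric])
 qed
 moreover have "?r * act ?Z u = act ?Z idb"
 proof (rule tq_cancel[OF X Y])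
  have "(?r * act ?Z u) * ?q = ?q * ac X (ra Y * ac Y u)" using X Y M by (simp add: assoc tq_comm[symmetric] act_o) (simp add: assoc[symmetric] r(2))
  thus "(?r * act ?Z u) * ?q = act ?Z idb * ?q" using X Y by (simp add: ra_u tq_unit tq_one)
  show "(?r * act ?Z u) * act ?Z idb = ?r * act ?Z u" using X Y by (simp add: assoc act_o[symmetric])
  show "act ?Z idb * act ?Z idb = act ?Z idb" using X Y by (simp add: act_o[symmetric])
 qed
 moreover have "?r * ?l = ?l * A ?r"
 proof (rule tq_cancel_A[OF X Y])
  have "(?r * ?l) * A ?q = ?q * ac X (ra Y) * la X" using X Y M by (simp add: assoc l(2)) (simp add: assoc[symmetric] r(2))
  moreover have "(?l * A ?r) * A ?q = ?q * la X * A (ac X (ra Y))" using X Y M by (simp add: assoc A_o[symmetric] r(2))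
    (simp add: A_o assoc[symmetric] l(2))
  ultimately show "(?r * ?l) * A ?q = (?l * A ?r) * A ?q" using X Y by (simp add: la_comm)
  show "(?r * ?l) * A (act ?Z idb) = ?r * ?l" using l1 by (simp add: assoc)
  show "(?l * A ?r) * A (act ?Z idb) = ?l * A ?r" using X Y M r1 by (simp add: assoc A_o[symmetric])
 qed
 ultimately show ?thesis using X Y l(1) r(1) by (simp add: tens_eq bim_iff del: is_bimodule.simps)
qed

section \<open>Bimodule maps and their tensor products\<close>

lemma bmapsD:
 assumes "bim X" "bim Y" "f : bmaps X Y" shows "f : M" "f : homs (ob X) (ob Y)" "f * la X = la Y * A f" "f * ra X = ra Y * f"
  "x : M ==> f * ac X x = ac Y x * f" "f * ac X idb = f" "ac Y idb * f = f" using assms(3) unfolding bimodule_maps_iff[OF assms(1,2)] by (auto simp: homs_def)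

lemma bmapsI:
 "bim X ==> bim Y ==> f : homs (ob X) (ob Y) ==> f * la X = la Y * A f ==> f * ra X = ra Y * f
  ==> f : bmaps X Y" by (simp add: bimodule_maps_iff)

lemma bmaps_in: "bim X ==> bim Y ==> f : bmaps X Y ==> f : M" by (rule bmapsD)

lemma bmaps_one: "bim X ==> ac X idb : bmaps X X" by (rule bmapsI) (simp_all add: hom_one la_one la_one' ra_one ra_one')

lemma bmaps_o:
 assumes X: "bim X" and Y: "bim Y" and Z: "bim Z" and f: "f : bmaps X Y" and g: "g : bmaps Y Z" shows "g * f : bmaps X Z"
proof (rule bmapsI[OF X Z])
 note F = bmapsD[OF X Y f] and G = bmapsD[OF Y Z g]
 show "g * f : homs (ob X) (ob Z)" using F G by (blast intro: hom_o)
 show "(g * f) * la X = la Z * A (g * f)" using F(1,3) G(1,3) by (simp add: assoc A_o) (simp add: assoc[symmetric])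
 show "(g * f) * ra X = ra Z * g * f" using F(4) G(4) by (simp add: assoc) (simp add: assoc[symmetric])
qed

lemma bmaps_0: "bim X ==> bim Y ==> 0 : bmaps X Y" by (simp add: bimodule_maps_iff)

lemma bmaps_add: "bim X ==> bim Y ==> f : bmaps X Y ==> g : bmaps X Y ==> f + g : bmaps X Y" unfolding bimodule_maps_iff
 by (auto simp: hom_add add_left add_right A_add homD(1))

lemma bmaps_scale: "bim X ==> bim Y ==> f : bmaps X Y ==> scl c f : bmaps X Y" unfolding bimodule_maps_iff
 by (auto simp: hom_scale scale_left scale_right A_scale homD(1))

definition tenm :: "'h bm => 'h bm => 'h bm => 'h bm => 'h op => 'h op => 'h op" where
 "tenm X X' Y Y' f g = (tq X' Y' * f * ac X g) * ts X Y"

lemma tenm_aux: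
 assumes X: "bim X" and X': "bim X'" and Y: "bim Y" and Y': "bim Y'"
  and f: "f : bmaps X X'" and g: "g : bmaps Y Y'" shows "tq X' Y' * f * ac X g : homs (ec (ob X) (ob Y)) (tob X' Y')"
  "balanced X Y (tq X' Y' * f * ac X g)"
proof -
 note F = bmapsD[OF X X' f] and G = bmapsD[OF Y Y' g]
 show "tq X' Y' * f * ac X g : homs (ec (ob X) (ob Y)) (tob X' Y')" using X X' Y Y' by (intro hom_o[OF tq_hom[OF X' Y']] hom_ten[OF F(2) G(2)]) auto
 have "(tq X' Y' * f * ac X g) * ra X = tq X' Y' * (f * ra X) * ac X (A g)" using X G(1) by (simp add: assoc ra_comm)
 also have "... = (tq X' Y' * ra X') * f * ac X (A g)" by (simp add: F(4) assoc)
 also have "... = tq X' Y' * (f * ac X (la Y')) * ac X (A g)" using X X' Y Y' by (simp add: tq_balanced F(5) assoc)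
 also have "... = tq X' Y' * f * ac X (g * la Y)" using X Y' G(1) by (simp add: assoc act_o[symmetric] G(3))
 also have "... = (tq X' Y' * f * ac X g) * ac X (la Y)" using X Y G(1) by (simp add: assoc act_o)
 finally show "balanced X Y (tq X' Y' * f * ac X g)" .
qed

lemma tenm_props:
 assumes X: "bim X" and X': "bim X'" and Y: "bim Y" and Y': "bim Y'"
  and f: "f : bmaps X X'" and g: "g : bmaps Y Y'" shows tenm_tq: "tenm X X' Y Y' f g * tq X Y = tq X' Y' * f * ac X g"
  and tenm_hom: "tenm X X' Y Y' f g : homs (tob X Y) (tob X' Y')"
  and tenm_bmaps: "tenm X X' Y Y' f g : bmaps (tens X Y) (tens X' Y')"
proof -
 note F = bmapsD[OF X X' f] and G = bmapsD[OF Y Y' g]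
 note aux = tenm_aux[OF assms]
 let ?t = "tenm X X' Y Y' f g"
 show tq: "?t * tq X Y = tq X' Y' * f * ac X g"
  and h: "?t : homs (tob X Y) (tob X' Y')" using factor_tq[OF X Y aux] by (simp_all add: tenm_def)
 have tM: "?t : M" using homD(1)[OF h] .
 have t1: "?t * act (tob X Y) idb = ?t" by (rule homD(3)[OF h])
 have l: "la (tens X Y) * A (act (tob X Y) idb) = la (tens X Y)"
  and r: "ra (tens X Y) * act (tob X Y) idb = ra (tens X Y)" using la_one'[OF tens_bim[OF X Y]] ra_one'[OF tens_bim[OF X Y]] by (simp_all add: tens_ob[OF X Y])
 show "?t : bmaps (tens X Y) (tens X' Y')"
 proof (rule bmapsI)
  show "?t : homs (ob (tens X Y)) (ob (tens X' Y'))" using h X X' Y Y' by (simp add: tens_ob)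
  show "?t * la (tens X Y) = la (tens X' Y') * A ?t"
  proof (rule tq_cancel_A[OF X Y])
   have "(?t * la (tens X Y)) * A (tq X Y) = (tq X' Y' * f * ac X g) * la X" using X Y by (simp add: assoc tens_la) (simp add: assoc[symmetric] tq)
   also have "... = tq X' Y' * (f * la X) * A (ac X g)" using X G(1) by (simp add: assoc la_comm)
   also have "... = (tq X' Y' * la X') * A (f * ac X g)" using X G(1) F(1) by (simp add: F(3) A_o assoc)
   also have "... = la (tens X' Y') * A (tq X' Y' * f * ac X g)" using X X' Y' G(1) F(1) by (simp add: tens_la[symmetric] A_o assoc)
   also have "... = (la (tens X' Y') * A ?t) * A (tq X Y)" using X Y tM by (simp add: tq[symmetric] A_o assoc)
   finally show "(?t * la (tens X Y)) * A (tq X Y) = (la (tens X' Y') * A ?t) * A (tq X Y)" .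
   show "(?t * la (tens X Y)) * A (act (tob X Y) idb) = ?t * la (tens X Y)" by (simp add: assoc l)
   show "(la (tens X' Y') * A ?t) * A (act (tob X Y) idb) = la (tens X' Y') * A ?t" using X Y tM by (simp add: assoc A_o[symmetric] t1)
  qed
  show "?t * ra (tens X Y) = ra (tens X' Y') * ?t"
  proof (rule tq_cancel[OF X Y])
   have "(?t * ra (tens X Y)) * tq X Y = (tq X' Y' * f * ac X g) * ac X (ra Y)" using X Y by (simp add: assoc tens_ra) (simp add: assoc[symmetric] tq)
   also have "... = tq X' Y' * f * ac X (ra Y') * ac X g" using X Y Y' G(1) by (simp add: assoc act_o[symmetric] G(4))
   also have "... = tq X' Y' * (f * ac X (ra Y')) * ac X g" by (simp add: assoc)
   also have "... = (tq X' Y' * ac X' (ra Y')) * f * ac X g" using Y' F(5) by (simp add: assoc)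
   also have "... = (ra (tens X' Y') * ?t) * tq X Y" using X' Y' by (simp add: tens_ra[symmetric] assoc tq)
   finally show "(?t * ra (tens X Y)) * tq X Y = (ra (tens X' Y') * ?t) * tq X Y" .
   show "(?t * ra (tens X Y)) * act (tob X Y) idb = ?t * ra (tens X Y)" by (simp add: assoc r)
   show "(ra (tens X' Y') * ?t) * act (tob X Y) idb = ra (tens X' Y') * ?t" by (simp add: assoc t1)
  qed
 qed (use X X' Y Y' in simp_all)
qed

text \<open>On plain tensor products the associator is the identity. Hence it is obtained from the
  sections of one bracketing followed by the projections of the other.\<close>

definition asc :: "'h bm => 'h bm => 'h bm => 'h op" where
 "asc X Y Z = ((tq X (tens Y Z) * ac X (tq Y Z)) * ts X Y) * ts (tens X Y) Z"

definition asc_inv :: "'h bm => 'h bm => 'h bm => 'h op" where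
 "asc_inv X Y Z = ((tq (tens X Y) Z * tq X Y) * ac X (ts Y Z)) * ts X (tens Y Z)"

definition lun :: "'h bm => 'h op" where "lun X = la X * ts UU X"
definition run :: "'h bm => 'h op" where "run X = ra X * ts X UU"

text \<open>Maps out of iterated tensor products are determined on the plain tensor product of the
 underlying objects. All coherence laws are checked there.\<close>

lemma tq2_cancel:
 assumes X: "bim X" and Y: "bim Y" and Z: "bim Z"
  and "k * tq (tens X Y) Z * tq X Y = k' * tq (tens X Y) Z * tq X Y"
  "k * act (tob (tens X Y) Z) idb = k" "k' * act (tob (tens X Y) Z) idb = k'" shows "k = k'"
proof (rule tq_cancel[OF tens_bim[OF X Y] Z _ assms(5,6)], rule tq_cancel[OF X Y])
 show "(k * tq (tens X Y) Z) * tq X Y = (k' * tq (tens X Y) Z) * tq X Y" using assms(4) by (simp add: assoc)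
 show "(k * tq (tens X Y) Z) * act (tob X Y) idb = k * tq (tens X Y) Z"
  "(k' * tq (tens X Y) Z) * act (tob X Y) idb = k' * tq (tens X Y) Z" using tq_unit(2)[OF tens_bim[OF X Y] Z] by (simp_all add: assoc tens_ob[OF X Y])
qed

lemma tq2_cancel':
 assumes X: "bim X" and Y: "bim Y" and Z: "bim Z"
  and "k * tq X (tens Y Z) * ac X (tq Y Z) = k' * tq X (tens Y Z) * ac X (tq Y Z)"
  "k * act (tob X (tens Y Z)) idb = k" "k' * act (tob X (tens Y Z)) idb = k'" shows "k = k'"
proof (rule tq_cancel[OF X tens_bim[OF Y Z] _ assms(5,6)])
 have *: "(j * tq X (tens Y Z) * ac X (tq Y Z)) * ac X (ts Y Z) = j * tq X (tens Y Z)" for j using tq_unit(1)[OF X tens_bim[OF Y Z]] X Y Z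
  by (simp add: assoc act_o[symmetric] tq_ts tens_ob)
 show "k * tq X (tens Y Z) = k' * tq X (tens Y Z)" using *[of k] *[of k'] assms(4) by simp
qed

lemma asc_props:
 assumes X: "bim X" and Y: "bim Y" and Z: "bim Z" shows asc_hom: "asc X Y Z : homs (tob (tens X Y) Z) (tob X (tens Y Z))"
  and asc_tq: "asc X Y Z * tq (tens X Y) Z * tq X Y = tq X (tens Y Z) * ac X (tq Y Z)"
proof -
 let ?XY = "tens X Y" and ?YZ = "tens Y Z"
 define h where "h = tq X ?YZ * ac X (tq Y Z)"
 \<comment> \<open>The map \<open>h\<close> on the plain product \<open>X Y Z\<close> descends in
   two stages: \<open>h1\<close> has passed to the tensor product of \<open>X\<close> and
   \<open>Y\<close> over \<open>A\<close>, and the final map also to that with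
   \<open>Z\<close>.\<close>
 define h1 where "h1 = h * ts X Y"
 note B = X Y Z tens_bim[OF X Y] tens_bim[OF Y Z]
 have XY: "ob ?XY = tob X Y" and YZ: "ob ?YZ = tob Y Z" using X Y Z by (simp_all add: tens_ob)
 have h: "h : homs (ec (ob X) (ec (ob Y) (ob Z))) (tob X ?YZ)"
  unfolding h_def using B hom_whisker_left[OF tq_hom[OF Y Z], of "ob X"] by (intro hom_o[OF tq_hom[OF X B(5)]]) (simp add: YZ)
 have h_bal: "balanced X Y h"
 proof -
  have "h * ra X = (tq X ?YZ * ra X) * ac X (A (tq Y Z))" using B by (simp add: h_def assoc ra_comm)
  also have "... = tq X ?YZ * ac X (la ?YZ * A (tq Y Z))" using B by (simp add: tq_balanced assoc act_o)
  also have "... = h * ac X (la Y)" using B by (simp add: tens_la h_def act_o assoc)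
  finally show ?thesis .
 qed
 have he: "h * bal X Y = h"
 proof -
  have "h * bal X Y = (h * ra X) * ac X (A (la Y) * dl)" by (simp add: bal_def assoc)
  also have "... = h * ac X ((la Y * A (la Y)) * dl)" using B by (simp add: h_bal assoc act_o)
  also have "(la Y * A (la Y)) * dl = ac Y idb" using Y by (simp add: la_la assoc dl_section la_u)
  also have "h * ac X (ac Y idb) = h" using B by (simp add: h_def assoc act_o[symmetric] tq_unit)
  finally show ?thesis .
 qed
 have h1q: "h1 * tq X Y = h" using B by (simp add: h1_def assoc ts_tq he)
 have h1: "h1 : homs (ec (ob ?XY) (ob Z)) (tob X ?YZ)"
 proof -
  have "ts X Y * act (tob X Y) (ac Z idb) : homs (ec (tob X Y) (ob Z)) (ec (ec (ob X) (ob Y)) (ob Z))" using B by (intro hom_ten[OF ts_hom[OF X Y] hom_one]) auto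
  hence "h * ts X Y * act (tob X Y) (ac Z idb) : homs (ec (ob ?XY) (ob Z)) (tob X ?YZ)" unfolding XY by (intro hom_o[OF h]) (simp add: endo_comp_assoc)
  moreover have "h * ts X Y * act (tob X Y) (ac Z idb) = h1" using B homD(2)[OF ts_hom[OF X Y], of "ac Z idb"] homD(3)[OF h]
   by (simp add: h1_def) (simp add: assoc[symmetric])
  ultimately show ?thesis by simp
 qed
 have h1_bal: "balanced ?XY Z h1"
 proof (rule tq_cancel[OF X Y])
  have "(h1 * ra ?XY) * tq X Y = h * ac X (ra Y)" using B by (simp add: assoc tens_ra) (simp add: assoc[symmetric] h1q)
  also have "... = tq X ?YZ * ac X (tq Y Z * ra Y)" using B by (simp add: h_def assoc act_o)
  also have "... = h * ac X (ac Y (la Z))" using B by (simp add: h_def assoc act_o tq_balanced)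
  also have "... = (h1 * ac ?XY (la Z)) * tq X Y" unfolding XY using B by (simp add: assoc tq_comm[symmetric]) (simp add: assoc[symmetric] h1q)
  finally show "(h1 * ra ?XY) * tq X Y = (h1 * ac ?XY (la Z)) * tq X Y" .
  show "(h1 * ra ?XY) * act (tob X Y) idb = h1 * ra ?XY" using ra_one'[OF B(4)] by (simp add: XY assoc)
  show "(h1 * ac ?XY (la Z)) * act (tob X Y) idb = h1 * ac ?XY (la Z)" unfolding XY using B by (simp add: assoc act_o[symmetric])
 qed
 show "asc X Y Z : homs (tob ?XY Z) (tob X ?YZ)" using factor_tq(1)[OF B(4) Z h1 h1_bal] by (simp add: asc_def h1_def h_def)
 show "asc X Y Z * tq ?XY Z * tq X Y = tq X ?YZ * ac X (tq Y Z)"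
 proof -
  have "asc X Y Z = h1 * ts ?XY Z" by (simp add: asc_def h1_def h_def)
  hence "asc X Y Z * tq ?XY Z * tq X Y = ((h1 * ts ?XY Z) * tq ?XY Z) * tq X Y" by (simp add: assoc)
  also have "... = h" by (simp add: factor_tq(2)[OF B(4) Z h1 h1_bal] h1q)
  finally show ?thesis by (simp add: h_def)
 qed
qed

lemma asc_inv_props:
 assumes X: "bim X" and Y: "bim Y" and Z: "bim Z" shows asc_inv_hom: "asc_inv X Y Z : homs (tob X (tens Y Z)) (tob (tens X Y) Z)"
  and asc_inv_tq: "asc_inv X Y Z * tq X (tens Y Z) * ac X (tq Y Z) = tq (tens X Y) Z * tq X Y"
proof -
 let ?XY = "tens X Y" and ?YZ = "tens Y Z"
 define h where "h = tq ?XY Z * tq X Y"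
 define h1 where "h1 = h * ac X (ts Y Z)"
 note B = X Y Z tens_bim[OF X Y] tens_bim[OF Y Z]
 have XY: "ob ?XY = tob X Y" and YZ: "ob ?YZ = tob Y Z" using X Y Z by (simp_all add: tens_ob)
 have h: "h : homs (ec (ob X) (ec (ob Y) (ob Z))) (tob ?XY Z)"
 proof -
  have 1: "h * ac X (ac Y (ac Z x)) = act (tob ?XY Z) x * h" if "x : M" for x using B that tq_comm[OF B(4) Z that]
   by (simp add: h_def assoc tq_comm XY) (simp add: assoc[symmetric])
  have 2: "h * ac X (ac Y (ac Z idb)) = h" using B tq_unit(1)[OF B(4) Z] by (simp add: h_def assoc tq_comm XY) (simp add: assoc[symmetric])
  show ?thesis using B 1 2 1[OF M_id] by (simp add: homs_def h_def)
 qed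
 have h_bal: "h * ac X (ra Y) = h * ac X (ac Y (la Z))"
 proof -
  have "h * ac X (ra Y) = (tq ?XY Z * ra ?XY) * tq X Y" using B by (simp add: h_def assoc tens_ra)
  also have "... = tq ?XY Z * tq X Y * ac X (ac Y (la Z))" using B by (simp add: tq_balanced assoc XY tq_comm)
  finally show ?thesis by (simp add: h_def assoc)
 qed
 have he: "h * ac X (bal Y Z) = h"
 proof -
  have "h * ac X (bal Y Z) = (h * ac X (ra Y)) * ac X (ac Y (A (la Z) * dl))" using B by (simp add: bal_def act_o assoc)
  also have "... = h * ac X (ac Y ((la Z * A (la Z)) * dl))" using B by (simp add: h_bal assoc act_o)
  also have "(la Z * A (la Z)) * dl = ac Z idb" using Z by (simp add: la_la assoc dl_section la_u)
  finally show ?thesis using homD(3)[OF h] B by simp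
 qed
 have h1q: "h1 * ac X (tq Y Z) = h" using B by (simp add: h1_def assoc act_o[symmetric] ts_tq he)
 have h1: "h1 : homs (ec (ob X) (ob ?YZ)) (tob ?XY Z)" unfolding h1_def YZ using B by (intro hom_o[OF h] hom_whisker_left[OF ts_hom[OF Y Z]]) auto
 have cancel: "k = k'" if "k * ac X (tq Y Z) = k' * ac X (tq Y Z)"
  "k * ac X (act (tob Y Z) idb) = k" "k' * ac X (act (tob Y Z) idb) = k'" for k k'
 proof -
  have "(k * ac X (tq Y Z)) * ac X (ts Y Z) = (k' * ac X (tq Y Z)) * ac X (ts Y Z)" using that(1) by simp
  thus ?thesis using that(2,3) B by (simp add: assoc act_o[symmetric] tq_ts)
 qed
 have cancel_A: "k = k'" if "k * ac X (A (tq Y Z)) = k' * ac X (A (tq Y Z))"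
  "k * ac X (A (act (tob Y Z) idb)) = k" "k' * ac X (A (act (tob Y Z) idb)) = k'" for k k'
 proof -
  have "(k * ac X (A (tq Y Z))) * ac X (A (ts Y Z)) = (k' * ac X (A (tq Y Z))) * ac X (A (ts Y Z))" using that(1) by simp
  thus ?thesis using that(2,3) B by (simp add: assoc act_o[symmetric] A_o[symmetric] tq_ts)
 qed
 have h1_one: "h1 * ac X (act (tob Y Z) idb) = h1" using homD(3)[OF h1] B by (simp add: YZ)
 have h1_bal: "balanced X ?YZ h1"
 proof (rule cancel_A)
  have "(h1 * ra X) * ac X (A (tq Y Z)) = h * ra X" using B by (simp add: assoc ra_comm) (simp add: assoc[symmetric] h1q)
  also have "... = h * ac X (la Y)" using B by (simp add: h_def assoc tq_balanced)
  also have "... = (h1 * ac X (la ?YZ)) * ac X (A (tq Y Z))" using B by (simp add: assoc act_o[symmetric] tens_la)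
    (simp add: act_o assoc[symmetric] h1q)
  finally show "(h1 * ra X) * ac X (A (tq Y Z)) = (h1 * ac X (la ?YZ)) * ac X (A (tq Y Z))" .
  show "(h1 * ra X) * ac X (A (act (tob Y Z) idb)) = h1 * ra X" using B by (simp add: assoc ra_comm) (simp add: assoc[symmetric] h1_one)
  show "(h1 * ac X (la ?YZ)) * ac X (A (act (tob Y Z) idb)) = h1 * ac X (la ?YZ)" using B la_one'[OF B(5)] by (simp add: assoc act_o[symmetric] YZ)
 qed
 show "asc_inv X Y Z : homs (tob X ?YZ) (tob ?XY Z)" using factor_tq(1)[OF X B(5) h1 h1_bal] by (simp add: asc_inv_def h1_def h_def)
 show "asc_inv X Y Z * tq X ?YZ * ac X (tq Y Z) = tq ?XY Z * tq X Y"
 proof -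
  have "asc_inv X Y Z = h1 * ts X ?YZ" by (simp add: asc_inv_def h1_def h_def)
  hence "asc_inv X Y Z * tq X ?YZ * ac X (tq Y Z) = ((h1 * ts X ?YZ) * tq X ?YZ) * ac X (tq Y Z)" by (simp add: assoc)
  also have "... = h" by (simp add: factor_tq(2)[OF X B(5) h1 h1_bal] h1q)
  finally show ?thesis by (simp add: h_def)
 qed
qed

lemma asc_inverse:
 assumes X: "bim X" and Y: "bim Y" and Z: "bim Z" shows "asc_inv X Y Z * asc X Y Z = act (tob (tens X Y) Z) idb"
  "asc X Y Z * asc_inv X Y Z = act (tob X (tens Y Z)) idb"
proof -
 let ?XY = "tens X Y" and ?YZ = "tens Y Z"
 note B = X Y Z tens_bim[OF X Y] tens_bim[OF Y Z]
 note a = asc_hom[OF X Y Z] asc_tq[OF X Y Z] and b = asc_inv_hom[OF X Y Z] asc_inv_tq[OF X Y Z]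
 show "asc_inv X Y Z * asc X Y Z = act (tob ?XY Z) idb"
 proof (rule tq2_cancel[OF X Y Z])
  have "(asc_inv X Y Z * asc X Y Z) * tq ?XY Z * tq X Y = tq ?XY Z * tq X Y" by (simp add: assoc a(2) b(2))
  thus "(asc_inv X Y Z * asc X Y Z) * tq ?XY Z * tq X Y = act (tob ?XY Z) idb * tq ?XY Z * tq X Y" using B by (simp add: assoc[symmetric] tq_one)
  show "(asc_inv X Y Z * asc X Y Z) * act (tob ?XY Z) idb = asc_inv X Y Z * asc X Y Z" using homD(3)[OF a(1)] by (simp add: assoc)
  show "act (tob ?XY Z) idb * act (tob ?XY Z) idb = act (tob ?XY Z) idb" using B by (simp add: act_o[symmetric])
 qed
 show "asc X Y Z * asc_inv X Y Z = act (tob X ?YZ) idb"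
 proof (rule tq2_cancel'[OF X Y Z])
  have "(asc X Y Z * asc_inv X Y Z) * tq X ?YZ * ac X (tq Y Z) = tq X ?YZ * ac X (tq Y Z)" by (simp add: assoc a(2) b(2))
  thus "(asc X Y Z * asc_inv X Y Z) * tq X ?YZ * ac X (tq Y Z) = act (tob X ?YZ) idb * tq X ?YZ * ac X (tq Y Z)" using B by (simp add: assoc[symmetric] tq_one)
  show "(asc X Y Z * asc_inv X Y Z) * act (tob X ?YZ) idb = asc X Y Z * asc_inv X Y Z" using homD(3)[OF b(1)] by (simp add: assoc)
  show "act (tob X ?YZ) idb * act (tob X ?YZ) idb = act (tob X ?YZ) idb" using B by (simp add: act_o[symmetric])
 qed
qed

declare is_bimodule.simps [simp del] bimodule_maps.simps [simp del] bimod_tensor.simps [simp del]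
 rel_tensor.simps [simp del]

section \<open>Comparison with the data of the bimodule category\<close>

abbreviation BB :: "('h bm, 'h op) moncat" where "BB \<equiv> bimodule_category CC AA"

lemma BB_simps [simp]: "Ob BB = {X. bim X}" "Mor BB = bmaps" "Cmp BB = (*)" "Scl BB = scl"
 "TenO BB = tens" "Unt BB = UU" by (auto simp: bimodule_category_def)

lemma BB_Idm: "bim X ==> Idm BB X = ac X idb" by (simp add: bimodule_category_def endo_id_act)

lemma BB_TenM:
 assumes X: "bim X" and X': "bim X'" and Y: "bim Y" and Y': "bim Y'"
  and f: "f : bmaps X X'" and g: "g : bmaps Y Y'" shows "TenM BB X X' Y Y' f g = tenm X X' Y Y' f g" using the_factor_tq[OF X Y tenm_aux[OF assms] tob_Obj[OF X' Y']]
 by (simp add: bimodule_category_def whisk_simps tenm_def)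

lemma BB_Asc:
 assumes X: "bim X" and Y: "bim Y" and Z: "bim Z" shows "Asc BB X Y Z = asc X Y Z"
proof -
 let ?XY = "tens X Y" and ?YZ = "tens Y Z"
 note B = X Y Z tens_bim[OF X Y] tens_bim[OF Y Z]
 have XY: "ob ?XY = tob X Y" and YZ: "ob ?YZ = tob Y Z" using X Y Z by (simp_all add: tens_ob)
 have 1: "k * tq ?XY Z * rwhisk CC (ec (ob X) (ob Y)) (ob ?XY) (ob Z) (tq X Y)
   = k * tq ?XY Z * tq X Y" for k
 proof -
  have "tq ?XY Z * tq X Y * ac X (ac Y (ac Z idb)) = (tq ?XY Z * ac ?XY (ac Z idb)) * tq X Y" using B by (simp add: tq_comm XY assoc)
  also have "... = tq ?XY Z * tq X Y" using B by (simp add: tq_unit)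
  finally show ?thesis using B by (simp add: whisk_simps endo_id_act)
 qed
 have 2: "tq X ?YZ * lwhisk CC (ob X) (ec (ob Y) (ob Z)) (ob ?YZ) (tq Y Z) *
   Asc CC (ob X) (ob Y) (ob Z) = tq X ?YZ * ac X (tq Y Z)" using B by (simp add: whisk_simps endo_id_act act_o[symmetric] tq_unit)
 have "(THE k. k : Mor CC (tob ?XY Z) (tob X ?YZ) &
   k * tq ?XY Z * tq X Y = tq X ?YZ * ac X (tq Y Z)) = asc X Y Z"
 proof (rule the_equality)
  show "asc X Y Z : Mor CC (tob ?XY Z) (tob X ?YZ) &
   asc X Y Z * tq ?XY Z * tq X Y = tq X ?YZ * ac X (tq Y Z)" using asc_props[OF X Y Z] B by (simp add: Mor_CC)
  fix k assume "k : Mor CC (tob ?XY Z) (tob X ?YZ) &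
   k * tq ?XY Z * tq X Y = tq X ?YZ * ac X (tq Y Z)"
  hence k: "k : homs (tob ?XY Z) (tob X ?YZ)" "k * tq ?XY Z * tq X Y = tq X ?YZ * ac X (tq Y Z)" using B by (simp_all add: Mor_CC)
  show "k = asc X Y Z" by (rule tq2_cancel[OF X Y Z _ homD(3)[OF k(1)] homD(3)[OF asc_hom[OF X Y Z]]])
    (simp add: k(2) asc_tq[OF X Y Z])
 qed
 thus ?thesis unfolding bimodule_category_def Let_def by (simp only: moncat.simps endo_category_simps(2,5) 1 2[unfolded endo_category_simps(2)])
qed

lemma run_props: assumes X: "bim X" shows run_hom: "run X : homs (tob X UU) (ob X)" and run_tq: "run X * tq X UU = ra X"
  and run_eq: "RUn BB X = run X"
proof -
 have U: "bim UU" by simp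
 have h: "ra X : homs (ec (ob X) (ob UU)) (ob X)" "balanced X UU (ra X)" using bim_hom[OF X] X by (simp_all add: ra_ra)
 show "run X : homs (tob X UU) (ob X)" "run X * tq X UU = ra X" using factor_tq[OF X U h] by (simp_all add: run_def)
 show "RUn BB X = run X" using the_factor_tq[OF X U h bim_ob[OF X]] by (simp add: bimodule_category_def Let_def run_def)
qed

lemma lun_props: assumes X: "bim X" shows lun_hom: "lun X : homs (tob UU X) (ob X)" and lun_tq: "lun X * tq UU X = la X"
  and lun_eq: "LUn BB X = lun X"
proof -
 have U: "bim UU" by simp
 have h: "la X : homs (ec (ob UU) (ob X)) (ob X)" "balanced UU X (la X)" using bim_hom[OF X] X by (simp_all add: la_la)
 show "lun X : homs (tob UU X) (ob X)" "lun X * tq UU X = la X" using factor_tq[OF U X h] by (simp_all add: lun_def)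
 show "LUn BB X = lun X" using the_factor_tq[OF U X h bim_ob[OF X]] by (simp add: bimodule_category_def Let_def lun_def)
qed

lemma is_inverse_BB: "is_inverse BB X Y f g \<longleftrightarrow>
 f : bmaps X Y & g : bmaps Y X & g * f = Idm BB X & f * g = Idm BB Y" by (simp add: is_inverse_def)

text \<open>Because of this, isomorphisms of bimodules need only an inverse of the underlying
  morphism.\<close>

lemma inv_bmaps:
 assumes X: "bim X" and Y: "bim Y" and f: "f : bmaps X Y"
  and g: "g : homs (ob Y) (ob X)" "g * f = ac X idb" "f * g = ac Y idb" shows "g : bmaps Y X"
proof (rule bmapsI[OF Y X g(1)])
 note F = bmapsD[OF X Y f]
 have gM: "g : M" using homD(1)[OF g(1)] .
 have g1: "ac X idb * g = g" "g * ac Y idb = g" using homD(3,4)[OF g(1)] by auto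
 have "g * la Y = g * la Y * A (f * g)" using Y by (simp add: g(3) la_one')
 also have "... = g * (la Y * A f) * A g" using gM F(1) by (simp add: A_o assoc)
 also have "... = (g * f) * la X * A g" by (simp add: F(3)[symmetric] assoc)
 also have "... = la X * A g" using X by (simp add: g(2) assoc[symmetric] la_one)
 finally show "g * la Y = la X * A g" .
 have "g * ra Y = g * ra Y * (f * g)" using Y by (simp add: g(3) ra_one')
 also have "... = g * (ra Y * f) * g" by (simp add: assoc)
 also have "... = (g * f) * ra X * g" by (simp add: F(4)[symmetric] assoc)
 also have "... = ra X * g" using X by (simp add: g(2) assoc[symmetric] ra_one)
 finally show "g * ra Y = ra X * g" .
qed

lemma is_iso_BBI:
 assumes X: "bim X" and Y: "bim Y" and f: "f : bmaps X Y"
  and g: "g : homs (ob Y) (ob X)" "g * f = ac X idb" "f * g = ac Y idb" shows "is_inverse BB X Y f g" using inv_bmaps[OF assms] assms by (simp add: is_inverse_BB BB_Idm)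

lemma asc_bmaps:
 assumes X: "bim X" and Y: "bim Y" and Z: "bim Z" shows "asc X Y Z : bmaps (tens (tens X Y) Z) (tens X (tens Y Z))"
proof -
 let ?XY = "tens X Y" and ?YZ = "tens Y Z" and ?a = "asc X Y Z"
 note B = X Y Z tens_bim[OF X Y] tens_bim[OF Y Z]
 have XY: "ob ?XY = tob X Y" and YZ: "ob ?YZ = tob Y Z" using X Y Z by (simp_all add: tens_ob)
 have o: "ob (tens ?XY Z) = tob ?XY Z" "ob (tens X ?YZ) = tob X ?YZ" using B by (simp_all add: tens_ob)
 note a = asc_hom[OF X Y Z] asc_tq[OF X Y Z]
 have aM: "?a : M" using homD(1)[OF a(1)] .
 note a1 = homD(3)[OF a(1)]
 note T = tens_bim[OF B(4) Z] tens_bim[OF X B(5)]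
 show ?thesis
 proof (rule bmapsI[OF T])
  show "?a : homs (ob (tens ?XY Z)) (ob (tens X ?YZ))" using a(1) by (simp add: o)
  show "?a * la (tens ?XY Z) = la (tens X ?YZ) * A ?a"
  proof -
   have "(?a * la (tens ?XY Z)) * A (tq ?XY Z) * A (tq X Y) = ?a * (la (tens ?XY Z) * A (tq ?XY Z)) * A (tq X Y)" by (simp add: assoc)
   also have "... = ?a * tq ?XY Z * la ?XY * A (tq X Y)" using B by (simp add: tens_la assoc)
   also have "... = (?a * tq ?XY Z * tq X Y) * la X" using B by (simp add: tens_la assoc)
   also have "... = tq X ?YZ * la X * A (ac X (tq Y Z))" using B by (simp add: a(2) assoc la_comm)
   also have "... = la (tens X ?YZ) * A (tq X ?YZ * ac X (tq Y Z))" using B by (simp add: assoc[symmetric] tens_la[symmetric] A_o)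
   also have "... = (la (tens X ?YZ) * A ?a) * A (tq ?XY Z) * A (tq X Y)" using B aM by (simp add: a(2)[symmetric] A_o assoc)
   finally have 1: "((?a * la (tens ?XY Z)) * A (tq ?XY Z)) * A (tq X Y) =
    ((la (tens X ?YZ) * A ?a) * A (tq ?XY Z)) * A (tq X Y)" by (simp add: assoc)
   have un: "A (tq ?XY Z) * A (act (tob X Y) idb) = A (tq ?XY Z)" using B tq_unit(2)[OF B(4) Z] by (simp add: A_o[symmetric] XY)
   have 2: "(?a * la (tens ?XY Z)) * A (tq ?XY Z) = (la (tens X ?YZ) * A ?a) * A (tq ?XY Z)" by (rule tq_cancel_A[OF X Y 1]) (simp_all add: assoc un)
   show ?thesis by (rule tq_cancel_A[OF B(4) Z 2])
     (use la_one'[OF T(1)] B aM in \<open>simp_all add: o assoc A_o[symmetric] a1\<close>)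
  qed
  show "?a * ra (tens ?XY Z) = ra (tens X ?YZ) * ?a"
  proof (rule tq2_cancel[OF X Y Z])
   have "(?a * ra (tens ?XY Z)) * tq ?XY Z * tq X Y = ?a * (ra (tens ?XY Z) * tq ?XY Z) * tq X Y" by (simp add: assoc)
   also have "... = ?a * tq ?XY Z * act (tob X Y) (ra Z) * tq X Y" using B by (simp add: tens_ra XY assoc)
   also have "... = (?a * tq ?XY Z * tq X Y) * ac X (ac Y (ra Z))" using B by (simp add: tq_comm assoc)
   also have "... = tq X ?YZ * ac X (tq Y Z * ac Y (ra Z))" using B by (simp add: a(2) act_o assoc)
   also have "... = (tq X ?YZ * ac X (ra ?YZ)) * ac X (tq Y Z)" using B by (simp add: tens_ra[OF Y Z, symmetric] act_o assoc)
   also have "... = (ra (tens X ?YZ) * ?a) * tq ?XY Z * tq X Y" by (simp add: assoc a(2) eq_tail[OF tens_ra[OF X B(5)]])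
   finally show "(?a * ra (tens ?XY Z)) * tq ?XY Z * tq X Y = (ra (tens X ?YZ) * ?a) * tq ?XY Z * tq X Y" .
   show "(?a * ra (tens ?XY Z)) * act (tob ?XY Z) idb = ?a * ra (tens ?XY Z)" using ra_one'[OF T(1)] by (simp add: assoc o)
   show "(ra (tens X ?YZ) * ?a) * act (tob ?XY Z) idb = ra (tens X ?YZ) * ?a" by (simp add: assoc a1)
  qed
 qed
qed

lemma asc_is_inverse:
 assumes X: "bim X" and Y: "bim Y" and Z: "bim Z" shows "is_inverse BB (tens (tens X Y) Z) (tens X (tens Y Z)) (asc X Y Z) (asc_inv X Y Z)"
proof (rule is_iso_BBI)
 have o: "ob (tens (tens X Y) Z) = tob (tens X Y) Z" "ob (tens X (tens Y Z)) = tob X (tens Y Z)" using X Y Z by (simp_all add: tens_ob)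
 show "asc_inv X Y Z : homs (ob (tens X (tens Y Z))) (ob (tens (tens X Y) Z))"
  "asc_inv X Y Z * asc X Y Z = ac (tens (tens X Y) Z) idb"
  "asc X Y Z * asc_inv X Y Z = ac (tens X (tens Y Z)) idb" using asc_inv_hom[OF X Y Z] asc_inverse[OF X Y Z] by (simp_all add: o)
qed (use asc_bmaps[OF X Y Z] X Y Z in simp_all)

lemma lun_bmaps: assumes X: "bim X" shows "lun X : bmaps (tens UU X) X"
proof (rule bmapsI)
 have U: "bim UU" by simp
 note h = lun_hom[OF X] lun_tq[OF X]
 have M: "lun X : M" using homD(1)[OF h(1)] .
 note T = tens_bim[OF U X]
 have o: "ob (tens UU X) = tob UU X" using X by (simp add: tens_ob)
 show "lun X : homs (ob (tens UU X)) (ob X)" using h by (simp add: o)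
 show "lun X * la (tens UU X) = la X * A (lun X)"
 proof (rule tq_cancel_A[OF U X])
  have "(lun X * la (tens UU X)) * A (tq UU X) = (lun X * tq UU X) * m" using X tens_la[OF U X] by (simp add: assoc)
  also have "... = la X * A (lun X * tq UU X)" using X by (simp add: h(2) la_la)
  also have "... = (la X * A (lun X)) * A (tq UU X)" using X M by (simp add: A_o assoc)
  finally show "(lun X * la (tens UU X)) * A (tq UU X) = (la X * A (lun X)) * A (tq UU X)" .
  show "(lun X * la (tens UU X)) * A (act (tob UU X) idb) = lun X * la (tens UU X)" using la_one'[OF T] by (simp add: assoc o)
  show "(la X * A (lun X)) * A (act (tob UU X) idb) = la X * A (lun X)" using homD(3)[OF h(1)] X M by (simp add: assoc A_o[symmetric])
 qed
 show "lun X * ra (tens UU X) = ra X * lun X"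
 proof (rule tq_cancel[OF U X])
  have "(lun X * ra (tens UU X)) * tq UU X = (lun X * tq UU X) * A (ra X)" using X tens_ra[OF U X] by (simp add: assoc)
  also have "... = (ra X * lun X) * tq UU X" using X by (simp add: h(2) ra_la assoc)
  finally show "(lun X * ra (tens UU X)) * tq UU X = (ra X * lun X) * tq UU X" .
  show "(lun X * ra (tens UU X)) * act (tob UU X) idb = lun X * ra (tens UU X)" using ra_one'[OF T] by (simp add: assoc o)
  show "(ra X * lun X) * act (tob UU X) idb = ra X * lun X" using homD(3)[OF h(1)] by (simp add: assoc)
 qed
qed (use X in simp_all)

lemma run_bmaps: assumes X: "bim X" shows "run X : bmaps (tens X UU) X"
proof (rule bmapsI)
 have U: "bim UU" by simp
 note h = run_hom[OF X] run_tq[OF X]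
 have M: "run X : M" using homD(1)[OF h(1)] .
 note T = tens_bim[OF X U]
 have o: "ob (tens X UU) = tob X UU" using X by (simp add: tens_ob)
 show "run X : homs (ob (tens X UU)) (ob X)" using h by (simp add: o)
 show "run X * la (tens X UU) = la X * A (run X)"
 proof (rule tq_cancel_A[OF X U])
  have "(run X * la (tens X UU)) * A (tq X UU) = (run X * tq X UU) * la X" using X tens_la[OF X U] by (simp add: assoc)
  also have "... = la X * A (run X * tq X UU)" using X by (simp add: h(2) ra_la)
  also have "... = (la X * A (run X)) * A (tq X UU)" using X M by (simp add: A_o assoc)
  finally show "(run X * la (tens X UU)) * A (tq X UU) = (la X * A (run X)) * A (tq X UU)" .
  show "(run X * la (tens X UU)) * A (act (tob X UU) idb) = run X * la (tens X UU)" using la_one'[OF T] by (simp add: assoc o)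
  show "(la X * A (run X)) * A (act (tob X UU) idb) = la X * A (run X)" using homD(3)[OF h(1)] X M by (simp add: assoc A_o[symmetric])
 qed
 show "run X * ra (tens X UU) = ra X * run X"
 proof (rule tq_cancel[OF X U])
  have "(run X * ra (tens X UU)) * tq X UU = (run X * tq X UU) * ac X m" using X tens_ra[OF X U] by (simp add: assoc)
  also have "... = (ra X * run X) * tq X UU" using X by (simp add: h(2) ra_ra assoc)
  finally show "(run X * ra (tens X UU)) * tq X UU = (ra X * run X) * tq X UU" .
  show "(run X * ra (tens X UU)) * act (tob X UU) idb = run X * ra (tens X UU)" using ra_one'[OF T] by (simp add: assoc o)
  show "(ra X * run X) * act (tob X UU) idb = ra X * run X" using homD(3)[OF h(1)] by (simp add: assoc)
 qed
qed (use X in simp_all)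

lemma lun_is_inverse: assumes X: "bim X" shows "is_inverse BB (tens UU X) X (lun X) (tq UU X * u * ac X idb)"
proof (rule is_iso_BBI[OF _ X lun_bmaps[OF X]])
 have U: "bim UU" by simp
 have o: "ob (tens UU X) = tob UU X" using X by (simp add: tens_ob)
 note h = lun_hom[OF X] lun_tq[OF X]
 show "bim (tens UU X)" using X by simp
 have "u * ac X idb : homs (ec (Some id) (ob X)) (ec (ob UU) (ob X))" using X hom_ten[OF mu_hom(2) hom_one[OF bim_ob[OF X]]] by simp
 hence "tq UU X * u * ac X idb : homs (ec (Some id) (ob X)) (tob UU X)" by (rule hom_o[OF tq_hom[OF U X]])
 thus "tq UU X * u * ac X idb : homs (ob X) (ob (tens UU X))" by (cases "ob X") (simp_all add: o homs_def)
 have "(lun X * tq UU X * u * ac X idb) = (lun X * tq UU X) * u * ac X idb" by (simp add: assoc)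
 also have "... = (la X * u) * ac X idb" by (simp add: h(2) assoc)
 finally show "lun X * tq UU X * u * ac X idb = ac X idb" using X by (simp add: la_u ac_ones)
 show "(tq UU X * u * ac X idb) * lun X = ac (tens UU X) idb" unfolding o
 proof (rule tq_cancel[OF U X])
  have "((tq UU X * u * ac X idb) * lun X) * tq UU X = tq UU X * u * (ac X idb * la X)" by (simp add: assoc h(2))
  also have "... = (tq UU X * A (la X)) * u" using X by (simp add: la_one u_comm assoc)
  also have "... = (tq UU X * m) * u" using tq_balanced[OF U X] by simp
  also have "... = act (tob UU X) idb * tq UU X" using X U by (simp add: assoc m_unit_left tq_one)
  finally show "((tq UU X * u * ac X idb) * lun X) * tq UU X = act (tob UU X) idb * tq UU X" .
  show "((tq UU X * u * ac X idb) * lun X) * act (tob UU X) idb = (tq UU X * u * ac X idb) * lun X" using homD(3)[OF h(1)] by (simp add: assoc)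
  show "act (tob UU X) idb * act (tob UU X) idb = act (tob UU X) idb" using U X by (simp add: act_o[symmetric])
 qed
qed

lemma run_is_inverse: assumes X: "bim X" shows "is_inverse BB (tens X UU) X (run X) (tq X UU * ac X u)"
proof (rule is_iso_BBI[OF _ X run_bmaps[OF X]])
 have U: "bim UU" by simp
 have o: "ob (tens X UU) = tob X UU" using X by (simp add: tens_ob)
 note h = run_hom[OF X] run_tq[OF X]
 show "bim (tens X UU)" using X by simp
 have "ac X u : homs (ec (ob X) (Some id)) (ec (ob X) (ob UU))" using X hom_whisker_left[OF mu_hom(2), of "ob X"] by simp
 hence "tq X UU * ac X u : homs (ec (ob X) (Some id)) (tob X UU)" by (rule hom_o[OF tq_hom[OF X U]])
 thus "tq X UU * ac X u : homs (ob X) (ob (tens X UU))" by (cases "ob X") (simp_all add: o homs_def)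
 have "run X * tq X UU * ac X u = (run X * tq X UU) * ac X u" by (simp add: assoc)
 thus "run X * tq X UU * ac X u = ac X idb" using X by (simp add: h(2) ra_u)
 show "(tq X UU * ac X u) * run X = ac (tens X UU) idb" unfolding o
 proof (rule tq_cancel[OF X U])
  have "((tq X UU * ac X u) * run X) * tq X UU = tq X UU * (ac X u * ra X)" by (simp add: assoc h(2))
  also have "... = (tq X UU * ra X) * ac X (A u)" using X by (simp add: ra_comm assoc)
  also have "... = tq X UU * ac X (m * A u)" using tq_balanced[OF X U] X by (simp add: assoc act_o)
  also have "... = act (tob X UU) idb * tq X UU" using X U by (simp add: m_unit_right tq_one tq_unit)
  finally show "((tq X UU * ac X u) * run X) * tq X UU = act (tob X UU) idb * tq X UU" .
  show "((tq X UU * ac X u) * run X) * act (tob X UU) idb = (tq X UU * ac X u) * run X" using homD(3)[OF h(1)] by (simp add: assoc)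
  show "act (tob X UU) idb * act (tob X UU) idb = act (tob X UU) idb" using U X by (simp add: act_o[symmetric])
 qed
qed

section \<open>Naturality and coherence of the constraints\<close>

lemma homs_cancel:
 assumes X: "bim X" and Y: "bim Y" and k: "k : homs (tob X Y) W" "k' : homs (tob X Y) W'"
  and eq: "k * tq X Y = k' * tq X Y" shows "k = k'" by (rule tq_cancel[OF X Y eq homD(3)[OF k(1)] homD(3)[OF k(2)]])

lemma homs_cancel2:
 assumes X: "bim X" and Y: "bim Y" and Z: "bim Z"
  and k: "k : homs (tob (tens X Y) Z) W" "k' : homs (tob (tens X Y) Z) W'"
  and eq: "k * tq (tens X Y) Z * tq X Y = k' * tq (tens X Y) Z * tq X Y" shows "k = k'" by (rule tq2_cancel[OF X Y Z eq homD(3)[OF k(1)] homD(3)[OF k(2)]])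

lemma BB_lwhisk:
 assumes "bim X" "bim Y" "bim Y'" "g : bmaps Y Y'" shows "lwhisk BB X Y Y' g = tenm X X Y Y' (ac X idb) g" using assms by (simp add: lwhisk_def BB_Idm BB_TenM bmaps_one)

lemma BB_rwhisk:
 assumes "bim X" "bim X'" "bim Y" "f : bmaps X X'" shows "rwhisk BB X X' Y f = tenm X X' Y Y f (ac Y idb)" using assms by (simp add: rwhisk_def BB_Idm BB_TenM bmaps_one)

lemma lwhisk_props:
 assumes X: "bim X" and Y: "bim Y" and Y': "bim Y'" and g: "g : bmaps Y Y'" shows lwhisk_tq: "lwhisk BB X Y Y' g * tq X Y = tq X Y' * ac X g"
  and lwhisk_bmaps: "lwhisk BB X Y Y' g : bmaps (tens X Y) (tens X Y')"
  and lwhisk_hom: "lwhisk BB X Y Y' g : homs (tob X Y) (tob X Y')" using tenm_props[OF X X Y Y' bmaps_one[OF X] g] bmapsD(1)[OF Y Y' g] X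
 by (simp_all add: BB_lwhisk[OF assms] ac_ones)

lemma rwhisk_props:
 assumes X: "bim X" and X': "bim X'" and Y: "bim Y" and f: "f : bmaps X X'" shows rwhisk_tq: "rwhisk BB X X' Y f * tq X Y = tq X' Y * f"
  and rwhisk_bmaps: "rwhisk BB X X' Y f : bmaps (tens X Y) (tens X' Y)"
  and rwhisk_hom: "rwhisk BB X X' Y f : homs (tob X Y) (tob X' Y)"
proof -
 note t = tenm_props[OF X X' Y Y f bmaps_one[OF Y]] and F = bmapsD[OF X X' f]
 have "tq X' Y * f * ac X (ac Y idb) = (tq X' Y * ac X' (ac Y idb)) * f" using Y by (simp add: F(5) assoc)
 also have "... = tq X' Y * f" using X' Y by (simp add: tq_unit)
 finally show "rwhisk BB X X' Y f * tq X Y = tq X' Y * f" using t by (simp add: BB_rwhisk[OF assms])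
 show "rwhisk BB X X' Y f : bmaps (tens X Y) (tens X' Y)"
  "rwhisk BB X X' Y f : homs (tob X Y) (tob X' Y)" using t by (simp_all add: BB_rwhisk[OF assms])
qed

lemma asc_natural:
 assumes X: "bim X" "bim X'" and Y: "bim Y" "bim Y'" and Z: "bim Z" "bim Z'"
  and f: "f : bmaps X X'" and g: "g : bmaps Y Y'" and h: "h : bmaps Z Z'" shows "asc X' Y' Z' * tenm (tens X Y) (tens X' Y') Z Z' (tenm X X' Y Y' f g) h
  = tenm X X' (tens Y Z) (tens Y' Z') f (tenm Y Y' Z Z' g h) * asc X Y Z"
proof (rule homs_cancel2[OF X(1) Y(1) Z(1)])
 note XY = tens_bim[OF X(1) Y(1)] tens_bim[OF X(2) Y(2)] and YZ = tens_bim[OF Y(1) Z(1)] tens_bim[OF Y(2) Z(2)]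
 note fg = tenm_props[OF X Y f g] and gh = tenm_props[OF Y Z g h]
 note fg_h = tenm_props[OF XY Z fg(3) h] and f_gh = tenm_props[OF X YZ f gh(3)]
 note a = asc_props[OF X(1) Y(1) Z(1)] and a' = asc_props[OF X(2) Y(2) Z(2)]
 note F = bmapsD[OF X f] and G = bmapsD[OF Y g] and H = bmapsD[OF Z h] and GH = homD(1)[OF gh(2)]
 have ob: "ob (tens X Y) = tob X Y" using X Y by (simp add: tens_ob)
 show "asc X' Y' Z' * tenm (tens X Y) (tens X' Y') Z Z' (tenm X X' Y Y' f g) h
   : homs (tob (tens X Y) Z) (tob X' (tens Y' Z'))" by (rule hom_o[OF a'(1) fg_h(2)])
 show "tenm X X' (tens Y Z) (tens Y' Z') f (tenm Y Y' Z Z' g h) * asc X Y Z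
   : homs (tob (tens X Y) Z) (tob X' (tens Y' Z'))" by (rule hom_o[OF f_gh(2) a(1)])
 have "(asc X' Y' Z' * tenm (tens X Y) (tens X' Y') Z Z' (tenm X X' Y Y' f g) h)
   * tq (tens X Y) Z * tq X Y
  = asc X' Y' Z' * tq (tens X' Y') Z' * (tenm X X' Y Y' f g * act (tob X Y) h) * tq X Y" by (simp add: assoc eq_tail[OF fg_h(1)] ob)
 also have "... = asc X' Y' Z' * tq (tens X' Y') Z' * (tenm X X' Y Y' f g * tq X Y) * ac X (ac Y h)" using X Y H(1) by (simp add: assoc tq_comm)
 also have "... = (asc X' Y' Z' * tq (tens X' Y') Z' * tq X' Y') * f * ac X g * ac X (ac Y h)" by (simp add: assoc fg(1))
 also have "... = tq X' (tens Y' Z') * (f * ac X (tq Y' Z')) * ac X g * ac X (ac Y h)" using Y Z by (simp add: a'(2) F(5) assoc)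
 also have "... = tq X' (tens Y' Z') * f * ac X (tenm Y Y' Z Z' g h * tq Y Z)" using X Y Z G(1) H(1) by (simp add: gh(1) act_o assoc)
 also have "... = (tenm X X' (tens Y Z) (tens Y' Z') f (tenm Y Y' Z Z' g h) * tq X (tens Y Z))
   * ac X (tq Y Z)" using X Y Z GH by (simp add: f_gh(1) act_o assoc)
 also have "... = (tenm X X' (tens Y Z) (tens Y' Z') f (tenm Y Y' Z Z' g h) * asc X Y Z)
   * tq (tens X Y) Z * tq X Y" by (simp add: assoc a(2))
 finally show "(asc X' Y' Z' * tenm (tens X Y) (tens X' Y') Z Z' (tenm X X' Y Y' f g) h)
   * tq (tens X Y) Z * tq X Y
  = (tenm X X' (tens Y Z) (tens Y' Z') f (tenm Y Y' Z Z' g h) * asc X Y Z)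
   * tq (tens X Y) Z * tq X Y" .
qed

lemma asc_pentagon:
 assumes W: "bim W" and X: "bim X" and Y: "bim Y" and Z: "bim Z" shows "asc W X (tens Y Z) * asc (tens W X) Y Z
  = lwhisk BB W (tens (tens X Y) Z) (tens X (tens Y Z)) (asc X Y Z) * asc W (tens X Y) Z
   * rwhisk BB (tens (tens W X) Y) (tens W (tens X Y)) Z (asc W X Y)"
  (is "?L = ?l * ?a * ?r")
proof -
 let ?WX = "tens W X" and ?XY = "tens X Y" and ?YZ = "tens Y Z"
 note B = tens_bim[OF W X] tens_bim[OF X Y] tens_bim[OF Y Z]
 note B2 = tens_bim[OF B(1) Y] tens_bim[OF W B(2)] tens_bim[OF B(2) Z] tens_bim[OF X B(3)]
 have obs: "ob ?WX = tob W X" "ob ?XY = tob X Y" "ob ?YZ = tob Y Z"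
  "ob (tens ?WX Y) = tob ?WX Y" using W X Y Z B by (simp_all add: tens_ob)
 note a1 = asc_props[OF W X B(3)] and a2 = asc_props[OF B(1) Y Z] and a3 = asc_props[OF X Y Z]
  and a4 = asc_props[OF W B(2) Z] and a5 = asc_props[OF W X Y]
 note l = lwhisk_props[OF W B2(3,4) asc_bmaps[OF X Y Z]] and r = rwhisk_props[OF B2(1,2) Z asc_bmaps[OF W X Y]]
 have L_hom: "?L : homs (tob (tens ?WX Y) Z) (tob W (tens X ?YZ))" using hom_o[OF a1(1), of "asc ?WX Y Z"] a2(1) by simp
 have R_hom: "?l * ?a * ?r : homs (tob (tens ?WX Y) Z) (tob W (tens X ?YZ))" by (rule hom_o[OF l(3) hom_o[OF a4(1) r(3)]])
 \<comment> \<open>Both sides of the pentagon turn into the same iterated projection of the plain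
   product \<open>W X Y Z\<close>.\<close>
 have L: "?L * tq (tens ?WX Y) Z * tq ?WX Y * tq W X
  = tq W (tens X ?YZ) * ac W (tq X ?YZ * ac X (tq Y Z))"
 proof -
  have "?L * tq (tens ?WX Y) Z * tq ?WX Y * tq W X
   = asc W X ?YZ * (asc ?WX Y Z * tq (tens ?WX Y) Z * tq ?WX Y) * tq W X" by (simp add: assoc)
  also have "... = (asc W X ?YZ * tq ?WX ?YZ * tq W X) * ac W (ac X (tq Y Z))" using W X Y Z by (simp add: a2(2) obs(1) tq_comm assoc)
  also have "... = tq W (tens X ?YZ) * ac W (tq X ?YZ * ac X (tq Y Z))" using W X Y Z by (simp add: a1(2) act_o assoc)
  finally show ?thesis .
 qed
 have R: "(?l * ?a * ?r) * tq (tens ?WX Y) Z * tq ?WX Y * tq W X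
  = tq W (tens X ?YZ) * ac W (tq X ?YZ * ac X (tq Y Z))"
 proof -
  have "(?l * ?a * ?r) * tq (tens ?WX Y) Z * tq ?WX Y * tq W X
   = ?l * ?a * (?r * tq (tens ?WX Y) Z) * tq ?WX Y * tq W X" by (simp add: assoc)
  also have "... = ?l * ?a * tq (tens W ?XY) Z * (asc W X Y * tq ?WX Y * tq W X)" by (simp add: r(1) assoc)
  also have "... = ?l * (?a * tq (tens W ?XY) Z * tq W ?XY) * ac W (tq X Y)" by (simp add: a5(2) assoc)
  also have "... = (?l * tq W (tens ?XY Z)) * ac W (tq ?XY Z) * ac W (tq X Y)" by (simp add: a4(2) assoc)
  also have "... = tq W (tens X ?YZ) * ac W (asc X Y Z * tq ?XY Z * tq X Y)" using W X Y Z homD(1)[OF a3(1)] by (simp add: l(1) act_o assoc)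
  finally show ?thesis by (simp add: a3(2))
 qed
 have 1: "?L * tq (tens ?WX Y) Z = (?l * ?a * ?r) * tq (tens ?WX Y) Z"
 proof (rule tq2_cancel[OF W X Y])
  show "(?L * tq (tens ?WX Y) Z) * tq ?WX Y * tq W X
   = ((?l * ?a * ?r) * tq (tens ?WX Y) Z) * tq ?WX Y * tq W X" using L R by (simp add: assoc)
  show "(?L * tq (tens ?WX Y) Z) * act (tob ?WX Y) idb = ?L * tq (tens ?WX Y) Z"
   "((?l * ?a * ?r) * tq (tens ?WX Y) Z) * act (tob ?WX Y) idb = (?l * ?a * ?r) * tq (tens ?WX Y) Z" using tq_unit(2)[OF B2(1) Z] by (simp_all add: assoc obs(4))
 qed
 show ?thesis by (rule homs_cancel[OF B2(1) Z L_hom R_hom 1])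
qed

lemma asc_triangle:
 assumes X: "bim X" and Y: "bim Y" shows "lwhisk BB X (tens UU Y) Y (lun Y) * asc X UU Y = rwhisk BB (tens X UU) X Y (run X)"
proof (rule homs_cancel2[OF X UU_bim Y])
 note U = UU_bim
 note a = asc_props[OF X U Y]
  and l = lwhisk_props[OF X tens_bim[OF U Y] Y lun_bmaps[OF Y]]
  and r = rwhisk_props[OF tens_bim[OF X U] X Y run_bmaps[OF X]]
 show "lwhisk BB X (tens UU Y) Y (lun Y) * asc X UU Y : homs (tob (tens X UU) Y) (tob X Y)" by (rule hom_o[OF l(3) a(1)])
 show "rwhisk BB (tens X UU) X Y (run X) : homs (tob (tens X UU) Y) (tob X Y)" by (rule r(3))
 have "(lwhisk BB X (tens UU Y) Y (lun Y) * asc X UU Y) * tq (tens X UU) Y * tq X UU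
  = tq X Y * ac X (lun Y * tq UU Y)" using X Y U homD(1)[OF lun_hom[OF Y]] by (simp add: assoc a(2) eq_tail[OF l(1)] act_o)
 also have "... = tq X Y * ra X" using X Y by (simp add: lun_tq tq_balanced)
 also have "... = rwhisk BB (tens X UU) X Y (run X) * tq (tens X UU) Y * tq X UU" using X by (simp add: eq_tail[OF r(1)] assoc run_tq)
 finally show "(lwhisk BB X (tens UU Y) Y (lun Y) * asc X UU Y) * tq (tens X UU) Y * tq X UU
  = rwhisk BB (tens X UU) X Y (run X) * tq (tens X UU) Y * tq X UU" .
qed

lemma tenm_one: assumes X: "bim X" and Y: "bim Y" shows "tenm X X Y Y (ac X idb) (ac Y idb) = act (tob X Y) idb"
proof (rule homs_cancel[OF X Y])
 note t = tenm_props[OF X X Y Y bmaps_one[OF X] bmaps_one[OF Y]]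
 show "tenm X X Y Y (ac X idb) (ac Y idb) : homs (tob X Y) (tob X Y)" by (rule t(2))
 show "act (tob X Y) idb : homs (tob X Y) (tob X Y)" using X Y by (simp add: hom_one)
 show "tenm X X Y Y (ac X idb) (ac Y idb) * tq X Y = act (tob X Y) idb * tq X Y" using X Y by (simp add: t(1) ac_ones tq_unit tq_one)
qed

lemma tenm_compose:
 assumes X: "bim X" "bim X'" "bim X''" and Y: "bim Y" "bim Y'" "bim Y''"
  and f: "f : bmaps X X'" "f' : bmaps X' X''" and g: "g : bmaps Y Y'" "g' : bmaps Y' Y''"
 shows "tenm X X'' Y Y'' (f' * f) (g' * g) = tenm X' X'' Y' Y'' f' g' * tenm X X' Y Y' f g"
proof (rule homs_cancel[OF X(1) Y(1)])
 note t = tenm_props[OF X(1,3) Y(1,3) bmaps_o[OF X f] bmaps_o[OF Y g]]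
  and t1 = tenm_props[OF X(1,2) Y(1,2) f(1) g(1)] and t2 = tenm_props[OF X(2,3) Y(2,3) f(2) g(2)]
 note F = bmapsD[OF X(1,2) f(1)] and G = bmapsD[OF Y(1,2) g(1)] and G' = bmapsD[OF Y(2,3) g(2)]
 show "tenm X X'' Y Y'' (f' * f) (g' * g) : homs (tob X Y) (tob X'' Y'')" by (rule t(2))
 show "tenm X' X'' Y' Y'' f' g' * tenm X X' Y Y' f g : homs (tob X Y) (tob X'' Y'')" by (rule hom_o[OF t2(2) t1(2)])
 have "tenm X X'' Y Y'' (f' * f) (g' * g) * tq X Y = tq X'' Y'' * f' * (f * ac X g') * ac X g" using X(1) G(1) G'(1) by (simp add: t(1) act_o assoc)
 also have "... = (tenm X' X'' Y' Y'' f' g' * tenm X X' Y Y' f g) * tq X Y" by (simp add: F(5)[OF G'(1)] assoc t1(1) eq_tail[OF t2(1)])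
 finally show "tenm X X'' Y Y'' (f' * f) (g' * g) * tq X Y
  = (tenm X' X'' Y' Y'' f' g' * tenm X X' Y Y' f g) * tq X Y" .
qed

theorem bimodule_linear_monoidal: "linear_monoidal_category BB"
proof (intro linear_monoidal_category.intro linear_category.intro linear_monoidal_category_axioms.intro)
 show "Idm BB X : Mor BB X X" if "X : Ob BB" for X using that by (simp add: BB_Idm bmaps_one)
 show "Cmp BB g f : Mor BB X Z" if "X : Ob BB" "Y : Ob BB" "Z : Ob BB" "f : Mor BB X Y" "g : Mor BB Y Z" for X Y Z f g using that by (simp add: bmaps_o)
 show "Cmp BB (Idm BB Y) f = f" "Cmp BB f (Idm BB X) = f" if "X : Ob BB" "Y : Ob BB" "f : Mor BB X Y" for X Y f using that bmapsD[of X Y f] by (simp_all add: BB_Idm)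
 show "f + f' : Mor BB X Y" if "X : Ob BB" "Y : Ob BB" "f : Mor BB X Y" "f' : Mor BB X Y" for X Y f f' using that by (simp add: bmaps_add)
 show "Scl BB a f : Mor BB X Y" if "X : Ob BB" "Y : Ob BB" "f : Mor BB X Y" for X Y f a using that by (simp add: bmaps_scale)
 show "0 : Mor BB X Y" if "X : Ob BB" "Y : Ob BB" for X Y using that by (simp add: bmaps_0)
 show "Cmp BB g (Scl BB a f) = Scl BB a (Cmp BB g f)" if "X : Ob BB" "Y : Ob BB" "Z : Ob BB" "f : Mor BB X Y" "g : Mor BB Y Z" for X Y Z f g a
  using that bmaps_in[of Y Z g] by (simp add: scale_right)
 show "TenM BB X X' Y Y' f g : Mor BB (TenO BB X Y) (TenO BB X' Y')"
  if "X : Ob BB" "X' : Ob BB" "Y : Ob BB" "Y' : Ob BB" "f : Mor BB X X'" "g : Mor BB Y Y'" for X X' Y Y' f g using that by (simp add: BB_TenM tenm_bmaps)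
 show "TenM BB X X Y Y (Idm BB X) (Idm BB Y) = Idm BB (TenO BB X Y)" if "X : Ob BB" "Y : Ob BB" for X Y
  using that by (simp add: BB_Idm BB_TenM bmaps_one tenm_one tens_ob)
 show "TenM BB X X'' Y Y'' (Cmp BB f' f) (Cmp BB g' g)
   = Cmp BB (TenM BB X' X'' Y' Y'' f' g') (TenM BB X X' Y Y' f g)" if "X : Ob BB" "X' : Ob BB" "X'' : Ob BB" "Y : Ob BB" "Y' : Ob BB" "Y'' : Ob BB"
   "f : Mor BB X X'" "f' : Mor BB X' X''" "g : Mor BB Y Y'" "g' : Mor BB Y' Y''" for X X' X'' Y Y' Y'' f f' g g'
  using that bmaps_o[of X X' X'' f f'] bmaps_o[of Y Y' Y'' g g'] by (simp add: BB_TenM tenm_compose[of X X' X'' Y Y' Y''])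
 show "TenM BB X X' Y Y' (f + f') g = TenM BB X X' Y Y' f g + TenM BB X X' Y Y' f' g"
  if "X : Ob BB" "X' : Ob BB" "Y : Ob BB" "Y' : Ob BB" "f : Mor BB X X'" "f' : Mor BB X X'" "g : Mor BB Y Y'"
  for X X' Y Y' f f' g using that by (simp add: BB_TenM bmaps_add tenm_def add_left add_right)
 show "TenM BB X X' Y Y' f (g + g') = TenM BB X X' Y Y' f g + TenM BB X X' Y Y' f g'"
  if "X : Ob BB" "X' : Ob BB" "Y : Ob BB" "Y' : Ob BB" "f : Mor BB X X'" "g : Mor BB Y Y'" "g' : Mor BB Y Y'"
  for X X' Y Y' f g g' using that bmaps_in[of Y Y' g] bmaps_in[of Y Y' g'] by (simp add: BB_TenM bmaps_add tenm_def add_left add_right act_add)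
 show "TenM BB X X' Y Y' (Scl BB a f) g = Scl BB a (TenM BB X X' Y Y' f g)" if "X : Ob BB" "X' : Ob BB" "Y : Ob BB" "Y' : Ob BB" "f : Mor BB X X'" "g : Mor BB Y Y'"
  for X X' Y Y' f g a using that by (simp add: BB_TenM bmaps_scale tenm_def scale_left scale_right)
 show "TenM BB X X' Y Y' f (Scl BB a g) = Scl BB a (TenM BB X X' Y Y' f g)" if "X : Ob BB" "X' : Ob BB" "Y : Ob BB" "Y' : Ob BB" "f : Mor BB X X'" "g : Mor BB Y Y'"
  for X X' Y Y' f g a using that bmaps_in[of X X' f] bmaps_in[of Y Y' g] by (simp add: BB_TenM bmaps_scale tenm_def scale_left scale_right act_scale)
 show "is_iso BB (TenO BB (TenO BB X Y) Z) (TenO BB X (TenO BB Y Z)) (Asc BB X Y Z)"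
  if "X : Ob BB" "Y : Ob BB" "Z : Ob BB" for X Y Z using that asc_is_inverse[of X Y Z] by (auto simp: is_iso_def BB_Asc)
 show "Cmp BB (Asc BB X' Y' Z') (TenM BB (TenO BB X Y) (TenO BB X' Y') Z Z' (TenM BB X X' Y Y' f g) h)
   = Cmp BB (TenM BB X X' (TenO BB Y Z) (TenO BB Y' Z') f (TenM BB Y Y' Z Z' g h)) (Asc BB X Y Z)"
  if "X : Ob BB" "X' : Ob BB" "Y : Ob BB" "Y' : Ob BB" "Z : Ob BB" "Z' : Ob BB"
   "f : Mor BB X X'" "g : Mor BB Y Y'" "h : Mor BB Z Z'" for X X' Y Y' Z Z' f g h using that asc_natural[of X X' Y Y' Z Z' f g h] by (simp add: BB_Asc BB_TenM tenm_bmaps)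
 show "is_iso BB (TenO BB (Unt BB) X) X (LUn BB X)" "is_iso BB (TenO BB X (Unt BB)) X (RUn BB X)"
  if "X : Ob BB" for X using that lun_is_inverse[of X] run_is_inverse[of X] by (auto simp: is_iso_def lun_eq run_eq)
 show "Cmp BB (LUn BB X') (lwhisk BB (Unt BB) X X' f) = Cmp BB f (LUn BB X)" if X: "X : Ob BB" and X': "X' : Ob BB" and f: "f : Mor BB X X'" for X X' f
 proof -
  have B: "bim X" "bim X'" "f : bmaps X X'" using X X' f by auto
  note w = lwhisk_props[OF UU_bim B]
  have "lun X' * lwhisk BB UU X X' f = f * lun X"
  proof (rule homs_cancel[OF UU_bim B(1)])
   show "lun X' * lwhisk BB UU X X' f : homs (tob UU X) (ob X')" "f * lun X : homs (tob UU X) (ob X')"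
    using hom_o[OF lun_hom[OF B(2)] w(3)] hom_o[OF bmapsD(2)[OF B] lun_hom[OF B(1)]] by auto
   show "(lun X' * lwhisk BB UU X X' f) * tq UU X = (f * lun X) * tq UU X" using B bmapsD(3)[OF B] by (simp add: assoc w(1) lun_tq)
     (simp add: assoc[symmetric] lun_tq)
  qed
  thus ?thesis using B by (simp add: lun_eq)
 qed
 show "Cmp BB (RUn BB X') (rwhisk BB X X' (Unt BB) f) = Cmp BB f (RUn BB X)" if X: "X : Ob BB" and X': "X' : Ob BB" and f: "f : Mor BB X X'" for X X' f
 proof -
  have B: "bim X" "bim X'" "f : bmaps X X'" using X X' f by auto
  note w = rwhisk_props[OF B(1,2) UU_bim B(3)]
  have "run X' * rwhisk BB X X' UU f = f * run X"
  proof (rule homs_cancel[OF B(1) UU_bim])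
   show "run X' * rwhisk BB X X' UU f : homs (tob X UU) (ob X')" "f * run X : homs (tob X UU) (ob X')"
    using hom_o[OF run_hom[OF B(2)] w(3)] hom_o[OF bmapsD(2)[OF B] run_hom[OF B(1)]] by auto
   show "(run X' * rwhisk BB X X' UU f) * tq X UU = (f * run X) * tq X UU" using B bmapsD(4)[OF B] by (simp add: assoc w(1) run_tq)
     (simp add: assoc[symmetric] run_tq)
  qed
  thus ?thesis using B by (simp add: run_eq)
 qed
 show "Cmp BB (Asc BB W X (TenO BB Y Z)) (Asc BB (TenO BB W X) Y Z)
   = Cmp BB (lwhisk BB W (TenO BB (TenO BB X Y) Z) (TenO BB X (TenO BB Y Z)) (Asc BB X Y Z))
     (Cmp BB (Asc BB W (TenO BB X Y) Z)
      (rwhisk BB (TenO BB (TenO BB W X) Y) (TenO BB W (TenO BB X Y)) Z (Asc BB W X Y)))"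
  if "W : Ob BB" "X : Ob BB" "Y : Ob BB" "Z : Ob BB" for W X Y Z using that asc_pentagon[of W X Y Z] by (simp add: BB_Asc)
 show "Cmp BB (lwhisk BB X (TenO BB (Unt BB) Y) Y (LUn BB Y)) (Asc BB X (Unt BB) Y)
   = rwhisk BB (TenO BB X (Unt BB)) X Y (RUn BB X)" if "X : Ob BB" "Y : Ob BB" for X Y using that asc_triangle[of X Y] by (simp add: BB_Asc lun_eq run_eq)
qed (simp_all add: assoc add_left add_right scale_left
   op_space.scale_left_distrib op_space.scale_right_distrib)

end

section \<open>Semisimplicity of the category of bimodules\<close>

context separable_algebra
begin

text \<open>Left modules and the averaging operator on maps between them: it fixes module maps and commutes
 with composition by them, so it transports von Neumann regularity.\<close>

definition lmod :: "'h endo option => 'h op => bool" where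
 "lmod X l \<longleftrightarrow> X : Obj & l : homs (ec (Some A) X) X & l * m = l * A l & l * u = act X idb"

lemma lmodD:
 assumes "lmod X l" shows "X : Obj" "l : M" "l * m = l * A l" "l * u = act X idb"
  "x : M ==> l * A (act X x) = act X x * l" "act X idb * l = l" "l * A (act X idb) = l" using assms unfolding lmod_def by (auto simp: homs_def)

lemma bim_lmod: "bim X ==> lmod (ob X) (la X)" by (simp add: lmod_def bim_hom la_la la_u)

definition avg_left :: "'h op => 'h op => 'h op => 'h op" where
 "avg_left l l' f = l' * A (f * l) * dl"

lemma avg_left_hom:
 assumes X: "lmod X l" and Y: "lmod Y l'" and f: "f : homs X Y" shows "avg_left l l' f : homs X Y"
proof -
 note L = lmodD[OF X] and L' = lmodD[OF Y] and fM = homD(1)[OF f]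
 have eq: "avg_left l l' f * act X x = act Y x * avg_left l l' f" if "x : M" for x
 proof -
  have "avg_left l l' f * act X x = l' * A (f * (l * A (act X x))) * dl" using that L(1,2) L'(1,2) fM by (simp add: avg_left_def assoc A_o dl_comm)
  also have "... = l' * A ((f * act X x) * l) * dl" using that L by (simp add: assoc)
  also have "... = (l' * A (act Y x)) * A (f * l) * dl" using that L(1,2) L'(1,2) fM homD(2)[OF f that] by (simp add: A_o assoc)
  also have "... = act Y x * avg_left l l' f" by (simp add: L'(5)[OF that] avg_left_def assoc)
  finally show ?thesis .
 qed
 have "act Y idb * avg_left l l' f = avg_left l l' f" using L' by (simp add: avg_left_def assoc[symmetric])
 thus ?thesis using eq[of idb] eq L L' fM by (simp add: homs_def) (simp add: avg_left_def)
qed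

lemma avg_left_module:
 assumes X: "lmod X l" and Y: "lmod Y l'" and f: "f : homs X Y" shows "avg_left l l' f * l = l' * A (avg_left l l' f)"
proof -
 note L = lmodD[OF X] and L' = lmodD[OF Y] and fM = homD(1)[OF f]
 have "avg_left l l' f * l = l' * A (f * (l * A l)) * dl" using L L' fM by (simp add: avg_left_def assoc A_o dl_comm)
 also have "... = l' * A (f * l) * (A m * dl)" using L L' fM by (simp add: L(3)[symmetric] A_o assoc)
 also have "... = l' * A (f * l) * m * A dl" by (simp add: dl_central)
 also have "... = (l' * m) * A (A (f * l)) * A dl" using L fM by (simp add: assoc eq_tail[OF m_comm])
 also have "... = l' * A (avg_left l l' f)" using L L' fM by (simp add: L'(3) avg_left_def A_o assoc)
 finally show ?thesis .
qed

lemma avg_left_natural: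
 assumes M: "l : M" "l' : M" "k : M" "f : M" "g : M" "h : M"
  and g: "g * k = l * A g" and h: "h * l' = k' * A h" shows "avg_left k k' (h * f * g) = h * avg_left l l' f * g"
proof -
 have "h * avg_left l l' f * g = (h * l') * A (f * (l * A g)) * dl" using M by (simp add: avg_left_def assoc A_o dl_comm)
 also have "... = k' * A h * A (f * g * k) * dl" using M by (simp add: g[symmetric] h assoc)
 finally show ?thesis using M by (simp add: avg_left_def A_o assoc)
qed

lemma avg_left_fixed:
 assumes X: "lmod X l" and Y: "lmod Y l'" and f: "f : homs X Y" "f * l = l' * A f" shows "avg_left l l' f = f"
proof -
 note L = lmodD[OF X] and L' = lmodD[OF Y] and fM = homD(1)[OF f(1)]
 have "avg_left l l' f = (f * l) * A l * dl" using L(1,2) fM by (simp add: avg_left_def A_o assoc eq_tail[OF f(2)])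
 also have "... = f * (l * A l) * dl" by (simp add: assoc)
 also have "... = f * act X idb" using L by (simp add: L(3)[symmetric] assoc dl_section)
 also have "... = f" by (rule homD(3)[OF f(1)])
 finally show ?thesis .
qed

definition avg_right :: "'h bm => 'h bm => 'h op => 'h op" where
 "avg_right X Y f = ra Y * f * ra X * ac X dl"

lemma avg_right_hom:
 assumes X: "bim X" and Y: "bim Y" and f: "f : homs (ob X) (ob Y)" shows "avg_right X Y f : homs (ob X) (ob Y)"
proof -
 note fM = homD(1)[OF f]
 have eq: "avg_right X Y f * ac X x = ac Y x * avg_right X Y f" if "x : M" for x
 proof -
  have "avg_right X Y f * ac X x = ra Y * f * (ra X * ac X (A (A x))) * ac X dl" using that X by (simp add: avg_right_def assoc act_o[symmetric] dl_comm)
  also have "... = ra Y * (f * ac X (A x)) * ra X * ac X dl" using that X by (simp add: ra_comm assoc)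
  also have "... = (ra Y * ac Y (A x)) * f * ra X * ac X dl" using that homD(2)[OF f] by (simp add: assoc)
  finally show ?thesis using that Y by (simp add: ra_comm avg_right_def assoc)
 qed
 have "ac Y idb * avg_right X Y f = avg_right X Y f" using Y by (simp add: avg_right_def assoc[symmetric] ra_one)
 thus ?thesis using eq[of idb] eq X Y fM by (simp add: homs_def) (simp add: avg_right_def)
qed

lemma avg_right_module:
 assumes X: "bim X" and Y: "bim Y" and f: "f : homs (ob X) (ob Y)" shows "avg_right X Y f * ra X = ra Y * avg_right X Y f"
proof -
 note fM = homD(1)[OF f]
 have "avg_right X Y f * ra X = ra Y * f * (ra X * ra X) * ac X (A dl)" using X by (simp add: avg_right_def assoc ra_comm)
 also have "... = ra Y * f * ra X * ac X (A m * dl)" using X by (simp add: ra_ra assoc act_o[symmetric] dl_central)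
 also have "... = ra Y * f * (ra X * ac X (A m)) * ac X dl" using X by (simp add: assoc act_o)
 also have "... = ra Y * (f * ac X m) * ra X * ac X dl" using X by (simp add: ra_comm assoc)
 also have "... = (ra Y * ra Y) * f * ra X * ac X dl" using Y homD(2)[OF f, of m] by (simp add: ra_ra assoc)
 finally show ?thesis by (simp add: avg_right_def assoc)
qed

text \<open>The right average does not destroy left linearity, so the two averages can be applied
  one after the other to obtain a bimodule map.\<close>

lemma avg_right_left_module:
 assumes X: "bim X" and Y: "bim Y" and f: "f : homs (ob X) (ob Y)" "f * la X = la Y * A f" shows "avg_right X Y f * la X = la Y * A (avg_right X Y f)"
proof -
 note fM = homD(1)[OF f(1)]
 have "avg_right X Y f * la X = ra Y * f * (ra X * la X) * A (ac X dl)" using X by (simp add: avg_right_def assoc la_comm)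
 also have "... = ra Y * (f * la X) * A (ra X) * A (ac X dl)" using X by (simp add: ra_la assoc)
 also have "... = (ra Y * la Y) * A f * A (ra X) * A (ac X dl)" by (simp add: f(2) assoc)
 also have "... = la Y * A (avg_right X Y f)" using X Y fM by (simp add: ra_la avg_right_def A_o assoc)
 finally show ?thesis .
qed

lemma avg_right_natural:
 assumes "f : homs (ob X) (ob Y)" "g * ra Z = ra X * g" "h * ra Y = ra W * h"
  "g * ac Z dl = ac X dl * g" shows "avg_right Z W (h * f * g) = h * avg_right X Y f * g" unfolding avg_right_def
 by (simp add: assoc eq_tail[OF assms(2)] eq_tail[OF assms(3)] assms(4))

lemma avg_right_fixed:
 assumes X: "bim X" and Y: "bim Y" and f: "f : homs (ob X) (ob Y)" "f * ra X = ra Y * f" shows "avg_right X Y f = f"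
proof -
 have "avg_right X Y f = (ra Y * f) * ra X * ac X dl" by (simp add: avg_right_def assoc)
 also have "... = f * (ra X * ra X) * ac X dl" by (simp add: f(2)[symmetric] assoc)
 also have "... = f * ra X * ac X (m * dl)" using X by (simp add: ra_ra act_o assoc)
 also have "... = f" using X homD(3)[OF f(1)] by (simp add: dl_section ra_u)
 finally show ?thesis .
qed

end

text \<open>\<open>unit_homs\<close> says that the unit object occurs once in \<open>A\<close>. It
  makes \<open>A\<close> a simple bimodule, that is, the dual category has a simple unit.\<close>

locale semisimple_algebra = separable_algebra M S A m u dl + cuntz_factor M v1 v2 for M :: "'h::complex_hilbert_space op set" and S A m u dl v1 v2 +
 fixes P :: "'h endo set"
 assumes P_endo: "P <= End" and P_irr: "Q : P ==> irr Q"
  and P_finite: "finite P" and S_eq: "S = sums_of M P"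
  and unit_homs: "Hom id A = range (%c. scl c u)"
begin

lemmas sums_iff = sums_of_iff[OF P_endo P_irr]

lemma S_iff: "H : S \<longleftrightarrow> H : End & idb : gideal M P H H" by (simp add: S_eq sums_iff)

lemma P_S: "Q : P ==> Q : S" using P_endo by (auto simp: S_iff intro: gideal_base)

lemma homs_regular:
 assumes "X : Obj" "Y : Obj" "f : homs X Y"
 obtains g where "g : homs Y X" "f * g * f = f"
proof (cases "f = 0")
 case True
 thus ?thesis using that[of 0] by simp
next
 case False
 then obtain H L where "X = Some H" "Y = Some L" "H : S" "L : S" using assms by (cases X; cases Y) (auto simp: hom_None)
 thus ?thesis using intertwiners_regular[OF P_endo P_irr, of H L f] that assms(3) by (auto simp: hom_Some S_eq[symmetric] S_endoD)
qed

lemma endo_sum_S: assumes "H : S" "L : S" shows "endo_sum H L : S"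
proof -
 note e = S_endoD[OF assms(1)] S_endoD[OF assms(2)]
 note v = v_intertwiners[OF e]
 have "v1 * (idb * cadj v1) + v2 * (idb * cadj v2) : gideal M P (endo_sum H L) (endo_sum H L)"
  using assms v by (intro gideal_add gideal_left[OF gideal_right]) (auto simp: S_iff)
 thus ?thesis using e by (simp add: S_iff v_sum)
qed

text \<open>The formal zero object is not an endomorphism, so \<open>endo_sum\<close> applies only
  if both objects are genuine.\<close>

lemma Obj_biproduct:
 assumes "X : Obj" "Y : Obj"
 obtains Z i1 i2 p1 p2 where "Z : Obj" "i1 : homs X Z" "i2 : homs Y Z" "p1 : homs Z X" "p2 : homs Z Y"
  "p1 * i1 = act X idb" "p2 * i2 = act Y idb" "p1 * i2 = 0" "p2 * i1 = 0" "i1 * p1 + i2 * p2 = act Z idb"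
proof (cases X)
 case None
 thus ?thesis using assms that[of Y 0 "act Y idb" 0 "act Y idb"] by (auto simp: hom_one act_o[symmetric])
next
 case (Some H)
 note H = this
 show ?thesis
 proof (cases Y)
  case None
  thus ?thesis using assms that[of X "act X idb" 0 "act X idb" 0] by (auto simp: hom_one act_o[symmetric])
 next
  case (Some L)
  have S: "H : S" "L : S" using assms H Some by auto
  show ?thesis using that[of "Some (endo_sum H L)" v1 v2 "cadj v1" "cadj v2"] S H Some
    v_intertwiners[of H L] endo_sum_S[of H L] by (simp add: S_endoD hom_Some v_iso v_orth v_sum endo_id)
 qed
qed

definition biproduct :: "'h bm => 'h bm => 'h bm => 'h op => 'h op => 'h op => 'h op => bool" where
 "biproduct Z X Y i1 i2 p1 p2 \<longleftrightarrow> i1 : bmaps X Z & i2 : bmaps Y Z & p1 : bmaps Z X & p2 : bmaps Z Y &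
  p1 * i1 = ac X idb & p2 * i2 = ac Y idb & p1 * i2 = 0 & p2 * i1 = 0 & i1 * p1 + i2 * p2 = ac Z idb"

lemma biproduct_exists:
 assumes X: "bim X" and Y: "bim Y"
 obtains ZZ i1 i2 p1 p2 where "bim ZZ" "biproduct ZZ X Y i1 i2 p1 p2"
proof -
 obtain Z i1 i2 p1 p2 where Z: "Z : Obj" and i: "i1 : homs (ob X) Z" "i2 : homs (ob Y) Z"
  and p: "p1 : homs Z (ob X)" "p2 : homs Z (ob Y)"
  and r: "p1 * i1 = ac X idb" "p2 * i2 = ac Y idb" "p1 * i2 = 0" "p2 * i1 = 0"
  and one: "i1 * p1 + i2 * p2 = act Z idb" by (rule Obj_biproduct[OF bim_ob[OF X] bim_ob[OF Y]])
 note M = homD(1)[OF i(1)] homD(1)[OF i(2)] homD(1)[OF p(1)] homD(1)[OF p(2)]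
 define l where "l = i1 * la X * A p1 + i2 * la Y * A p2"
 define k where "k = i1 * ra X * p1 + i2 * ra Y * p2"
 have Ap: "A p1 : homs (ec (Some A) Z) (ec (Some A) (ob X))"
  "A p2 : homs (ec (Some A) Z) (ec (Some A) (ob Y))" using hom_whisker_left[OF p(1), of "Some A"] hom_whisker_left[OF p(2), of "Some A"] X Y Z by auto
 have pA: "p1 : homs (ec Z (Some A)) (ec (ob X) (Some A))"
  "p2 : homs (ec Z (Some A)) (ec (ob Y) (Some A))" using hom_unit_whisker[OF p(1)] hom_unit_whisker[OF p(2)] X Y Z by auto
 have r': "A p1 * A i1 = A (ac X idb)" "A p2 * A i2 = A (ac Y idb)" "A p1 * A i2 = 0" "A p2 * A i1 = 0" using M by (simp_all add: A_o[symmetric] r)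
 have absorb: "A (ac X idb) * A (la X) = A (la X)" "A (ac Y idb) * A (la Y) = A (la Y)"
  "A (ac X idb) * A (ra X) = A (ra X)" "A (ac Y idb) * A (ra Y) = A (ra Y)" using X Y by (simp_all add: A_o[symmetric] la_one ra_one)
 have pc: "p1 * act Z x = ac X x * p1" "p2 * act Z x = ac Y x * p2" if "x : M" for x using homD(2)[OF p(1) that] homD(2)[OF p(2) that] by auto
 note [simp] = X Y Z M
 note rules = add_left add_right assoc A_add A_o r r' absorb
  eq_tail[OF r(1)] eq_tail[OF r(2)] eq_tail[OF r(3)] eq_tail[OF r(4)]
  eq_tail[OF r'(1)] eq_tail[OF r'(2)] eq_tail[OF r'(3)] eq_tail[OF r'(4)]
  eq_tail[OF absorb(1)] eq_tail[OF absorb(2)] eq_tail[OF absorb(3)] eq_tail[OF absorb(4)]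
  la_one ra_one eq_tail[OF la_one] eq_tail[OF ra_one]
 have bim: "bim (Z, l, k)" unfolding bim_iff
 proof (intro conjI)
  show "l : homs (ec (Some A) Z) Z" unfolding l_def using i Ap bim_hom[OF X] bim_hom[OF Y] by (intro hom_add hom_o[OF i(1)] hom_o[OF i(2)]
     hom_o[OF _ Ap(1)] hom_o[OF _ Ap(2)])
  show "k : homs (ec Z (Some A)) Z" unfolding k_def using i pA bim_hom[OF X] bim_hom[OF Y] by (intro hom_add hom_o[OF i(1)] hom_o[OF i(2)]
     hom_o[OF _ pA(1)] hom_o[OF _ pA(2)])
  show "l * m = l * A l" by (simp add: l_def rules m_comm[symmetric])
    (simp add: eq_tail[OF la_la] assoc)
  have "l * u = i1 * (la X * u) * p1 + i2 * (la Y * u) * p2" by (simp add: l_def add_left assoc u_comm)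
  thus "l * u = act Z idb" using homD(4)[OF p(1)] homD(4)[OF p(2)] by (simp add: la_u one)
  show "k * k = k * act Z m" by (simp add: k_def rules pc) (simp add: eq_tail[OF ra_ra] assoc)
  show "k * act Z u = act Z idb" using homD(4)[OF p(1)] homD(4)[OF p(2)] by (simp add: k_def rules pc eq_tail[OF ra_u] one)
  show "k * l = l * A k" by (simp add: k_def l_def rules) (simp add: eq_tail[OF ra_la] assoc)
 qed (rule Z)
 have "biproduct (Z, l, k) X Y i1 i2 p1 p2" unfolding biproduct_def
 proof (intro conjI)
  show "i1 : bmaps X (Z, l, k)" "i2 : bmaps Y (Z, l, k)" using i by (auto intro!: bmapsI simp: bim[unfolded l_def k_def] l_def k_def rules la_one' ra_one')
  show "p1 : bmaps (Z, l, k) X" "p2 : bmaps (Z, l, k) Y" using p by (auto intro!: bmapsI simp: bim[unfolded l_def k_def] l_def k_def rules)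
 qed (use r one in simp_all)
 with bim that show ?thesis by blast
qed

lemma zero_bim [simp]: "bim (None, 0, 0)" by (simp add: bim_iff)

lemma direct_sum_Nil: "bim Z ==> ac Z idb = 0 ==> is_direct_sum BB Z []" by (simp add: is_direct_sum_def BB_Idm)

lemma direct_sum_iff:
 assumes "bim X" shows "is_direct_sum BB X XXs \<longleftrightarrow> (EX i p.
  (ALL k<length XXs. i k : bmaps (XXs ! k) X & p k : bmaps X (XXs ! k)) &
  (ALL j<length XXs. ALL k<length XXs. p j * i k = (if j = k then Idm BB (XXs ! k) else 0)) &
  (\<Sum>k<length XXs. i k * p k) = ac X idb)" unfolding is_direct_sum_def BB_simps BB_Idm[OF assms] ..

lemma direct_sum_append:
 assumes Z: "bim Z" and X: "bim X" and Y: "bim Y" and b: "biproduct Z X Y i1 i2 p1 p2"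
  and XXs: "is_direct_sum BB X XXs" "set XXs <= Ob BB" and YYs: "is_direct_sum BB Y YYs" "set YYs <= Ob BB" shows "is_direct_sum BB Z (XXs @ YYs)"
proof -
 note B = b[unfolded biproduct_def]
 obtain i p where ip0: "ALL k<length XXs. i k : bmaps (XXs ! k) X & p k : bmaps X (XXs ! k)"
  "ALL j<length XXs. ALL k<length XXs. p j * i k = (if j = k then Idm BB (XXs ! k) else 0)"
  "(\<Sum>k<length XXs. i k * p k) = ac X idb" using XXs(1) unfolding direct_sum_iff[OF X] by blast
 note ip = ip0(1)[rule_format] ip0(2)[rule_format] ip0(3)
 obtain i' p' where ip'0: "ALL k<length YYs. i' k : bmaps (YYs ! k) Y & p' k : bmaps Y (YYs ! k)"
  "ALL j<length YYs. ALL k<length YYs. p' j * i' k = (if j = k then Idm BB (YYs ! k) else 0)"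
  "(\<Sum>k<length YYs. i' k * p' k) = ac Y idb" using YYs(1) unfolding direct_sum_iff[OF Y] by blast
 note ip' = ip'0(1)[rule_format] ip'0(2)[rule_format] ip'0(3)
 define n where "n = length XXs"
 define I where "I k = (if k < n then i1 * i k else i2 * i' (k - n))" for k
 define R where "R k = (if k < n then p k * p1 else p' (k - n) * p2)" for k
 have bX: "bim (XXs ! k)" if "k < length XXs" for k using subsetD[OF XXs(2) nth_mem[OF that]] by simp
 have bY: "bim (YYs ! k)" if "k < length YYs" for k using subsetD[OF YYs(2) nth_mem[OF that]] by simp
 have absX: "p j * ac X idb = p j" "ac X idb * i j = i j" if "j < length XXs" for j using bmapsD(6)[OF X bX[OF that]] bmapsD(7)[OF bX[OF that] X] ip(1)[OF that] by auto
 have absY: "p' j * ac Y idb = p' j" "ac Y idb * i' j = i' j" if "j < length YYs" for j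
  using bmapsD(6)[OF Y bY[OF that]] bmapsD(7)[OF bY[OF that] Y] ip'(1)[OF that] by auto
 have len: "length (XXs @ YYs) = n + length YYs" by (simp add: n_def)
 have "ALL k<length (XXs @ YYs). I k : bmaps ((XXs @ YYs) ! k) Z & R k : bmaps Z ((XXs @ YYs) ! k)"
 proof (intro allI impI)
  fix k assume k: "k < length (XXs @ YYs)"
  show "I k : bmaps ((XXs @ YYs) ! k) Z & R k : bmaps Z ((XXs @ YYs) ! k)"
  proof (cases "k < n")
   case True
   thus ?thesis using bX[of k] ip(1)[of k] B X Z bmaps_o[of "XXs ! k" X Z "i k" i1] bmaps_o[of Z X "XXs ! k" p1 "p k"] by (simp add: I_def R_def n_def nth_append)
  next
   case False
   hence "k - n < length YYs" using k by (simp add: n_def)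
   thus ?thesis using False bY[of "k - n"] ip'(1)[of "k - n"] B Y Z
     bmaps_o[of "YYs ! (k - n)" Y Z "i' (k - n)" i2] bmaps_o[of Z Y "YYs ! (k - n)" p2 "p' (k - n)"] by (simp add: I_def R_def n_def nth_append)
  qed
 qed
 moreover have "ALL j<length (XXs @ YYs). ALL k<length (XXs @ YYs).
   R j * I k = (if j = k then Idm BB ((XXs @ YYs) ! k) else 0)"
 proof (intro allI impI)
  fix j k assume jk: "j < length (XXs @ YYs)" "k < length (XXs @ YYs)"
  have 1: "(p a * p1) * (i1 * i b) = p a * i b" if "a < length XXs" "b < length XXs" for a b using B absX(2)[OF that(2)] by (simp add: assoc eq_tail[of p1 i1])
  have 2: "(p' a * p2) * (i2 * i' b) = p' a * i' b" if "a < length YYs" "b < length YYs" for a b using B absY(2)[OF that(2)] by (simp add: assoc eq_tail[of p2 i2])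
  have 3: "(a * p1) * (i2 * b) = 0" "(a * p2) * (i1 * b) = 0" for a b using B by (simp_all add: assoc eq_tail[of p1 i2] eq_tail[of p2 i1])
  have sh: "a - n < length YYs" if "a < length (XXs @ YYs)" "\<not> a < n" for a using that by (simp add: n_def)
  show "R j * I k = (if j = k then Idm BB ((XXs @ YYs) ! k) else 0)" using jk sh[OF jk(1)] sh[OF jk(2)] by (auto simp: R_def I_def 3 1 2 ip(2) ip'(2) n_def nth_append)
 qed
 moreover have "(\<Sum>k<length (XXs @ YYs). I k * R k) = Idm BB Z"
 proof -
  have "(\<Sum>k<n + length YYs. I k * R k) = (\<Sum>k<n. I k * R k) + (\<Sum>k<length YYs. I (k + n) * R (k + n))"
   using sum.atLeastLessThan_concat[of 0 n "n + length YYs" "%k. I k * R k"]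
    sum.shift_bounds_nat_ivl[of "%k. I k * R k" 0 n "length YYs"] by (simp add: atLeast0LessThan add.commute)
  also have "(\<Sum>k<n. I k * R k) = i1 * ac X idb * p1" by (simp add: I_def R_def ip(3)[symmetric] n_def compose_sum_left compose_sum_right assoc)
  also have "(\<Sum>k<length YYs. I (k + n) * R (k + n)) = i2 * ac Y idb * p2" by (simp add: I_def R_def ip'(3)[symmetric] compose_sum_left compose_sum_right assoc)
  also have "i1 * ac X idb * p1 + i2 * ac Y idb * p2 = Idm BB Z" using B Z X Y bmapsD(7)[of Z X p1] bmapsD(7)[of Z Y p2] by (simp add: BB_Idm)
  finally show ?thesis by (simp only: len)
 qed
 ultimately show ?thesis unfolding is_direct_sum_def by (intro exI[of _ I] exI[of _ R]) simp
qed

lemma direct_sum_single: "bim X ==> is_direct_sum BB X [X]" unfolding is_direct_sum_def by (intro exI[of _ "%_. ac X idb"]) (simp add: BB_Idm bmaps_one ac_ones)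

lemma bimodule_additive: "set XXs <= Ob BB ==> EX Z:Ob BB. is_direct_sum BB Z XXs"
proof (induction XXs)
 case Nil
 show ?case by (intro bexI[of _ "(None, 0, 0)"] direct_sum_Nil) simp_all
next
 case (Cons X XXs)
 then obtain Y where Y: "bim Y" "is_direct_sum BB Y XXs" by auto
 have X: "bim X" using Cons.prems by simp
 obtain Z i1 i2 p1 p2 where Z: "bim Z" "biproduct Z X Y i1 i2 p1 p2" using biproduct_exists[OF X Y(1)] .
 have "is_direct_sum BB Z ([X] @ XXs)" using Cons.prems X by (intro direct_sum_append[OF Z(1) X Y(1) Z(2) direct_sum_single[OF X] _ Y(2)]) auto
 thus ?case using Z(1) by (intro bexI[of _ Z]) simp_all
qed

lemma bimodule_splitting:
 assumes X: "bim X" and e: "e : bmaps X X" "e * e = e"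
 obtains YY r s where "bim YY" "r : bmaps X YY" "s : bmaps YY X" "r * s = ac YY idb" "s * r = e"
proof -
 note E = bmapsD[OF X X e(1)]
 obtain Y r s where Y: "Y : Obj" and rs: "r : homs (ob X) Y" "s : homs Y (ob X)" "r * s = act Y idb" "s * r = e" using splitting_Obj[OF bim_ob[OF X] E(2) e(2)] by blast
 note M = homD(1)[OF rs(1)] homD(1)[OF rs(2)]
 have es: "e * s = s" using homD(3)[OF rs(2)] by (simp add: rs(3) assoc flip: rs(4))
 have re: "r * e = r" using homD(4)[OF rs(1)] by (simp add: assoc[symmetric] rs(3) flip: rs(4))
 have Aes: "A e * A s = A s" using M E(1) by (simp add: A_o[symmetric] es)
 have Asr: "A s * A r = A e" using M by (simp add: A_o[symmetric] rs(4))
 have sc: "s * act Y x = ac X x * s" if "x : M" for x using homD(2)[OF rs(2) that] .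
 \<comment> \<open>The actions are compressed to the image of \<open>e\<close>. Since
   \<open>e\<close> is a bimodule map, the compressions satisfy the axioms again.\<close>
 define l where "l = r * la X * A s"
 define k where "k = r * ra X * s"
 have As: "A s : homs (ec (Some A) Y) (ec (Some A) (ob X))" using hom_whisker_left[OF rs(2), of "Some A"] X Y by simp
 have sA: "s : homs (ec Y (Some A)) (ec (ob X) (Some A))" using hom_unit_whisker[OF rs(2)] X Y by simp
 note [simp] = X Y M
 have lre: "r * la X * A e = r * la X" by (simp add: E(3)[symmetric] eq_tail[OF re])
 have rre: "r * ra X * e = r * ra X" by (simp add: E(4)[symmetric] eq_tail[OF re])
 note tails = eq_tail[OF rs(4)] eq_tail[OF Asr]
 have slide: "r * x * e * y = r * x * y" if "e * y = y" for x y using that by simp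
 have e_la: "e * la X * A s = la X * A s" by (simp add: eq_tail[OF E(3)] assoc Aes)
 have e_ra: "e * ra X * s = ra X * s" by (simp add: eq_tail[OF E(4)] assoc es)
 have sl: "s * l = la X * A s" by (simp add: l_def tails e_la)
 have sk: "s * k = ra X * s" by (simp add: k_def tails e_ra)
 have lM: "l : M" "k : M" by (simp_all add: l_def k_def)
 have lr: "l * A r = r * la X" by (simp add: l_def assoc Asr lre)
 have kr: "k * r = r * ra X" by (simp add: k_def assoc rs(4) rre)
 have bim: "bim (Y, l, k)" unfolding bim_iff
 proof (intro conjI)
  show "l : homs (ec (Some A) Y) Y" unfolding l_def by (rule hom_o[OF rs(1) hom_o[OF bim_hom(1)[OF X] As]])
  show "k : homs (ec Y (Some A)) Y" unfolding k_def by (rule hom_o[OF rs(1) hom_o[OF bim_hom(2)[OF X] sA]])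
  have "l * A l = r * la X * A (s * l)" using lM by (simp add: l_def[of] A_o assoc)
  also have "... = r * (la X * A (la X)) * A (A s)" by (simp add: sl A_o assoc)
  also have "... = l * m" by (simp add: la_la assoc m_comm l_def)
  finally show "l * m = l * A l" by simp
  have "l * u = r * (la X * u) * s" by (simp add: l_def assoc u_comm)
  thus "l * u = act Y idb" using homD(4)[OF rs(2)] by (simp add: la_u rs(3))
  have "k * k = r * ra X * (s * k)" by (simp add: k_def[of] assoc)
  also have "... = r * (ra X * ra X) * s" by (simp add: sk assoc)
  also have "... = k * act Y m" by (simp add: ra_ra k_def assoc sc)
  finally show "k * k = k * act Y m" .
  have "k * act Y u = r * (ra X * ac X u) * s" by (simp add: k_def assoc sc)
  thus "k * act Y u = act Y idb" using homD(4)[OF rs(2)] by (simp add: ra_u rs(3))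
  have "k * l = r * ra X * (s * l)" by (simp add: k_def assoc)
  also have "... = r * (ra X * la X) * A s" by (simp add: sl assoc)
  also have "... = r * la X * A (s * k)" by (simp add: ra_la sk A_o assoc)
  also have "... = l * A k" using lM by (simp add: l_def A_o assoc)
  finally show "k * l = l * A k" .
 qed (rule Y)
 have "r : bmaps X (Y, l, k)" "s : bmaps (Y, l, k) X" using rs lr kr sl sk by (auto intro!: bmapsI simp: bim)
 with bim rs(3,4) that[of "(Y, l, k)" r s] show ?thesis by simp
qed

text \<open>A regular inverse of the underlying morphism is averaged to become left and then right
  linear. Both averages commute with composition by the bimodule map \<open>f\<close> and fix it, so
  \<open>f * g * f = f\<close> survives.\<close>

lemma bimodule_regular:
 assumes X: "bim X" and Y: "bim Y" and f: "f : bmaps X Y"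
 obtains g where "g : bmaps Y X" "f * g * f = f"
proof -
 note F = bmapsD[OF X Y f]
 obtain g where g: "g : homs (ob Y) (ob X)" "f * g * f = f" using homs_regular[OF bim_ob[OF X] bim_ob[OF Y] F(2)] .
 define g1 where "g1 = avg_left (la Y) (la X) g"
 define g2 where "g2 = avg_right Y X g1"
 note L = bim_lmod[OF X] bim_lmod[OF Y]
 have g1: "g1 : homs (ob Y) (ob X)" "g1 * la Y = la X * A g1" unfolding g1_def using avg_left_hom[OF L(2,1) g(1)] avg_left_module[OF L(2,1) g(1)] .
 have "g2 : homs (ob Y) (ob X)" "g2 * la Y = la X * A g2" "g2 * ra Y = ra X * g2"
  unfolding g2_def using avg_right_hom[OF Y X g1(1)] avg_right_left_module[OF Y X g1] avg_right_module[OF Y X g1(1)] .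
 hence "g2 : bmaps Y X" by (intro bmapsI[OF Y X])
 moreover have "f * g1 * f = f" using avg_left_natural[of "la Y" "la X" "la X" g f f "la Y"] homD(1)[OF g(1)] F X Y g(2)
   avg_left_fixed[OF L F(2,3)] by (simp add: g1_def)
 hence "f * g2 * f = f" using avg_right_natural[OF g1(1), of f X f Y] F(4,5) avg_right_fixed[OF X Y F(2,4)] by (simp add: g2_def)
 ultimately show ?thesis using that by blast
qed

end

subsection \<open>Simple objects\<close>

context factor
begin

text \<open>A nonzero \<open>t\<close> has a nonzero scalar \<open>t * cadj t\<close>, so every
  other intertwiner \<open>s\<close> is recovered from the scalar \<open>cadj t * s\<close>.\<close>

lemma schur_one_dimensional:
 assumes Q: "Q : End" "irr Q" and Q': "Q' : End" "irr Q'" shows "EX c. Hom Q Q' <= range (%a. scl a c)"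
proof (cases "Hom Q Q' <= {0}")
 case True
 thus ?thesis by (intro exI[of _ 0]) auto
next
 case False
 then obtain t where t: "t : Hom Q Q'" "t ~= 0" by auto
 note t' = Hom_cadj[OF Q(1) Q'(1) t(1)] and tM = HomD(1)[OF t(1)]
 obtain b where b: "t * cadj t = scl b idb" using irreducible_scalar[OF Q'(2)] Hom_o[OF t(1) t'] by blast
 have b0: "b ~= 0"
 proof
  assume "b = 0"
  hence "cadj (cadj t) * cadj t = 0" using b tM by simp
  hence "cadj t = 0" by (rule cadj_self_eq_0[OF M_cadj[OF tM]])
  hence "cadj (cadj t) = 0" by simp
  thus False using t(2) tM by simp
 qed
 have "s : range (%a. scl a t)" if s: "s : Hom Q Q'" for s
 proof -
  obtain a where a: "cadj t * s = scl a idb" using irreducible_scalar[OF Q(2)] Hom_o[OF t' s] by blast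
  have "scl b s = (t * cadj t) * s" by (simp add: b scale_left)
  also have "... = scl a t" using tM by (simp add: assoc a scale_right)
  finally have "scl (1 / b) (scl b s) = scl (1 / b) (scl a t)" by simp
  hence "s = scl (1 / b \<^bold>* a) t" using b0 by simp
  thus ?thesis by blast
 qed
 thus ?thesis by blast
qed

text \<open>An orthonormal decomposition of \<open>H\<close> splits every intertwiner into matrix
  entries, each in a space of dimension at most one.\<close>

lemma intertwiners_finite_span:
 assumes P: "P <= End" "!!Q. Q : P ==> irr Q" and H: "H : sums_of M P" shows "EX B. finite B & Hom H H <= op_space.span B"
proof -
 have H': "H : End" "idb : gideal M P H H" using H sums_of_iff[OF P] by auto
 obtain ps where ps: "orthonormal M H ps" "!!p. p : set ps ==> fst p : P" "rproj ps = idb"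
  using gram_schmidt[OF P H'(1) H'(1) intertwiners_id H'(2)] by (metis compose_id(1))
 have "EX c. Hom (fst q) (fst p) <= range (%a. scl a c)" if "p : set ps" "q : set ps" for p q using schur_one_dimensional[of "fst q" "fst p"] ps(2) that P by blast
 then obtain c where c: "!!p q. p : set ps ==> q : set ps ==>
   Hom (fst q) (fst p) <= range (%a. scl a (c p q))" by metis
 define B where "B = (%(p, q). snd p * c p q * cadj (snd q)) ` (set ps \<times> set ps)"
 have "f : op_space.span B" if f: "f : Hom H H" for f
 proof -
  have piece: "snd p * (cadj (snd p) * f * snd q) * cadj (snd q) : op_space.span B" if pq: "p : set ps" "q : set ps" for p q
  proof -
   note p = orthonormal_props[OF ps(1) pq(1)] and q = orthonormal_props[OF ps(1) pq(2)]
   have "cadj (snd p) : Hom H (fst p)" using p(1) H'(1) ps(2)[OF pq(1)] P(1) by (intro Hom_cadj) auto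
   hence "cadj (snd p) * f * snd q : Hom (fst q) (fst p)" using q(1) f by (intro Hom_o)
   then obtain a where "cadj (snd p) * f * snd q = scl a (c p q)" using c[OF pq] by blast
   hence "snd p * (cadj (snd p) * f * snd q) * cadj (snd q) = scl a (snd p * c p q * cadj (snd q))" using p(2) by (simp add: scale_left scale_right)
   moreover have "snd p * c p q * cadj (snd q) : B" using pq by (auto simp: B_def)
   ultimately show ?thesis by (simp add: op_space.span_scale op_space.span_base)
  qed
  have inner: "snd p * cadj (snd p) * f * rproj qs : op_space.span B" if p: "p : set ps" and "set qs <= set ps" for p qs using that(2)
  proof (induction qs)
   case (Cons q qs)
   hence "snd p * (cadj (snd p) * f * snd q) * cadj (snd q) + snd p * cadj (snd p) * f * rproj qs : op_space.span B" using piece[OF p] by (intro op_space.span_add) auto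
   thus ?case by (simp add: add_right assoc)
  qed (simp add: op_space.span_zero)
  have "rproj qs * f * rproj ps : op_space.span B" if "set qs <= set ps" for qs using that
  proof (induction qs)
   case (Cons q qs)
   hence "snd q * cadj (snd q) * f * rproj ps + rproj qs * f * rproj ps : op_space.span B" using inner[of q ps] by (intro op_space.span_add) auto
   thus ?case by (simp add: add_left assoc)
  qed (simp add: op_space.span_zero)
  from this[of ps] show ?thesis by (simp add: ps(3))
 qed
 thus ?thesis by (intro exI[of _ B]) (auto simp: B_def)
qed

end

context semisimple_algebra
begin

lemma bmaps_finite_span: assumes "bim X" shows "EX B. finite B & bmaps X X <= op_space.span B"
proof -
 have sub: "bmaps X X <= homs (ob X) (ob X)" using assms by (auto simp: bimodule_maps_iff)
 show ?thesis
 proof (cases "ob X")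
  case None
  thus ?thesis using sub by (intro exI[of _ "{0}"]) (auto simp: hom_None intro: op_space.span_zero)
 next
  case (Some H)
  hence "H : S" using bim_ob[OF assms] by simp
  thus ?thesis using intertwiners_finite_span[OF P_endo P_irr, of H] sub Some by (auto simp: hom_Some S_eq[symmetric])
 qed
qed

lemma bmaps_subspace: "bim X ==> bim Y ==> op_space.subspace (bmaps X Y)" by (simp add: op_space.subspace_def bmaps_0 bmaps_add bmaps_scale)

text \<open>Evaluation of a polynomial at \<open>f\<close> by Horner's scheme. The constant term is
  multiplied by \<open>e\<close>, which stands for the identity of the bimodule and may differ from
  \<open>idb\<close>.\<close>

definition peval :: "'h op => 'h op => complex poly => 'h op" where
 "peval e f p = fold_coeffs (%a b. scl a e + f * b) p 0"

lemma peval_0 [simp]: "peval e f 0 = 0" by (simp add: peval_def)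

lemma peval_pCons [simp]: "peval e f (pCons a p) = scl a e + f * peval e f p" by (cases "p = 0 & a = 0") (auto simp: peval_def)

lemma peval_add: "peval e f (p + q) = peval e f p + peval e f q"
proof (induction p q rule: poly_induct2)
 case (pCons a p b q)
 thus ?case by (simp add: op_space.scale_left_distrib add_right)
qed simp

lemma peval_smult: "f : M ==> peval e f (smult c p) = scl c (peval e f p)" by (induction p) (simp_all add: op_space.scale_right_distrib scale_right)

lemma peval_sum: "peval e f (sum g I) = (\<Sum>i\<in>I. peval e f (g i))" by (induction I rule: infinite_finite_induct) (auto simp: peval_add)

lemma peval_bmaps:
 assumes X: "bim X" and f: "f : bmaps X X" shows "peval (ac X idb) f p : bmaps X X"
 by (induction p) (auto simp: X f bmaps_0 intro!: bmaps_add bmaps_scale bmaps_one bmaps_o[OF X X X])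

lemma annihilating_poly:
 assumes X: "bim X" and f: "f : bmaps X X" shows "EX p. p ~= 0 & peval (ac X idb) f p = 0"
proof -
 let ?w = "%i. peval (ac X idb) f (monom 1 i)"
 have fM: "f : M" using bmapsD(1)[OF X X f] .
 obtain B where B: "finite B" "bmaps X X <= op_space.span B" using bmaps_finite_span[OF X] by blast
 show ?thesis
 proof (cases "inj_on ?w {..card B}")
  \<comment> \<open>Coinciding powers are treated apart, because linear dependence is a property of
    the set of powers and not of the family. Here a difference of two monomials annihilates
    \<open>f\<close>.\<close>
  case False
  then obtain i j where ij: "i ~= j" "?w i = ?w j" by (auto simp: inj_on_def)
  have "coeff (monom 1 i + smult (-1) (monom 1 j) :: complex poly) i = 1" using ij by simp
  hence "monom 1 i + smult (-1) (monom 1 j) ~= (0 :: complex poly)" by (metis coeff_0 zero_neq_one)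
  moreover have "peval (ac X idb) f (monom 1 i + smult (-1) (monom 1 j)) = 0" unfolding peval_add peval_smult[OF fM] using ij by simp
  ultimately show ?thesis by blast
 next
  case True
  have "op_space.dependent (?w ` {..card B})"
  proof (rule ccontr)
   assume "\<not> op_space.dependent (?w ` {..card B})"
   hence "card (?w ` {..card B}) <= card B" using op_space.independent_span_bound[OF B(1)] B(2) peval_bmaps[OF X f] by blast
   thus False using card_image[OF True] by simp
  qed
  then obtain c where c: "EX v:?w ` {..card B}. c v ~= 0" "(\<Sum>v\<in>?w ` {..card B}. scl (c v) v) = 0" using op_space.dependent_finite[of "?w ` {..card B}"] by auto
  define p where "p = (\<Sum>i\<le>card B. smult (c (?w i)) (monom 1 i))"
  have "peval (ac X idb) f p = (\<Sum>i\<le>card B. scl (c (?w i)) (?w i))" by (simp add: p_def peval_sum peval_smult[OF fM])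
  also have "... = 0" using c(2) by (simp add: sum.reindex[OF True] o_def)
  finally have "peval (ac X idb) f p = 0" .
  moreover have "p ~= 0"
  proof -
   obtain i where i: "i <= card B" "c (?w i) ~= 0" using c(1) by auto
   have "coeff p i = (\<Sum>j\<le>card B. if i = j then c (?w j) else 0)" unfolding p_def coeff_sum by (intro sum.cong) auto
   hence "coeff p i = c (?w i)" using i by simp
   thus ?thesis using i by auto
  qed
  ultimately show ?thesis by blast
 qed
qed

text \<open>An eigenvalue \<open>\<lambda>\<close> of a nonscalar endomorphism \<open>f\<close> makes \<open>f - \<lambda>\<close> a nonzero zero divisor, and a
 regular inverse of it yields a nontrivial idempotent.\<close>

lemma nontrivial_idempotent:
 assumes X: "bim X" and f: "f : bmaps X X" "!!a. f ~= scl a (ac X idb)"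
 obtains e where "e : bmaps X X" "e * e = e" "e ~= 0" "e ~= ac X idb"
proof -
 let ?ev = "peval (ac X idb) f"
 have fM: "f : M" using bmapsD(1)[OF X X f(1)] .
 \<comment> \<open>Minimality of the degree ensures that the cofactor \<open>q\<close> of a linear
   factor does not annihilate \<open>f\<close>, so \<open>d\<close> below is a zero divisor.\<close>
 obtain p where p: "p ~= 0" "?ev p = 0" and min: "!!q. q ~= 0 ==> ?ev q = 0 ==> degree p <= degree q"
  using ex_has_least_nat[of "%p. p ~= 0 & ?ev p = 0" _ degree] annihilating_poly[OF X f(1)] by blast
 have one: "ac X idb ~= 0" using f bmapsD(6)[OF X X f(1)] by (metis blinfun_compose_zero(2) op_space.scale_zero_left)
 have "degree p ~= 0"
 proof
  assume "degree p = 0"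
  then obtain a where "p = [:a:]" by (auto elim: degree_eq_zeroE)
  thus False using p one by auto
 qed
 then obtain z where z: "poly p z = 0" using fundamental_theorem_of_algebra[of p] by (auto simp: constant_degree)
 then obtain q where q: "p = [:- z, 1:] \<^bold>* q" using poly_eq_0_iff_dvd unfolding dvd_def by blast
 have q0: "q ~= 0" using p q by auto
 have "degree p = Suc (degree q)" unfolding q using q0 by (subst degree_mult_eq) auto
 hence ev_q: "?ev q ~= 0" using min[OF q0] by auto
 define d where "d = f + scl (- z) (ac X idb)"
 have d: "d : bmaps X X" unfolding d_def using X f(1) by (intro bmaps_add bmaps_scale bmaps_one)
 have "p = smult (- z) q + pCons 0 q" by (simp add: q)
 hence "?ev p = scl (- z) (?ev q) + f * ?ev q" by (simp only: peval_add peval_smult[OF fM] peval_pCons) simp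
 also have "... = d * ?ev q" using bmapsD(7)[OF X X peval_bmaps[OF X f(1)], of q] by (simp add: d_def diff_left scale_left)
 finally have dq: "d * ?ev q = 0" using p(2) by simp
 have d0: "d ~= 0"
 proof
  assume "d = 0"
  hence "f = scl z (ac X idb)" by (simp add: d_def add_eq_0_iff2)
  thus False using f(2) by blast
 qed
 obtain g where g: "g : bmaps X X" "d * g * d = d" using bimodule_regular[OF X X d] .
 have "(g * d) * ?ev q ~= ac X idb * ?ev q" using dq ev_q bmapsD(7)[OF X X peval_bmaps[OF X f(1)], of q] by (simp add: assoc)
 hence "g * d ~= ac X idb" by metis
 moreover have "g * d ~= 0" using g(2) d0 by auto
 moreover have "(g * d) * (g * d) = g * d" using g(2) by (simp add: assoc)
 moreover have "g * d : bmaps X X" using X d g(1) by (blast intro: bmaps_o)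
 ultimately show ?thesis using that by blast
qed

definition endo_dim :: "'h bm => nat" where "endo_dim X = op_space.dim (bmaps X X)"

text \<open>Endomorphisms \<open>g\<close> of \<open>Y\<close> embed as \<open>s * g * r\<close>.
  All of these are fixed by \<open>s * r\<close>, whereas the identity of \<open>X\<close> is not,
  so the image is a proper subspace.\<close>

lemma endo_dim_less:
 assumes X: "bim X" and Y: "bim Y" and r: "r : bmaps X Y" and s: "s : bmaps Y X"
  and rs: "r * s = ac Y idb" and ne: "s * r ~= ac X idb" shows "endo_dim Y < endo_dim X"
proof -
 note R = bmapsD[OF X Y r] and S = bmapsD[OF Y X s]
 let ?\<Phi> = "%g. s * g * r"
 obtain Bx where Bx: "Bx <= bmaps X X" "\<not> op_space.dependent Bx" "bmaps X X <= op_space.span Bx"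
  "card Bx = op_space.dim (bmaps X X)" by (rule op_space.basis_exists)
 obtain By where By: "By <= bmaps Y Y" "\<not> op_space.dependent By" "bmaps Y Y <= op_space.span By"
  "card By = op_space.dim (bmaps Y Y)" by (rule op_space.basis_exists)
 obtain Cx where Cx: "finite Cx" "bmaps X X <= op_space.span Cx" using bmaps_finite_span[OF X] by blast
 obtain Cy where Cy: "finite Cy" "bmaps Y Y <= op_space.span Cy" using bmaps_finite_span[OF Y] by blast
 have finite: "finite Bx" "finite By" using op_space.independent_span_bound[OF Cx(1) Bx(2) order_trans[OF Bx(1) Cx(2)]]
   op_space.independent_span_bound[OF Cy(1) By(2) order_trans[OF By(1) Cy(2)]] by simp_all
 have lin: "Vector_Spaces.linear scl scl ?\<Phi>" unfolding Vector_Spaces.linear_iff using S(1)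
  by (auto simp: op_space.vector_space_axioms add_left add_right scale_left scale_right)
 have span_By: "op_space.span By <= bmaps Y Y" using By(1) bmaps_subspace[OF Y Y] by (rule op_space.span_minimal)
 have \<Phi>_inv: "r * ?\<Phi> g * s = g" if "g : bmaps Y Y" for g using bmapsD(6,7)[OF Y Y that] by (simp add: assoc rs eq_tail[OF rs])
 have inj: "inj_on ?\<Phi> (bmaps Y Y)" by (rule inj_onI) (metis \<Phi>_inv)
 have indep: "\<not> op_space.dependent (?\<Phi> ` By)"
 proof -
  interpret module_hom scl scl ?\<Phi> using lin by (rule Vector_Spaces.linear.axioms(3))
  show ?thesis by (rule independent_injective_image[OF By(2) inj_on_subset[OF inj span_By]])
 qed
 have fixed_by: "op_space.span (?\<Phi> ` By) <= {x. (s * r) * x = x}"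
 proof (rule op_space.span_minimal)
  have "(s * r) * ?\<Phi> g = ?\<Phi> g" if "g : By" for g by (simp add: assoc eq_tail[OF rs]
     eq_tail[OF bmapsD(7)[OF Y Y subsetD[OF By(1) that]]])
  thus "?\<Phi> ` By <= {x. (s * r) * x = x}" by blast
  have "s * r : M" using R S by simp
  thus "op_space.subspace {x. (s * r) * x = x}" by (auto simp: op_space.subspace_def add_right scale_right)
 qed
 have nin: "ac X idb \<notin> op_space.span (?\<Phi> ` By)"
 proof
  assume "ac X idb : op_space.span (?\<Phi> ` By)"
  hence "(s * r) * ac X idb = ac X idb" using fixed_by by blast
  thus False using ne R(6) by (simp add: assoc)
 qed
 have ind: "\<not> op_space.dependent (insert (ac X idb) (?\<Phi> ` By))" by (rule op_space.independent_insertI[OF nin indep])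
 have notin: "ac X idb \<notin> ?\<Phi> ` By" using nin op_space.span_base[of "ac X idb" "?\<Phi> ` By"] by metis
 have "insert (ac X idb) (?\<Phi> ` By) <= bmaps X X" using bmaps_o[OF X Y X bmaps_o[OF X Y Y r] s] By(1) bmaps_one[OF X] by blast
 hence "card (insert (ac X idb) (?\<Phi> ` By)) <= card Bx" using op_space.independent_span_bound[OF finite(1) ind] Bx(3) by blast
 moreover have "card (insert (ac X idb) (?\<Phi> ` By)) = Suc (card By)" using notin finite(2) card_image[OF inj_on_subset[OF inj By(1)]] by simp
 ultimately show ?thesis using Bx(4) By(4) by (simp add: endo_dim_def)
qed

lemma simple_BB_iff: "simple_object BB X \<longleftrightarrow>
 bim X & ac X idb ~= 0 & bmaps X X = range (%a. scl a (ac X idb))" by (auto simp: simple_object_def BB_Idm)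

text \<open>A nonscalar endomorphism yields a nontrivial idempotent, and both of its summands have
  strictly smaller endomorphism spaces.\<close>

lemma simple_decomposition:
 "bim X ==> EX XXs. (ALL Y:set XXs. simple_object BB Y) & is_direct_sum BB X XXs"
proof (induction "endo_dim X" arbitrary: X rule: less_induct)
 case less
 note X = less.prems
 show ?case
 proof (cases "EX f:bmaps X X. ALL a. f ~= scl a (ac X idb)")
  case False
  hence "bmaps X X <= range (%a. scl a (ac X idb))" by blast
  hence "bmaps X X = range (%a. scl a (ac X idb))" using bmaps_scale[OF X X bmaps_one[OF X]] by blast
  thus ?thesis using X direct_sum_single[OF X] direct_sum_Nil[OF X] simple_BB_iff[of X] by (cases "ac X idb = 0") (auto intro: exI[of _ "[]"] exI[of _ "[X]"])
 next
  case True
  then obtain e where e: "e : bmaps X X" "e * e = e" "e ~= 0" "e ~= ac X idb" using nontrivial_idempotent[OF X] by metis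
  note E = bmapsD[OF X X e(1)]
  define e' where "e' = ac X idb + scl (-1) e"
  have e': "e' : bmaps X X" unfolding e'_def using X e by (intro bmaps_add bmaps_scale bmaps_one)
  have ee: "e * e' = 0" "e' * e = 0" "e' * e' = e'" using E(1,6,7) X M_id by (simp_all add: e'_def diff_left diff_right e(2) ac_ones)
  obtain Y r s where Y: "bim Y" "r : bmaps X Y" "s : bmaps Y X" "r * s = ac Y idb" "s * r = e" using bimodule_splitting[OF X e(1,2)] .
  obtain Z r' s' where Z: "bim Z" "r' : bmaps X Z" "s' : bmaps Z X" "r' * s' = ac Z idb" "s' * r' = e'" using bimodule_splitting[OF X e' ee(3)] .
  have s: "s = e * s" "s' = e' * s'" "r = r * e" "r' = r' * e'"
   using bmapsD(6)[OF Y(1) X Y(3)] bmapsD(6)[OF Z(1) X Z(3)] bmapsD(7)[OF X Y(1) Y(2)] bmapsD(7)[OF X Z(1) Z(2)] Y(4) Z(4)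
   by (simp_all add: Y(5)[symmetric] Z(5)[symmetric] assoc) (simp_all add: assoc[symmetric])
  have "r * s' = (r * e) * (e' * s')" "r' * s = (r' * e') * (e * s)" using s by metis+
  hence orth: "r * s' = 0" "r' * s = 0" by (simp_all add: assoc eq_tail[OF ee(1)] eq_tail[OF ee(2)])
  have b: "biproduct X Y Z s s' r r'" unfolding biproduct_def using Y Z orth by (simp add: e'_def)
  have "e' ~= ac X idb" using e(3) by (auto simp: e'_def)
  hence lt: "endo_dim Y < endo_dim X" "endo_dim Z < endo_dim X" using endo_dim_less[OF X Y(1-4)] endo_dim_less[OF X Z(1-4)] Y(5) Z(5) e(4) by auto
  obtain YYs ZZs where YZ: "ALL Y:set YYs. simple_object BB Y" "is_direct_sum BB Y YYs"
   "ALL Y:set ZZs. simple_object BB Y" "is_direct_sum BB Z ZZs" using less.hyps[OF lt(1) Y(1)] less.hyps[OF lt(2) Z(1)] by (elim exE conjE)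
  have "is_direct_sum BB X (YYs @ ZZs)" using YZ by (intro direct_sum_append[OF X Y(1) Z(1) b]) (auto simp: simple_BB_iff)
  thus ?thesis using YZ by (intro exI[of _ "YYs @ ZZs"]) auto
 qed
qed

section \<open>Finitely many simple bimodules\<close>

lemma isomorphic_sym: "isomorphic BB X Y ==> isomorphic BB Y X" unfolding isomorphic_def is_iso_def is_inverse_BB by blast

lemma isomorphic_trans:
 assumes X: "bim X" "bim Y" "bim Z" and "isomorphic BB X Y" "isomorphic BB Y Z" shows "isomorphic BB X Z"
proof -
 obtain f f' g g' where f: "f : bmaps X Y" "f' : bmaps Y X" "f' * f = ac X idb" "f * f' = ac Y idb"
  and g: "g : bmaps Y Z" "g' : bmaps Z Y" "g' * g = ac Y idb" "g * g' = ac Z idb" using assms unfolding isomorphic_def is_iso_def is_inverse_BB by (auto simp: BB_Idm)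
 have "(f' * g') * (g * f) = ac X idb" "(g * f) * (f' * g') = ac Z idb" using bmapsD(7)[OF X(1,2) f(1)] bmapsD(7)[OF X(3,2) g(2)] f(3) g(4)
  by (simp_all add: assoc eq_tail[OF g(3)] eq_tail[OF f(4)])
 thus ?thesis unfolding isomorphic_def is_iso_def is_inverse_BB using X by (intro exI[of _ "g * f"] exI[of _ "f' * g'"])
   (auto simp: BB_Idm intro: bmaps_o[OF X(1,2,3) f(1) g(1)] bmaps_o[OF X(3,2,1) g(2) f(2)])
qed

text \<open>For a regular inverse \<open>g\<close> of \<open>f\<close>, both composites are scalars
  by simplicity, and \<open>f * g * f = f\<close> forces them to be 1.\<close>

lemma simple_isomorphic:
 assumes X: "simple_object BB X" and Y: "simple_object BB Y" and f: "f : bmaps X Y" "f ~= 0" shows "isomorphic BB X Y"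
proof -
 have b: "bim X" "bim Y" using X Y by (auto simp: simple_BB_iff)
 note F = bmapsD[OF b f(1)]
 obtain g where g: "g : bmaps Y X" "f * g * f = f" using bimodule_regular[OF b f(1)] .
 have gf: "g * f : bmaps X X" "f * g : bmaps Y Y" using b f(1) g(1) by (blast intro: bmaps_o)+
 obtain c where c: "g * f = scl c (ac X idb)" using gf(1) X by (auto simp: simple_BB_iff)
 obtain d where d: "f * g = scl d (ac Y idb)" using gf(2) Y by (auto simp: simple_BB_iff)
 have "scl c f = f" using g(2) F(1,6) b by (simp add: c scale_right)
 hence c1: "c = 1" using f(2) op_space.scale_right_imp_eq[of f c 1] by simp
 have "scl d f = (f * g) * f" using F(7) by (simp add: d scale_left)
 hence "scl d f = f" using g(2) by (simp add: assoc)
 hence "d = 1" using f(2) op_space.scale_right_imp_eq[of f d 1] by simp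
 thus ?thesis unfolding isomorphic_def is_iso_def is_inverse_BB using b f(1) g(1) c d c1 by (intro exI[of _ f] exI[of _ g]) (simp add: BB_Idm)
qed

lemma direct_sum_isomorphic:
 assumes X: "bim X" and ds: "is_direct_sum BB X XXs" and len: "length YYs = length XXs"
  and b: "set XXs <= Ob BB" "set YYs <= Ob BB"
  and iso: "!!k. k < length XXs ==> isomorphic BB (XXs ! k) (YYs ! k)" shows "is_direct_sum BB X YYs"
proof -
 obtain i p where ip0: "ALL k<length XXs. i k : bmaps (XXs ! k) X & p k : bmaps X (XXs ! k)"
  "ALL j<length XXs. ALL k<length XXs. p j * i k = (if j = k then Idm BB (XXs ! k) else 0)"
  "(\<Sum>k<length XXs. i k * p k) = ac X idb" using ds unfolding direct_sum_iff[OF X] by blast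
 note ip = ip0(1)[rule_format] ip0(2)[rule_format] ip0(3)
 have bX: "bim (XXs ! k)" "bim (YYs ! k)" if "k < length XXs" for k using subsetD[OF b(1) nth_mem, of k] subsetD[OF b(2) nth_mem, of k] that len by auto
 have "EX f g. is_inverse BB (XXs ! k) (YYs ! k) f g" if "k < length XXs" for k using iso[OF that] by (auto simp: isomorphic_def is_iso_def)
 then obtain f g where fg: "!!k. k < length XXs ==> is_inverse BB (XXs ! k) (YYs ! k) (f k) (g k)" by metis
 hence f: "f k : bmaps (XXs ! k) (YYs ! k)" and g: "g k : bmaps (YYs ! k) (XXs ! k)"
  and gf: "g k * f k = ac (XXs ! k) idb" and fg': "f k * g k = ac (YYs ! k) idb" if "k < length XXs" for k using that bX[OF that] by (auto simp: is_inverse_BB BB_Idm)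
 show ?thesis unfolding direct_sum_iff[OF X] len
 proof (rule exI[of _ "%k. i k * g k"], rule exI[of _ "%k. f k * p k"], intro conjI allI impI)
  fix k assume k: "k < length XXs"
  show "i k * g k : bmaps (YYs ! k) X" "f k * p k : bmaps X (YYs ! k)"
   using bmaps_o[OF bX(2)[OF k] bX(1)[OF k] X g[OF k]] bmaps_o[OF X bX[OF k] _ f[OF k]] ip(1)[OF k] by auto
 next
  fix j k assume jk: "j < length XXs" "k < length XXs"
  have "(f j * p j) * i k * g k = f j * (p j * i k) * g k" by (simp add: assoc)
  thus "(f j * p j) * i k * g k = (if j = k then Idm BB (YYs ! k) else 0)"
   using jk bX fg'[OF jk(2)] bmapsD(7)[OF bX(2,1)[OF jk(2)] g[OF jk(2)]] by (simp add: ip(2) BB_Idm)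
 next
  have "(i k * g k) * f k * p k = i k * p k" if k: "k < length XXs" for k using bmapsD(7)[OF X bX(1)[OF k], of "p k"] ip(1)[OF k]
   by (simp add: assoc eq_tail[OF gf[OF k]])
  thus "(\<Sum>k<length XXs. (i k * g k) * f k * p k) = ac X idb" using ip(3) by simp
 qed
qed

text \<open>Free bimodules are left adjoint to forgetting the actions. Hence a simple constituent
  \<open>Q\<close> of the underlying object gives a nonzero bimodule map out of
  \<open>free Q\<close>.\<close>

lemma free_map:
 assumes Q: "Q : S" and X: "bim X" and t: "t : homs (Some Q) (ob X)" shows "ra X * la X * A t : bmaps (free Q) X"
  "(ra X * la X * A t) * A (Q u) * u = t"
proof -
 have e: "Q : End" using Q by (rule S_endoD)
 note [simp] = endo_in[OF e] endo_id[OF e]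
 have tM [simp]: "t : M" using homD(1)[OF t] .
 have tc: "t * Q x = ac X x * t" if "x : M" for x using homD(2)[OF t that] by simp
 have At: "A t * A (Q x) = A (ac X x) * A t" if "x : M" for x using that X by (simp add: A_o[symmetric] tc)
 let ?T = "ra X * la X * A t"
 have la: "la X * A (ac X x) * y = ac X x * la X * y" if "x : M" for x y using eq_tail[OF la_comm[OF X that]] by (simp add: assoc)
 have ra: "ra X * ac X (A x) * y = ac X x * ra X * y" if "x : M" for x y using eq_tail[OF ra_comm[OF X that]] by (simp add: assoc)
 show "?T : bmaps (free Q) X"
 proof (rule bmapsI[OF free_bim[OF Q] X])
  have "?T * A (Q (A x)) = ac X x * ?T" if "x : M" for x using that X by (simp add: assoc At la ra)
  moreover have "ac X idb * ?T = ?T" using X by (simp add: assoc[symmetric] ra_one)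
  ultimately show "?T : homs (ob (free Q)) (ob X)" using X by (simp add: homs_def free_def)
  have "la X * A ?T = (la X * A (ra X)) * A (la X) * A (A t)" using X by (simp add: A_o assoc)
  also have "... = ra X * (la X * A (la X)) * A (A t)" using X by (simp add: ra_la[symmetric] assoc)
  also have "... = ?T * m" using X by (simp add: la_la assoc m_comm)
  finally show "?T * la (free Q) = la X * A ?T" by (simp add: free_def)
  have "?T * A (Q m) = ra X * ac X m * la X * A t" using X by (simp add: assoc At la)
  also have "... = ra X * ?T" by (simp add: assoc[symmetric] ra_ra[OF X])
  finally show "?T * ra (free Q) = ra X * ?T" by (simp add: free_def)
 qed
 have "?T * A (Q u) * u = ra X * ac X u * (la X * u) * t" using X by (simp add: assoc At eq_tail[OF At] la u_comm)
 also have "... = (ra X * ac X u) * ac X idb * t" using X by (simp add: la_u assoc)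
 finally show "?T * A (Q u) * u = t" using X homD(4)[OF t] by (simp add: ra_u)
qed

lemma nonzero_component:
 assumes X: "bim X" and nz: "ac X idb ~= 0"
 obtains Q t where "Q : P" "t : homs (Some Q) (ob X)" "t ~= 0"
proof -
 obtain H where H: "ob X = Some H" "H : S" using bim_ob[OF X] nz by (cases "ob X") auto
 have "idb : gideal M P H H" using H S_iff by simp
 moreover have "EX Q:P. EX t:Hom Q H. t ~= 0" if "x : gideal M P H H" "x ~= 0" for x using that
 proof (induction rule: gideal.induct)
  case (step x Q t a)
  thus ?case by (cases "t = 0") auto
 qed simp
 ultimately obtain Q t where "Q : P" "t : Hom Q H" "t ~= 0" using id_not_0(1) by blast
 thus ?thesis using that[of Q t] H P_S by (simp add: hom_Some)
qed

theorem bimodule_semisimple: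
 "EX T. finite T & (ALL X:T. simple_object BB X) &
  (ALL X:T. ALL Y:T. X ~= Y --> Mor BB X Y = {0}) &
  (ALL X:Ob BB. EX XXs. set XXs <= T & is_direct_sum BB X XXs)"
proof -
 have "ALL Q:P. EX XXs. (ALL Y:set XXs. simple_object BB Y) & is_direct_sum BB (free Q) XXs" using simple_decomposition free_bim P_S by blast
 then obtain ds where ds: "!!Q Y. Q : P ==> Y : set (ds Q) ==> simple_object BB Y"
  "!!Q. Q : P ==> is_direct_sum BB (free Q) (ds Q)" by metis
 \<comment> \<open>Every simple bimodule is isomorphic to a summand of some free bimodule on a
   simple object. The collection is finite but may contain isomorphic members.\<close>
 define All where "All = (\<Union>Q\<in>P. set (ds Q))"
 have All: "finite All" "!!Y. Y : All ==> simple_object BB Y" using P_finite ds(1) by (auto simp: All_def)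
 have in_All: "EX Y:All. isomorphic BB X Y" if X: "simple_object BB X" for X
 proof -
  have bX: "bim X" "ac X idb ~= 0" using X by (auto simp: simple_BB_iff)
  obtain Q t where t: "Q : P" "t : homs (Some Q) (ob X)" "t ~= 0" using nonzero_component[OF bX] .
  define T where "T = ra X * la X * A t"
  note f = free_bim[OF P_S[OF t(1)]]
  have T: "T : bmaps (free Q) X" "T ~= 0" using free_map[OF P_S[OF t(1)] bX(1) t(2)] t(3) by (auto simp: T_def)
  obtain i p where ip0: "ALL k<length (ds Q). i k : bmaps (ds Q ! k) (free Q) & p k : bmaps (free Q) (ds Q ! k)"
   "(\<Sum>k<length (ds Q). i k * p k) = ac (free Q) idb" using ds(2)[OF t(1)] unfolding direct_sum_iff[OF f] by blast
  have "T = T * (\<Sum>k<length (ds Q). i k * p k)" using bmapsD(6)[OF f bX(1) T(1)] by (simp add: ip0(2))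
  hence "(\<Sum>k<length (ds Q). T * i k * p k) ~= 0" using T(2) by (simp add: compose_sum_right)
  then obtain k where k: "k < length (ds Q)" "T * i k * p k ~= 0" by (metis (no_types, lifting) lessThan_iff sum.neutral)
  have s: "simple_object BB (ds Q ! k)" using ds(1)[OF t(1)] k(1) by simp
  hence "bim (ds Q ! k)" by (simp add: simple_BB_iff)
  hence "T * i k : bmaps (ds Q ! k) X" using bmaps_o[OF _ f bX(1), of "ds Q ! k" "i k" T] ip0(1) k(1) T(1) by blast
  moreover have "T * i k ~= 0" using k(2) by (auto simp: assoc[symmetric])
  ultimately have "isomorphic BB (ds Q ! k) X" using simple_isomorphic[OF s X] by blast
  moreover have "ds Q ! k : All" using k(1) t(1) nth_mem by (auto simp: All_def)
  ultimately show ?thesis using isomorphic_sym by blast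
 qed
 define rep where "rep X = (SOME Y. Y : All & isomorphic BB X Y)" for X
 have rep: "rep X : All" "isomorphic BB X (rep X)" if "simple_object BB X" for X
  using someI_ex[of "%Y. Y : All & isomorphic BB X Y"] in_All[OF that] by (auto simp: rep_def)
 have bim: "bim X" if "simple_object BB X" for X using that by (simp add: simple_BB_iff)
 have rep_eq: "rep X = rep Y" if "simple_object BB X" "simple_object BB Y" "isomorphic BB X Y" for X Y
 proof -
  note b = bim[OF that(1)] bim[OF that(2)]
  have "isomorphic BB X Z \<longleftrightarrow> isomorphic BB Y Z" if "Z : All" for Z
   using isomorphic_trans[OF b(2,1) bim[OF All(2)[OF that]] isomorphic_sym[OF \<open>isomorphic BB X Y\<close>]]
    isomorphic_trans[OF b bim[OF All(2)[OF that]] \<open>isomorphic BB X Y\<close>] by blast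
  hence "(%Z. Z : All & isomorphic BB X Z) = (%Z. Z : All & isomorphic BB Y Z)" by (intro ext) blast
  thus ?thesis by (simp add: rep_def)
 qed
 show ?thesis
 proof (intro exI[of _ "rep ` All"] conjI ballI impI)
  show "finite (rep ` All)" using All(1) by simp
  show "simple_object BB X" if "X : rep ` All" for X using that rep(1)[OF All(2)] All(2) by (elim imageE) metis
  show "Mor BB X Y = {0}" if XY: "X : rep ` All" "Y : rep ` All" "X ~= Y" for X Y
  proof -
   obtain a b where ab: "a : All" "X = rep a" "b : All" "Y = rep b" using XY by blast
   note s = All(2)[OF ab(1)] All(2)[OF ab(3)]
   have sr: "simple_object BB X" "simple_object BB Y" using All(2)[OF rep(1)[OF s(1)]] All(2)[OF rep(1)[OF s(2)]] unfolding ab by blast+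
   have "f = 0" if f: "f : bmaps X Y" for f
   proof (rule ccontr)
    assume "f ~= 0"
    hence "isomorphic BB X Y" using simple_isomorphic[OF sr f] by blast
    hence "isomorphic BB a Y" using isomorphic_trans[OF bim[OF s(1)] bim[OF sr(1)] bim[OF sr(2)]] rep(2)[OF s(1)] ab(2) by simp
    hence "isomorphic BB a b" using isomorphic_trans[OF bim[OF s(1)] bim[OF sr(2)] bim[OF s(2)]]
      isomorphic_sym[OF rep(2)[OF s(2)]] ab(4) by simp
    thus False using rep_eq[OF s] ab XY(3) by simp
   qed
   thus ?thesis using bmaps_0[OF bim[OF sr(1)] bim[OF sr(2)]] by auto
  qed
  show "EX XXs. set XXs <= rep ` All & is_direct_sum BB X XXs" if "X : Ob BB" for X
  proof -
   have X: "bim X" using that by simp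
   obtain XXs where XXs: "ALL Y:set XXs. simple_object BB Y" "is_direct_sum BB X XXs" using simple_decomposition[OF X] by blast
   \<comment> \<open>One application of \<open>rep\<close> ends in \<open>All\<close>; the second
     one ends in the image of \<open>All\<close> under \<open>rep\<close>, which is the set of
     representatives.\<close>
   define f where "f Y = rep (rep Y)" for Y
   have f: "f Y : rep ` All" "isomorphic BB Y (f Y)" "bim (f Y)" if "Y : set XXs" for Y
   proof -
    have s: "simple_object BB Y" using XXs(1) that by blast
    have r: "simple_object BB (rep Y)" using rep(1)[OF s] All(2) by blast
    have r2: "simple_object BB (f Y)" using rep(1)[OF r] All(2) by (simp add: f_def)
    show "f Y : rep ` All" using rep(1)[OF s] by (simp add: f_def)
    show "bim (f Y)" using bim[OF r2] .
    show "isomorphic BB Y (f Y)" using isomorphic_trans[OF bim[OF s] bim[OF r] bim[OF r2]] rep(2)[OF s] rep(2)[OF r] by (simp add: f_def)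
   qed
   have "is_direct_sum BB X (map f XXs)" using f XXs bim by (intro direct_sum_isomorphic[OF X XXs(2)]) auto
   thus ?thesis using f(1) by (intro exI[of _ "map f XXs"]) auto
  qed
 qed
qed

text \<open>A bimodule endomorphism of \<open>A\<close> is determined by its value on the unit,
  which lies in the one-dimensional space \<open>Hom id A\<close>.\<close>

lemma bimodule_simple_unit: "simple_object BB UU" unfolding simple_BB_iff
proof (intro conjI)
 show "bim UU" by simp
 show "ac UU idb ~= 0" by simp
 have "f : range (%a. scl a (ac UU idb))" if f: "f : bmaps UU UU" for f
 proof -
  note F = bmapsD[OF UU_bim UU_bim f]
  have "f * u : Hom id A" using F mu_hom(2) hom_o[OF F(2), of u "Some id"] by (simp add: hom_Some)
  then obtain c where c: "f * u = scl c u" using unit_homs by auto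
  have fm: "f * m = m * A f" using F(3) by simp
  have "f = f * (m * A u)" by (simp add: m_unit_right)
  also have "... = (f * m) * A u" by (simp add: assoc)
  also have "... = m * A (f * u)" using F(1) by (simp add: fm A_o assoc)
  also have "... = scl c idb" by (simp add: c A_scale scale_right m_unit_right)
  finally show ?thesis by auto
 qed
 thus "bmaps UU UU = range (%a. scl a (ac UU idb))" using bmaps_scale[OF UU_bim UU_bim bmaps_one[OF UU_bim]] by auto
qed

end

section \<open>Duals of bimodules\<close>

text \<open>Duals of underlying objects are stated by means of \<open>act\<close>, which includes
  the zero object, with itself as dual.\<close>

locale frobenius_algebra = semisimple_algebra M S A m u dl v1 v2 P for M :: "'h::complex_hilbert_space op set" and S A m u dl v1 v2 P +
 fixes ep :: "'h op"
 assumes ep_intertwiner: "ep : Hom A id"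
  and counit_right: "A ep * m * A dl = idb"
  and counit_left: "ep * m * A dl = idb"
  and plain_left_dual: "X : with_zero S ==> EX Y ev et. Y : with_zero S & ev : M & et : M &
   (ALL x:M. ev * act Y (act X x) = x * ev) & (ALL x:M. et * x = act X (act Y x) * et) &
   act X ev * et = act X idb & ev * act Y et = act Y idb"
  and plain_right_dual: "X : with_zero S ==> EX Y ev et. Y : with_zero S & ev : M & et : M &
   (ALL x:M. ev * act X (act Y x) = x * ev) & (ALL x:M. et * x = act Y (act X x) * et) &
   act Y ev * et = act Y idb & ev * act X et = act X idb"
begin

text \<open>The comultiplication of the Frobenius algebra, with counit \<open>ep\<close>:
  \<open>dl\<close> creates two factors of \<open>A\<close> and the multiplication absorbs one of
  them.\<close>

definition De :: "'h op" where "De = m * A dl"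

lemma De_eq: "De = A m * dl" by (simp add: De_def dl_central)

lemma ep_in [simp]: "ep : M" and De_in [simp]: "De : M" using ep_intertwiner by (auto simp: De_def HomD)

lemma ep_comm: "x : M ==> ep * A x = x * ep" using HomD(2)[OF ep_intertwiner] by simp

lemma De_u: "De * u = dl"
proof -
 have "De * u = (m * u) * dl" by (simp add: De_def assoc u_comm)
 thus ?thesis by (simp add: m_unit_left)
qed

lemma counit: "A ep * De = idb" "ep * De = idb" using counit_left counit_right by (simp_all add: De_def)

lemma counit_dl: "A ep * dl = u" "ep * dl = u"
proof -
 have "(A ep * De) * u = u" "(ep * De) * u = u" by (simp_all add: counit)
 thus "A ep * dl = u" "ep * dl = u" by (simp_all add: assoc De_u)
qed

lemma m_De: "m * De = idb"
proof -
 have "m * De = (m * m) * A dl" by (simp add: De_def assoc)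
 also have "... = m * A (m * dl)" by (simp add: m_assoc[symmetric] assoc A_o)
 finally show ?thesis by (simp add: dl_section m_unit_right)
qed

lemma De_m_left: "m * A De = De * m"
proof -
 have "m * A De = (m * A m) * A (A dl)" by (simp add: De_def A_o assoc)
 thus ?thesis by (simp add: m_assoc De_def assoc m_comm)
qed

lemma De_m_right: "A m * De = De * m"
proof -
 have "A m * De = A (m * m) * dl" by (simp add: De_eq A_o assoc)
 also have "... = A m * A (A m) * dl" by (simp add: m_assoc[symmetric] A_o assoc)
 finally show ?thesis by (simp add: De_eq dl_comm assoc)
qed

lemma coassoc: "De * dl = A De * dl"
proof -
 have "De * dl = A m * dl * dl" by (simp add: De_eq assoc)
 thus ?thesis by (simp add: dl_comm De_def A_o assoc)
qed

lemma inv_mor_BB_unique: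
 assumes "bim X" "bim Y" "is_inverse BB X Y f g" shows "inv_mor BB X Y f = g" unfolding inv_mor_def
proof (rule the_equality)
 show "is_inverse BB X Y f g" by (rule assms(3))
next
 fix g' assume "is_inverse BB X Y f g'"
 hence g': "g' : bmaps Y X" "g' * f = ac X idb" and g: "g : bmaps Y X" "f * g = ac Y idb" using assms by (simp_all add: is_inverse_BB BB_Idm)
 have "g' = g' * (f * g)" using bmapsD(6)[OF assms(2,1) g'(1)] by (simp add: g)
 also have "... = g" using bmapsD(7)[OF assms(2,1) g(1)] by (simp add: assoc[symmetric] g')
 finally show "g' = g" .
qed

text \<open>The evaluation and coevaluation are given by maps \<open>E : Y \<otimes> X \<rightarrow> A\<close> and \<open>et : 1 \<rightarrow> X \<otimes> Y\<close> on plain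
 tensor products.\<close>

lemma left_dualI:
 assumes X: "bim X" and Y: "bim Y"
  and E: "E : homs (ec (ob Y) (ob X)) (Some A)"
  and et: "et : M" "!!x. x : M ==> et * x = ac X (ac Y x) * et"
  and a: "E * la Y = m * A E" and b: "E * ac Y (ra X) = m * E" and c: "E * ra Y = E * ac Y (la X)"
  and d: "la X * A et = ac X (ra Y) * et"
  and e: "ra X * ac X E * et = ac X idb" and f: "la Y * E * ac Y et = ac Y idb" shows "is_left_dual BB X Y"
proof -
 define K where "K = la X * A et"
 define ev where "ev = E * ts Y X"
 define coev where "coev = tq X Y * K"
 note T = tens_bim[OF X Y] tens_bim[OF Y X] and U = UU_bim
 have EM [simp]: "E : M" using homD(1)[OF E] .
 note [simp] = et(1)
 have KM [simp]: "K : M" using X by (simp add: K_def)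
 have obs: "ob (tens X Y) = tob X Y" "ob (tens Y X) = tob Y X" using X Y by (simp_all add: tens_ob)
 have et1: "ac X (ac Y idb) * et = et" using et(2)[of idb] by simp
 have Kl: "K * m = la X * A K"
 proof -
  have "K * m = (la X * m) * A (A et)" using X by (simp add: K_def assoc m_comm)
  thus ?thesis using X by (simp add: la_la[symmetric] K_def A_o assoc)
 qed
 have Kr: "K * m = ac X (ra Y) * K"
 proof -
  have "K * m = ac X (ra Y) * ac X (ac Y m) * et" by (simp add: K_def d assoc et(2))
  also have "... = ac X (ra Y * ra Y) * et" using X Y by (simp add: ra_ra act_o assoc)
  finally show ?thesis using X Y by (simp add: K_def d act_o assoc)
 qed
 have Kx: "K * A x = ac X (ac Y x) * K" if "x : M" for x
 proof -
  have "K * A x = la X * A (ac X (ac Y x)) * A et" using that X Y by (simp add: K_def assoc A_o[symmetric] et(2))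
  thus ?thesis using that X Y eq_tail[OF la_comm[OF X, of "ac Y x"]] by (simp add: K_def assoc)
 qed
 have K_hom: "K : homs (Some A) (ec (ob X) (ob Y))" using X Y Kx Kx[OF M_id] by (simp add: homs_def)
 have ev_hom: "ev : homs (tob Y X) (Some A)" and ev_tq: "ev * tq Y X = E" using factor_tq[OF Y X E c] by (simp_all add: ev_def)
 have evM: "ev : M" using homD(1)[OF ev_hom] .
 have ev_map: "ev : bmaps (tens Y X) UU"
 proof (rule bmapsI[OF T(2) U])
  show "ev : homs (ob (tens Y X)) (ob UU)" using ev_hom by (simp add: obs)
  have "ev * la (tens Y X) = m * A ev"
  proof (rule tq_cancel_A[OF Y X])
   show "(ev * la (tens Y X)) * A (tq Y X) = (m * A ev) * A (tq Y X)" using X Y evM by (simp add: assoc tens_la A_o[symmetric] ev_tq)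
     (simp add: assoc[symmetric] ev_tq a)
   show "(ev * la (tens Y X)) * A (act (tob Y X) idb) = ev * la (tens Y X)" using la_one'[OF T(2)] by (simp add: assoc obs)
   show "(m * A ev) * A (act (tob Y X) idb) = m * A ev" using X Y evM homD(3)[OF ev_hom] by (simp add: assoc A_o[symmetric])
  qed
  thus "ev * la (tens Y X) = la UU * A ev" by simp
  have "ev * ra (tens Y X) = m * ev"
  proof (rule tq_cancel[OF Y X])
   show "(ev * ra (tens Y X)) * tq Y X = (m * ev) * tq Y X" using X Y by (simp add: assoc tens_ra ev_tq) (simp add: assoc[symmetric] ev_tq b)
   show "(ev * ra (tens Y X)) * act (tob Y X) idb = ev * ra (tens Y X)" using ra_one'[OF T(2)] by (simp add: assoc obs)
   show "(m * ev) * act (tob Y X) idb = m * ev" using homD(3)[OF ev_hom] by (simp add: assoc)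
  qed
  thus "ev * ra (tens Y X) = ra UU * ev" by simp
 qed
 have coev_map: "coev : bmaps UU (tens X Y)"
 proof (rule bmapsI[OF U T(1)])
  show "coev : homs (ob UU) (ob (tens X Y))" unfolding coev_def obs using hom_o[OF tq_hom[OF X Y] K_hom] by simp
  have "coev * m = tq X Y * la X * A K" by (simp add: coev_def assoc Kl)
  also have "... = la (tens X Y) * A coev" using X Y by (simp add: coev_def A_o eq_tail[OF tens_la] assoc)
  finally show "coev * la UU = la (tens X Y) * A coev" by simp
  have "coev * m = tq X Y * ac X (ra Y) * K" by (simp add: coev_def assoc Kr)
  also have "... = ra (tens X Y) * coev" using X Y by (simp add: coev_def eq_tail[OF tens_ra] assoc)
  finally show "coev * ra UU = ra (tens X Y) * coev" by simp
 qed
 let ?zig = "run X * lwhisk BB X (tens Y X) UU ev * asc X Y X * rwhisk BB UU (tens X Y) X coev"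
 have zig: "?zig = lun X"
 proof (rule homs_cancel[OF U X])
  note l = lwhisk_props[OF X T(2) U ev_map] and r = rwhisk_props[OF U T(1) X coev_map]
   and s = asc_props[OF X Y X]
  show "?zig : homs (tob UU X) (ob X)"
   by (rule hom_o[OF run_hom[OF X] hom_o[OF l(3) hom_o[OF s(1) r(3)]]])
  show "lun X : homs (tob UU X) (ob X)" by (rule lun_hom[OF X])
  have "(?zig) * tq UU X
   = run X * lwhisk BB X (tens Y X) UU ev * (asc X Y X * tq (tens X Y) X * tq X Y) * K" by (simp add: assoc r(1)) (simp add: coev_def assoc)
  also have "... = run X * (lwhisk BB X (tens Y X) UU ev * tq X (tens Y X)) * ac X (tq Y X) * K" by (simp add: s(2) assoc)
  also have "... = (run X * tq X UU) * ac X (ev * tq Y X) * K" using X Y evM by (simp add: l(1) act_o assoc)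
  also have "... = (ra X * la X) * A (ac X E) * A et" using X by (simp add: run_tq ev_tq K_def assoc eq_tail[OF la_comm])
  also have "... = la X * A (ra X * ac X E * et)" using X by (simp add: ra_la A_o assoc)
  also have "... = lun X * tq UU X" using X by (simp add: e la_one' lun_tq)
  finally show "(?zig) * tq UU X
   = lun X * tq UU X" .
 qed
 let ?zag = "lun Y * rwhisk BB (tens Y X) UU Y ev * asc_inv Y X Y * lwhisk BB Y UU (tens X Y) coev"
 have zag: "?zag = run Y"
 proof (rule homs_cancel[OF Y U])
  note l = lwhisk_props[OF Y U T(1) coev_map] and r = rwhisk_props[OF T(2) U Y ev_map]
   and s = asc_inv_props[OF Y X Y]
  show "?zag : homs (tob Y UU) (ob Y)"
   by (rule hom_o[OF lun_hom[OF Y] hom_o[OF r(3) hom_o[OF s(1) l(3)]]])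
  show "run Y : homs (tob Y UU) (ob Y)" by (rule run_hom[OF Y])
  have "(?zag) * tq Y UU
   = lun Y * rwhisk BB (tens Y X) UU Y ev * (asc_inv Y X Y * tq Y (tens X Y) * ac Y (tq X Y)) * ac Y K"
   using X Y by (simp add: assoc l(1)) (simp add: coev_def act_o assoc)
  also have "... = lun Y * (rwhisk BB (tens Y X) UU Y ev * tq (tens Y X) Y) * tq Y X * ac Y K" by (simp add: s(2) assoc)
  also have "... = (lun Y * tq UU Y) * (ev * tq Y X) * ac Y K" by (simp add: r(1) assoc)
  also have "... = la Y * (E * ac Y (ac X (ra Y))) * ac Y et" using X Y by (simp add: lun_tq ev_tq K_def d act_o assoc)
  also have "... = (la Y * A (ra Y)) * E * ac Y et" using homD(2)[OF E, of "ra Y"] X Y by (simp add: assoc)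
  also have "... = ra Y * la Y * E * ac Y et" using Y by (simp add: ra_la[symmetric] assoc)
  also have "... = run Y * tq Y UU" using Y by (simp add: f ra_one' run_tq)
  finally show "(?zag) * tq Y UU
   = run Y * tq Y UU" .
 qed
 have inv: "inv_mor BB (tens (tens Y X) Y) (tens Y (tens X Y)) (asc Y X Y) = asc_inv Y X Y"
  by (rule inv_mor_BB_unique[OF _ _ asc_is_inverse[OF Y X Y]]) (use X Y in simp_all)
 show ?thesis unfolding is_left_dual_def using X Y ev_map coev_map zig zag by (intro exI[of _ ev] exI[of _ coev]) (simp add: BB_Asc run_eq lun_eq inv)
qed

text \<open>The dual of the underlying object receives its right action by transposing the left
  action on \<open>X\<close>. Transposing the right action on \<open>X\<close> gives a coaction
  instead, which the Frobenius form \<open>ep * m\<close> turns into a left action.\<close>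

lemma bimodule_left_dual:
 assumes X: "bim X" shows "EX YY. bim YY & is_left_dual BB X YY"
proof -
 obtain Y ev et where Y [simp]: "Y : Obj" and M [simp]: "ev : M" "et : M"
  and ev: "!!x. x : M ==> ev * act Y (ac X x) = x * ev"
  and et: "!!x. x : M ==> et * x = ac X (act Y x) * et"
  and z: "ac X ev * et = ac X idb" "ev * act Y et = act Y idb" using plain_left_dual[OF bim_ob[OF X]] by blast
 note [simp] = X
 let ?l = "la X" and ?r = "ra X" and ?X = "ac X"
 \<comment> \<open>A map \<open>Y A -> Y\<close>: create \<open>X Y\<close>, let \<open>A\<close>
   act on this \<open>X\<close>, and evaluate it against the given \<open>Y\<close>.\<close>
 define rY where "rY = ev * act Y (?l * A et)"
 \<comment> \<open>The pairing \<open>Y X -> A\<close>: of the two factors created by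
   \<open>dl\<close>, one acts on \<open>X\<close> and the other is the value. Its composite with
   the counit is \<open>ev\<close>.\<close>
 define E where "E = ev * act Y (?r * ?X dl)"
 \<comment> \<open>The coaction \<open>Y -> A Y\<close> corresponding to the pairing
   \<open>E\<close>.\<close>
 define G where "G = E * act Y et"
 define lY where "lY = ep * m * A G"
 have M' [simp]: "rY : M" "E : M" "G : M" "lY : M" by (simp_all add: rY_def E_def G_def lY_def)
 have ev': "x * ev * act Y y = ev * act Y (?X x * y)" if "x : M" "y : M" for x y using that by (simp add: act_o eq_tail[OF ev] assoc)
 have X1: "?X idb * ?l = ?l" "?X idb * ?r = ?r" by (simp_all add: la_one ra_one)
 have l_slide: "?X x * ?l * y = ?l * A (?X x) * y" if "x : M" for x y by (simp only: assoc[symmetric] la_comm[OF X that])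
 have r_slide: "?X x * ?r * y = ?r * ?X (A x) * y" if "x : M" for x y by (simp only: assoc[symmetric] ra_comm[OF X that])
 have E1: "ev * act Y (?X idb) = ev" using ev[of idb] by simp
 have rY_comm: "rY * act Y (A x) = act Y x * rY" if "x : M" for x
 proof -
  have "rY * act Y (A x) = ev * act Y (?l * A (et * x))" using that by (simp add: rY_def assoc act_o A_o)
  also have "... = ev * act Y (?X (act Y x) * ?l * A et)" using that by (simp add: et A_o l_slide)
  finally show ?thesis using that by (simp add: ev'[symmetric] rY_def assoc)
 qed
 have ev1: "act Y idb * rY = rY" using rY_comm[of idb] by (simp add: rY_def assoc act_o[symmetric])
 have k1: "?X rY * et = ?l * A et"
 proof -
  have "?X rY * et = (?X ev * et) * ?l * A et" by (simp add: rY_def act_o assoc et)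
  thus ?thesis by (simp add: z assoc[symmetric] X1)
 qed
 have k2: "ev * rY = ev * act Y ?l"
 proof -
  have "ev * rY = ev * act Y (?X ev * ?l * A et)" by (simp add: rY_def ev')
  also have "... = ev * act Y (?l * A (?X ev * et))" by (simp add: l_slide A_o)
  finally show ?thesis by (simp add: z la_one')
 qed
 have E_comm: "E * act Y (?X x) = A x * E" if "x : M" for x
 proof -
  have "E * act Y (?X x) = ev * act Y (?r * ?X (dl * x))" using that by (simp add: E_def assoc act_o)
  also have "... = ev * act Y (?X (A x) * ?r * ?X dl)" using that by (simp add: dl_comm act_o r_slide)
  finally show ?thesis using that by (simp add: ev'[symmetric] E_def assoc)
 qed
 have E': "A x * E * act Y y = E * act Y (?X x * y)" if "x : M" "y : M" for x y using that by (simp add: act_o eq_tail[OF E_comm] assoc)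
 have G_comm: "G * act Y x = A (act Y x) * G" if "x : M" for x using that by (simp add: G_def assoc act_o[symmetric] et) (simp add: E')
 have k3: "?X E * et = ?r * ?X dl"
 proof -
  have "?X E * et = (?X ev * et) * ?r * ?X dl" by (simp add: E_def act_o assoc et)
  thus ?thesis by (simp add: z assoc[symmetric] X1)
 qed
 have rr: "?r * ?X dl * ?r = ?r * ?X De"
 proof -
  have "?r * ?X dl * ?r = (?r * ?r) * ?X (A dl)" by (simp add: assoc ra_comm)
  thus ?thesis by (simp add: ra_ra De_def act_o assoc)
 qed
 have r_slide2: "?X x * ?r * ?X y = ?r * ?X (A x * y)" if "x : M" "y : M" for x y using that by (simp add: r_slide act_o)
 have EG: "A x * E = ev * act Y (?r * ?X (A (A x) * dl))" if "x : M" for x using that by (simp add: E_def ev' r_slide2)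
 have DeE: "De * E = ev * act Y (?r * ?X (De * dl))" by (simp add: E_def ev' r_slide2 coassoc)
 have k6: "A E * G = De * E"
 proof -
  have "A E * G = (A E * E) * act Y et" by (simp add: G_def assoc)
  also have "... = ev * act Y (?r * ?X (dl * E) * et)" by (simp add: EG dl_comm act_o assoc)
  also have "... = ev * act Y (?r * ?X dl * ?X E * et)" by (simp add: act_o assoc)
  also have "... = ev * act Y ((?r * ?X dl * ?r) * ?X dl)" by (simp add: k3 assoc)
  finally show ?thesis by (simp add: rr DeE act_o assoc)
 qed
 \<comment> \<open>Coassociativity of the coaction, from which the module law of \<open>lY\<close>
   will follow.\<close>
 have k5: "A G * G = De * G"
 proof -
  have "A G * G = A E * A (act Y et) * G" by (simp add: G_def A_o assoc)
  also have "... = (A E * G) * act Y et" by (simp add: G_comm assoc)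
  finally show ?thesis by (simp only: k6 assoc G_def[symmetric])
 qed
 have k7: "ep * G = act Y idb"
 proof -
  have "ep * E = ev * act Y (?r * ?X (A ep * dl))" by (simp add: E_def ev' r_slide2)
  hence "ep * E = ev" by (simp add: counit_dl ra_u E1)
  hence "(ep * E) * act Y et = act Y idb" by (simp add: z)
  thus ?thesis by (simp add: G_def assoc)
 qed
 have k8: "lY * G = act Y idb"
 proof -
  have "lY * G = ep * (m * De) * G" by (simp add: lY_def assoc k5)
  thus ?thesis by (simp add: m_De k7)
 qed
 have eps_slide: "x * ep * m * A y = ep * m * A (A x * y)" if "x : M" "y : M" for x y
 proof -
  have "ep * m * A (A x * y) = (ep * A x) * m * A y" using that by (simp add: A_o assoc eq_tail[OF m_comm])
  thus ?thesis using that by (simp add: ep_comm assoc)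
 qed
 \<comment> \<open>The Frobenius form undoes a comultiplication up to a multiplication; this
   converts identities for the coaction \<open>G\<close> into identities for the action
   \<open>lY\<close>.\<close>
 have Frob: "ep * m * A (De * x) = m * A x" if "x : M" for x
 proof -
  have "ep * m * A (De * x) = (ep * De) * m * A x" using that by (simp add: A_o eq_tail[OF De_m_left] assoc)
  thus ?thesis by (simp add: counit)
 qed
 have k9: "G * lY = m * A G" by (simp add: lY_def eps_slide k5 Frob)
 have k10: "E * lY = m * A E" by (simp add: lY_def eps_slide k6 Frob)
 have k11: "E * rY = E * act Y ?l"
 proof -
  have "E * rY = (ev * rY) * act Y (A (?r * ?X dl))" by (simp add: E_def assoc rY_comm)
  also have "... = ev * act Y ((?l * A ?r) * A (?X dl))" by (simp add: k2 act_o A_o assoc)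
  also have "... = ev * act Y (?r * ?X dl * ?l)" by (simp add: ra_la[symmetric] assoc la_comm)
  finally show ?thesis by (simp add: E_def act_o assoc)
 qed
 have k12: "E * act Y ?r = m * E"
 proof -
  have "E * act Y ?r = ev * act Y (?r * ?X dl * ?r)" by (simp add: E_def act_o assoc)
  also have "... = ev * act Y (?X m * ?r * ?X dl)" by (simp add: rr De_eq act_o[of "ob X"] r_slide)
  finally show ?thesis by (simp add: E_def ev')
 qed
 have k13: "G * rY = A rY * G"
 proof -
  have "G * rY = (E * rY) * act Y (A et)" by (simp add: G_def assoc rY_comm)
  also have "... = E * act Y (?X rY * et)" by (simp add: k11 k1 act_o assoc)
  finally show ?thesis by (simp add: E'[symmetric] G_def)
 qed
 let ?YY = "(Y, lY, rY)"
 have bim: "bim ?YY" unfolding bim_iff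
 proof (intro conjI)
  have l1: "act Y idb * lY = lY" and lc: "!!x. x : M ==> lY * A (act Y x) = act Y x * lY"
  proof -
   show lc: "lY * A (act Y x) = act Y x * lY" if "x : M" for x
   proof -
    have "lY * A (act Y x) = ep * m * A (G * act Y x)" using that by (simp add: lY_def A_o assoc)
    thus ?thesis using that by (simp add: G_comm eps_slide[symmetric] lY_def)
   qed
   have "G * act Y idb = G" by (simp add: G_def assoc act_o[symmetric])
   hence "lY * A (act Y idb) = lY" by (simp add: lY_def assoc A_o[symmetric])
   thus "act Y idb * lY = lY" using lc[of idb] by simp
  qed
  thus "lY : homs (ec (Some A) Y) Y" using lc[of idb] by (simp add: homs_def)
  show "rY : homs (ec Y (Some A)) Y" using rY_comm rY_comm[of idb] ev1 by (simp add: homs_def)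
  have "lY * A y = ep * m * A (G * y)" if "y : M" for y using that by (simp add: lY_def A_o assoc)
  hence "lY * A lY = ep * m * A (G * lY)" by simp
  also have "... = ep * (m * A m) * A (A G)" by (simp add: k9 A_o assoc)
  also have "... = lY * m" by (simp add: m_assoc lY_def assoc m_comm)
  finally show "lY * m = lY * A lY" by simp
  have "lY * u = ep * (m * u) * G" by (simp add: lY_def assoc u_comm)
  thus "lY * u = act Y idb" by (simp add: m_unit_left k7)
  have "rY * rY = ev * act Y (?X rY * ?l * A et)" using ev'[of rY "?l * A et"] by (simp add: rY_def[symmetric])
  also have "... = ev * act Y (?l * A (?X rY * et))" by (simp add: l_slide A_o)
  also have "... = ev * act Y ((?l * A ?l) * A (A et))" by (simp add: k1 A_o assoc)
  also have "... = rY * act Y m" by (simp add: la_la rY_def act_o assoc m_comm)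
  finally show "rY * rY = rY * act Y m" .
  have "rY * act Y u = ev * act Y (?l * A et * u)" by (simp add: rY_def assoc act_o)
  also have "... = ev * act Y ((?l * u) * et)" by (simp add: u_comm assoc)
  also have "... = (ev * act Y (?X idb)) * act Y et" by (simp add: la_u act_o assoc)
  also have "... = ev * act Y et" by (simp add: E1)
  finally show "rY * act Y u = act Y idb" by (simp add: z)
  show "rY * lY = lY * A rY" by (simp add: lY_def eps_slide k13[symmetric] A_o assoc)
 qed simp
 have "is_left_dual BB X ?YY"
 proof (rule left_dualI[OF X bim])
  show "E : homs (ec (ob ?YY) (ob X)) (Some A)" using E_comm E_comm[of idb] by (simp add: homs_def)
  show "?r * ?X E * et = ?X idb"
  proof -
   have "?r * ?X E * et = (?r * ?r) * ?X dl" by (simp add: k3 assoc)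
   also have "... = ?r * ?X (m * dl)" by (simp add: ra_ra act_o assoc)
   finally show ?thesis by (simp add: dl_section ra_u)
  qed
  show "la ?YY * E * ac ?YY et = ac ?YY idb" using k8 by (simp add: G_def)
 qed (simp_all add: et k10 k11 k12 k1)
 with bim show ?thesis by blast
qed

text \<open>The mirror image of the left dual: now the right action on \<open>X\<close> is
  transposed directly, and the left action passes through a coaction \<open>Y -> Y A\<close> and the
  Frobenius form.\<close>

lemma bimodule_right_dual:
 assumes X: "bim X" shows "EX YY. bim YY & is_left_dual BB YY X"
proof -
 obtain Y ev et where Y [simp]: "Y : Obj" and M [simp]: "ev : M" "et : M"
  and ev: "!!x. x : M ==> ev * ac X (act Y x) = x * ev"
  and et: "!!x. x : M ==> et * x = act Y (ac X x) * et"
  and z: "act Y ev * et = act Y idb" "ev * ac X et = ac X idb" using plain_right_dual[OF bim_ob[OF X]] by blast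
 note [simp] = X
 let ?l = "la X" and ?r = "ra X" and ?X = "ac X"
 define lY where "lY = act Y (ev * ?r) * et"
 define E where "E = A (ev * ?l) * dl"
 define G where "G = act Y E * et"
 define rY where "rY = act Y (ep * m) * G"
 have M' [simp]: "rY : M" "E : M" "G : M" "lY : M" by (simp_all add: rY_def E_def G_def lY_def)
 have et': "act Y y * et * x = act Y (y * ?X x) * et" if "x : M" "y : M" for x y using that by (simp add: et act_o assoc)
 have dl': "A y * dl * x = A (y * A x) * dl" if "x : M" "y : M" for x y using that by (simp add: dl_comm A_o assoc)
 have ev': "ev * ?X (act Y x * y) = x * ev * ?X y" if "x : M" "y : M" for x y using that by (simp add: act_o eq_tail[OF ev] assoc)
 have E1: "ev * ?X idb = ev"
 proof -
  have "ev * ?X idb = (ev * ?X (act Y idb)) * ?X idb" by (simp add: ev)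
  also have "... = ev * ?X (act Y idb)" by (simp add: assoc act_o[symmetric])
  finally show ?thesis by (simp add: ev)
 qed
 have lY_mult: "lY * A x = act Y (ev * ?X x * ?r) * et" if "x : M" for x using that by (simp add: lY_def assoc et' ra_comm)
 have lY_comm: "lY * A (act Y x) = act Y x * lY" if "x : M" for x
 proof -
  have "lY * A (act Y x) = act Y ((ev * ?X (act Y x)) * ?r) * et" using that by (simp add: lY_mult assoc)
  thus ?thesis using that by (simp add: ev lY_def act_o assoc)
 qed
 have E_mult: "E * ?X x = A (ev * ?X x * ?l) * dl" if "x : M" for x using that by (simp add: E_def assoc dl' la_comm)
 have E_comm: "E * ?X (act Y x) = A x * E" if "x : M" for x
 proof -
  have "E * ?X (act Y x) = A ((ev * ?X (act Y x)) * ?l) * dl" using that by (simp add: E_mult assoc)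
  thus ?thesis using that by (simp add: ev E_def A_o assoc)
 qed
 have E': "E * ?X (act Y x * y) = A x * E * ?X y" if "x : M" "y : M" for x y using that by (simp add: act_o eq_tail[OF E_comm] assoc)
 have G_mult: "act Y y * G * act Y x = act Y (y * A x) * G" if "x : M" "y : M" for x y
 proof -
  have "act Y y * G * act Y x = act Y y * act Y (E * ?X (act Y x)) * et" using that by (simp add: G_def assoc et')
  thus ?thesis using that by (simp add: E_comm G_def act_o assoc)
 qed
 have XX1: "?X idb * ?r = ?r" "?X idb * ?l = ?l" by (simp_all add: ra_one la_one)
 have h1: "lY * A et = act Y ?r * et" by (simp add: lY_mult eq_tail[OF z(2)] XX1)
 have h2: "ev * ?X lY = ev * ?r" unfolding lY_def by (simp add: ev' z assoc ra_one')
 have h3: "E * ?X et = A ?l * dl" by (simp add: E_mult eq_tail[OF z(2)] XX1)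
 have h4: "E * ?l = m * A E"
 proof -
  have "E * ?l = A (ev * ?l * m) * dl" by (simp add: E_def assoc dl' la_la)
  also have "... = A (ev * ?l) * De" by (simp add: De_eq A_o assoc)
  also have "... = m * A E" by (simp add: De_def E_def A_o[of "A _"] eq_tail[OF m_comm] assoc)
  finally show ?thesis .
 qed
 have h5: "E * ?r = E * ?X lY"
 proof -
  have "E * ?r = A (ev * ?l * A ?r) * dl" by (simp add: E_def assoc dl')
  also have "... = E * ?X lY" by (simp add: E_mult eq_tail[OF h2] ra_la assoc)
  finally show ?thesis .
 qed
 have h6: "E * ?X G = De * E"
 proof -
  have "E * ?X G = A (E * ?l) * dl" by (simp add: G_def E' h3 A_o assoc)
  also have "... = A m * dl * E" by (simp add: h4 dl')
  finally show ?thesis by (simp add: De_eq assoc)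
 qed
 have h7: "G * G = act Y De * G"
 proof -
  have "G * x = act Y (E * ?X x) * et" if "x : M" for x using that by (simp add: G_def assoc et')
  hence "G * G = act Y (De * E) * et" by (simp add: h6)
  thus ?thesis by (simp only: act_o Y De_in M' assoc G_def[symmetric])
 qed
 have h8: "act Y ep * G = act Y idb"
 proof -
  have "ep * E = ev * (?l * u)" by (simp add: E_def eq_tail[OF ep_comm] counit_dl assoc)
  hence "act Y (ep * E) * et = act Y idb" by (simp add: la_u E1 z)
  thus ?thesis by (simp add: G_def act_o assoc)
 qed
 have h9: "rY * G = act Y idb"
 proof -
  have "rY * G = act Y (ep * (m * De)) * G" by (simp add: rY_def assoc h7 act_o)
  thus ?thesis by (simp add: m_De h8)
 qed
 have Frob: "A (ep * m) * De = m"
 proof -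
  have "A (ep * m) * De = (A ep * De) * m" by (simp add: A_o assoc De_m_right)
  thus ?thesis by (simp add: counit)
 qed
 have G_one: "act Y idb * G = G" by (simp add: G_def assoc[symmetric] act_o[symmetric])
 have h10: "G * rY = act Y m * G"
 proof -
  have "G * rY = (act Y idb * G * act Y (ep * m)) * G" by (simp add: G_one eq_tail[OF G_one] rY_def assoc)
  also have "... = act Y (A (ep * m)) * G * G" by (simp add: G_mult assoc)
  also have "... = act Y (A (ep * m) * De) * G" by (simp add: h7 act_o assoc)
  finally show ?thesis by (simp add: Frob)
 qed
 have h11: "E * ?X rY = m * E"
 proof -
  have "E * ?X rY = (A (ep * m) * De) * E" by (simp add: rY_def E' h6 assoc)
  thus ?thesis by (simp add: Frob)
 qed
 have h12: "G * lY = lY * A G"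
 proof -
  have evG: "ev * ?X G = E" by (simp add: G_def ev' z E_mult XX1 E_def[symmetric])
  have "G * lY = act Y (E * ?r) * et" by (simp add: G_def assoc et' h5)
  also have "... = lY * A G" by (simp add: lY_mult eq_tail[OF evG])
  finally show ?thesis .
 qed
 let ?YY = "(Y, lY, rY)"
 have bim: "bim ?YY" unfolding bim_iff
 proof (intro conjI)
  show "lY : homs (ec (Some A) Y) Y" using lY_comm lY_comm[of idb] by (simp add: homs_def) (simp add: lY_def assoc[symmetric] act_o[symmetric])
  have rY_comm: "rY * act Y (A x) = act Y x * rY" if "x : M" for x
  proof -
   have "rY * act Y (A x) = act Y ((ep * A x) * m) * G" using that by (simp add: rY_def assoc G_mult m_comm)
   thus ?thesis using that by (simp add: ep_comm rY_def act_o assoc)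
  qed
  show "rY : homs (ec Y (Some A)) Y" using rY_comm rY_comm[of idb] by (simp add: homs_def) (simp add: rY_def assoc[symmetric] act_o[symmetric])
  have "lY * A lY = act Y (ev * ?r * ?r) * et" by (simp add: lY_mult eq_tail[OF h2] assoc)
  also have "... = lY * m" by (simp add: ra_ra lY_def assoc et')
  finally show "lY * m = lY * A lY" by simp
  show "lY * u = act Y idb" by (simp add: lY_def assoc et' ra_u E1 z)
  have "rY * rY = act Y (ep * m) * G * rY" by (subst (1) rY_def) (simp only: assoc)
  also have "... = act Y (ep * m * m) * G" by (simp add: h10 act_o assoc)
  also have "... = rY * act Y m" by (simp add: rY_def assoc G_mult m_assoc)
  finally show "rY * rY = rY * act Y m" .
  show "rY * act Y u = act Y idb" by (simp add: rY_def assoc G_mult m_unit_right h8)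
  have "rY * lY = act Y (ep * m) * lY * A G" by (simp add: rY_def assoc h12)
  also have "... = lY * A rY" by (simp add: rY_def A_o eq_tail[OF lY_comm] assoc)
  finally show "rY * lY = lY * A rY" .
 qed simp
 have "is_left_dual BB ?YY X"
 proof (rule left_dualI[OF bim X])
  show "E : homs (ec (ob X) (ob ?YY)) (Some A)" using E_comm E_comm[of idb] by (simp add: homs_def)
  show "?l * E * ?X et = ?X idb"
  proof -
   have "?l * E * ?X et = (?l * m) * dl" by (simp add: h3 la_la[symmetric] assoc)
   thus ?thesis by (simp add: assoc dl_section la_u)
  qed
  show "ra ?YY * ac ?YY E * et = ac ?YY idb" using h9 by (simp add: G_def)
 qed (simp_all add: et h1 h4 h5 h11)
 with bim show ?thesis by blast
qed

theorem bimodule_fusion: "fusion_category BB"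
proof (intro fusion_category.intro bimodule_linear_monoidal fusion_category_axioms.intro)
 show "EX Y:Ob BB. EX r:Mor BB X Y. EX s:Mor BB Y X. Cmp BB r s = Idm BB Y & Cmp BB s r = e" if X: "X : Ob BB" and e: "e : Mor BB X X" "Cmp BB e e = e" for X e
 proof -
  have e': "bim X" "e : bmaps X X" "e * e = e" using X e by simp_all
  obtain YY r s where "bim YY" "r : bmaps X YY" "s : bmaps YY X" "r * s = ac YY idb" "s * r = e" by (rule bimodule_splitting[OF e'])
  thus ?thesis by (intro bexI[of _ YY] bexI[of _ r] bexI[of _ s]) (simp_all add: BB_Idm)
 qed
 show "EX Y:Ob BB. is_left_dual BB X Y" "EX Y:Ob BB. is_left_dual BB Y X" if "X : Ob BB" for X
  using that bimodule_left_dual[of X] bimodule_right_dual[of X] unfolding BB_simps by blast+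
 show "simple_object BB (Unt BB)" using bimodule_simple_unit by simp
qed (rule bimodule_additive bimodule_semisimple, assumption?)+

end

section \<open>Independence of the chosen relative tensor products\<close>

lemma (in linear_category) iso_compose:
 assumes o: "X : Ob C" "Y : Ob C" "Z : Ob C" and f: "is_iso C X Y f" and g: "is_iso C Y Z g" shows "is_iso C X Z (g \<cdot> f)"
proof -
 obtain f' g' where *: "f : Mor C X Y" "f' : Mor C Y X" "f' \<cdot> f = Idm C X" "f \<cdot> f' = Idm C Y"
  "g : Mor C Y Z" "g' : Mor C Z Y" "g' \<cdot> g = Idm C Y" "g \<cdot> g' = Idm C Z" using f g by (auto simp: is_iso_def is_inverse_def)
 have "(f' \<cdot> g') \<cdot> (g \<cdot> f) = f' \<cdot> ((g' \<cdot> g) \<cdot> f)" "(g \<cdot> f) \<cdot> (f' \<cdot> g') = g \<cdot> ((f \<cdot> f') \<cdot> g')"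
  using o * Cmp_in[of X Y Z f g] Cmp_in[of Z Y X g' f'] Cmp_assoc[of X Z Y X "g \<cdot> f" g' f'] Cmp_assoc[of X Y Z Y f g g']
   Cmp_assoc[of Z Y X Z "f' \<cdot> g'" f g] Cmp_in[of X Y Z "f" g] Cmp_assoc[of Z Y X Y g' f' f]
   Cmp_assoc[of Z X Y Z "f' \<cdot> g'" f g] by simp_all
 moreover have "f' \<cdot> (Idm C Y \<cdot> f) = Idm C X" "g \<cdot> (Idm C Y \<cdot> g') = Idm C Z"
  using o * by (simp_all add: Cmp_Idm_left[of X Y] Cmp_Idm_left[of Z Y])
 ultimately have "is_inverse C X Z (g \<cdot> f) (f' \<cdot> g')" unfolding is_inverse_def using * o Cmp_in[of X Y Z f g] Cmp_in[of Z Y X g' f'] by simp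
 thus ?thesis by (auto simp: is_iso_def)
qed

lemma (in tensor_equivalence) FM_iso:
 assumes "X : Ob C" "Y : Ob C" "is_iso C X Y f" shows "is_iso D (FO X) (FO Y) (FM X Y f)"
proof -
 obtain g where g: "f : Mor C X Y" "g : Mor C Y X" "g \<cdot>\<^bsub>C\<^esub> f = Idm C X" "f \<cdot>\<^bsub>C\<^esub> g = Idm C Y"
  using assms(3) by (auto simp: is_iso_def is_inverse_def)
 hence "is_inverse D (FO X) (FO Y) (FM X Y f) (FM Y X g)" unfolding is_inverse_def using FM_Cmp[OF assms(1,2,1) g(1,2)] FM_Cmp[OF assms(2,1,2) g(2,1)] FM_Idm assms
   bij_betw_apply[OF FM_bij[OF assms(1,2)] g(1)] bij_betw_apply[OF FM_bij[OF assms(2,1)] g(2)] by simp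
 thus ?thesis by (auto simp: is_iso_def)
qed

text \<open>Associativity of the composition in \<open>D\<close> is required for all elements of the ambient group, which
 saves checking that they are composable.\<close>

lemma tensor_equivalence_transport:
 fixes C C' :: "('o, 'm::ab_group_add) moncat" and D :: "('p, 'n::ab_group_add) moncat" (structure)
 assumes C: "linear_monoidal_category C" and D: "linear_monoidal_category D"
  and D_assoc: "!!f g h. (f \<cdot> g) \<cdot> h = f \<cdot> g \<cdot> h"
  and eq: "Ob C' = Ob C" "!!X Y. X : Ob C ==> Y : Ob C ==> Mor C' X Y = Mor C X Y"
   "Cmp C' = Cmp C" "!!X. X : Ob C ==> Idm C' X = Idm C X" "Scl C' = Scl C" "Unt C' = Unt C"
  and ten: "!!X Y. X : Ob C ==> Y : Ob C ==> X \<odot>\<^bsub>C'\<^esub> Y : Ob C"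
  and ka: "!!X Y. X : Ob C ==> Y : Ob C ==> is_iso C (TenO C X Y) (TenO C' X Y) (ka X Y)"
  and ka_natural: "!!X X' Y Y' f g. [|X : Ob C; X' : Ob C; Y : Ob C; Y' : Ob C; f : Mor C X X'; g : Mor C Y Y'|]
   ==> TenM C' X X' Y Y' f g : Mor C (TenO C' X Y) (TenO C' X' Y') &
    TenM C' X X' Y Y' f g \<cdot>\<^bsub>C\<^esub> ka X Y = ka X' Y' \<cdot>\<^bsub>C\<^esub> TenM C X X' Y Y' f g"
  and ka_assoc: "!!X Y Z. [|X : Ob C; Y : Ob C; Z : Ob C|]
   ==> Asc C' X Y Z : Mor C ((TenO C' X Y) \<odot>\<^bsub>C'\<^esub> Z) (X \<odot>\<^bsub>C'\<^esub> Y \<odot>\<^bsub>C'\<^esub> Z) &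
    Asc C' X Y Z \<cdot>\<^bsub>C\<^esub> ka (TenO C' X Y) Z \<cdot>\<^bsub>C\<^esub> rwhisk C (TenO C X Y) (TenO C' X Y) Z (ka X Y)
     = ka X (TenO C' Y Z) \<cdot>\<^bsub>C\<^esub> lwhisk C X (TenO C Y Z) (TenO C' Y Z) (ka Y Z) \<cdot>\<^bsub>C\<^esub> Asc C X Y Z"
  and ka_unit: "!!X. X : Ob C ==> LUn C' X : Mor C (TenO C' (Unt C) X) X & LUn C' X \<cdot>\<^bsub>C\<^esub> ka (Unt C) X = LUn C X"
   "!!X. X : Ob C ==> RUn C' X : Mor C (TenO C' X (Unt C)) X & RUn C' X \<cdot>\<^bsub>C\<^esub> ka X (Unt C) = RUn C X"
  and F: "tensor_equivalence C D FO FM J e" shows "tensor_equivalence C' D FO FM (%X Y. FM (TenO C X Y) (TenO C' X Y) (ka X Y) \<cdot> J X Y) e"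
proof -
 interpret C: linear_monoidal_category C by fact
 interpret D: linear_monoidal_category D by fact
 interpret F: tensor_equivalence C D FO FM J e by fact
 note o = C.TenO_in ten C.Unt_in F.FO_in D.TenO_in D.Unt_in
 have FM_in: "FM X Y f : Mor D (FO X) (FO Y)" if "X : Ob C" "Y : Ob C" "f : Mor C X Y" for X Y f using bij_betw_apply[OF F.FM_bij[OF that(1,2)] that(3)] .
 have ka_in: "ka X Y : Mor C (TenO C X Y) (TenO C' X Y)" if "X : Ob C" "Y : Ob C" for X Y using ka[OF that] by (auto simp: is_iso_def is_inverse_def)
 have J_in: "J X Y : Mor D (FO X \<odot> FO Y) (FO (TenO C X Y))" if "X : Ob C" "Y : Ob C" for X Y using F.J_iso[OF that] by (auto simp: is_iso_def is_inverse_def)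
 have e_in: "e : Mor D (Unt D) (FO (Unt C))" using F.e_iso by (auto simp: is_iso_def is_inverse_def)
 have asc_in: "Asc C X Y Z : Mor C ((TenO C X Y) \<odot>\<^bsub>C\<^esub> Z) (X \<odot>\<^bsub>C\<^esub> Y \<odot>\<^bsub>C\<^esub> Z)"
  if "X : Ob C" "Y : Ob C" "Z : Ob C" for X Y Z using C.Asc_iso[OF that] by (auto simp: is_iso_def is_inverse_def)
 have asc_D: "Asc D X Y Z : Mor D ((X \<odot> Y) \<odot> Z) (X \<odot> Y \<odot> Z)"
  if "X : Ob D" "Y : Ob D" "Z : Ob D" for X Y Z using D.Asc_iso[OF that] by (auto simp: is_iso_def is_inverse_def)
 have rw: "rwhisk D U W (FO Z) (g \<cdot> f) = rwhisk D V W (FO Z) g \<cdot> rwhisk D U V (FO Z) f"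
  if "U : Ob D" "V : Ob D" "W : Ob D" "Z : Ob C" "f : Mor D U V" "g : Mor D V W" for U V W Z f g
  using D.TenM_Cmp[of U V W "FO Z" "FO Z" "FO Z" f g "Idm D (FO Z)" "Idm D (FO Z)"] that o D.Idm_in by (simp add: rwhisk_def D.Cmp_Idm_left[of "FO Z" "FO Z"])
 have lw: "lwhisk D (FO Z) U W (g \<cdot> f) = lwhisk D (FO Z) V W g \<cdot> lwhisk D (FO Z) U V f"
  if "U : Ob D" "V : Ob D" "W : Ob D" "Z : Ob C" "f : Mor D U V" "g : Mor D V W" for U V W Z f g
  using D.TenM_Cmp[of "FO Z" "FO Z" "FO Z" U V W "Idm D (FO Z)" "Idm D (FO Z)" f g] that o D.Idm_in by (simp add: lwhisk_def D.Cmp_Idm_left[of "FO Z" "FO Z"])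
 have Jr: "J X' Z \<cdot> rwhisk D (FO X) (FO X') (FO Z) (FM X X' f)
   = FM (TenO C X Z) (TenO C X' Z) (rwhisk C X X' Z f) \<cdot> J X Z" if "X : Ob C" "X' : Ob C" "Z : Ob C" "f : Mor C X X'" for X X' Z f
  using F.J_natural[of X X' Z Z f "Idm C Z"] that C.Idm_in by (simp add: rwhisk_def F.FM_Idm)
 have Jl: "J Z X' \<cdot> lwhisk D (FO Z) (FO X) (FO X') (FM X X' f)
   = FM (TenO C Z X) (TenO C Z X') (lwhisk C Z X X' f) \<cdot> J Z X" if "X : Ob C" "X' : Ob C" "Z : Ob C" "f : Mor C X X'" for X X' Z f
  using F.J_natural[of Z Z X X' "Idm C Z" f] that C.Idm_in by (simp add: lwhisk_def F.FM_Idm)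
 have rw_in: "rwhisk C X X' Z f : Mor C (TenO C X Z) (TenO C X' Z)"
  and lw_in: "lwhisk C Z X X' f : Mor C (TenO C Z X) (TenO C Z X')" if "X : Ob C" "X' : Ob C" "Z : Ob C" "f : Mor C X X'" for X X' Z f
  using that C.Idm_in C.TenM_in by (simp_all add: rwhisk_def lwhisk_def)
 have FM3: "FM X Y f \<cdot> FM W X g \<cdot> h = FM W Y (f \<cdot>\<^bsub>C\<^esub> g) \<cdot> h"
  if "W : Ob C" "X : Ob C" "Y : Ob C" "g : Mor C W X" "f : Mor C X Y" for W X Y f g h using F.FM_Cmp[OF that] by (simp add: D_assoc)
 show ?thesis
 proof (unfold_locales; (unfold eq(1,3,5,6))?)
  fix X Y assume X: "X : Ob C" and Y: "Y : Ob C"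
  show "is_iso D (FO X \<odot> FO Y) (FO (TenO C' X Y)) (FM (TenO C X Y) (TenO C' X Y) (ka X Y) \<cdot> J X Y)"
   using X Y o by (intro D.iso_compose[OF _ _ _ F.J_iso[OF X Y] F.FM_iso[OF _ _ ka[OF X Y]]]) auto
 next
  fix X X' Y Y' f g
  assume X: "X : Ob C" "X' : Ob C" and Y: "Y : Ob C" "Y' : Ob C" and f: "f : Mor C' X X'" and g: "g : Mor C' Y Y'"
  have fg: "f : Mor C X X'" "g : Mor C Y Y'" using f g X Y by (simp_all add: eq)
  note n = ka_natural[OF X Y fg]
  let ?t = "FM (TenO C' X Y) (TenO C' X' Y') (TenM C' X X' Y Y' f g)"
   and ?k = "FM (TenO C X Y) (TenO C' X Y) (ka X Y)"
   and ?k' = "FM (TenO C X' Y') (TenO C' X' Y') (ka X' Y')"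
  have "?t \<cdot> ?k \<cdot> J X Y
   = FM (TenO C X Y) (TenO C' X' Y') (ka X' Y' \<cdot>\<^bsub>C\<^esub> TenM C X X' Y Y' f g) \<cdot> J X Y" using X Y n by (simp add: FM3 o ka_in)
  also have "... = ?k' \<cdot> FM (TenO C X Y) (TenO C X' Y') (TenM C X X' Y Y' f g) \<cdot> J X Y"
   using X Y fg by (simp add: FM3 o ka_in C.TenM_in)
  finally show "?t \<cdot> ?k \<cdot> J X Y
   = (?k' \<cdot> J X' Y') \<cdot> TenM D (FO X) (FO X') (FO Y) (FO Y') (FM X X' f) (FM Y Y' g)"
   using F.J_natural[OF X Y fg] by (simp add: D_assoc)
 next
  fix X Y Z assume X: "X : Ob C" and Y: "Y : Ob C" and Z: "Z : Ob C"
  let ?XY = "TenO C X Y" and ?YZ = "TenO C Y Z" and ?XY' = "TenO C' X Y" and ?YZ' = "TenO C' Y Z"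
  note O = X Y Z o C.TenO_in[OF X Y] C.TenO_in[OF Y Z] ten[OF X Y] ten[OF Y Z]
  note n = ka_assoc[OF X Y Z]
  let ?a = "FM (TenO C' ?XY' Z) (TenO C' X ?YZ') (Asc C' X Y Z)"
   and ?k = "FM (TenO C ?XY' Z) (TenO C' ?XY' Z) (ka ?XY' Z)"
   and ?k' = "FM (TenO C X ?YZ') (TenO C' X ?YZ') (ka X ?YZ')"
   and ?J = "rwhisk D (FO X \<odot> FO Y) (FO ?XY) (FO Z) (J X Y)"
   and ?r = "rwhisk D (FO X \<odot> FO Y) (FO ?XY') (FO Z) (FM ?XY ?XY' (ka X Y) \<cdot> J X Y)"
   and ?l = "lwhisk D (FO X) (FO Y \<odot> FO Z) (FO ?YZ') (FM ?YZ ?YZ' (ka Y Z) \<cdot> J Y Z) \<cdot> Asc D (FO X) (FO Y) (FO Z)"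
  have "?a \<cdot>
    (?k \<cdot> J ?XY' Z) \<cdot>
    ?r
   = ?a \<cdot> ?k \<cdot>
    (J ?XY' Z \<cdot> rwhisk D (FO ?XY) (FO ?XY') (FO Z) (FM ?XY ?XY' (ka X Y))) \<cdot>
    ?J" using O by (simp add: D_assoc rw[of _ "FO ?XY"] FM_in ka_in J_in)
  also have "... = ?a \<cdot>
    ?k \<cdot> FM (TenO C ?XY Z) (TenO C ?XY' Z) (rwhisk C ?XY ?XY' Z (ka X Y)) \<cdot>
    J ?XY Z \<cdot> ?J" using O by (simp add: D_assoc Jr ka_in)
  also have "... = FM (TenO C ?XY Z) (TenO C' X ?YZ')
    (Asc C' X Y Z \<cdot>\<^bsub>C\<^esub> ka ?XY' Z \<cdot>\<^bsub>C\<^esub> rwhisk C ?XY ?XY' Z (ka X Y)) \<cdot>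
    J ?XY Z \<cdot> ?J" using O n by (simp add: FM3 ka_in rw_in C.Cmp_in[of "TenO C ?XY Z" "TenO C ?XY' Z"])
  also have "... = ?k' \<cdot>
    FM (TenO C X ?YZ) (TenO C X ?YZ') (lwhisk C X ?YZ ?YZ' (ka Y Z)) \<cdot> FM (TenO C ?XY Z) (TenO C X ?YZ) (Asc C X Y Z) \<cdot>
    J ?XY Z \<cdot> ?J" using O n by (simp add: FM3 ka_in lw_in asc_in C.Cmp_in[of "TenO C ?XY Z" "TenO C X ?YZ"])
  also have "... = ?k' \<cdot>
    (J X ?YZ' \<cdot> lwhisk D (FO X) (FO ?YZ) (FO ?YZ') (FM ?YZ ?YZ' (ka Y Z))) \<cdot>
    lwhisk D (FO X) (FO Y \<odot> FO Z) (FO ?YZ) (J Y Z) \<cdot> Asc D (FO X) (FO Y) (FO Z)" using O F.J_assoc[OF X Y Z] by (simp add: Jl ka_in D_assoc)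
  also have "... = (?k' \<cdot> J X ?YZ') \<cdot>
    ?l"
   using O by (simp add: D_assoc lw[of _ "FO ?YZ"] FM_in ka_in J_in)
  finally show "?a \<cdot>
    (?k \<cdot> J ?XY' Z) \<cdot>
    ?r
   = (?k' \<cdot> J X ?YZ') \<cdot>
    ?l" .
 next
  fix X assume X: "X : Ob C"
  show "FM (TenO C' (Unt C) X) X (LUn C' X) \<cdot> (FM (TenO C (Unt C) X) (TenO C' (Unt C) X) (ka (Unt C) X) \<cdot> J (Unt C) X) \<cdot>
    rwhisk D (Unt D) (FO (Unt C)) (FO X) e = LUn D (FO X)" using F.e_left[OF X] X ka_unit(1)[OF X] by (simp add: D_assoc FM3 o ka_in)
  show "FM (TenO C' X (Unt C)) X (RUn C' X) \<cdot> (FM (TenO C X (Unt C)) (TenO C' X (Unt C)) (ka X (Unt C)) \<cdot> J X (Unt C)) \<cdot>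
    lwhisk D (FO X) (Unt D) (FO (Unt C)) e = RUn D (FO X)" using F.e_right[OF X] X ka_unit(2)[OF X] by (simp add: D_assoc FM3 o ka_in)
 qed (use F.FO_in F.FM_bij F.FM_Idm F.FM_Cmp F.FM_add F.FM_Scl F.essentially_surjective F.e_iso in
  \<open>simp_all add: eq\<close>)
qed

text \<open>Closure under retracts ensures that a tensor product chosen over \<open>S1\<close> of
  bimodules living in \<open>S0\<close> lives in \<open>S0\<close> again, since it is a retract of a
  plain product.\<close>

locale bimodule_subcategory = C0: separable_algebra M S0 A m u dl + C1: separable_algebra M S1 A m u dl for M :: "'h::complex_hilbert_space op set" and S0 S1 A m u dl +
 assumes sub: "S0 <= S1"
  and retract: "[|H : S1; L : S0; r : intertwiners M L H; s : intertwiners M H L; r * s = idb|] ==> H : S0"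
begin

lemma Obj_sub: "X : C0.Obj ==> X : C1.Obj" using sub by (cases X) auto

lemma bim_sub: "C0.bim X \<longleftrightarrow> C1.bim X & fst X : C0.Obj" using Obj_sub C0.bim_iff[of "fst X" "fst (snd X)" "snd (snd X)"]
  C1.bim_iff[of "fst X" "fst (snd X)" "snd (snd X)"] by auto

lemma bimD1: "C0.bim X ==> C1.bim X" by (simp add: bim_sub)

lemma bmaps_sub: "C0.bim X ==> C0.bim Y ==> C1.bmaps X Y = C0.bmaps X Y" using C0.bimodule_maps_iff C1.bimodule_maps_iff bimD1 by blast

lemma tob_sub: assumes "C0.bim X" "C0.bim Y" shows "C1.tob X Y : C0.Obj"
proof (cases "C1.tob X Y")
 case (Some H)
 note X = bimD1[OF assms(1)] and Y = bimD1[OF assms(2)]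
 note q = C1.tq_hom[OF X Y] and s = C1.ts_hom[OF X Y] and qs = C1.tq_ts[OF X Y]
 have H: "H : S1" using C1.tob_Obj[OF X Y] Some by simp
 have one: "C1.tq X Y * C1.ts X Y = idb" using qs H by (simp add: Some C0.endo_id C1.S_endoD)
 obtain L where L: "ec (fst X) (fst Y) = Some L" using q one C0.hom_None(1) by (cases "ec (fst X) (fst Y)") auto
 have "ec (fst X) (fst Y) : C0.Obj" using assms by (intro C0.endo_comp_Obj C0.bim_ob)
 hence "L : S0" by (simp add: L)
 hence "H : S0" using q s one H sub retract[of H L] C1.hom_Some[of L H] C1.hom_Some[of H L] by (auto simp: L Some)
 thus ?thesis by (simp add: Some)
qed simp

lemma tens_sub: assumes "C0.bim X" "C0.bim Y" shows "C0.bim (C1.tens X Y)"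
 unfolding bim_sub using C1.tens_bim[OF assms[THEN bimD1]] tob_sub[OF assms] C1.tens_ob[OF assms[THEN bimD1]] by simp

text \<open>Compares the tensor products chosen over \<open>S0\<close> and over \<open>S1\<close>.
  Both split the same idempotent \<open>bal\<close>, so this is an isomorphism.\<close>

definition ka :: "'h bm => 'h bm => 'h op" where "ka X Y = C1.tq X Y * C0.ts X Y"

lemma ka_tq: assumes "C0.bim X" "C0.bim Y" shows "ka X Y * C0.tq X Y = C1.tq X Y" using C0.ts_tq[OF assms] C1.tq_bal[OF assms[THEN bimD1]] by (simp add: ka_def assoc)

lemma ka_hom: assumes "C0.bim X" "C0.bim Y" shows "ka X Y : C0.homs (C0.tob X Y) (C1.tob X Y)"
 unfolding ka_def by (rule C0.hom_o[OF C1.tq_hom[OF assms[THEN bimD1]] C0.ts_hom[OF assms]])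

lemma ka_is_inverse:
 assumes X: "C0.bim X" and Y: "C0.bim Y" shows "is_inverse C0.BB (C0.tens X Y) (C1.tens X Y) (ka X Y) (C0.tq X Y * C1.ts X Y)"
proof (rule C0.is_iso_BBI)
 note X1 = bimD1[OF X] and Y1 = bimD1[OF Y]
 note T = C0.tens_bim[OF X Y] and T1 = tens_sub[OF X Y]
 note o = C0.tens_ob[OF X Y] C1.tens_ob[OF X1 Y1] and h = ka_hom[OF X Y] and t = ka_tq[OF X Y]
 have KM: "ka X Y : M" using C0.homD(1)[OF h] .
 show "C0.bim (C0.tens X Y)" "C0.bim (C1.tens X Y)" by (fact T T1)+
 show "ka X Y : C0.bmaps (C0.tens X Y) (C1.tens X Y)"
 proof (rule C0.bmapsI[OF T T1])
  show "ka X Y : C0.homs (fst (C0.tens X Y)) (fst (C1.tens X Y))" using h by (simp add: o)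
  show "ka X Y * C0.la (C0.tens X Y) = C0.la (C1.tens X Y) * A (ka X Y)"
  proof (rule C0.tq_cancel_A[OF X Y])
   show "(ka X Y * C0.la (C0.tens X Y)) * A (C0.tq X Y)
    = (C0.la (C1.tens X Y) * A (ka X Y)) * A (C0.tq X Y)" using X Y KM C1.tens_la[OF X1 Y1]
    by (simp add: assoc C0.tens_la C0.A_o[symmetric] t) (simp add: assoc[symmetric] t)
   show "(ka X Y * C0.la (C0.tens X Y)) * A (act (C0.tob X Y) idb) = ka X Y * C0.la (C0.tens X Y)" using C0.la_one'[OF T] by (simp add: assoc o)
   show "(C0.la (C1.tens X Y) * A (ka X Y)) * A (act (C0.tob X Y) idb) = C0.la (C1.tens X Y) * A (ka X Y)"
    using C0.homD(3)[OF h] KM X Y by (simp add: assoc C0.A_o[symmetric])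
  qed
  show "ka X Y * C0.ra (C0.tens X Y) = C0.ra (C1.tens X Y) * ka X Y"
  proof (rule C0.tq_cancel[OF X Y])
   show "(ka X Y * C0.ra (C0.tens X Y)) * C0.tq X Y = (C0.ra (C1.tens X Y) * ka X Y) * C0.tq X Y"
    using C1.tens_ra[OF X1 Y1] by (simp add: assoc C0.tens_ra[OF X Y] t) (simp add: assoc[symmetric] t)
   show "(ka X Y * C0.ra (C0.tens X Y)) * act (C0.tob X Y) idb = ka X Y * C0.ra (C0.tens X Y)" using C0.ra_one'[OF T] by (simp add: assoc o)
   show "(C0.ra (C1.tens X Y) * ka X Y) * act (C0.tob X Y) idb = C0.ra (C1.tens X Y) * ka X Y" using C0.homD(3)[OF h] by (simp add: assoc)
  qed
 qed
 show "C0.tq X Y * C1.ts X Y : C0.homs (fst (C1.tens X Y)) (fst (C0.tens X Y))" using C0.hom_o[OF C0.tq_hom[OF X Y] C1.ts_hom[OF X1 Y1]] by (simp add: o)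
 have "(C0.tq X Y * C1.ts X Y) * ka X Y = (C0.tq X Y * C0.bal X Y) * C0.ts X Y" by (simp add: ka_def assoc eq_tail[OF C1.ts_tq[OF X1 Y1]])
 thus "(C0.tq X Y * C1.ts X Y) * ka X Y = act (fst (C0.tens X Y)) idb" using X Y by (simp add: C0.tq_bal C0.tq_ts o)
 have "ka X Y * C0.tq X Y * C1.ts X Y = act (C1.tob X Y) idb" by (simp add: eq_tail[OF t] C1.tq_ts[OF X1 Y1])
 thus "ka X Y * C0.tq X Y * C1.ts X Y = act (fst (C1.tens X Y)) idb" by (simp add: o)
qed

theorem subcategory_equivalence:
 assumes D: "linear_monoidal_category D" and D_assoc: "Cmp D = (*)"
  and eq: "tensor_equivalent C0.BB D" shows "tensor_equivalent (full_subcategory C1.BB {XX. C0.bim XX}) D"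
proof -
 let ?C = "full_subcategory C1.BB {XX. C0.bim XX}"
 obtain FO FM J e where F: "tensor_equivalence C0.BB D FO FM J e" using eq by (auto simp: tensor_equivalent_def)
 have "tensor_equivalence ?C D FO FM
  (%X Y. FM (TenO C0.BB X Y) (TenO ?C X Y) (ka X Y) \<cdot>\<^bsub>D\<^esub> J X Y) e"
 proof (rule tensor_equivalence_transport[OF C0.bimodule_linear_monoidal D _ _ _ _ _ _ _ _ _ _ _ _ _ F])
  fix X X' Y Y' f g assume "X : Ob C0.BB" "X' : Ob C0.BB" "Y : Ob C0.BB" "Y' : Ob C0.BB"
   and "f : Mor C0.BB X X'" "g : Mor C0.BB Y Y'"
  hence X: "C0.bim X" "C0.bim X'" and Y: "C0.bim Y" "C0.bim Y'"
   and f: "f : C0.bmaps X X'" and g: "g : C0.bmaps Y Y'" by simp_all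
  note X1 = X[THEN bimD1] and Y1 = Y[THEN bimD1]
  have fg: "f : C1.bmaps X X'" "g : C1.bmaps Y Y'" using f g X Y by (simp_all add: bmaps_sub)
  note t = C0.tenm_props[OF X Y f g] and t1 = C1.tenm_props[OF X1 Y1 fg]
  have "C1.tenm X X' Y Y' f g * ka X Y = ka X' Y' * C0.tenm X X' Y Y' f g"
  proof (rule C0.homs_cancel[OF X(1) Y(1)])
   show "C1.tenm X X' Y Y' f g * ka X Y : C0.homs (C0.tob X Y) (C1.tob X' Y')" by (rule C0.hom_o[OF t1(2) ka_hom[OF X(1) Y(1)]])
   show "ka X' Y' * C0.tenm X X' Y Y' f g : C0.homs (C0.tob X Y) (C1.tob X' Y')" by (rule C0.hom_o[OF ka_hom[OF X(2) Y(2)] t(2)])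
   show "(C1.tenm X X' Y Y' f g * ka X Y) * C0.tq X Y = (ka X' Y' * C0.tenm X X' Y Y' f g) * C0.tq X Y"
    using X Y by (simp add: assoc ka_tq t(1) t1(1) eq_tail[OF ka_tq[OF X(2) Y(2)]])
  qed
  thus "TenM ?C X X' Y Y' f g : Mor C0.BB (TenO ?C X Y) (TenO ?C X' Y') &
   TenM ?C X X' Y Y' f g \<cdot>\<^bsub>C0.BB\<^esub> ka X Y = ka X' Y' \<cdot>\<^bsub>C0.BB\<^esub> TenM C0.BB X X' Y Y' f g"
   using t1(3) X Y f g fg X1 Y1 bmaps_sub[OF tens_sub tens_sub, OF X(1) Y(1) X(2) Y(2)] by (simp add: full_subcategory_def C1.BB_TenM C0.BB_TenM)
 next
  fix X Y Z assume "X : Ob C0.BB" "Y : Ob C0.BB" "Z : Ob C0.BB"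
  hence X: "C0.bim X" and Y: "C0.bim Y" and Z: "C0.bim Z" by simp_all
  note X1 = bimD1[OF X] and Y1 = bimD1[OF Y] and Z1 = bimD1[OF Z]
  note XY = C0.tens_bim[OF X Y] tens_sub[OF X Y] and YZ = C0.tens_bim[OF Y Z] tens_sub[OF Y Z]
  have k: "ka X Y : C0.bmaps (C0.tens X Y) (C1.tens X Y)" "ka Y Z : C0.bmaps (C0.tens Y Z) (C1.tens Y Z)"
   using ka_is_inverse[OF X Y] ka_is_inverse[OF Y Z] by (simp_all add: is_inverse_def)
  note r = C0.rwhisk_props[OF XY Z k(1)] and l = C0.lwhisk_props[OF X YZ k(2)]
   and a = C0.asc_props[OF X Y Z] and a1 = C1.asc_props[OF X1 Y1 Z1]
  let ?r = "rwhisk C0.BB (C0.tens X Y) (C1.tens X Y) Z (ka X Y)"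
   and ?l = "lwhisk C0.BB X (C0.tens Y Z) (C1.tens Y Z) (ka Y Z)"
  let ?a = "C1.asc X Y Z * ka (C1.tens X Y) Z * ?r" and ?b = "ka X (C1.tens Y Z) * ?l * C0.asc X Y Z"
  have "?a = ?b"
  proof (rule C0.homs_cancel2[OF X Y Z])
   show "?a
    : C0.homs (C0.tob (C0.tens X Y) Z) (C1.tob X (C1.tens Y Z))" by (rule C0.hom_o[OF a1(1) C0.hom_o[OF ka_hom[OF XY(2) Z] r(3)]])
   show "?b
    : C0.homs (C0.tob (C0.tens X Y) Z) (C1.tob X (C1.tens Y Z))" by (rule C0.hom_o[OF ka_hom[OF X YZ(2)] C0.hom_o[OF l(3) a(1)]])
   have "(?a) * C0.tq (C0.tens X Y) Z * C0.tq X Y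
    = C1.tq X (C1.tens Y Z) * act (fst X) (C1.tq Y Z)" by (simp add: assoc eq_tail[OF r(1)] eq_tail[OF ka_tq[OF XY(2) Z]] ka_tq[OF X Y] a1(2))
   also have "... = ka X (C1.tens Y Z) * C0.tq X (C1.tens Y Z) * act (fst X) (ka Y Z) * act (fst X) (C0.tq Y Z)" using X Y Z C0.homD(1)[OF ka_hom[OF Y Z]]
    by (simp add: ka_tq[symmetric] C0.act_o[symmetric] eq_tail[OF ka_tq[OF X YZ(2)]])
   also have "... = (?b) * C0.tq (C0.tens X Y) Z * C0.tq X Y" by (simp add: assoc a(2) eq_tail[OF l(1)])
   finally show "(?a) * C0.tq (C0.tens X Y) Z * C0.tq X Y
    = (?b) * C0.tq (C0.tens X Y) Z * C0.tq X Y" .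
  qed
  thus "Asc ?C X Y Z : Mor C0.BB ((TenO ?C X Y) \<odot>\<^bsub>?C\<^esub> Z) (X \<odot>\<^bsub>?C\<^esub> Y \<odot>\<^bsub>?C\<^esub> Z) &
    Asc ?C X Y Z \<cdot>\<^bsub>C0.BB\<^esub> ka (TenO ?C X Y) Z \<cdot>\<^bsub>C0.BB\<^esub> rwhisk C0.BB (TenO C0.BB X Y) (TenO ?C X Y) Z (ka X Y)
     = ka X (TenO ?C Y Z) \<cdot>\<^bsub>C0.BB\<^esub> lwhisk C0.BB X (TenO C0.BB Y Z) (TenO ?C Y Z) (ka Y Z) \<cdot>\<^bsub>C0.BB\<^esub> Asc C0.BB X Y Z"
   using C1.asc_bmaps[OF X1 Y1 Z1] X Y Z X1 Y1 Z1 bmaps_sub[OF tens_sub[OF XY(2) Z] tens_sub[OF X YZ(2)]] by (simp add: full_subcategory_def C1.BB_Asc C0.BB_Asc)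
 next
  fix X assume "X : Ob C0.BB"
  hence X: "C0.bim X" by simp
  note X1 = bimD1[OF X] and U = C0.UU_bim
  have "C1.lun X * ka C0.UU X = C0.lun X" "C1.run X * ka X C0.UU = C0.run X"
   by (simp_all add: ka_def C0.lun_def C0.run_def eq_tail[OF C1.lun_tq[OF X1]] eq_tail[OF C1.run_tq[OF X1]])
  thus "LUn ?C X : Mor C0.BB (TenO ?C (Unt C0.BB) X) X & LUn ?C X \<cdot>\<^bsub>C0.BB\<^esub> ka (Unt C0.BB) X = LUn C0.BB X"
   "RUn ?C X : Mor C0.BB (TenO ?C X (Unt C0.BB)) X & RUn ?C X \<cdot>\<^bsub>C0.BB\<^esub> ka X (Unt C0.BB) = RUn C0.BB X"
   using C1.lun_bmaps[OF X1] C1.run_bmaps[OF X1] X X1 bmaps_sub[OF tens_sub[OF U X] X] bmaps_sub[OF tens_sub[OF X U] X]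
   by (simp_all add: full_subcategory_def C1.lun_eq C0.lun_eq C1.run_eq C0.run_eq)
 next
  fix X Y assume "X : Ob C0.BB" "Y : Ob C0.BB"
  hence X: "C0.bim X" and Y: "C0.bim Y" by simp_all
  show "is_iso C0.BB (TenO C0.BB X Y) (TenO ?C X Y) (ka X Y)" using ka_is_inverse[OF X Y] by (auto simp: is_iso_def full_subcategory_def)
 qed (auto simp: D_assoc assoc full_subcategory_def bmaps_sub tens_sub C0.BB_Idm C1.BB_Idm bimD1)
 thus ?thesis by (auto simp: tensor_equivalent_def)
qed

end

section \<open>Dual pairs of endomorphisms\<close>

context factor
begin

lemma gideal_whisker_left:
 assumes x: "x : gideal M P H L" and e: "N : End" "P <= End"
  "H : End" "L : End" and P': "!!Q. Q : P ==> N o Q : P'" shows "N x : gideal M P' (N o H) (N o L)" using x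
proof (induction rule: gideal.induct)
 case zero
 thus ?case using e by (simp add: endo_0 gideal.zero)
next
 case (step x Q t a)
 have Q: "Q : End" using step e by auto
 have M: "x : M" "t : M" "a : M" using step gideal_intertwiners[OF step(1)] by (auto dest: HomD)
 have "N (x + t * a) = N x + N t * N a" using e(1) M by (simp add: endo_add endo_o)
 thus ?case using gideal.step[OF step.IH P'[OF step(2)]
    intertwiners_whisker_left[OF step(3) e(1) Q e(4)] intertwiners_whisker_left[OF step(4) e(1) e(3) Q]] by (simp only:)
qed

text \<open>Whiskering on either side reduces closure under composition to products of two members
  of \<open>P\<close>, that is, to the fusion rules.\<close>

lemma sums_of_comp:
 assumes P: "P <= End" "!!Q. Q : P ==> irr Q"
  and prod: "!!Q Q'. Q : P ==> Q' : P ==> idb : gideal M P (Q o Q') (Q o Q')"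
  and H: "H : sums_of M P" and L: "L : sums_of M P" shows "H o L : sums_of M P"
proof -
 have e: "H : End" "L : End"
  and g: "idb : gideal M P H H" "idb : gideal M P L L" using H L sums_of_iff[OF P] by auto
 have "idb : gideal M ((%Q. Q o L) ` P) (H o L) (H o L)" by (rule gideal_whisker_right[OF g(1) e(2)]) auto
 hence "idb : gideal M P (H o L) (H o L)"
 proof (rule gideal_trans)
  fix N assume "N : (%Q. Q o L) ` P"
  then obtain Q where Q: "Q : P" "N = Q o L" by blast
  hence Qe: "Q : End" using P by auto
  have "Q idb : gideal M ((%Q'. Q o Q') ` P) (Q o L) (Q o L)" by (rule gideal_whisker_left[OF g(2) Qe P(1) e(2) e(2)]) auto
  hence "idb : gideal M ((%Q'. Q o Q') ` P) (Q o L) (Q o L)" by (simp add: endo_id[OF Qe])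
  thus "idb : gideal M P N N" unfolding Q(2) by (rule gideal_trans) (use prod[OF Q(1)] in auto)
 qed
 thus ?thesis using e by (simp add: sums_of_iff[OF P])
qed

text \<open>The range of an automorphism is all of \<open>M\<close>, so a self-intertwiner is
  central and hence scalar.\<close>

lemma automorphism_irreducible: assumes "be : Aut" shows "irr be"
proof -
 have e: "be : End" and b: "bij_betw be M M" using assms by (auto simp: automorphisms_def)
 have "EX c. t = scl c idb" if t: "t : Hom be be" for t
 proof (rule center)
  show "t : M" using t by (rule HomD)
  fix y assume "y : M"
  then obtain x where "x : M" "y = be x" using b by (auto simp: bij_betw_def)
  thus "t * y = y * t" using HomD(2)[OF t] by simp
 qed
 thus ?thesis by (auto simp: irreducible_endo_def Hom_scale[OF e])
qed

lemma irreducible_iso: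
 assumes Q: "Q : End" "irr Q" and Q': "Q' : End" "irr Q'"
  and t: "t : Hom Q Q'" "t ~= 0"
 obtains c :: complex where "c ~= 0" "cadj t * t = scl c idb" "t * cadj t = scl c idb"
  "isum Q' [Q]"
proof -
 have M: "t : M" using t(1) by (rule HomD)
 have t': "cadj t : Hom Q' Q" by (rule Hom_cadj[OF Q(1) Q'(1) t(1)])
 obtain c where c: "cadj t * t = scl c idb" using irreducible_scalar[OF Q(2) Hom_o[OF t' t(1)]] by blast
 obtain d where d: "t * cadj t = scl d idb" using irreducible_scalar[OF Q'(2) Hom_o[OF t(1) t']] by blast
 obtain r where r: "r >= 0" "c = complex_of_real r" by (rule cadj_self_scalar[OF M c])
 have "r ~= 0" using c r cadj_self_eq_0[OF M] t(2) by auto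
 hence r0: "r > 0" using r by simp
 have "scl d t = (t * cadj t) * t" by (simp add: d scale_left)
 also have "... = scl c t" using M by (simp add: assoc c scale_right)
 finally have "scl (d - c) t = 0" by (simp add: op_space.scale_left_diff_distrib)
 hence dc: "d = c" using t(2) by simp
 define s where "s = scl (complex_of_real (1 / sqrt r)) t"
 have sc: "complex_of_real (1 / sqrt r) \<^bold>* (complex_of_real (1 / sqrt r) \<^bold>* c) = 1"
  using r0 unfolding r(2) of_real_mult[symmetric] by (simp add: field_simps)
 have s: "s : Hom Q Q'" unfolding s_def by (rule Hom_scale[OF Q'(1) t(1)])
 have "cadj s * s = idb" "s * cadj s = idb" using M sc by (simp_all add: s_def cadj_scale scale_left scale_right c d dc)
 hence "isum Q' [Q]" using s by (auto simp: isometric_sum_unitary)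
 thus ?thesis using that[of c] r0 r c d dc by simp
qed

text \<open>The convention makes \<open>L\<close> a left dual of \<open>H\<close>; right duals are
  expressed by exchanging the two endomorphisms.\<close>

definition dual_pair :: "'h endo => 'h endo => 'h op => 'h op => bool" where
 "dual_pair H L ev et \<longleftrightarrow> ev : Hom (L o H) id & et : Hom id (H o L) &
  H ev * et = idb & ev * L et = idb"

lemma dual_pairD:
 assumes "dual_pair H L ev et" shows "ev : M" "et : M" "x : M ==> ev * L (H x) = x * ev" "x : M ==> et * x = H (L x) * et"
  "H ev * et = idb" "ev * L et = idb" using assms by (auto simp: dual_pair_def intertwiners_def)

lemma dual_pair_twist:
 assumes e: "H : End" "L : End" "be : End" "be' : End"
  and be: "!!x. x : M ==> be (be' x) = x" "!!x. x : M ==> be' (be x) = x" shows "dual_pair H L ev et ==> dual_pair (H o be) (be' o L) (be' ev) et"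
  "dual_pair L H ev et ==> dual_pair (be' o L) (H o be) ev (be' et)"
proof -
 note [simp] = e[THEN endo_in] be
 have c: "be' x * be' y = be' (x * y)" if "x : M" "y : M" for x y using endo_o[OF e(4)] that by simp
 have m: "be' x * y = be' (x * be y)" "y * be' x = be' (be y * x)" if "x : M" "y : M" for x y using c[of x "be y"] c[of "be y" x] that by simp_all
 show "dual_pair (H o be) (be' o L) (be' ev) et" if "dual_pair H L ev et" using dual_pairD[OF that] by (simp add: dual_pair_def intertwiners_def c m(2) endo_id[OF e(4)])
 show "dual_pair (be' o L) (H o be) ev (be' et)" if "dual_pair L H ev et" using dual_pairD[OF that] by (simp add: dual_pair_def intertwiners_def c m(1) endo_id[OF e(4)])
qed

text \<open>Direct sums represent an object only up to unitary equivalence, so duals must be carried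
  along the unitary.\<close>

lemma dual_pair_unitary:
 assumes e: "H : End" "L : End" "N : End"
  and s: "s : Hom L H" "cadj s * s = idb" "s * cadj s = idb" shows "dual_pair L N ev et ==> dual_pair H N (ev * N (cadj s)) (s * et)"
  "dual_pair N L ev et ==> dual_pair N H (ev * cadj s) (N s * et)"
proof -
 have s': "cadj s : Hom H L" by (rule Hom_cadj[OF e(2,1) s(1)])
 note [simp] = e[THEN endo_in] HomD(1)[OF s(1)] HomD(1)[OF s']
 note sx = HomD(2)[OF s(1)] and s'x = HomD(2)[OF s']
 have c: "N x * N y = N (x * y)" if "x : M" "y : M" for x y using endo_o[OF e(3)] that by simp
 have ct: "N x * N y * z = N (x * y) * z" if "x : M" "y : M" for x y z using c[OF that] by (simp add: assoc[symmetric])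
 note cu = c ct endo_id[OF e(3)] assoc eq_tail[OF s(2)] eq_tail[OF s(3)] s(2,3)
 show "dual_pair H N (ev * N (cadj s)) (s * et)" if d: "dual_pair L N ev et"
 proof -
  note D = dual_pairD[OF d] and [simp] = dual_pairD(1,2)[OF d]
  have "(ev * N (cadj s)) * N (H x) = x * ev * N (cadj s)" if "x : M" for x
  proof -
   have "(ev * N (cadj s)) * N (H x) = (ev * N (L x)) * N (cadj s)" using that by (simp add: assoc c s'x)
   thus ?thesis using that by (simp add: D(3) assoc)
  qed
  moreover have "(s * et) * x = H (N x) * s * et" if "x : M" for x using that eq_tail[OF sx[of "N x"]] by (simp add: assoc D(4))
  moreover have "H (ev * N (cadj s)) * s * et = idb"
  proof -
   have "H (ev * N (cadj s)) * s * et = s * L (ev * N (cadj s)) * et" using sx[of "ev * N (cadj s)"] by (simp add: assoc[symmetric])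
   also have "... = s * (L ev * et) * cadj s" by (simp add: endo_o[OF e(2)] assoc D(4))
   finally show ?thesis by (simp add: D(5) s)
  qed
  moreover have "(ev * N (cadj s)) * N (s * et) = idb" by (simp add: cu D(6))
  ultimately show ?thesis by (simp add: dual_pair_def intertwiners_def)
 qed
 show "dual_pair N H (ev * cadj s) (N s * et)" if d: "dual_pair N L ev et"
 proof -
  note D = dual_pairD[OF d] and [simp] = dual_pairD(1,2)[OF d]
  have "(ev * cadj s) * H (N x) = x * ev * cadj s" if "x : M" for x
  proof -
   have "(ev * cadj s) * H (N x) = (ev * L (N x)) * cadj s" using that by (simp add: assoc s'x)
   thus ?thesis using that by (simp add: D(3) assoc)
  qed
  moreover have "(N s * et) * x = N (H x) * N s * et" if "x : M" for x using that by (simp add: assoc D(4) ct sx)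
  moreover have "N (ev * cadj s) * N s * et = idb" by (simp add: cu D(5))
  moreover have "(ev * cadj s) * H (N s * et) = idb"
  proof -
   have "(ev * cadj s) * H (N s * et) = (ev * L (N s)) * L et * cadj s" by (simp add: assoc s'x endo_o[OF e(2)])
   also have "... = s * (ev * L et) * cadj s" by (simp add: D(3) assoc)
   finally show ?thesis by (simp add: D(6) s)
  qed
  ultimately show ?thesis by (simp add: dual_pair_def intertwiners_def)
 qed
qed

text \<open>A left dual of an irreducible endomorphism is irreducible, because \<open>End(L)\<close> embeds into
 \<open>Hom(1, H L) = End(H)\<close>. If \<open>H\<close> is self-dual, then nonzero maps \<open>b\<close> and \<open>d\<close> give isomorphisms of
 \<open>H\<close> and \<open>L\<close> in both directions.\<close>

lemma irreducible_snake:
 assumes H: "H : End" "irr H" and L: "L : End"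
  and dp: "dual_pair H L ev et"
  and b: "b : Hom (H o H) id" "b ~= 0" and d: "d : Hom id (H o H)" "d ~= 0" shows "H b * d ~= 0"
proof -
 note D = dual_pairD[OF dp]
 have M [simp]: "b : M" "d : M" "ev : M" "et : M" using b d D by (auto dest: HomD)
 note [simp] = endo_in[OF H(1)] endo_in[OF L]
 note sc = endo_o[OF H(1)] and tc = endo_o[OF L]
 have bx: "b * H (H x) = x * b" and dx: "d * x = H (H x) * d" if "x : M" for x using that b d by (auto simp: intertwiners_def)
 \<comment> \<open>Under the duality, \<open>f\<close> is the transpose of \<open>d\<close>; the map
   \<open>h\<close> of the next line is that of \<open>b\<close>.\<close>
 define f where "f = ev * L d"
 define h where "h = b * H et"
 have [simp]: "f : M" "h : M" by (simp_all add: f_def h_def)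
 have f: "f : Hom L H"
 proof -
  have "f * L x = H x * f" if "x : M" for x
  proof -
   have "f * L x = ev * L (H (H x) * d)" using that by (simp add: f_def assoc tc[symmetric] dx)
   also have "... = (ev * L (H (H x))) * L d" using that by (simp add: tc assoc)
   finally show ?thesis using that by (simp add: D(3) f_def assoc)
  qed
  thus ?thesis by (simp add: intertwiners_def)
 qed
 have h: "h : Hom H L"
 proof -
  have "h * H x = L x * h" if "x : M" for x
  proof -
   have "h * H x = (b * H (H (L x))) * H et" using that by (simp add: h_def assoc sc[symmetric] D(4))
   thus ?thesis using that by (simp add: bx h_def assoc)
  qed
  thus ?thesis by (simp add: intertwiners_def)
 qed
 have d_eq: "H f * et = d"
 proof -
  have "H f * et = (H ev * et) * d" by (simp add: f_def sc assoc D(4))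
  thus ?thesis by (simp add: D(5))
 qed
 have b_eq: "ev * h = b"
 proof -
  have "ev * h = (b * H (H ev)) * H et" by (simp add: h_def bx assoc)
  also have "... = b * H (H ev * et)" by (simp add: sc assoc)
  finally show ?thesis by (simp add: D(5) endo_id[OF H(1)])
 qed
 have scalar: "EX c. k = scl c idb" if k: "k : Hom L L" for k
 proof -
  have kM [simp]: "k : M" using k by (rule HomD)
  have kx: "k * L x = L x * k" if "x : M" for x using k that by (simp add: intertwiners_def)
  define t where "t = H (ev * k) * et"
  have [simp]: "t : M" by (simp add: t_def)
  have "t * H x = H x * t" if "x : M" for x
  proof -
   have "t * H x = H (ev * k * L (H x)) * et" using that by (simp add: t_def assoc D(4) sc)
   also have "... = H ((ev * L (H x)) * k) * et" using that by (simp add: kx assoc)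
   finally show ?thesis using that by (simp add: D(3) sc t_def assoc)
  qed
  then obtain c where c: "t = scl c idb" using irreducible_scalar[OF H(2), of t] by (auto simp: intertwiners_def)
  have "ev * L t * L et = k"
  proof -
   have "t * et = H (ev * k) * H (L et) * et" by (simp add: t_def assoc D(4))
   hence "ev * L t * L et = ev * L (H (ev * k) * H (L et) * et)" by (simp add: tc[symmetric])
   also have "... = (ev * L (H (ev * k * L et))) * L et" by (simp add: sc tc assoc)
   also have "... = (ev * L et) * k * ev * L et" by (simp add: D(3) kx assoc)
   finally show ?thesis by (simp add: D(6))
  qed
  moreover have "ev * L t * L et = scl c idb" using D(6) by (simp add: c endo_scale[OF L] endo_id[OF L] scale_left scale_right)
  ultimately show ?thesis by auto
 qed
 hence L_irr: "irr L" by (auto simp: irreducible_endo_def Hom_scale[OF L])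
 have f0: "f ~= 0" using d_eq d(2) endo_0[OF H(1)] by auto
 have h0: "h ~= 0" using b_eq b(2) by auto
 obtain c where c: "h * f = scl c idb" using scalar[OF Hom_o[OF h f]] by blast
 have "c ~= 0"
 proof
  assume "c = 0"
  obtain r where r: "r ~= 0" "cadj h * h = scl r idb" by (rule irreducible_iso[OF H L L_irr h h0])
  have "scl r f = cadj h * h * f" using eq_tail[OF r(2), of f] by (simp add: scale_left)
  thus False using c \<open>c = 0\<close> f0 r by simp
 qed
 have "H b * d = H (ev * h * f) * et" by (simp add: b_eq[symmetric] d_eq[symmetric] sc assoc)
 also have "... = scl c idb" by (simp add: c scale_right endo_scale[OF H(1)] scale_left D(5))
 finally show ?thesis using \<open>c ~= 0\<close> by simp
qed

end

lemma (in cuntz_factor) dual_pair_endo_sum: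
 assumes e: "H1 : End" "H2 : End" "L1 : End" "L2 : End"
  and d1: "dual_pair H1 L1 ev1 et1" and d2: "dual_pair H2 L2 ev2 et2" shows "dual_pair (endo_sum H1 H2) (endo_sum L1 L2)
  (ev1 * L1 (cadj v1) * cadj v1 + ev2 * L2 (cadj v2) * cadj v2) (v1 * H1 v1 * et1 + v2 * H2 v2 * et2)"
  (is "dual_pair ?H ?L ?ev ?et")
proof -
 note D1 = dual_pairD[OF d1] and D2 = dual_pairD[OF d2]
 note [simp] = D1(1,2) D2(1,2) e[THEN endo_in]
 note c = e[THEN endo_o] e[THEN endo_add]
 have one: "H1 x * H1 y * z = H1 (x * y) * z" "H2 x * H2 y * z = H2 (x * y) * z"
  "L1 x * L1 y * z = L1 (x * y) * z" "L2 x * L2 y * z = L2 (x * y) * z"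
  "H1 x * H1 y = H1 (x * y)" "H2 x * H2 y = H2 (x * y)"
  "L1 x * L1 y = L1 (x * y)" "L2 x * L2 y = L2 (x * y)" if "x : M" "y : M" for x y z using that c by (simp_all add: assoc[symmetric])
 note S = add_left add_right assoc v_tail v_iso v_orth
 have M: "?ev : M" "?et : M" by simp_all
 have "?ev * ?L (?H x) = x * ?ev" if "x : M" for x
 proof -
  have "?ev * ?L (?H x) = ev1 * L1 (cadj v1 * ?H x) * cadj v1 + ev2 * L2 (cadj v2 * ?H x) * cadj v2"
   using that endo_sum_star_hom(1)[OF e(1,2) that] by (simp add: endo_sum_def[of L1] S one)
  also have "... = (ev1 * L1 (H1 x)) * L1 (cadj v1) * cadj v1 + (ev2 * L2 (H2 x)) * L2 (cadj v2) * cadj v2" using that by (simp add: endo_sum_def S one)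
  finally show ?thesis using that by (simp add: D1 D2 add_right assoc)
 qed
 moreover have "?et * x = ?H (?L x) * ?et" if "x : M" for x
 proof -
  have "?H (?L x) * ?et = v1 * H1 (?L x * v1) * et1 + v2 * H2 (?L x * v2) * et2" using that endo_sum_star_hom(1)[OF e(3,4) that] by (simp add: endo_sum_def[of H1] S one)
  also have "... = v1 * H1 v1 * (H1 (L1 x) * et1) + v2 * H2 v2 * (H2 (L2 x) * et2)" using that by (simp add: endo_sum_def S one)
  finally show ?thesis using that by (simp add: D1(4)[symmetric] D2(4)[symmetric] add_left assoc)
 qed
 moreover have "?H ?ev * ?et = idb"
 proof -
  have "?H z * ?et = v1 * H1 (z * v1) * et1 + v2 * H2 (z * v2) * et2" if "z : M" for z using that by (simp add: endo_sum_def[of H1] S one)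
  from this[OF M(1)] have "?H ?ev * ?et = v1 * H1 (?ev * v1) * et1 + v2 * H2 (?ev * v2) * et2" .
  also have "... = v1 * H1 ev1 * (H1 (L1 (cadj v1)) * et1) + v2 * H2 ev2 * (H2 (L2 (cadj v2)) * et2)" by (simp add: S one)
  also have "... = v1 * (H1 ev1 * et1) * cadj v1 + v2 * (H2 ev2 * et2) * cadj v2" by (simp add: D1(4)[symmetric] D2(4)[symmetric] assoc)
  finally show ?thesis by (simp add: D1(5) D2(5) v_sum)
 qed
 moreover have "?ev * ?L ?et = idb"
 proof -
  have "?ev * ?L z = ev1 * L1 (cadj v1 * z) * cadj v1 + ev2 * L2 (cadj v2 * z) * cadj v2" if "z : M" for z using that by (simp add: endo_sum_def[of L1] S one)
  from this[OF M(2)] have "?ev * ?L ?et = ev1 * L1 (cadj v1 * ?et) * cadj v1 + ev2 * L2 (cadj v2 * ?et) * cadj v2" .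
  also have "... = (ev1 * L1 (H1 v1)) * L1 et1 * cadj v1 + (ev2 * L2 (H2 v2)) * L2 et2 * cadj v2" by (simp add: S one)
  also have "... = v1 * (ev1 * L1 et1) * cadj v1 + v2 * (ev2 * L2 et2) * cadj v2" by (simp add: D1(3) D2(3) assoc)
  finally show ?thesis by (simp add: D1(6) D2(6) v_sum)
 qed
 ultimately show ?thesis using M by (simp add: dual_pair_def intertwiners_def)
qed

context endo_tensor
begin

lemma left_dual_dual_pair:
 assumes H: "H : S" and Y: "Y : Obj" and d: "is_left_dual CC (Some H) Y"
 obtains L ev et where "Y = Some L" "L : S" "dual_pair H L ev et"
proof -
 obtain ev et where *: "ev : homs (ec Y (Some H)) (Some id)" "et : homs (Some id) (ec (Some H) Y)"
  and z: "Defs.endo_id (Some H) * lwhisk CC (Some H) (ec Y (Some H)) (Some id) ev *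
    Asc CC (Some H) Y (Some H) * rwhisk CC (Some id) (ec (Some H) Y) (Some H) et = Defs.endo_id (Some H)"
   "Defs.endo_id Y * rwhisk CC (ec Y (Some H)) (Some id) Y ev *
    inv_mor CC (ec (ec Y (Some H)) Y) (ec Y (ec (Some H) Y)) (Asc CC Y (Some H) Y) *
    lwhisk CC Y (Some id) (ec (Some H) Y) et = Defs.endo_id Y" using d H Y by (auto simp: is_left_dual_def Mor_CC)
 show ?thesis
 proof (cases Y)
  case None
  hence "idb = (0 :: 'h op)" using z(1) * by (simp add: hom_None whisk_simps Defs.endo_id_def)
  thus ?thesis by simp
 next
  case (Some L)
  have L: "L : S" using Y by (simp add: Some)
  have e: "H : End" "L : End" using H L by (simp_all add: S_endoD)
  have i: "inv_mor CC (Some (L o H o L)) (Some (L o (H o L))) idb = idb" using inv_mor_CC[of "Some (L o H o L)"] H L e by (simp add: comp_assoc endo_id)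
  have "dual_pair H L ev et" using * z H L by (simp add: dual_pair_def Some hom_Some whisk_simps Defs.endo_id_def endo_id[OF e(1)] endo_id[OF e(2)] i)
  thus ?thesis using that Some L by blast
 qed
qed

text \<open>Gram-Schmidt orthogonalization of the two injections of \<open>id \<oplus> id\<close>.\<close>

lemma cuntz_pair:
 assumes Z: "Z : Obj" and d: "is_direct_sum CC Z [Some id, Some id]"
 obtains v1 v2 where "cuntz_factor M v1 v2"
proof -
 let ?Xs = "[Some id, Some id :: 'h endo option]"
 obtain i p where raw: "ALL k<length ?Xs. i k : Mor CC (?Xs ! k) Z & p k : Mor CC Z (?Xs ! k)"
  "ALL j<length ?Xs. ALL k<length ?Xs. p j * i k = (if j = k then Idm CC (?Xs ! k) else 0)"
  "(\<Sum>k<length ?Xs. i k * p k) = Idm CC Z" using d unfolding is_direct_sum_def endo_category_simps(2) by (elim exE conjE)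
 have "?Xs ! k = Some id" if "k < 2" for k using that by (auto simp: less_2_cases_iff)
 with raw Z have ip: "i k : homs (Some id) Z" "p k : homs Z (Some id)" if "k < 2" for k using that by (simp_all add: Mor_CC numeral_2_eq_2)
 have pi: "p j * i k = (if j = k then idb else 0)" if "j < 2" "k < 2" for j k
  using raw(2) that \<open>\<And>k. k < 2 ==> ?Xs ! k = Some id\<close>[OF that(2)] by (simp add: Defs.endo_id_def)
 have sum: "i 0 * p 0 + i 1 * p 1 = Defs.endo_id Z" using raw(3) by (simp add: numeral_2_eq_2)
 obtain H where H: "Z = Some H" "H : S" using Z ip(1)[of 0] pi[of 0 0] by (cases Z) (auto simp: hom_None)
 have e: "H : End" using H by (simp add: S_endoD)
 have i: "i 0 : Hom id H" "i 1 : Hom id H" using ip(1)[of 0] ip(1)[of 1] H by (simp_all add: hom_Some)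
 have [simp]: "i 0 : M" "i (Suc 0) : M" "p 0 : M" "p (Suc 0) : M" using ip[of 0] ip[of 1] by (auto dest: homD(1))
 have id_irr: "irr id" by (rule automorphism_irreducible) (simp add: automorphisms_def)
 have unit: "EX v:Hom id H. cadj v * v = idb & (EX c. w = scl c v)" if w: "w : Hom id H" "w ~= 0" for w
 proof -
  have wM: "w : M" using w by (auto dest: HomD)
  obtain c where c: "cadj w * w = scl c idb" using irreducible_scalar[OF id_irr Hom_o[OF Hom_cadj[OF id_endo e w(1)] w(1)]] by blast
  obtain r where r: "r >= 0" "c = complex_of_real r" by (rule cadj_self_scalar[OF wM c])
  have r0: "r > 0" using c r cadj_self_eq_0[OF wM] w(2) by (cases "r = 0") auto
  have sc: "complex_of_real (1 / sqrt r) \<^bold>* (complex_of_real (1 / sqrt r) \<^bold>* c) = 1"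
   using r0 unfolding r(2) of_real_mult[symmetric] by (simp add: field_simps)
  show ?thesis
  proof (intro bexI conjI exI)
   show "scl (complex_of_real (1 / sqrt r)) w : Hom id H" by (rule Hom_scale[OF e w(1)])
   show "cadj (scl (complex_of_real (1 / sqrt r)) w) * scl (complex_of_real (1 / sqrt r)) w = idb" using wM sc by (simp add: cadj_scale scale_left scale_right c)
   show "w = scl (complex_of_real (sqrt r)) (scl (complex_of_real (1 / sqrt r)) w)" using r0 by (simp flip: of_real_mult)
  qed
 qed
 have i0: "i 0 ~= 0" using pi[of 0 0] by auto
 obtain v1 c1 where v1: "v1 : Hom id H" "cadj v1 * v1 = idb" "i 0 = scl c1 v1" using unit[OF i(1) i0] by blast
 have v1M [simp]: "v1 : M" using v1 by (auto dest: HomD)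
 \<comment> \<open>The second injection made orthogonal to \<open>v1\<close>. It is nonzero because
   the second projection kills \<open>v1\<close> but not the second injection.\<close>
 define w where "w = i 1 - v1 * cadj v1 * i 1"
 have w: "w : Hom id H" unfolding w_def using v1(1) i(2) e by (intro intertwiners_diff Hom_o) (auto intro: Hom_cadj)
 have p1v1: "p (Suc 0) * v1 = 0"
 proof -
  have "c1 ~= 0" using i0 v1 by auto
  moreover have "scl c1 (p 1 * v1) = 0" using pi[of 1 0] by (simp add: v1(3) scale_right)
  ultimately show ?thesis by simp
 qed
 have "p 1 * w = idb" using pi[of 1 1] by (simp add: w_def diff_right eq_tail[OF p1v1])
 hence "w ~= 0" by auto
 obtain v2 c2 where v2: "v2 : Hom id H" "cadj v2 * v2 = idb" "w = scl c2 v2" using unit[OF w \<open>w ~= 0\<close>] by blast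
 have v2M [simp]: "v2 : M" using v2 by (auto dest: HomD)
 have c2: "c2 ~= 0" using \<open>w ~= 0\<close> v2 by auto
 have "cadj v1 * w = 0" by (simp add: w_def diff_right eq_tail[OF v1(2)])
 hence o: "cadj v1 * v2 = 0" using c2 by (simp add: v2(3) scale_right)
 from arg_cong[OF o, of cadj] have o': "cadj v2 * v1 = 0" by (simp add: cadj_o)
 let ?q = "v1 * cadj v1 + v2 * cadj v2"
 have qv: "?q * v1 = v1" "?q * v2 = v2" by (simp_all add: add_left assoc v1(2) v2(2) o o')
 have q0: "?q * i 0 = i 0" by (simp add: v1(3) scale_right qv)
 have "?q * w = w" by (simp add: v2(3) scale_right qv)
 moreover have "i 1 = w + v1 * cadj v1 * i 1" by (simp add: w_def)
 ultimately have q1: "?q * i 1 = i 1" by (metis add_right assoc qv(1))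
 have one: "i 0 * p 0 + i 1 * p 1 = idb" using sum by (simp add: H Defs.endo_id_def)
 have "?q * (i 0 * p 0 + i 1 * p 1) = i 0 * p 0 + i 1 * p 1" by (simp only: add_right assoc[symmetric] q0 q1)
 hence q: "?q = idb" by (simp only: one compose_id)
 \<comment> \<open>On \<open>M\<close> the object \<open>H\<close> is the direct sum of two
   identities. As an object of the category it is normal, and this is the required instance.\<close>
 have eq: "H x = v1 * x * cadj v1 + v2 * x * cadj v2" if "x : M" for x
 proof -
  have "H x = H x * ?q" by (simp add: q)
  also have "... = (H x * v1) * cadj v1 + (H x * v2) * cadj v2" by (simp add: add_right assoc)
  finally show ?thesis by (simp only: HomD(2)[OF v1(1) that, symmetric] HomD(2)[OF v2(1) that, symmetric]
     id_apply assoc)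
 qed
 have "cuntz_factor M v1 v2"
 proof unfold_locales
  show "normal_map M (%x. v1 * x * cadj v1 + v2 * x * cadj v2)" using endo_normal[OF endo_cong[OF e eq]] .
 qed (use v1 v2 q in simp_all)
 thus ?thesis by (rule that)
qed

end

lemma (in endo_tensor) right_dual_dual_pair:
 assumes L: "L : S" and X: "X : Obj" and d: "is_left_dual CC X (Some L)"
 obtains H ev et where "X = Some H" "H : S" "dual_pair H L ev et"
proof (cases X)
 case None
 have "Mor CC None (Some id) = {0}" using L by (simp add: Mor_CC hom_None)
 hence "rwhisk CC None (Some id) (Some L) ev = 0" if "ev : Mor CC None (Some id)" for ev using that by (simp add: rwhisk_def endo_category_def)
 hence "Defs.endo_id (Some L) = 0" using d unfolding is_left_dual_def None by (force simp: Defs.endo_id_def)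
 thus ?thesis by (simp add: Defs.endo_id_def)
next
 case (Some H)
 have "H : S" using X by (simp add: Some)
 thus ?thesis using left_dual_dual_pair[of H "Some L"] L d that by (auto simp: Some)
qed

text \<open>If the counit were degenerate, then \<open>dl\<close> would come from a map \<open>d : 1 \<rightarrow> L L\<close> that is annihilated
 by the part \<open>b : L L \<rightarrow> 1\<close> of the multiplication.\<close>

lemma (in separable_algebra) counit_exists:
 assumes L: "L : End" "irr L" and L': "L' : End" "dual_pair L L' ev et"
  and zero: "Hom id L = {0}" and sum: "isum A [id, L]"
 obtains ep where "ep : Hom A id" "A ep * m * A dl = idb" "ep * m * A dl = idb"
  "Hom id A = range (%c. scl c u)"
proof -
 obtain w :: "nat => 'h op" where w: "ALL i<2. w i : Hom ([id, L] ! i) A & cadj (w i) * w i = idb"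
  "(\<Sum>i<2. w i * cadj (w i)) = idb" using sum unfolding isometric_sum_def by (auto simp: numeral_2_eq_2)
 define s where "s = w 0"
 define t where "t = w 1"
 have s: "s : Hom id A" "cadj s * s = idb" and t: "t : Hom L A" "cadj t * t = idb"
  and one: "s * cadj s + t * cadj t = idb" using w(1)[rule_format, of 0] w(1)[rule_format, of 1] w(2) by (simp_all add: s_def t_def numeral_2_eq_2)
 have s': "cadj s : Hom A id" and t': "cadj t : Hom A L" using s t L by (simp_all add: Hom_cadj)
 have M [simp]: "s : M" "t : M" using s t by (auto dest: HomD)
 note [simp] = endo_in[OF L(1)]
 have sx: "A x * s = s * x" and s'x: "cadj s * A x = x * cadj s" and tx: "A x * t = t * L x"
  and t'x: "cadj t * A x = L x * cadj t" if "x : M" for x using HomD(2)[OF s(1) that] HomD(2)[OF s' that] HomD(2)[OF t(1) that]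
   HomD(2)[OF t' that] by simp_all
 have id_irr: "irr id" by (rule automorphism_irreducible) (simp add: automorphisms_def)
 have s_span: "EX c. f = scl c s" if f: "f : Hom id A" for f
 proof -
  have "(s * cadj s + t * cadj t) * f = f" by (simp only: one compose_id)
  hence "f = s * (cadj s * f) + t * (cadj t * f)" by (simp only: add_left assoc)
  moreover have "cadj t * f = 0" using Hom_o[OF t' f] zero by simp
  moreover obtain c where "cadj s * f = scl c idb" using irreducible_scalar[OF id_irr Hom_o[OF s' f]] by blast
  ultimately show ?thesis by (auto simp: scale_right)
 qed
 have u_hom: "u : Hom id A" using mu_hom(2) by (simp add: hom_Some)
 obtain z where z: "u = scl z s" using s_span[OF u_hom] by blast
 have "u ~= 0" using m_unit_left by auto
 hence z0: "z ~= 0" using z by auto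
 have s_u: "s = scl (1 / z) u" using z0 by (simp add: z)
 have span: "EX c. f = scl c u" if f: "f : Hom id A" for f using s_span[OF f] by (metis s_u op_space.scale_scale)
 have unit_homs: "Hom id A = range (%c. scl c u)" using span Hom_scale[OF A_endo u_hom] by auto
 have su: "cadj s * u = scl z idb" by (simp add: z scale_right s)
 have "cadj s * dl : Hom id A" by (simp add: intertwiners_def assoc dl_comm) (simp add: assoc[symmetric] s'x)
 then obtain c where c: "cadj s * dl = scl c u" using span by blast
 have "A (cadj s) * dl : Hom id A" by (simp add: intertwiners_def assoc dl_comm) (simp add: assoc[symmetric] A_o[symmetric] s'x)
 then obtain c' where c': "A (cadj s) * dl = scl c' u" using span by blast
 \<comment> \<open>Projecting both legs of \<open>dl\<close> to the unit object gives the same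
   scalar in either order, so the left and right constants coincide.\<close>
 have "cadj s * A (cadj s) * dl = cadj s * cadj s * dl" by (simp add: assoc[symmetric] s'x)
 hence "scl (c' \<^bold>* z) (idb :: 'h op) = scl (c \<^bold>* z) idb" by (simp add: c c' scale_right su)
 hence cc: "c' = c" using z0 by (simp del: op_space.scale_scale)
 have e1: "cadj s * m * A dl = scl c idb"
 proof -
  have "cadj s * m * A dl = (cadj s * A m) * dl" by (simp add: dl_central assoc)
  thus ?thesis by (simp add: s'x assoc c scale_right m_unit_left)
 qed
 have e2: "A (cadj s) * m * A dl = scl c idb"
 proof -
  have "A (cadj s) * m * A dl = m * A (A (cadj s) * dl)" by (simp add: A_o eq_tail[OF m_comm] assoc)
  thus ?thesis by (simp add: c' cc A_scale scale_right m_unit_right)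
 qed
 have "c ~= 0"
 proof
  assume "c = 0"
  hence 0: "cadj s * dl = 0" "A (cadj s) * dl = 0" by (simp_all add: c c' cc)
  define d where "d = L (cadj t) * cadj t * dl"
  define b where "b = cadj s * m * t * L t"
  have [simp]: "d : M" "b : M" by (simp_all add: d_def b_def)
  have dl1: "t * cadj t * dl = dl" using arg_cong[OF one, of "%x. x * dl"] by (simp add: add_left assoc 0)
  have dl2: "A t * A (cadj t) * dl = dl"
  proof -
   have "A (s * cadj s + t * cadj t) * dl = dl" by (simp add: one)
   thus ?thesis by (simp add: A_add A_o add_left assoc 0)
  qed
  have dl_eq: "t * L t * d = dl"
  proof -
   have "t * L t * d = (t * L t) * (L (cadj t) * cadj t) * dl" by (simp add: d_def assoc)
   also have "... = A t * (t * cadj t * A (cadj t) * dl)" by (simp add: tx[symmetric] t'x assoc eq_tail[OF t'x])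
   also have "... = A t * A (cadj t) * dl"
   proof -
    have "t * cadj t * A (cadj t) * dl = t * L (cadj t) * cadj t * dl" by (simp add: eq_tail[OF t'x] assoc)
    also have "... = A (cadj t) * t * cadj t * dl" by (simp add: eq_tail[OF tx[symmetric]] assoc)
    finally show ?thesis by (simp add: dl1)
   qed
   finally show ?thesis by (simp add: dl2)
  qed
  have "d * x = L (L x) * d" if "x : M" for x
  proof -
   have "d * x = L (cadj t) * (cadj t * A (A x)) * dl" using that by (simp add: d_def assoc dl_comm)
   also have "... = L (cadj t * A x) * cadj t * dl" using that by (simp only: t'x[OF A_in[OF that]]) (simp add: endo_o[OF L(1)] assoc)
   also have "... = L (L x * cadj t) * cadj t * dl" using that by (simp add: t'x)
   finally show ?thesis using that by (simp add: endo_o[OF L(1)] d_def assoc)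
  qed
  hence d: "d : Hom id (L o L)" by (simp add: intertwiners_def)
  have "b * L (L x) = x * b" if "x : M" for x
  proof -
   have "b * L (L x) = cadj s * m * t * L (t * L x)" using that by (simp add: b_def assoc endo_o[OF L(1)])
   also have "... = cadj s * m * t * L (A x * t)" using that by (simp only: tx)
   also have "... = cadj s * m * (t * L (A x)) * L t" using that by (simp add: endo_o[OF L(1)] assoc)
   also have "... = cadj s * (m * A (A x)) * t * L t" using that by (simp only: tx[OF A_in, symmetric] assoc)
   also have "... = (cadj s * A x) * m * t * L t" using that by (simp add: m_comm assoc)
   finally show ?thesis using that by (simp add: s'x b_def assoc)
  qed
  hence b: "b : Hom (L o L) id" by (simp add: intertwiners_def)
  \<comment> \<open>From \<open>m * dl = u\<close> the composite \<open>b * d\<close> is the nonzero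
    scalar \<open>z\<close>, so neither map vanishes and \<open>L b * d\<close> is nonzero as well.
    Degeneracy will give \<open>L b * d = 0\<close>.\<close>
  have "b * d = cadj s * m * t * L t * d" by (simp add: b_def assoc)
  hence "b * d = scl z idb" by (simp add: dl_eq dl_section su)
  hence "b ~= 0" "d ~= 0" using z0 by auto
  hence ne: "L b * d ~= 0" using irreducible_snake[OF L L' b _ d] by simp
  have "A (cadj s * m) * dl = 0" using e2 \<open>c = 0\<close> by (simp add: A_o dl_central assoc)
  hence "(A (cadj s * m) * dl) * t = 0" by simp
  hence "A (cadj s * m * A t) * dl = 0" by (simp add: assoc dl_comm A_o)
  hence "A (cadj s * m * A t) * t * L t * d = 0" by (simp add: dl_eq)
  moreover have "A (cadj s * m * A t) * t * L t * d = t * L (cadj s * m * A t * t) * d" by (simp add: eq_tail[OF tx] endo_o[OF L(1)] assoc)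
  ultimately have "t * L b * d = 0" by (simp add: tx b_def)
  hence "L b * d = 0" using eq_tail[OF t(2), of "L b * d"] by simp
  with ne show False by simp
 qed
 define ep where "ep = scl (1 / c) (cadj s)"
 show ?thesis
 proof (rule that[of ep])
  show "ep : Hom A id" unfolding ep_def by (rule Hom_scale[OF id_endo s'])
  show "A ep * m * A dl = idb" "ep * m * A dl = idb" using \<open>c ~= 0\<close> by (simp_all add: ep_def A_scale scale_left e1 e2)
 qed (rule unit_homs)
qed

section \<open>The even part of the subfactor\<close>

context factor
begin

lemma gideal_one_cong: "idb : gideal M P H H ==> (!!x. x : M ==> H x = L x) ==> idb : gideal M P L L" using gideal_cong[of H L H L] by blast

lemma lub_automorphism:
 assumes e: "be : End" "be' : End" and be: "!!x. x : M ==> be (be' x) = x" "!!x. x : M ==> be' (be x) = x"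
  and D: "D <= M" and lub: "is_lub_in M D s" shows "is_lub_in M (be ` D) (be s)" unfolding is_lub_in_def
proof (intro conjI ballI impI)
 have s: "s : M" using lub by (simp add: is_lub_in_def)
 show "be s : M" using endo_in[OF e(1) s] .
 show "le_in M y (be s)" if "y : be ` D" for y using that lub le_in_endo[OF e(1) _ s] D by (auto simp: is_lub_in_def)
 fix t assume t: "t : M" "ALL y:be ` D. le_in M y t"
 have t': "be' t : M" using endo_in[OF e(2) t(1)] .
 have "le_in M x (be' t)" if "x : D" for x using that t le_in_endo[OF e(2) endo_in[OF e(1)] t(1), of x] D be(2)[of x] by auto
 hence "le_in M s (be' t)" using lub t' by (simp add: is_lub_in_def)
 thus "le_in M (be s) t" using le_in_endo[OF e(1) s t'] be(1)[OF t(1)] by simp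
qed

text \<open>The expectation is conjugated by the automorphism, which keeps the Pimsner-Popa
  constant.\<close>

lemma finite_index_twist:
 assumes e: "be : End" "be' : End" and be: "!!x. x : M ==> be (be' x) = x" "!!x. x : M ==> be' (be x) = x"
  and H: "H : finite_index_endomorphisms M" shows "be o H : finite_index_endomorphisms M"
proof -
 obtain F c where He: "H : End" and F: "conditional_expectation M (H ` M) F" and n: "normal_map M F"
  and c: "c > 0" "!!x. x : M ==> le_in M (c *\<^sub>R (cadj x * x)) (F (cadj x * x))" using H by (auto simp: finite_index_endomorphisms_def)
 note [simp] = e[THEN endo_in] endo_in[OF He] be
 have FM: "F x : M" if "x : M" for x using F that unfolding conditional_expectation_def by fastforce
 have scaleR: "be (r *\<^sub>R x) = r *\<^sub>R be x" if "x : M" for r x using endo_scale[OF e(1) that, of "complex_of_real r"] by (simp add: op_scale_of_real)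
 define F' where "F' x = be (F (be' x))" for x
 have cond: "F a = a" "F (x + y) = F x + F y" "F (scl z x) = scl z (F x)"
  "F (a * x * b) = a * F x * b" "le_in M 0 (F (cadj x * x))" "F x : H ` M"
  if "a : H ` M" "b : H ` M" "x : M" "y : M" for a b x y z using F that unfolding conditional_expectation_def by auto
 have H0: "H 0 : H ` M" by simp
 have mult: "F' ((be o H) p * x * (be o H) q) = (be o H) p * F' x * (be o H) q" if "p : M" "q : M" "x : M" for p q x
 proof -
  have "F' ((be o H) p * x * (be o H) q) = be (F (H p * be' x * H q))" using that by (simp add: F'_def endo_o[OF e(2)])
  also have "F (H p * be' x * H q) = H p * F (be' x) * H q" using that by (intro cond(4)[OF _ _ _ M_0]) auto
  finally show ?thesis using that FM by (simp add: F'_def endo_o[OF e(1)])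
 qed
 have "conditional_expectation M ((be o H) ` M) F'" unfolding conditional_expectation_def
 proof (intro conjI ballI allI)
  fix x assume x: "x : M"
  show "F' x : (be o H) ` M" using cond(6)[OF H0 H0 _ M_0, of "be' x"] x by (auto simp: F'_def image_iff)
  show "F' (x + y) = F' x + F' y" if "y : M" for y using x that FM cond(2)[OF H0 H0, of "be' x" "be' y"] by (simp add: F'_def endo_add[OF e(2)] endo_add[OF e(1)])
  have "le_in M 0 (F (cadj (be' x) * be' x))" using x by (intro cond(5)[OF H0 H0 _ M_0]) auto
  hence "le_in M (be 0) (be (F (cadj (be' x) * be' x)))" using x FM by (intro le_in_endo[OF e(1)]) auto
  thus "le_in M 0 (F' (cadj x * x))" using x by (simp add: F'_def endo_o[OF e(2)] endo_cadj[OF e(2)] endo_0[OF e(1)])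
 next
  fix z x assume x: "x : M"
  show "F' (scl z x) = scl z (F' x)" using x FM cond(3)[OF H0 H0 _ M_0, of "be' x"] by (simp add: F'_def endo_scale[OF e(2)] endo_scale[OF e(1)])
 qed (use mult cond(1)[OF _ H0 M_0 M_0] in \<open>auto simp: F'_def\<close>)
 moreover have "normal_map M F'" unfolding normal_map_def
 proof (intro allI impI)
  fix D s
  assume D: "D ~= {} & D <= {x : M. cadj x = x} & (ALL x:D. ALL y:D. EX z:D. le_in M x z & le_in M y z) & is_lub_in M D s"
  hence DM: "D <= M" and sM: "s : M" by (auto simp: is_lub_in_def)
  have lub: "is_lub_in M (be' ` D) (be' s)" using D by (intro lub_automorphism[OF e(2,1) be(2,1) DM]) auto
  have dir: "EX z:be' ` D. le_in M x z & le_in M y z" if xy: "x : be' ` D" "y : be' ` D" for x y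
  proof -
   obtain p q where p: "p : D" "x = be' p" "q : D" "y = be' q" using xy by blast
   obtain z where z: "z : D" "le_in M p z" "le_in M q z" using D p by blast
   have "p : M" "q : M" "z : M" using p z DM by auto
   thus ?thesis using le_in_endo[OF e(2), of p z] le_in_endo[OF e(2), of q z] z p by blast
  qed
  hence dir': "ALL x:be' ` D. ALL y:be' ` D. EX z:be' ` D. le_in M x z & le_in M y z" by blast
  have sub: "be' ` D ~= {}" "be' ` D <= {x : M. cadj x = x}" using D DM by (auto simp: endo_cadj[OF e(2), symmetric])
  have "is_lub_in M (F ` be' ` D) (F (be' s))" by (rule n[unfolded normal_map_def, rule_format]) (intro conjI; fact sub dir' lub)
  hence "is_lub_in M (be ` F ` be' ` D) (be (F (be' s)))" using DM FM by (intro lub_automorphism[OF e be]) auto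
  thus "is_lub_in M (F' ` D) (F' s)" by (simp add: F'_def image_image)
 qed
 moreover have "le_in M (c *\<^sub>R (cadj x * x)) (F' (cadj x * x))" if x: "x : M" for x
 proof -
  have "le_in M (be (c *\<^sub>R (cadj (be' x) * be' x))) (be (F (cadj (be' x) * be' x)))" using x FM c(2)[of "be' x"] by (intro le_in_endo[OF e(1)]) auto
  thus ?thesis using x by (simp add: F'_def scaleR endo_o[OF e(2)] endo_cadj[OF e(2)] endo_o[OF e(1)] endo_cadj[OF e(1)])
 qed
 ultimately show ?thesis using He e(1) c(1) unfolding finite_index_endomorphisms_def by (auto intro!: exI[of _ F'])
qed

end

context subfactor_3G
begin

sublocale factor M using factor by unfold_locales (simp add: type_III_factor_def)

abbreviation simples :: "'h endo set" where
 "simples \<equiv> range \<alpha> \<union> range (%g. \<alpha> g o \<rho>)"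

abbreviation evens :: "'h endo set" where "evens \<equiv> even_objects M \<alpha> \<rho>"

lemma alpha_endo [simp]: "\<alpha> g : End" using alpha_aut by (auto simp: automorphisms_def)

lemma rho_endo' [simp]: "\<rho> : End" using rho_endo by (auto simp: finite_index_endomorphisms_def)

lemma alpha_in [simp]: "x : M ==> \<alpha> g x : M" and rho_in [simp]: "x : M ==> \<rho> x : M" by (simp_all add: endo_in)

lemma alpha_inverse: "x : M ==> \<alpha> g (\<alpha> (- g) x) = x" "x : M ==> \<alpha> (- g) (\<alpha> g x) = x"
 using alpha_add[of x g "- g"] alpha_add[of x "- g" g] alpha_zero[of x] by simp_all

lemma finite_group: "finite (UNIV :: 'g set)" using rho_square by (metis List.finite_set)

lemma simples_endo: "simples <= End" by auto

lemma simples_irreducible: "Q : simples ==> irr Q" using automorphism_irreducible[OF alpha_aut] rho_irreducible by auto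

lemma finite_simples: "finite simples" using finite_group by simp

lemma evens_eq: "evens = sums_of M simples" by (auto simp: even_objects_def sums_of_def)

lemma evens_iff: "H : evens \<longleftrightarrow> H : End & idb : gideal M simples H H" unfolding evens_eq by (rule sums_of_iff[OF simples_endo simples_irreducible])

lemma gideal_simple: "Q : simples ==> (!!x. x : M ==> H x = Q x) ==> idb : gideal M simples H H" by (rule gideal_one_cong[OF gideal_base]) auto

text \<open>Sliding \<open>\<alpha>\<close> past \<open>\<rho>\<close> turns every product into a
  single simple object, except for \<open>\<rho> o \<rho>\<close>, where the given decomposition
  enters.\<close>

lemma simples_comp:
 assumes "Q : simples" "Q' : simples" shows "idb : gideal M simples (Q o Q') (Q o Q')"
proof -
 have rho_left: "idb : gideal M simples (\<alpha> g o (\<rho> o \<rho>)) (\<alpha> g o (\<rho> o \<rho>))" for g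
 proof -
  obtain gs where gs: "isum (\<rho> o \<rho>) (id # map (%g. \<alpha> g o \<rho>) gs)" using rho_square by blast
  let ?P' = "set (id # map (%g. \<alpha> g o \<rho>) gs)"
  have P': "?P' <= End" by auto
  have "idb : gideal M ?P' (\<rho> o \<rho>) (\<rho> o \<rho>)" by (rule isometric_sum_gideal[OF gs _ P']) simp
  hence "\<alpha> g idb : gideal M ((%Q. \<alpha> g o Q) ` ?P') (\<alpha> g o (\<rho> o \<rho>)) (\<alpha> g o (\<rho> o \<rho>))"
   by (rule gideal_whisker_left[OF _ _ P']) auto
  hence "idb : gideal M ((%Q. \<alpha> g o Q) ` ?P') (\<alpha> g o (\<rho> o \<rho>)) (\<alpha> g o (\<rho> o \<rho>))" by (simp add: endo_id)
  thus ?thesis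
  proof (rule gideal_trans)
   fix Q assume "Q : (%Q. \<alpha> g o Q) ` ?P'"
   then consider "Q = \<alpha> g" | h where "Q = \<alpha> g o (\<alpha> h o \<rho>)" by auto
   thus "idb : gideal M simples Q Q"
   proof cases
    case (2 h)
    thus ?thesis by (intro gideal_simple[of "\<alpha> (g + h) o \<rho>"]) (simp_all add: alpha_add)
   qed (simp add: gideal_base)
  qed
 qed
 from assms consider g h where "Q = \<alpha> g" "Q' = \<alpha> h" | g h where "Q = \<alpha> g" "Q' = \<alpha> h o \<rho>"
  | g h where "Q = \<alpha> g o \<rho>" "Q' = \<alpha> h" | g h where "Q = \<alpha> g o \<rho>" "Q' = \<alpha> h o \<rho>" by auto
 thus ?thesis
 proof cases
  case (1 g h)
  thus ?thesis by (intro gideal_simple[of "\<alpha> (g + h)"]) (simp_all add: alpha_add)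
 next
  case (2 g h)
  thus ?thesis by (intro gideal_simple[of "\<alpha> (g + h) o \<rho>"]) (simp_all add: alpha_add)
 next
  case (3 g h)
  thus ?thesis using alpha_rho[of _ "- h"] by (intro gideal_simple[of "\<alpha> (g - h) o \<rho>"]) (simp_all add: alpha_add[of _ g "- h", simplified])
 next
  case (4 g h)
  show ?thesis using alpha_rho[of _ "- h"] unfolding 4 by (intro gideal_one_cong[OF rho_left[of "g - h"]]) (simp add: alpha_add[of _ g "- h", simplified])
 qed
qed

sublocale even: endo_tensor M evens
proof
 show "evens <= End" by (auto simp: even_objects_def)
 show "id : evens" unfolding evens_iff using gideal_simple[of "\<alpha> 0" id] by (simp add: alpha_zero)
 show "H o L : evens" if "H : evens" "L : evens" for H L
  using sums_of_comp[OF simples_endo simples_irreducible simples_comp that[unfolded evens_eq]] by (simp only: evens_eq)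
qed

lemma simples_even: "simples <= evens"
proof
 fix Q assume "Q : simples"
 thus "Q : evens" unfolding evens_iff using subsetD[OF simples_endo] gideal_base[of Q] by simp
qed

lemma even_fusion: "fusion_category even.CC" using fusion by (simp add: even_part_def)

lemma cuntz_exists: obtains v1 v2 where "cuntz_factor M v1 v2"
proof -
 interpret C: fusion_category even.CC by (rule even_fusion)
 obtain Z where "Z : even.Obj" "is_direct_sum even.CC Z [Some id, Some id]" using C.additive[of "[Some id, Some id]"] by auto
 thus ?thesis using even.cuntz_pair that by blast
qed

lemma even_duals:
 assumes "H : evens" shows "EX L:evens. EX ev et. dual_pair H L ev et" "EX L:evens. EX ev et. dual_pair L H ev et"
proof -
 interpret C: fusion_category even.CC by (rule even_fusion)
 obtain Y where Y: "Y : even.Obj" "is_left_dual even.CC (Some H) Y" using C.left_dual[of "Some H"] assms by auto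
 show "EX L:evens. EX ev et. dual_pair H L ev et" using even.left_dual_dual_pair[OF assms Y] by metis
 obtain X where X: "X : even.Obj" "is_left_dual even.CC X (Some H)" using C.right_dual[of "Some H"] assms by auto
 show "EX L:evens. EX ev et. dual_pair L H ev et" using even.right_dual_dual_pair[OF assms X] by metis
qed

lemma even_objects_mono:
 assumes "!!j. EX k. ALL x:M. \<alpha> j (H1 x) = \<alpha> k (H2 x)" shows "even_objects M \<alpha> H1 <= even_objects M \<alpha> H2"
proof
 fix H assume "H : even_objects M \<alpha> H1"
 then obtain Hs where H: "H : End" "isum H Hs"
  "set Hs <= range \<alpha> \<union> range (%j. \<alpha> j o H1)" by (auto simp: even_objects_def)
 have "EX L. L : range \<alpha> \<union> range (%j. \<alpha> j o H2) & (ALL x:M. Q x = L x)" if "Q : set Hs" for Q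
 proof -
  have "Q : range \<alpha> \<union> range (%j. \<alpha> j o H1)" using H(3) that by blast
  thus ?thesis
  proof (elim UnE rangeE)
   fix j assume "Q = \<alpha> j o H1"
   thus ?thesis using assms[of j] by (metis UnCI comp_apply rangeI)
  qed blast
 qed
 then obtain f where f: "!!Q. Q : set Hs ==> f Q : range \<alpha> \<union> range (%j. \<alpha> j o H2) & (ALL x:M. Q x = f Q x)" by metis
 have "isum H (map f Hs)" by (rule isometric_sum_cong[OF H(2)]) (use f in auto)
 moreover have "set (map f Hs) <= range \<alpha> \<union> range (%j. \<alpha> j o H2)" using f by auto
 ultimately show "H : even_objects M \<alpha> H2" using H(1) unfolding even_objects_def by blast
qed

lemma even_part_translate: "even_part M \<alpha> (\<alpha> g o \<rho>) = even_part M \<alpha> \<rho>"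
proof -
 have "EX k. ALL x:M. \<alpha> j ((\<alpha> g o \<rho>) x) = \<alpha> k (\<rho> x)" for j by (rule exI[of _ "j + g"]) (simp add: alpha_add)
 moreover have "EX k. ALL x:M. \<alpha> j (\<rho> x) = \<alpha> k ((\<alpha> g o \<rho>) x)" for j by (rule exI[of _ "j - g"]) (simp add: alpha_add[symmetric])
 ultimately have "even_objects M \<alpha> (\<alpha> g o \<rho>) = evens" by (intro equalityI even_objects_mono)
 thus ?thesis by (simp add: even_part_def)
qed

text \<open>Passing from \<open>\<rho>\<close> to \<open>\<alpha> g o \<rho>\<close> relabels the
  noninvertible simple objects and keeps the square: the two twists in
  \<open>\<alpha> g o \<rho> o \<alpha> g o \<rho>\<close> cancel. Self-duality thus becomes
  applicable to the algebra \<open>1 + \<alpha> g \<rho>\<close>.\<close>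

lemma subfactor_translate:
 assumes q: "q_system (even_part M \<alpha> \<rho>) (A, m, u)" "isum A [id, \<alpha> g o \<rho>]" shows "subfactor_3G M \<alpha> (\<alpha> g o \<rho>)"
proof (rule subfactor_3G.intro)
 have eq: "(\<alpha> h o (\<alpha> g o \<rho>)) x = (\<alpha> (h + g) o \<rho>) x" if "x : M" for h x using that by (simp add: alpha_add)
 have sum_eq: "isum H [\<alpha> h o (\<alpha> g o \<rho>)] \<longleftrightarrow> isum H [\<alpha> (h + g) o \<rho>]" for H h
  by (intro iffI; erule isometric_sum_cong) (use eq in \<open>auto simp: nth_Cons'\<close>)
 show "\<alpha> g o \<rho> : finite_index_endomorphisms M" using alpha_inverse by (intro finite_index_twist[of _ "\<alpha> (- g)"] rho_endo) auto
 show "\<alpha> h ((\<alpha> g o \<rho>) x) = (\<alpha> g o \<rho>) (\<alpha> (- h) x)" if "x : M" for h x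
  using that alpha_add[of "\<rho> x" h g] alpha_add[of "\<rho> x" g h] alpha_rho[OF that, of h] by (simp add: add.commute)
 show "irr (\<alpha> h o (\<alpha> g o \<rho>))" for h using rho_irreducible[of "h + g"]
   Hom_cong[of "\<alpha> h o (\<alpha> g o \<rho>)" "\<alpha> (h + g) o \<rho>" "\<alpha> h o (\<alpha> g o \<rho>)" "\<alpha> (h + g) o \<rho>"] eq
  by (simp add: irreducible_endo_def)
 show "h = k" if "isum (\<alpha> h o (\<alpha> g o \<rho>)) [\<alpha> k o (\<alpha> g o \<rho>)]" for h k
 proof -
  have "isum (\<alpha> (h + g) o \<rho>) [\<alpha> (k + g) o \<rho>]" using that by (rule isometric_sum_cong) (use eq in \<open>auto simp: nth_Cons'\<close>)
  thus ?thesis using alpha_rho_inequiv by fastforce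
 qed
 show "\<not> isum (\<alpha> h) [\<alpha> k o (\<alpha> g o \<rho>)]" for h k using alpha_not_rho by (simp add: sum_eq)
 show "EX gs. distinct gs & set gs = UNIV &
   isum (\<alpha> g o \<rho> o (\<alpha> g o \<rho>)) (id # map (%h. \<alpha> h o (\<alpha> g o \<rho>)) gs)"
 proof -
  obtain gs where gs: "distinct gs" "set gs = UNIV" "isum (\<rho> o \<rho>) (id # map (%g. \<alpha> g o \<rho>) gs)" using rho_square by blast
  \<comment> \<open>The relabeling shifts the enumeration of the group:
    \<open>\<alpha> (h - g)\<close> composed with the new generator is
    \<open>\<alpha> h o \<rho>\<close>.\<close>
  have "isum (\<alpha> g o \<rho> o (\<alpha> g o \<rho>)) (id # map (%h. \<alpha> h o (\<alpha> g o \<rho>)) (map (%h. h - g) gs))" using gs(3)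
  proof (rule isometric_sum_cong)
   show "(\<rho> o \<rho>) x = (\<alpha> g o \<rho> o (\<alpha> g o \<rho>)) x" if "x : M" for x
    using arg_cong[OF alpha_rho[OF rho_in[OF that], of "- g"], of "\<alpha> g"] that by (simp add: alpha_inverse)
   show "((id # map (%g. \<alpha> g o \<rho>) gs) ! i) x = ((id # map (%h. \<alpha> h o (\<alpha> g o \<rho>)) (map (%h. h - g) gs)) ! i) x"
    if "i < length (id # map (%g. \<alpha> g o \<rho>) gs)" "x : M" for i x using that by (cases i) (simp_all add: alpha_add[of _ _ g, symmetric])
  qed simp
  moreover have "distinct (map (%h. h - g) gs)" using gs(1) by (simp add: distinct_map inj_on_def)
  moreover have "set (map (%h. h - g) gs) = UNIV" using gs(2) surj_plus_right[of "- g"] by simp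
  ultimately show ?thesis by blast
 qed
 show "EX A m u. q_system (even_part M \<alpha> (\<alpha> g o \<rho>)) (A, m, u) & isum A [id, \<alpha> g o \<rho>]" using q unfolding even_part_translate by blast
qed (use factor alpha_aut alpha_zero alpha_add alpha_inequiv fusion in \<open>simp_all add: even_part_translate\<close>)

text \<open>A tensor equivalence with the semisimple category of even endomorphisms makes the multiplication,
 which is a bimodule map \<open>A \<otimes> A \<rightarrow> A\<close>, a split epimorphism.\<close>

lemma separability:
 assumes alg: "is_algebra even.CC (Some A, m, u)"
  and eq: "tensor_equivalent (bimodule_category even.CC (Some A, m, u)) even.CC"
 obtains dl where "dl : Hom id (A o A)" "m * A dl = A m * dl" "m * dl = u"
proof -
 interpret A: endo_algebra M evens A m u by unfold_locales (rule alg)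
 let ?B = "bimodule_category even.CC A.AA"
 obtain FO FM J e where F: "tensor_equivalence ?B even.CC FO FM J e" using eq by (auto simp: tensor_equivalent_def)
 interpret F: tensor_equivalence ?B even.CC FO FM J e by fact
 \<comment> \<open>\<open>A A\<close> with its outer actions, so that \<open>m\<close> is a bimodule
   map from it to \<open>A\<close>. Its existence avoids decomposing any relative tensor
   product.\<close>
 let ?X = "A.free id"
 have X: "A.bim ?X" by (rule A.free_bim) simp
 have Xs: "fst ?X = Some (A o A)" "fst (snd ?X) = m" "snd (snd ?X) = A m" by (simp_all add: A.free_def)
 have ob: "?X : Ob ?B" "A.UU : Ob ?B" using X A.UU_bim by (simp_all add: bimodule_category_def)
 have B: "Mor ?B = bimodule_maps even.CC A.AA" "Cmp ?B = (*)" by (simp_all add: bimodule_category_def)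
 have m: "m : Mor ?B ?X A.UU" unfolding B A.bimodule_maps_iff[OF X A.UU_bim] using A.mu_hom(1) by (simp add: Xs A.m_assoc del: is_bimodule.simps)
 let ?f = "FM ?X A.UU m"
 have f: "?f : even.homs (FO ?X) (FO A.UU)" using bij_betw_apply[OF F.FM_bij[OF ob] m] F.FO_in[OF ob(1)] F.FO_in[OF ob(2)] by (simp add: even.Mor_CC)
 have "EX g:even.homs (FO A.UU) (FO ?X). ?f * g * ?f = ?f"
 proof (cases "FO ?X"; cases "FO A.UU")
  fix H L assume *: "FO ?X = Some H" "FO A.UU = Some L"
  hence e: "H : evens" "L : evens" using F.FO_in[OF ob(1)] F.FO_in[OF ob(2)] by simp_all
  have f': "?f : Hom H L" using f e by (simp add: * even.hom_Some)
  have H: "H : sums_of M simples" using e(1) by (simp only: evens_eq)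
  obtain g where "g : Hom L H" "?f * (g * ?f) = ?f" by (rule intertwiners_regular[OF simples_endo simples_irreducible H even.S_endoD[OF e(2)] f'])
  thus ?thesis using e by (intro bexI[of _ g]) (simp_all add: * even.hom_Some)
 qed (use f in \<open>auto simp: even.hom_None intro!: bexI[of _ 0]\<close>)
 then obtain g where g: "g : even.homs (FO A.UU) (FO ?X)" "?f * g * ?f = ?f" by blast
 hence "g : FM A.UU ?X ` Mor ?B A.UU ?X" using F.FM_bij[OF ob(2,1)] F.FO_in[OF ob(1)] F.FO_in[OF ob(2)] by (simp add: bij_betw_def even.Mor_CC)
 then obtain h where h: "h : Mor ?B A.UU ?X" "g = FM A.UU ?X h" by blast
 have "h : even.homs (Some A) (Some (A o A)) & h * m = m * A h & h * m = A m * h"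
  using h(1) unfolding B A.bimodule_maps_iff[OF A.UU_bim X] Xs fst_conv snd_conv by assumption
 hence h': "h : even.homs (Some A) (Some (A o A))" "h * m = m * A h" "h * m = A m * h" by blast+
 have hM [simp]: "h : M" using even.homD(1)[OF h'(1)] .
 have comp: "y * x : Mor ?B X Z" if x: "x : Mor ?B X Y" and y: "y : Mor ?B Y Z"
  and b: "A.bim X" "A.bim Y" "A.bim Z" for x y X Y Z
 proof -
  have x': "x : even.homs (fst X) (fst Y)" "x * fst (snd X) = fst (snd Y) * A x" "x * snd (snd X) = snd (snd Y) * x"
   using x unfolding B A.bimodule_maps_iff[OF b(1,2)] by blast+
  have y': "y : even.homs (fst Y) (fst Z)" "y * fst (snd Y) = fst (snd Z) * A y" "y * snd (snd Y) = snd (snd Z) * y"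
   using y unfolding B A.bimodule_maps_iff[OF b(2,3)] by blast+
  show ?thesis unfolding B A.bimodule_maps_iff[OF b(1,3)] using even.hom_o[OF y'(1) x'(1)] even.homD(1)[OF x'(1)] even.homD(1)[OF y'(1)]
   by (simp add: assoc x' A.A_o eq_tail[OF y'(2)] eq_tail[OF y'(3)])
 qed
 have hm: "h * m : Mor ?B ?X ?X" by (rule comp[OF m h(1) X A.UU_bim X])
 have mh: "m * h * m : Mor ?B ?X A.UU" by (rule comp[OF hm m X X A.UU_bim])
 have "FM ?X A.UU (m * h * m) = ?f * g * ?f" using F.FM_Cmp[OF ob(1,1,2) hm m] F.FM_Cmp[OF ob(1,2,1) m h(1)] by (simp add: B h(2))
 hence "m * h * m = m" using F.FM_bij[OF ob] mh m g(2) by (auto simp: bij_betw_def inj_on_def)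
 \<comment> \<open>Regularity becomes a splitting, because \<open>m\<close> can be cancelled on the
   right by \<open>u\<close>.\<close>
 hence "(m * h * m) * u = m * u" by simp
 hence mh1: "m * h = idb" by (simp add: assoc A.m_unit_left)
 show ?thesis
 \<comment> \<open>The separability element is the value of the bimodule section on the
   unit.\<close>
 proof (rule that[of "h * u"])
  show "h * u : Hom id (A o A)" using even.hom_o[OF h'(1) A.mu_hom(2)] by (simp add: even.hom_Some)
  have "m * A (h * u) = h" by (simp add: A.A_o eq_tail[OF h'(2)[symmetric]] assoc A.m_unit_right)
  moreover have "A m * h * u = h" by (simp add: eq_tail[OF h'(3)[symmetric]] assoc A.m_unit_left)
  ultimately show "m * A (h * u) = A m * h * u" by simp
  show "m * h * u = u" by (simp add: eq_tail[OF mh1])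
 qed
qed

end

section \<open>The crossed product\<close>

context factor
begin

lemma automorphism_surj: "be : Aut ==> y : M ==> EX x:M. y = be x" by (auto simp: automorphisms_def bij_betw_def)

lemma automorphism_comp: "be : Aut ==> be' : Aut ==> be o be' : Aut" by (auto simp: automorphisms_def intro: bij_betw_trans)

lemma Hom_automorphism:
 assumes "be : Aut" shows "Hom (H o be) (L o be) = Hom H L"
proof -
 have "ALL y:M. t * H y = L y * t" if "ALL x:M. t * H (be x) = L (be x) * t" for t using that automorphism_surj[OF assms] by metis
 moreover have "be x : M" if "x : M" for x using assms that by (auto simp: automorphisms_def intro: endo_in)
 ultimately show ?thesis by (auto simp: intertwiners_def)
qed

lemma unitary_symmetric:
 assumes "H : End" "L : End" "isum H [L]" shows "isum L [H]"
proof -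
 obtain s where s: "s : Hom L H" "cadj s * s = idb" "s * cadj s = idb" using assms(3) by (auto simp: isometric_sum_unitary)
 have "cadj s : Hom H L" by (rule Hom_cadj[OF assms(2,1) s(1)])
 thus ?thesis unfolding isometric_sum_unitary using s HomD(1)[OF s(1)] by (intro bexI[of _ "cadj s"]) simp_all
qed

end

lemma (in cuntz_factor) endo_sum_sums_of:
 assumes P: "P <= End" "!!Q. Q : P ==> irr Q"
  and st: "H : sums_of M P" "L : sums_of M P" shows "endo_sum H L : sums_of M P"
proof -
 have e: "H : End" "L : End"
  and g: "idb : gideal M P H H" "idb : gideal M P L L" using st sums_of_iff[OF P] by auto
 note v = v_intertwiners[OF e]
 have "v1 * (idb * cadj v1) + v2 * (idb * cadj v2) : gideal M P (endo_sum H L) (endo_sum H L)" by (intro gideal_add gideal_left[OF gideal_right[OF g(1) v(3)] v(1)]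
    gideal_left[OF gideal_right[OF g(2) v(4)] v(2)])
 thus ?thesis using e by (simp add: sums_of_iff[OF P] v_sum)
qed

text \<open>Otherwise \<open>\<rho> o \<rho>\<close> would be irreducible, although it contains both
  the identity and some \<open>\<alpha> g o \<rho>\<close>, which are inequivalent.\<close>

lemma (in subfactor_3G) rho_not_automorphism: "\<rho> \<notin> Aut"
proof
 assume "\<rho> : Aut"
 hence irr: "irr (\<rho> o \<rho>)" by (intro automorphism_irreducible automorphism_comp)
 obtain gs where gs: "set gs = UNIV" "isum (\<rho> o \<rho>) (id # map (%g. \<alpha> g o \<rho>) gs)" using rho_square by blast
 then obtain g gs' where gs': "gs = g # gs'" by (cases gs) auto
 obtain s where s: "!!i. i < Suc (length gs) ==>
   s i : Hom ((id # map (%g. \<alpha> g o \<rho>) gs) ! i) (\<rho> o \<rho>) & cadj (s i) * s i = idb" using gs(2) unfolding isometric_sum_def by auto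
 have s0: "s 0 : Hom id (\<rho> o \<rho>)" "cadj (s 0) * s 0 = idb" using s[of 0] by auto
 have s1: "s 1 : Hom (\<alpha> g o \<rho>) (\<rho> o \<rho>)" "cadj (s 1) * s 1 = idb" using s[of 1] by (auto simp: gs')
 have r: "irr (\<alpha> g o \<rho>)" "irr (\<alpha> 0)" using simples_irreducible by auto
 have e: "\<alpha> g o \<rho> : End" "\<rho> o \<rho> : End" by simp_all
 have s0': "s 0 : Hom (\<alpha> 0) (\<rho> o \<rho>)" using s0(1) Hom_cong[of "\<alpha> 0" id "\<rho> o \<rho>" "\<rho> o \<rho>"] by (simp add: alpha_zero)
 have "s 1 ~= 0" "s 0 ~= 0" using s0 s1 by auto
 then obtain c where c: "c ~= 0" "s 0 * cadj (s 0) = scl c idb" using irreducible_iso[OF alpha_endo r(2) e(2) irr s0'] by metis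
 have "cadj (s 0) * s 1 ~= 0"
 proof
  assume "cadj (s 0) * s 1 = 0"
  hence "(s 0 * cadj (s 0)) * s 1 = 0" by (simp add: assoc)
  thus False using c \<open>s 1 ~= 0\<close> by (simp add: scale_left)
 qed
 moreover have "cadj (s 0) * s 1 : Hom (\<alpha> g o \<rho>) (\<alpha> 0)" using Hom_o[OF Hom_cadj[OF alpha_endo e(2) s0'] s1(1)] .
 ultimately have "isum (\<alpha> 0) [\<alpha> g o \<rho>]" using irreducible_iso[OF e(1) r(1) alpha_endo r(2)] by metis
 thus False using alpha_not_rho by blast
qed

locale crossed_3G = subfactor_3G M \<alpha> \<rho> for M :: "'h::complex_hilbert_space op set" and \<alpha> :: "'g::ab_group_add => 'h op => 'h op" and \<rho> +
 fixes \<gamma> :: "'h op => 'h op" and \<theta> :: "'g => 'g" and g0 :: 'g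
 assumes gamma: "\<gamma> : Aut"
  and gamma_cube: "x : M ==> \<gamma> (\<gamma> (\<gamma> x)) = x"
  and gamma_rho: "x : M ==> \<gamma> (\<rho> x) = \<rho> (\<gamma> x)"
  and gamma_alpha: "x : M ==> \<gamma> (\<alpha> h x) = \<alpha> (\<theta> h) (\<gamma> x)"
  and theta_fixed: "\<theta> h = h ==> h = 0"
  and g0: "g0 ~= 0"
begin

abbreviation Ga :: "nat => 'h op => 'h op" where "Ga k \<equiv> \<gamma> ^^ k"

lemma Gamma_aut: "Ga k : Aut"
proof (induction k)
 case 0
 have "id : Aut" by (simp add: automorphisms_def)
 thus ?case by (simp add: id_def)
next
 case (Suc k)
 from automorphism_comp[OF gamma this] show ?case by (simp only: funpow.simps)
qed

lemma Gamma_endo [simp]: "Ga k : End" using Gamma_aut by (auto simp: automorphisms_def)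

lemma gamma_endo [simp]: "\<gamma> : End" using Gamma_endo[of 1] by simp

lemma Gamma_in [simp]: "x : M ==> Ga k x : M" by (simp add: endo_in)

lemma Gamma_add: "Ga k (Ga l x) = Ga (k + l) x" by (simp add: funpow_add)

lemma Gamma_mod: "x : M ==> Ga k x = Ga (k mod 3) x"
proof (induction k rule: less_induct)
 case (less k)
 show ?case
 proof (cases "k < 3")
  case False
  hence "Ga k x = Ga 3 (Ga (k - 3) x)" by (simp add: Gamma_add)
  also have "... = Ga (k - 3) x" using less.prems by (simp add: eval_nat_numeral gamma_cube)
  also have "... = Ga ((k - 3) mod 3) x" by (rule less.IH[OF _ less.prems]) (use False in simp)
  finally show ?thesis using False by (simp add: le_mod_geq)
 qed simp
qed

lemma Gamma_rho: "x : M ==> Ga k (\<rho> x) = \<rho> (Ga k x)" by (induction k) (simp_all add: gamma_rho)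

lemma Gamma_alpha: "x : M ==> Ga k (\<alpha> h x) = \<alpha> ((\<theta> ^^ k) h) (Ga k x)" by (induction k) (simp_all add: gamma_alpha)

text \<open>The order three of \<open>\<gamma>\<close> is inherited by \<open>\<theta>\<close>,
  because inequivalent \<open>\<alpha> h\<close> cannot agree on \<open>M\<close>.\<close>

lemma theta_cube: "\<theta> (\<theta> (\<theta> h)) = h"
proof -
 have "\<alpha> (\<theta> (\<theta> (\<theta> h))) x = \<alpha> h x" if x: "x : M" for x
 proof -
  have "\<alpha> (\<theta> (\<theta> (\<theta> h))) (\<gamma> (\<gamma> (\<gamma> x))) = \<gamma> (\<gamma> (\<gamma> (\<alpha> h x)))"
   using x endo_in[OF gamma_endo] by (simp add: gamma_alpha)
  thus ?thesis using x by (simp add: gamma_cube)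
 qed
 hence "isum (\<alpha> (\<theta> (\<theta> (\<theta> h)))) [\<alpha> h]" unfolding isometric_sum_unitary by (intro bexI[of _ idb]) (simp_all add: intertwiners_def)
 thus ?thesis by (rule alpha_inequiv)
qed

text \<open>Since the third power of \<open>\<theta>\<close> is the identity, a fixed point of its
  square is a fixed point of \<open>\<theta>\<close>.\<close>

lemma theta_pow_fixed: assumes "(\<theta> ^^ k) h = (\<theta> ^^ l) h" "k < 3" "l < 3" "k ~= l" shows "h = 0"
proof -
 have inj: "\<theta> a = \<theta> b ==> a = b" for a b using theta_cube by metis
 have two: "h = 0" if "\<theta> (\<theta> h) = h" using that theta_cube[of h] theta_fixed by simp
 have "k = 0 \<or> k = 1 \<or> k = 2" "l = 0 \<or> l = 1 \<or> l = 2" using assms by auto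
 then consider "\<theta> h = h" | "h = \<theta> h" | "\<theta> (\<theta> h) = h" | "h = \<theta> (\<theta> h)"
  | "\<theta> (\<theta> h) = \<theta> h" | "\<theta> h = \<theta> (\<theta> h)" using assms(1,4) by (elim disjE) (simp_all add: numeral_2_eq_2)
 thus ?thesis by cases (use theta_fixed[of h] two inj[of h "\<theta> h"] inj[of "\<theta> h" h] in simp_all)
qed

definition component :: "nat => 'h endo set" where "component k = (%Q. Q o Ga k) ` simples"

definition csimples :: "'h endo set" where "csimples = (\<Union>k<3. component k)"

abbreviation crossed :: "'h endo set" where "crossed \<equiv> crossed_objects M \<alpha> \<rho> \<gamma>"

lemma component_0: "component 0 = simples" by (force simp: component_def)

lemma component_endo: "component k <= End" by (auto simp: component_def)

lemma component_irreducible: "Q : component k ==> irr Q" using simples_irreducible Hom_automorphism[OF Gamma_aut] unfolding component_def irreducible_endo_def by blast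

lemma csimples_endo: "csimples <= End" using component_endo by (auto simp: csimples_def)

lemma csimples_irreducible: "Q : csimples ==> irr Q" using component_irreducible by (auto simp: csimples_def)

lemma finite_csimples: "finite csimples" using finite_simples by (simp add: csimples_def component_def)

lemma component_sub: "k < 3 ==> component k <= csimples" by (auto simp: csimples_def)

text \<open>Powers of \<open>\<gamma>\<close> normalize the simple objects of the even part, so in a
  product they can be moved to the right, where the exponents add up modulo 3.\<close>

lemma component_comp:
 assumes "Q : component k" "Q' : component l" shows "idb : gideal M (component ((k + l) mod 3)) (Q o Q') (Q o Q')"
proof -
 obtain p p' where p: "p : simples" "Q = p o Ga k" and p': "p' : simples" "Q' = p' o Ga l" using assms by (auto simp: component_def)
 obtain q where q: "q : simples" "!!x. x : M ==> Ga k (p' x) = q (Ga k x)"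
 proof -
  from p'(1) consider h where "p' = \<alpha> h" | h where "p' = \<alpha> h o \<rho>" by auto
  thus ?thesis
  proof cases
   case (1 h)
   thus ?thesis by (intro that[of "\<alpha> ((\<theta> ^^ k) h)"]) (auto simp: Gamma_alpha)
  next
   case (2 h)
   thus ?thesis by (intro that[of "\<alpha> ((\<theta> ^^ k) h) o \<rho>"]) (auto simp: Gamma_alpha Gamma_rho)
  qed
 qed
 have "idb : gideal M (component ((k + l) mod 3)) (p o q o Ga ((k + l) mod 3)) (p o q o Ga ((k + l) mod 3))"
  by (rule gideal_whisker_right[OF simples_comp[OF p(1) q(1)] Gamma_endo]) (auto simp: component_def)
 thus ?thesis
 proof (rule gideal_one_cong)
  fix x assume x: "x : M"
  have "p (q (Ga ((k + l) mod 3) x)) = p (q (Ga k (Ga l x)))" using Gamma_mod[OF x, of "k + l"] by (simp add: Gamma_add)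
  thus "(p o q o Ga ((k + l) mod 3)) x = (Q o Q') x" using x by (simp add: p p' q(2))
 qed
qed

lemmas crossed_sums_iff = sums_of_iff[OF csimples_endo csimples_irreducible]

lemma crossed_sums_comp:
 assumes "H : sums_of M csimples" "L : sums_of M csimples" shows "H o L : sums_of M csimples"
proof (rule sums_of_comp[OF csimples_endo csimples_irreducible _ assms])
 fix Q Q' assume "Q : csimples" "Q' : csimples"
 then obtain k l where "Q : component k" "Q' : component l" by (auto simp: csimples_def)
 from component_comp[OF this] show "idb : gideal M csimples (Q o Q') (Q o Q')" by (rule gideal_mono) (simp add: component_sub)
qed

text \<open>Each rule of generation preserves the ideal condition, and conversely all simple objects
  in the three degrees are generated. This gives the generated category an explicit list of simple
  objects.\<close>

lemma crossed_eq: "crossed = sums_of M csimples"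
proof (intro equalityI subsetI)
 fix H assume "H : crossed"
 thus "H : sums_of M csimples" unfolding crossed_objects_def
 proof (induction rule: generated.induct)
  case (base H)
  have "\<gamma> : sums_of M csimples"
  proof -
   have "\<alpha> 0 o Ga 1 : csimples" using component_sub[of 1] by (auto simp: component_def)
   from gideal_one_cong[OF gideal_base[OF this], of \<gamma>] show ?thesis using endo_in[OF gamma_endo] by (simp add: crossed_sums_iff alpha_zero)
  qed
  moreover have "H : sums_of M csimples" if "H : evens"
   using that gideal_mono[of idb simples H H csimples] component_sub[of 0] by (simp add: crossed_sums_iff evens_iff component_0)
  ultimately show ?case using base by blast
 next
  case (compose H L)
  thus ?case by (intro crossed_sums_comp)
 next
  case (sum H Ls)
  have e: "set Ls <= End" and i: "!!L. L : set Ls ==> idb : gideal M csimples L L" using sum.IH crossed_sums_iff by auto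
  have "idb : gideal M (set Ls) H H" by (rule isometric_sum_gideal[OF sum.hyps(2,1) e])
  from gideal_trans[OF this i] show ?case using sum.hyps(1) by (simp add: crossed_sums_iff)
 next
  case (sub H L w)
  have L: "L : End" "idb : gideal M csimples L L" using sub.IH crossed_sums_iff by auto
  have "cadj w * (idb * w) : gideal M csimples H H" by (intro gideal_left[OF gideal_right[OF L(2) sub.hyps(3)]] Hom_cadj[OF sub.hyps(1) L(1) sub.hyps(3)])
  thus ?case using sub.hyps by (simp add: crossed_sums_iff)
 qed
next
 fix H assume "H : sums_of M csimples"
 then obtain Hs where H: "H : End" "set Hs <= csimples" "isum H Hs" by (auto simp: sums_of_def)
 let ?g = "generated M (insert \<gamma> evens)"
 have G: "Ga k : ?g" for k
 proof (induction k)
  case 0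
  show ?case using even.S_id by (auto intro!: generated.base simp: id_def)
 next
  case (Suc k)
  have "\<gamma> : ?g" by (rule generated.base) simp
  from generated.compose[OF this Suc] show ?case by (simp only: funpow.simps)
 qed
 have "Q : ?g" if Q: "Q : csimples" for Q
 proof -
  obtain p k where p: "p : simples" "Q = p o Ga k" using Q unfolding csimples_def component_def by blast
  hence "p : ?g" using simples_even by (intro generated.base) blast
  from generated.compose[OF this G] show ?thesis by (simp only: p)
 qed
 thus "H : crossed" unfolding crossed_objects_def using H by (intro generated.sum[of H M Hs]) auto
qed

lemma crossed_iff: "H : crossed \<longleftrightarrow> H : End & idb : gideal M csimples H H" unfolding crossed_eq by (rule crossed_sums_iff)

sublocale cr: endo_tensor M crossed
proof
 show "crossed <= End" using crossed_iff by blast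
 show "id : crossed" unfolding crossed_objects_def using even.S_id by (auto intro: generated.base)
 show "H o L : crossed" if "H : crossed" "L : crossed" for H L using that unfolding crossed_objects_def by (rule generated.compose)
qed

lemma evens_crossed: "evens <= crossed" unfolding crossed_objects_def by (auto intro: generated.base)

text \<open>A unitary equivalence \<open>s\<close> of \<open>Q \<gamma>\<^sup>k\<close> and \<open>Q' \<gamma>\<^sup>l\<close> yields the equivalence \<open>\<alpha>\<^sub>b(s\<^sup>*) s\<close> of
 \<open>\<alpha>\<^sub>a Q\<close> and \<open>\<alpha>\<^sub>b Q\<close>, where \<open>\<plusminus>a\<close> and \<open>\<plusminus>b\<close> are the images of \<open>g0\<close> under \<open>\<theta>\<^sup>k\<close> and \<open>\<theta>\<^sup>l\<close>.\<close>

lemma twisted_inequivalent: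
 assumes Q: "Q : End" "Q' : End"
  and c: "!!x. x : M ==> Q (Ga k (\<alpha> g0 x)) = \<alpha> a (Q (Ga k x))" "!!x. x : M ==> Q' (Ga l (\<alpha> g0 x)) = \<alpha> b (Q' (Ga l x))"
  and eq: "isum (Q' o Ga l) [Q o Ga k]" shows "isum (\<alpha> b o Q) [\<alpha> a o Q]"
proof -
 obtain s where s: "s : Hom (Q o Ga k) (Q' o Ga l)" "cadj s * s = idb" "s * cadj s = idb" using eq by (auto simp: isometric_sum_unitary)
 have [simp]: "s : M" using s(1) by (rule HomD)
 note [simp] = endo_in[OF Q(1)] endo_in[OF Q(2)]
 note bc = endo_o[OF alpha_endo]
 define w where "w = \<alpha> b (cadj s) * s"
 have cw: "cadj w = cadj s * \<alpha> b s" by (simp add: w_def cadj_o endo_cadj[OF alpha_endo])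
 have bs: "\<alpha> b (cadj s) * \<alpha> b s * x = x" "\<alpha> b s * \<alpha> b (cadj s) * x = x" for x
  using s by (simp_all add: assoc[symmetric] bc[symmetric] endo_id)
 have sx: "s * Q (Ga k x) = Q' (Ga l x) * s" if "x : M" for x using HomD(2)[OF s(1) that] by simp
 have wx: "w * \<alpha> a (Q (Ga k x)) = \<alpha> b (Q (Ga k x)) * w" if "x : M" for x
 proof -
  have "s * \<alpha> a (Q (Ga k x)) = \<alpha> b (Q' (Ga l x)) * s" using sx[of "\<alpha> g0 x"] that by (simp add: c)
  moreover have "Q' (Ga l x) = s * Q (Ga k x) * cadj s" using sx[OF that] s by (simp add: assoc[symmetric]) (simp add: assoc)
  ultimately have "s * \<alpha> a (Q (Ga k x)) = \<alpha> b s * \<alpha> b (Q (Ga k x)) * w" using that by (simp add: w_def bc assoc)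
  thus ?thesis by (simp add: w_def assoc) (simp add: bs w_def)
 qed
 have "w : Hom (\<alpha> a o Q) (\<alpha> b o Q)" using wx automorphism_surj[OF Gamma_aut[of k]] by (fastforce simp: intertwiners_def w_def)
 moreover have "cadj w * w = idb" "w * cadj w = idb" using s unfolding cw by (simp_all add: w_def assoc bs eq_tail[OF s(3)]) (simp add: bs(1)[of idb, simplified])
 ultimately show ?thesis by (auto simp: isometric_sum_unitary)
qed

text \<open>Objects of different degree are told apart by how they commute with
  \<open>\<alpha> g0\<close>, since the images of \<open>g0\<close> under the relevant powers of
  \<open>\<theta>\<close> differ.\<close>

lemma components_inequivalent:
 assumes Q: "Q : simples" "Q' : simples" and kl: "k < 3" "l < 3" "k ~= l" shows "\<not> isum (Q' o Ga l) [Q o Ga k]"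
proof
 assume eq: "isum (Q' o Ga l) [Q o Ga k]"
 let ?t = "%k. (\<theta> ^^ k) g0"
 have aa: "\<alpha> h (Ga k (\<alpha> g0 x)) = \<alpha> (?t k) (\<alpha> h (Ga k x))" if "x : M" for h k x
  using that alpha_add[of "Ga k x" h "?t k"] alpha_add[of "Ga k x" "?t k" h] by (simp add: Gamma_alpha add.commute)
 have ar: "\<alpha> h (\<rho> (Ga k (\<alpha> g0 x))) = \<alpha> (- ?t k) (\<alpha> h (\<rho> (Ga k x)))" if "x : M" for h k x
  using that alpha_rho[of "Ga k x" "- ?t k"] alpha_add[of "\<rho> (Ga k x)" h "- ?t k"] alpha_add[of "\<rho> (Ga k x)" "- ?t k" h] by (simp add: Gamma_alpha add.commute)
 \<comment> \<open>An equivalence between objects of different type would make \<open>\<rho>\<close>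
   bijective on \<open>M\<close>.\<close>
 have mixed: False if eq: "isum (\<alpha> h' o \<rho> o Ga l) [\<alpha> h o Ga k]" for h h' k l
 proof -
  obtain s where s: "s : Hom (\<alpha> h o Ga k) (\<alpha> h' o \<rho> o Ga l)" "cadj s * s = idb" "s * cadj s = idb" using eq by (auto simp: isometric_sum_unitary)
  have [simp]: "s : M" using s(1) by (rule HomD)
  have "EX x:M. y = \<rho> x" if y: "y : M" for y
  proof -
   have "cadj s * \<alpha> h' y * s : M" using y by simp
   then obtain x where x: "x : M" "cadj s * \<alpha> h' y * s = (\<alpha> h o Ga k) x" using automorphism_surj[OF automorphism_comp[OF alpha_aut Gamma_aut]] by blast
   have "s * (\<alpha> h o Ga k) x = (\<alpha> h' o \<rho> o Ga l) x * s" by (rule HomD(2)[OF s(1) x(1)])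
   hence "\<alpha> h' y * s = \<alpha> h' (\<rho> (Ga l x)) * s"
    by (simp only: x(2)[symmetric] eq_tail[OF s(3)] compose_id comp_apply[of _ "Ga l"] comp_apply[of "\<alpha> h'"])
   hence "(\<alpha> h' y * s) * cadj s = (\<alpha> h' (\<rho> (Ga l x)) * s) * cadj s" by simp
   hence "\<alpha> h' y = \<alpha> h' (\<rho> (Ga l x))" by (simp add: assoc s(3))
   from arg_cong[OF this, of "\<alpha> (- h')"] have "y = \<rho> (Ga l x)" by (simp only: alpha_inverse(2) y x(1) rho_in Gamma_in)
   thus ?thesis using Gamma_in[OF x(1)] by blast
  qed
  moreover have "inj_on \<rho> M"
  proof (rule inj_onI)
   fix x y assume xy: "x : M" "y : M" "\<rho> x = \<rho> y"
   obtain x' y' where x': "x' : M" "x = Ga l x'" "y' : M" "y = Ga l y'" using automorphism_surj[OF Gamma_aut] xy by metis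
   have "s * (\<alpha> h o Ga k) x' = s * (\<alpha> h o Ga k) y'" using HomD(2)[OF s(1) x'(1)] HomD(2)[OF s(1) x'(3)] xy x' by simp
   hence "(cadj s * s) * (\<alpha> h o Ga k) x' = (cadj s * s) * (\<alpha> h o Ga k) y'" by (simp add: assoc)
   hence "(\<alpha> h o Ga k) x' = (\<alpha> h o Ga k) y'" by (simp add: s(2))
   moreover have "inj_on (\<alpha> h o Ga k) M" using automorphism_comp[OF alpha_aut Gamma_aut, of h k] unfolding automorphisms_def bij_betw_def by blast
   ultimately have "x' = y'" using x' by (meson inj_onD)
   thus "x = y" using x' by simp
  qed
  ultimately have "\<rho> : Aut" by (auto simp: automorphisms_def bij_betw_def)
  thus False using rho_not_automorphism by blast
 qed
 have ne: "?t k ~= ?t l" using theta_pow_fixed[of k g0 l] kl g0 by blast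
 from Q show False
 proof (elim UnE rangeE)
  fix h h' assume *: "Q = \<alpha> h" "Q' = \<alpha> h'"
  have "isum (\<alpha> (?t l) o \<alpha> h) [\<alpha> (?t k) o \<alpha> h]" using eq unfolding * by (intro twisted_inequivalent[of _ "\<alpha> h'" k _ l]) (auto simp: aa)
  hence "isum (\<alpha> (?t l + h)) [\<alpha> (?t k + h)]" by (rule isometric_sum_cong) (auto simp: alpha_add nth_Cons')
  from alpha_inequiv[OF this] ne show False by simp
 next
  fix h h' assume *: "Q = \<alpha> h o \<rho>" "Q' = \<alpha> h' o \<rho>"
  have "isum (\<alpha> (- ?t l) o (\<alpha> h o \<rho>)) [\<alpha> (- ?t k) o (\<alpha> h o \<rho>)]"
   using eq unfolding * by (intro twisted_inequivalent[of _ "\<alpha> h' o \<rho>" k _ l]) (auto simp: ar)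
  hence "isum (\<alpha> (- ?t l + h) o \<rho>) [\<alpha> (- ?t k + h) o \<rho>]" by (rule isometric_sum_cong) (auto simp: alpha_add[symmetric] nth_Cons')
  from alpha_rho_inequiv[OF this] ne show False by simp
 next
  fix h h' assume *: "Q = \<alpha> h" "Q' = \<alpha> h' o \<rho>"
  show False by (rule mixed[OF eq[unfolded *]])
 next
  fix h h' assume *: "Q = \<alpha> h o \<rho>" "Q' = \<alpha> h'"
  have "isum (\<alpha> h o \<rho> o Ga k) [\<alpha> h' o Ga l]" by (rule unitary_symmetric[OF _ _ eq[unfolded *]]) simp_all
  thus False by (rule mixed)
 qed
qed

lemma components_orthogonal:
 assumes Q: "Q : component k" "Q' : component l" and kl: "k < 3" "l < 3" "k ~= l"
  and t: "t : Hom Q Q'" shows "t = 0"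
proof (rule ccontr)
 assume "t ~= 0"
 hence "isum Q' [Q]" by (rule irreducible_iso[OF subsetD[OF component_endo Q(1)] component_irreducible[OF Q(1)]
    subsetD[OF component_endo Q(2)] component_irreducible[OF Q(2)] t])
 thus False using components_inequivalent kl Q by (auto simp: component_def)
qed

text \<open>A simple object \<open>p o Ga k\<close> has the dual of \<open>p\<close> twisted by the
  inverse power of \<open>\<gamma>\<close>. Having duals on both sides passes to direct sums, so
  \<open>sums_of_closed\<close> applies.\<close>

lemma crossed_duals:
 assumes v: "cuntz_factor M v1 v2" and H: "H : crossed" shows "EX L:crossed. EX ev et. dual_pair H L ev et" "EX L:crossed. EX ev et. dual_pair L H ev et"
proof -
 interpret v: cuntz_factor M v1 v2 by (rule v)
 let ?T = "{H : End. (EX L:crossed. EX ev et. dual_pair H L ev et) & (EX L:crossed. EX ev et. dual_pair L H ev et)}"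
 have sum: "v.endo_sum H L : crossed" if "H : crossed" "L : crossed" for H L
  using v.endo_sum_sums_of[OF csimples_endo csimples_irreducible that[unfolded crossed_eq]] by (simp only: crossed_eq)
 have G: "Ga k : crossed" for k using gideal_one_cong[OF gideal_base, of "\<alpha> 0 o Ga (k mod 3)" csimples "Ga k"] component_sub[of "k mod 3"] Gamma_mod[of _ k]
  by (auto simp: crossed_iff component_def alpha_zero)
 have "EX L:?T. isum H [L]"
 proof (rule v.sums_of_closed[OF csimples_endo csimples_irreducible H[unfolded crossed_eq]])
  show "v.endo_sum H L : ?T" if "H : ?T" "L : ?T" for H L using that sum v.dual_pair_endo_sum cr.S_endoD by simp blast
  show "csimples <= ?T"
  proof
   fix Q assume "Q : csimples"
   then obtain p k where p: "p : simples" "Q = p o Ga k" "k < 3" by (auto simp: csimples_def component_def)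
   have e: "p : evens" using p simples_even by blast
   have inv: "Ga k (Ga (3 - k) x) = x" "Ga (3 - k) (Ga k x) = x" if "x : M" for x using that p(3) Gamma_mod[OF that, of 3] by (simp_all add: Gamma_add)
   obtain L ev et where 1: "L : evens" "dual_pair p L ev et" using even_duals(1)[OF e] by blast
   obtain N ev' et' where 2: "N : evens" "dual_pair N p ev' et'" using even_duals(2)[OF e] by blast
   note tw = dual_pair_twist[OF even.S_endoD[OF e] even.S_endoD Gamma_endo Gamma_endo inv]
   have "dual_pair Q (Ga (3 - k) o L) (Ga (3 - k) ev) et" "dual_pair (Ga (3 - k) o N) Q ev' (Ga (3 - k) et')"
    unfolding p(2) using tw(1)[OF 1(1) _ _ 1(2)] tw(2)[OF 2(1) _ _ 2(2)] by auto
   moreover have "Ga (3 - k) o L : crossed" "Ga (3 - k) o N : crossed" using 1 2 G evens_crossed by auto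
   moreover have "Q : End" using even.S_endoD[OF e] by (simp add: p(2))
   ultimately show "Q : ?T" by blast
  qed
 qed (assumption, rule Collect_restrict)
 then obtain L where L: "L : ?T" "isum H [L]" by blast
 obtain s where s: "s : Hom L H" "cadj s * s = idb" "s * cadj s = idb" using L(2) by (auto simp: isometric_sum_unitary)
 have e: "H : End" "L : End" using H L cr.S_endoD by auto
 show "EX L:crossed. EX ev et. dual_pair H L ev et" "EX L:crossed. EX ev et. dual_pair L H ev et" using L dual_pair_unitary[OF e cr.S_endoD s] by blast+
qed

lemma even_algebra_crossed: "is_algebra even.CC (Some A, m, u) ==> is_algebra cr.CC (Some A, m, u)"
 using evens_crossed by (auto simp: endo_category_def rwhisk_def lwhisk_def with_zero_def)

end

lemma (in subfactor_3G) even_separable: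
 assumes "is_algebra even.CC (Some A, m, u)"
  and "dl : Hom id (A o A)" "m * A dl = A m * dl" "m * dl = u" shows "separable_algebra M evens A m u dl"
proof -
 obtain v1 v2 where "cuntz_factor M v1 v2" by (rule cuntz_exists)
 then interpret V: cuntz_factor M v1 v2 .
 show ?thesis
 proof
 fix H e assume "H : evens" "e : Hom H H" "e * e = e" "e ~= 0"
 thus "EX L:evens. EX r:Hom H L. EX s:Hom L H. r * s = idb & s * r = e" unfolding evens_eq using V.idempotent_splitting[OF simples_endo simples_irreducible] by metis
 qed (use assms in auto)
qed

locale dual_3G = crossed_3G M \<alpha> \<rho> \<gamma> \<theta> g0 + cuntz_factor M v1 v2
 for M :: "'h::complex_hilbert_space op set" and \<alpha> :: "'g::ab_group_add => 'h op => 'h op"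
  and \<rho> \<gamma> \<theta> g0 v1 v2 +
 fixes A :: "'h op => 'h op" and m u dl ep :: "'h op"
 assumes even_algebra: "is_algebra (endo_category M (even_objects M \<alpha> \<rho>)) (Some A, m, u)"
  and A_sum: "isum A [id, \<alpha> g0 o \<rho>]"
  and delta: "dl : Hom id (A o A)" "m * A dl = A m * dl" "m * dl = u"
  and epsilon: "ep : Hom A id" "A ep * m * A dl = idb" "ep * m * A dl = idb"
  and unit: "Hom id A = range (%c. scl c u)"
begin

sublocale even: separable_algebra M evens A m u dl by (rule even_separable[OF even_algebra delta])

sublocale cr: frobenius_algebra M crossed A m u dl v1 v2 csimples ep
proof
 fix H e assume "H : crossed" "e : Hom H H" "e * e = e" "e ~= 0"
 thus "EX L:crossed. EX r:Hom H L. EX s:Hom L H. r * s = idb & s * r = e" unfolding crossed_eq using idempotent_splitting[OF csimples_endo csimples_irreducible] by metis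
next
 fix X assume X: "X : with_zero crossed"
 have v: "cuntz_factor M v1 v2" by unfold_locales
 show "EX Y ev et. Y : with_zero crossed & ev : M & et : M &
   (ALL x:M. ev * act Y (act X x) = x * ev) & (ALL x:M. et * x = act X (act Y x) * et) &
   act X ev * et = act X idb & ev * act Y et = act Y idb"
 proof (cases X)
  case None
  thus ?thesis by (intro exI[of _ None] exI[of _ 0]) simp
 next
  case (Some H)
  hence H: "H : crossed" using X by simp
  obtain L ev et where d: "L : crossed" "dual_pair H L ev et" using crossed_duals(1)[OF v H] by blast
  thus ?thesis using dual_pairD[OF d(2)] X by (intro exI[of _ "Some L"] exI[of _ ev] exI[of _ et]) (simp add: Some endo_id cr.S_endoD)
 qed
 show "EX Y ev et. Y : with_zero crossed & ev : M & et : M &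
   (ALL x:M. ev * act X (act Y x) = x * ev) & (ALL x:M. et * x = act Y (act X x) * et) &
   act Y ev * et = act Y idb & ev * act X et = act X idb"
 proof (cases X)
  case None
  thus ?thesis by (intro exI[of _ None] exI[of _ 0]) simp
 next
  case (Some H)
  hence H: "H : crossed" using X by simp
  obtain L ev et where d: "L : crossed" "dual_pair L H ev et" using crossed_duals(2)[OF v H] by blast
  thus ?thesis using dual_pairD[OF d(2)] X by (intro exI[of _ "Some L"] exI[of _ ev] exI[of _ et]) (simp add: Some endo_id cr.S_endoD)
 qed
qed (use even_algebra_crossed[OF even_algebra] delta epsilon unit csimples_endo csimples_irreducible
  finite_csimples crossed_eq in auto)

sublocale sub: bimodule_subcategory M evens crossed A m u dl
proof
 show "evens <= crossed" by (rule evens_crossed)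
 fix H L r s assume *: "H : crossed" "L : evens" "r : Hom L H" "s : Hom H L" "r * s = idb"
 have "r * (idb * s) : gideal M simples H H" using * by (intro gideal_left[OF gideal_right]) (auto simp: evens_iff)
 thus "H : evens" using * cr.S_endoD by (simp add: evens_iff)
qed

end

section \<open>The grading\<close>

context dual_3G
begin

definition ideal :: "nat => 'h endo option => 'h endo option => 'h op set" where
 "ideal k X Y = (case (X, Y) of (Some H, Some L) => gideal M (component k) H L | _ => {0})"

text \<open>All simple constituents have degree \<open>k\<close>. Objects of \<open>crossed\<close>
  are graded first; a bimodule inherits the degree of its underlying object because \<open>A\<close>
  has degree 0.\<close>

definition homogeneous :: "nat => 'h endo option => bool" where
 "homogeneous k X \<longleftrightarrow> X : cr.Obj & act X idb : ideal k X X"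

lemma ideal_simps [simp]: "ideal k None Y = {0}" "ideal k X None = {0}"
 "ideal k (Some H) (Some L) = gideal M (component k) H L" by (auto simp: ideal_def split: option.split)

lemma ideal_zero: "0 : ideal k X Y" by (auto simp: ideal_def gideal.zero split: option.split)

lemma ideal_add: "x : ideal k X Y ==> y : ideal k X Y ==> x + y : ideal k X Y" by (auto simp: ideal_def intro: gideal_add split: option.splits)

lemma ideal_sum: "(!!i. i : I ==> f i : ideal k X Y) ==> sum f I : ideal k X Y" by (induction I rule: infinite_finite_induct) (auto intro: ideal_add ideal_zero)

lemma ideal_hom:
 assumes "X : cr.Obj" "Y : cr.Obj" "x : ideal k X Y" shows "x : cr.homs X Y" using assms gideal_intertwiners by (cases X; cases Y) (auto simp: cr.hom_Some)

lemma ideal_left: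
 assumes "X : cr.Obj" "Y : cr.Obj" "Z : cr.Obj" "x : ideal k X Y" "y : cr.homs Y Z" shows "y * x : ideal k X Z" using assms gideal_left[of x "component k"]
 by (cases X; cases Y; cases Z) (auto simp: cr.hom_Some cr.hom_None gideal.zero)

lemma ideal_right:
 assumes "X : cr.Obj" "Y : cr.Obj" "Z : cr.Obj" "x : ideal k X Y" "y : cr.homs Z X" shows "x * y : ideal k Z Y" using assms gideal_right[of x "component k"]
 by (cases X; cases Y; cases Z) (auto simp: cr.hom_Some cr.hom_None gideal.zero)

lemma ideal_orthogonal:
 assumes o: "X : cr.Obj" "Y : cr.Obj" "Y' : cr.Obj" "Z : cr.Obj"
  and x: "x : ideal k X Y" and y: "y : ideal l Y' Z" and f: "f : cr.homs Y Y'" and kl: "k < 3" "l < 3" "k ~= l" shows "y * f * x = 0"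
proof (cases X; cases Y; cases Y'; cases Z)
 fix H L L' N assume *: "X = Some H" "Y = Some L" "Y' = Some L'" "Z = Some N"
 have f': "f : Hom L L'" using f o by (simp add: * cr.hom_Some)
 show ?thesis by (rule gideal_orth[OF x[unfolded * ideal_simps] y[unfolded * ideal_simps] f'])
   (use components_orthogonal kl in blast)
qed (use x y in auto)

text \<open>Every term of the identity factors through a simple object of a definite degree; the
  terms are collected degree by degree.\<close>

lemma unit_decomposition:
 assumes X: "X : cr.Obj"
 obtains x where "ALL k<3. x k : ideal k X X" "(\<Sum>k<(3::nat). x k) = act X idb"
proof (cases X)
 case None
 thus ?thesis by (intro that[of "%_. 0"]) simp_all
next
 case (Some H)
 have H: "H : End" "idb : gideal M csimples H H" using X crossed_iff by (simp_all add: Some)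
 have "EX y. (ALL k<3. y k : gideal M (component k) H H) & x = (\<Sum>k<(3::nat). y k)" if "x : gideal M csimples H H" for x using that
 proof (induction rule: gideal.induct)
  case zero
  thus ?case by (intro exI[of _ "%_. 0"]) (simp add: gideal.zero)
 next
  case (step x Q t a)
  obtain y where y: "!!k. k < 3 ==> y k : gideal M (component k) H H" "x = (\<Sum>k<(3::nat). y k)" using step.IH by blast
  obtain j where j: "j < 3" "Q : component j" using step.hyps by (auto simp: csimples_def)
  define z where "z k = (if k = j then y k + t * a else y k)" for k
  have "z k : gideal M (component k) H H" if "k < 3" for k using y(1)[OF that] gideal.step[OF y(1)[OF that], of Q t a] j step.hyps by (auto simp: z_def)
  moreover have "(\<Sum>k<(3::nat). z k) = (\<Sum>k<(3::nat). y k + (if k = j then t * a else 0))" by (rule sum.cong) (auto simp: z_def)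
  hence "(\<Sum>k<(3::nat). z k) = x + t * a" using j by (simp add: sum.distrib y(2))
  ultimately show ?case by (intro exI[of _ z]) simp
 qed
 from this[OF H(2)] obtain y where "ALL k<3. y k : gideal M (component k) H H" "idb = (\<Sum>k<(3::nat). y k)" by blast
 thus ?thesis using H by (intro that[of y]) (simp_all add: Some endo_id)
qed

lemma whisker_ideal_left:
 assumes N: "idb : gideal M (component j) N N" "N : End" and H: "H : End"
  and x: "x : gideal M (component k) H H" and jk: "(j + k) mod 3 = l" shows "N x : gideal M (component l) (N o H) (N o H)"
proof -
 have "N x : gideal M ((%Q. N o Q) ` component k) (N o H) (N o H)" by (rule gideal_whisker_left[OF x N(2) component_endo H H]) blast
 thus ?thesis
 proof (rule gideal_trans)
  fix Q' assume "Q' : (%Q. N o Q) ` component k"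
  then obtain Q where Q: "Q : component k" "Q' = N o Q" by blast
  have "idb : gideal M ((%p. p o Q) ` component j) (N o Q) (N o Q)" by (rule gideal_whisker_right[OF N(1) subsetD[OF component_endo Q(1)]]) blast
  thus "idb : gideal M (component l) Q' Q'" unfolding Q(2) by (rule gideal_trans) (use component_comp Q(1) jk in blast)
 qed
qed

lemma whisker_ideal_right:
 assumes N: "idb : gideal M (component j) N N" "N : End"
  and x: "x : gideal M (component k) H H" and jk: "(k + j) mod 3 = l" shows "x : gideal M (component l) (H o N) (H o N)"
proof -
 have "x : gideal M ((%Q. Q o N) ` component k) (H o N) (H o N)" by (rule gideal_whisker_right[OF x N(2)]) blast
 thus ?thesis
 proof (rule gideal_trans)
  fix Q' assume "Q' : (%Q. Q o N) ` component k"
  then obtain Q where Q: "Q : component k" "Q' = Q o N" by blast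
  have e: "Q : End" using component_endo Q(1) by blast
  have "Q idb : gideal M ((%p. Q o p) ` component j) (Q o N) (Q o N)" by (rule gideal_whisker_left[OF N(1) e component_endo N(2,2)]) blast
  hence "idb : gideal M ((%p. Q o p) ` component j) (Q o N) (Q o N)" by (simp add: endo_id[OF e])
  thus "idb : gideal M (component l) Q' Q'" unfolding Q(2) by (rule gideal_trans) (use component_comp Q(1) jk in blast)
 qed
qed

lemma even_homogeneous: "N : evens ==> idb : gideal M (component 0) N N" by (simp add: evens_iff component_0)

lemma homogeneous_comp:
 assumes X: "homogeneous k X" and Y: "homogeneous l Y" shows "homogeneous ((k + l) mod 3) (ec X Y)"
proof (cases X; cases Y)
 fix H L assume *: "X = Some H" "Y = Some L"
 have e: "H : crossed" "L : crossed" "H : End" "L : End" using X Y by (auto simp: homogeneous_def * cr.S_endoD)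
 have "idb : gideal M (component k) H H" "idb : gideal M (component l) L L" using X Y e by (simp_all add: homogeneous_def * endo_id)
 hence "H idb : gideal M (component ((k + l) mod 3)) (H o L) (H o L)" using e by (intro whisker_ideal_left) auto
 thus ?thesis using e by (simp add: homogeneous_def * endo_id)
qed (use X Y in \<open>auto simp: homogeneous_def\<close>)

lemma homogeneous_retract:
 assumes X: "homogeneous k X" and Y: "Y : cr.Obj" and r: "r : cr.homs X Y" and s: "s : cr.homs Y X"
  and rs: "r * s = act Y idb" shows "homogeneous k Y"
proof -
 have "r * (act X idb * s) : ideal k Y Y" using X Y by (intro ideal_left[OF _ _ _ ideal_right[OF _ _ _ _ s] r]) (auto simp: homogeneous_def)
 thus ?thesis using Y rs cr.homD(4)[OF s] by (simp add: homogeneous_def)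
qed

abbreviation piece :: "nat => 'h bm set" where "piece k \<equiv> {X. cr.bim X & homogeneous k (fst X)}"

text \<open>Translates between equivalence to an even object times a power of
  \<open>\<gamma>\<close> and the ideal condition.\<close>

lemma piece_eq:
 assumes k: "k < 3" shows "bimodule_components cr.CC cr.AA (crossed_components M \<alpha> \<rho> \<gamma>) (int k) = piece k"
proof -
 have "Some H : crossed_components M \<alpha> \<rho> \<gamma> (int k) \<longleftrightarrow> homogeneous k (Some H)" for H
 proof
  assume "Some H : crossed_components M \<alpha> \<rho> \<gamma> (int k)"
  then obtain L where H: "H : crossed" and L: "L : evens" "isum H [L o Ga k]" by (auto simp: crossed_components_def with_zero_def)
  obtain s where s: "s : Hom (L o Ga k) H" "s * cadj s = idb" using L(2) by (auto simp: isometric_sum_unitary)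
  have e: "H : End" "L o Ga k : End" using H L cr.S_endoD even.S_endoD by auto
  have "idb : gideal M (component k) (L o Ga k) (L o Ga k)" using L(1) by (intro gideal_whisker_right[of _ simples]) (auto simp: evens_iff component_def)
  hence "s * (idb * cadj s) : gideal M (component k) H H" by (intro gideal_left[OF gideal_right[OF _ Hom_cadj[OF e(2,1) s(1)]] s(1)])
  thus "homogeneous k (Some H)" using H e s by (simp add: homogeneous_def endo_id)
 next
  assume "homogeneous k (Some H)"
  hence H: "H : crossed" "H : End" "idb : gideal M (component k) H H" by (auto simp: homogeneous_def endo_id cr.S_endoD)
  \<comment> \<open>Composition with \<open>Ga (3 - k)\<close>, the inverse of \<open>Ga k\<close>
    on \<open>M\<close>, brings \<open>H\<close> back to degree 0.\<close>
  define L where "L = H o Ga (3 - k)"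
  have G: "Ga (3 - k) (Ga k x) = x" "Ga k (Ga (3 - k) x) = x" if "x : M" for x using k Gamma_mod[OF that, of 3] by (simp_all add: Gamma_add)
  have "idb : gideal M ((%Q. Q o Ga (3 - k)) ` component k) L L" unfolding L_def by (rule gideal_whisker_right[OF H(3) Gamma_endo]) blast
  hence "idb : gideal M simples L L"
  proof (rule gideal_trans)
   fix Q assume "Q : (%Q. Q o Ga (3 - k)) ` component k"
   then obtain p where p: "p : simples" "Q = p o Ga k o Ga (3 - k)" unfolding component_def by blast
   show "idb : gideal M simples Q Q" by (rule gideal_simple[OF p(1)]) (simp add: p(2) G)
  qed
  hence L: "L : evens" using H by (simp add: evens_iff L_def)
  have "isum H [L o Ga k]" unfolding isometric_sum_unitary by (intro bexI[of _ idb]) (simp_all add: intertwiners_def L_def G)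
  thus "Some H : crossed_components M \<alpha> \<rho> \<gamma> (int k)" using H L by (auto simp: crossed_components_def with_zero_def)
 qed
 hence "X : crossed_components M \<alpha> \<rho> \<gamma> (int k) \<longleftrightarrow> homogeneous k X" for X
  by (cases X) (auto simp: crossed_components_def with_zero_def homogeneous_def)
 thus ?thesis by (auto simp: bimodule_components_def)
qed

text \<open>Maps between different degrees vanish, so the projections to the degrees commute with
  every morphism. The actions of \<open>A\<close> preserve the degree, hence the projections are
  bimodule maps.\<close>

lemma homogeneous_projections:
 assumes X: "cr.bim X"
 obtains x where "ALL k<3. x k : ideal k (fst X) (fst X) & x k : cr.bmaps X X"
  "ALL j<3. ALL k<3. x j * x k = (if j = k then x k else 0)" "(\<Sum>k<(3::nat). x k) = act (fst X) idb"
proof -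
 note o = cr.bim_ob[OF X]
 obtain x where x': "ALL k<3. x k : ideal k (fst X) (fst X)" "(\<Sum>k<(3::nat). x k) = act (fst X) idb" by (rule unit_decomposition[OF o])
 note x = x'(1)[rule_format] x'(2)
 have h: "x k : cr.homs (fst X) (fst X)" if "k < 3" for k by (rule ideal_hom[OF o o x(1)[OF that]])
 have orth: "x j * x k = 0" if "j < 3" "k < 3" "j ~= k" for j k
  using ideal_orthogonal[OF o o o o x(1)[OF that(2)] x(1)[OF that(1)] cr.hom_one[OF o]] that cr.homD(4)[OF h[OF that(2)]] by simp
 have left_one: "(\<Sum>j<(3::nat). f * g j) = f * g k"
  if "k < 3" "!!j. j < 3 ==> j ~= k ==> f * g j = 0" for f g k using that by (subst sum.remove[of _ k]) (auto intro: sum.neutral)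
 have right_one: "(\<Sum>j<(3::nat). g j * f) = g k * f"
  if "k < 3" "!!j. j < 3 ==> j ~= k ==> g j * f = 0" for f g k using that by (subst sum.remove[of _ k]) (auto intro: sum.neutral)
 have idem: "x k * x k = x k" if k: "k < 3" for k
 proof -
  have "x k * (\<Sum>j<(3::nat). x j) = x k" using cr.homD(3)[OF h[OF k]] by (simp add: x(2))
  hence "(\<Sum>j<(3::nat). x k * x j) = x k" by (simp add: compose_sum_right)
  thus ?thesis using left_one[of k "x k" x] orth k by auto
 qed
 \<comment> \<open>Multiplying \<open>x k * f\<close> by the identity of \<open>Y\<close> on the
   right, or \<open>f * y k\<close> by that of \<open>X\<close> on the left, leaves the same
   diagonal term in both cases.\<close>
 have commute: "x k * f = f * y k" if k: "k < 3" and f: "f : cr.homs Y (fst X)" and Y: "Y : cr.Obj"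
   and y: "!!j. j < 3 ==> y j : ideal j Y Y" "(\<Sum>j<(3::nat). y j) = act Y idb" for k f Y y
 proof -
  have yh: "y j : cr.homs Y Y" if "j < 3" for j by (rule ideal_hom[OF Y Y y(1)[OF that]])
  have o': "x i * f * y j = 0" if "i < 3" "j < 3" "i ~= j" for i j using ideal_orthogonal[OF Y Y o o y(1)[OF that(2)] x(1)[OF that(1)] f] that by simp
  have "x k * f = x k * f * (\<Sum>j<(3::nat). y j)" using cr.homD(3)[OF f] by (simp add: y(2))
  also have "... = (\<Sum>j<(3::nat). (x k * f) * y j)" by (simp add: compose_sum_right assoc)
  also have "... = (x k * f) * y k" by (rule left_one[OF k]) (use o' k in \<open>simp add: assoc\<close>)
  also have "... = (\<Sum>j<(3::nat). x j * (f * y k))" by (subst right_one[OF k]) (use o' k in \<open>simp_all add: assoc\<close>)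
  also have "... = (\<Sum>j<(3::nat). x j) * f * y k" by (simp add: compose_sum_left)
  also have "... = f * y k" using cr.homD(4)[OF cr.hom_o[OF f yh[OF k]]] by (simp add: x(2))
  finally show ?thesis .
 qed
 have A_even: "A : evens" by simp
 have la: "x k * cr.la X = cr.la X * A (x k)" if k: "k < 3" for k
 proof (rule commute[OF k])
  show "cr.la X : cr.homs (ec (Some A) (fst X)) (fst X)" by (rule cr.bim_hom(1)[OF X])
  show "ec (Some A) (fst X) : cr.Obj" using o by simp
  show "A (x j) : ideal j (ec (Some A) (fst X)) (ec (Some A) (fst X))" if "j < 3" for j
  proof (cases "fst X")
   case (Some H)
   thus ?thesis using whisker_ideal_left[OF even_homogeneous[OF A_even] cr.A_endo, of H "x j" j j] x(1)[OF that] o that by (simp add: cr.S_endoD)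
  qed (use x(1)[OF that] in simp)
  have "(\<Sum>j<(3::nat). A (x j)) = A (\<Sum>j<(3::nat). x j)" using h[THEN cr.homD(1)] by (simp add: numeral_3_eq_3 cr.A_add)
  thus "(\<Sum>j<(3::nat). A (x j)) = act (ec (Some A) (fst X)) idb" using o by (simp add: x(2))
 qed
 have ra: "x k * cr.ra X = cr.ra X * x k" if k: "k < 3" for k
 proof (rule commute[OF k])
  show "cr.ra X : cr.homs (ec (fst X) (Some A)) (fst X)" by (rule cr.bim_hom(2)[OF X])
  show "ec (fst X) (Some A) : cr.Obj" using o by simp
  show "x j : ideal j (ec (fst X) (Some A)) (ec (fst X) (Some A))" if "j < 3" for j
  proof (cases "fst X")
   case (Some H)
   thus ?thesis using whisker_ideal_right[OF even_homogeneous[OF A_even] cr.A_endo, of "x j" j H j] x(1)[OF that] that by simp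
  qed (use x(1)[OF that] in simp)
  show "(\<Sum>j<(3::nat). x j) = act (ec (fst X) (Some A)) idb" using o by (simp add: x(2))
 qed
 have "x k : cr.bmaps X X" if "k < 3" for k by (rule cr.bmapsI[OF X X h[OF that] la[OF that] ra[OF that]])
 thus ?thesis using x orth idem by (intro that[of x]) auto
qed

theorem faithful_grading:
 "faithful_grading (integer_mod_group 3) cr.BB
  (bimodule_components cr.CC cr.AA (crossed_components M \<alpha> \<rho> \<gamma>))"
  (is "faithful_grading ?K _ ?C")
proof -
 have car: "EX j<3. k = int j & ?C k = piece j" if "k : carrier ?K" for k
 proof -
  have "nat k < 3" "int (nat k) = k" using that by (auto simp: carrier_integer_mod_group)
  thus ?thesis using piece_eq[of "nat k"] by (intro exI[of _ "nat k"]) simp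
 qed
 have car': "int j : carrier ?K" if "j < 3" for j using that by (simp add: carrier_integer_mod_group)
 show ?thesis
 proof
  show "?C k <= Ob cr.BB" for k by (auto simp: bimodule_components_def)
 next
  fix k Xs Z assume k: "k : carrier ?K" and Xs: "set Xs <= ?C k" and Z: "Z : Ob cr.BB" and d: "is_direct_sum cr.BB Z Xs"
  obtain j where j: "j < 3" "?C k = piece j" using car[OF k] by blast
  have Zb: "cr.bim Z" using Z by simp
  obtain i p where ip: "ALL n<length Xs. i n : Mor cr.BB (Xs ! n) Z & p n : Mor cr.BB Z (Xs ! n)"
   "(\<Sum>n<length Xs. i n * p n) = Idm cr.BB Z" using d unfolding is_direct_sum_def cr.BB_simps by (elim exE conjE)
  have "i n * p n : ideal j (fst Z) (fst Z)" if n: "n < length Xs" for n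
  proof -
   have Xn: "cr.bim (Xs ! n)" "homogeneous j (fst (Xs ! n))" using subsetD[OF Xs nth_mem[OF n]] unfolding j(2) by blast+
   have "i n : cr.bmaps (Xs ! n) Z" "p n : cr.bmaps Z (Xs ! n)" using ip(1) n by auto
   note I = cr.bmapsD[OF Xn(1) Zb this(1)] and P = cr.bmapsD[OF Zb Xn(1) this(2)]
   have "i n * (act (fst (Xs ! n)) idb * p n) : ideal j (fst Z) (fst Z)"
    using Xn Zb by (intro ideal_left[OF _ _ _ ideal_right[OF _ _ _ _ P(2)] I(2)]) (auto simp: homogeneous_def)
   thus ?thesis by (simp add: P(7))
  qed
  hence "act (fst Z) idb : ideal j (fst Z) (fst Z)" using ideal_sum[of "{..<length Xs}" "%n. i n * p n"] Zb by (simp add: ip(2) cr.BB_Idm)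
  thus "Z : ?C k" using Zb by (simp add: j homogeneous_def)
 next
  fix X assume "X : Ob cr.BB"
  hence X: "cr.bim X" by simp
  obtain x where x': "ALL k<3. x k : ideal k (fst X) (fst X) & x k : cr.bmaps X X"
   "ALL j<3. ALL k<3. x j * x k = (if j = k then x k else 0)" "(\<Sum>k<(3::nat). x k) = act (fst X) idb" by (rule homogeneous_projections[OF X])
  have x: "k < 3 ==> x k : ideal k (fst X) (fst X)" "k < 3 ==> x k : cr.bmaps X X"
   "j < 3 ==> k < 3 ==> x j * x k = (if j = k then x k else 0)" "(\<Sum>k<(3::nat). x k) = act (fst X) idb" for j k using x' by auto
  have "EX YY r s. cr.bim YY & r : cr.bmaps X YY & s : cr.bmaps YY X & r * s = act (fst YY) idb & s * r = x k" if "k < 3" for k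
  proof -
   have "x k * x k = x k" using x(3)[OF that that] by simp
   thus ?thesis using cr.bimodule_splitting[OF X x(2)[OF that]] by metis
  qed
  then obtain Y r s where Y: "!!k. k < 3 ==> cr.bim (Y k)" "!!k. k < 3 ==> r k : cr.bmaps X (Y k)"
   "!!k. k < 3 ==> s k : cr.bmaps (Y k) X" "!!k. k < 3 ==> r k * s k = act (fst (Y k)) idb"
   "!!k. k < 3 ==> s k * r k = x k" by metis
  have Yp: "Y k : piece k" if k: "k < 3" for k
  proof -
   note R = cr.bmapsD[OF X Y(1)[OF k] Y(2)[OF k]] and S = cr.bmapsD[OF Y(1)[OF k] X Y(3)[OF k]]
   note o = cr.bim_ob[OF X] cr.bim_ob[OF Y(1)[OF k]]
   have "r k * (x k * s k) : ideal k (fst (Y k)) (fst (Y k))" by (rule ideal_left[OF o(2,1,2) ideal_right[OF o(1,1,2) x(1)[OF k] S(2)] R(2)])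
   moreover have "r k * (x k * s k) = act (fst (Y k)) idb" using o by (simp add: Y(5)[OF k, symmetric] assoc Y(4)[OF k] eq_tail[OF Y(4)[OF k]]
      cr.act_o[symmetric])
   ultimately show ?thesis using Y(1)[OF k] o by (simp add: homogeneous_def)
  qed
  let ?Ys = "map Y [0..<3]"
  have n: "?Ys ! k = Y k" if "k < 3" for k using that by (simp del: upt.simps)
  have "is_direct_sum cr.BB X ?Ys" unfolding is_direct_sum_def cr.BB_simps
  proof (rule exI[of _ s], rule exI[of _ r], intro conjI allI impI)
   fix j k assume "j < length ?Ys" "k < length ?Ys"
   hence jk: "j < 3" "k < 3" by simp_all
   have s: "s k = s k * r k * s k" using cr.bmapsD(6)[OF Y(1) X Y(3), OF jk(2) jk(2)] by (simp add: Y(4)[OF jk(2)])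
   have r: "r j = r j * s j * r j" using cr.bmapsD(7)[OF X Y(1) Y(2), OF jk(1) jk(1)] eq_tail[OF Y(4)[OF jk(1)], of "r j"] by simp
   have "r j * s k = (r j * s j * r j) * (s k * r k * s k)" using r s by simp
   also have "... = r j * (x j * x k) * s k" using Y(5)[OF jk(1)] Y(5)[OF jk(2)] by (simp add: assoc) (metis assoc)
   finally have *: "r j * s k = r j * (x j * x k) * s k" .
   show "r j * s k = (if j = k then Idm cr.BB (?Ys ! k) else 0)" using * jk x(3) Y(1,4) n by (cases "j = k") (simp_all add: cr.BB_Idm)
  qed (use Y x(4) X n in \<open>simp_all add: cr.BB_Idm del: upt.simps\<close>)
  moreover have "set ?Ys <= (\<Union>k\<in>carrier ?K. ?C k)" using Yp piece_eq car' by fastforce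
  ultimately show "EX Xs. set Xs <= (\<Union>k\<in>carrier ?K. ?C k) & is_direct_sum cr.BB X Xs" by blast
 next
  fix k l X Y assume k: "k : carrier ?K" and l: "l : carrier ?K" and kl: "k ~= l" and X: "X : ?C k" and Y: "Y : ?C l"
  obtain i where i: "i < 3" "k = int i" "?C k = piece i" using car[OF k] by blast
  obtain j where j: "j < 3" "l = int j" "?C l = piece j" using car[OF l] by blast
  have b: "cr.bim X" "cr.bim Y" "homogeneous i (fst X)" "homogeneous j (fst Y)" using X Y unfolding i(3) j(3) by blast+
  have "f = 0" if f: "f : cr.bmaps X Y" for f
  proof -
   note F = cr.bmapsD[OF b(1,2) f]
   have "act (fst Y) idb * f * act (fst X) idb = 0"
    using b F(2) i j kl by (intro ideal_orthogonal[of "fst X" "fst X" "fst Y" "fst Y" _ i _ j]) (auto simp: homogeneous_def)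
   thus ?thesis by (simp add: F)
  qed
  thus "Mor cr.BB X Y = {0}" using cr.bmaps_0[OF b(1,2)] by auto
 next
  fix k l X Y assume k: "k : carrier ?K" and l: "l : carrier ?K" and X: "X : ?C k" and Y: "Y : ?C l"
  obtain i where i: "i < 3" "k = int i" "?C k = piece i" using car[OF k] by blast
  obtain j where j: "j < 3" "l = int j" "?C l = piece j" using car[OF l] by blast
  have b: "cr.bim X" "cr.bim Y" "homogeneous i (fst X)" "homogeneous j (fst Y)" using X Y unfolding i(3) j(3) by blast+
  have "homogeneous ((i + j) mod 3) (cr.tob X Y)" by (rule homogeneous_retract[OF homogeneous_comp[OF b(3,4)] cr.tob_Obj[OF b(1,2)] cr.tq_hom[OF b(1,2)]
     cr.ts_hom[OF b(1,2)] cr.tq_ts[OF b(1,2)]])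
  moreover have "k \<otimes>\<^bsub>?K\<^esub> l = int ((i + j) mod 3)" by (simp add: i j mult_integer_mod_group zmod_int)
  ultimately show "X \<odot>\<^bsub>cr.BB\<^esub> Y : ?C (k \<otimes>\<^bsub>?K\<^esub> l)" using piece_eq[of "(i + j) mod 3"] b by (simp add: cr.tens_ob)
 next
  fix k assume k: "k : carrier ?K"
  obtain j where j: "j < 3" "k = int j" "?C k = piece j" using car[OF k] by blast
  \<comment> \<open>On \<open>M\<close> this is \<open>Ga j\<close>; the free bimodule on it
    witnesses faithfulness in degree \<open>j\<close>.\<close>
  let ?Q = "\<alpha> 0 o Ga j"
  have Q: "?Q : component j" by (auto simp: component_def)
  hence Qc: "?Q : crossed" using cr.P_S component_sub[OF j(1)] by blast
  have dQ: "homogeneous j (Some ?Q)" using Q Qc gideal_base[OF Q] by (simp add: homogeneous_def endo_id)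
  have dA: "homogeneous 0 (Some A)" using even_homogeneous[of A] by (simp add: homogeneous_def)
  have "homogeneous j (fst (cr.free ?Q))" using homogeneous_comp[OF dA homogeneous_comp[OF dQ dA]] j by (simp add: cr.free_def)
  hence "cr.free ?Q : ?C k" using cr.free_bim[OF Qc] j by simp
  moreover have "Idm cr.BB (cr.free ?Q) ~= 0" using cr.BB_Idm[OF cr.free_bim[OF Qc]] by (simp add: cr.free_def endo_id)
  ultimately show "EX X:?C k. Idm cr.BB X ~= 0" by blast
 qed
qed

lemma even_piece: "piece 0 = {XX. even.bim XX}"
proof -
 have "homogeneous 0 X \<longleftrightarrow> X : even.Obj" for X using evens_crossed by (cases X) (auto simp: homogeneous_def evens_iff component_0 endo_id cr.S_endoD)
 thus ?thesis by (auto simp: sub.bim_sub)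
qed

theorem graded_extension:
 assumes "tensor_equivalent (bimodule_category even.CC even.AA) even.CC" shows "graded_extension (integer_mod_group 3) cr.BB
  (bimodule_components cr.CC cr.AA (crossed_components M \<alpha> \<rho> \<gamma>)) even.CC"
proof -
 interpret C: fusion_category even.CC by (rule even_fusion)
 have "tensor_equivalent (full_subcategory cr.BB (piece 0)) even.CC" unfolding even_piece by (rule sub.subcategory_equivalence[OF _ _ assms]) (unfold_locales, simp)
 moreover have "bimodule_components cr.CC cr.AA (crossed_components M \<alpha> \<rho> \<gamma>) \<one>\<^bsub>integer_mod_group 3\<^esub> = piece 0"
  using piece_eq[of 0] by (simp add: one_integer_mod_group)
 ultimately show ?thesis unfolding graded_extension_def using cr.bimodule_fusion faithful_grading by (simp add: group_integer_mod_group carrier_integer_mod_group)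
qed

end

section \<open>Invertible bimodules\<close>

context separable_algebra
begin

text \<open>An invertible bimodule \<open>X\<close> makes \<open>Y \<otimes>\<^sub>A -\<close> faithful on left module maps into \<open>X\<close>, and reduces them to
 left module maps into \<open>A\<close>.\<close>

lemma invertible_faithful:
 assumes X: "bim X" and Y: "bim Y" and \<psi>: "is_inverse BB (tens X Y) UU \<psi> \<psi>'"
  and f: "f : M" "f * la X = la X * A f" "f * ac X idb = f" and 0: "tq Y X * ac Y f = 0" shows "f = 0"
proof -
 note B = tens_bim[OF X Y] and U = UU_bim
 have \<psi>m: "\<psi> : bmaps (tens X Y) UU" "\<psi> * \<psi>' = idb" using \<psi> by (simp_all add: is_inverse_BB BB_Idm)
 \<comment> \<open>Associativity turns the vanishing of \<open>f\<close> tensored with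
   \<open>Y\<close> on the left into vanishing after tensoring with \<open>tens X Y\<close>, which
   is isomorphic to \<open>A\<close>.\<close>
 have "tq (tens X Y) X * act (tob X Y) f * tq X Y = (tq (tens X Y) X * tq X Y) * ac X (ac Y f)" using X Y f(1) by (simp add: tq_comm assoc)
 also have "... = asc_inv X Y X * tq X (tens Y X) * ac X (tq Y X * ac Y f)" using X Y f(1) by (simp add: asc_inv_props(2)[OF X Y X, symmetric] act_o assoc)
 finally have "(tq (tens X Y) X * act (tob X Y) f) * tq X Y = 0 * tq X Y" using X by (simp add: 0 assoc)
 hence "tq (tens X Y) X * act (tob X Y) f = 0"
 proof (rule tq_cancel[OF X Y])
  have "act (tob X Y) f * act (tob X Y) idb = act (tob X Y) f" using X Y f(1) by (simp add: act_o[symmetric])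
  thus "(tq (tens X Y) X * act (tob X Y) f) * act (tob X Y) idb = tq (tens X Y) X * act (tob X Y) f" by (simp add: assoc)
 qed simp
 hence "rwhisk BB (tens X Y) UU X \<psi> * tq (tens X Y) X * act (tob X Y) f = 0" by simp
 hence "tq UU X * \<psi> * ac (tens X Y) f = 0" using X Y by (simp add: eq_tail[OF rwhisk_tq[OF B U X \<psi>m(1)]] tens_ob assoc)
 hence "(tq UU X * A f * \<psi>) * \<psi>' = 0" using bmapsD(5)[OF B U \<psi>m(1) f(1)] by simp
 hence "lun X * tq UU X * A f = 0" by (simp add: assoc \<psi>m(2))
 hence "f * la X * u = 0" by (simp add: eq_tail[OF lun_tq[OF X]] eq_tail[OF f(2)])
 thus ?thesis using X f(3) by (simp add: la_u)
qed

lemma invertible_module_maps: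
 assumes X: "bim X" and Y: "bim Y" and \<phi>: "is_inverse BB (tens Y X) UU \<phi> \<phi>'"
  and f: "f : M" "!!x. x : M ==> f * ac X (Q x) = ac X x * f" "f * la X = la X * A f" "f * ac X idb = f"
  and Q: "!!x. x : M ==> Q x : M"
 obtains t where "t : Hom Q A" "tq Y X * ac Y f = \<phi>' * m * A t * \<phi> * tq Y X"
proof -
 note T = tens_bim[OF Y X] and U = UU_bim
 let ?T = "tens Y X" and ?q = "tq Y X"
 have \<phi>m: "\<phi> : bmaps ?T UU" "\<phi>' : bmaps UU ?T" "\<phi>' * \<phi> = ac ?T idb" "\<phi> * \<phi>' = idb"
  using \<phi> T by (simp_all add: is_inverse_BB BB_Idm)
 note P = bmapsD[OF T U \<phi>m(1)] and P' = bmapsD[OF U T \<phi>m(2)]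
 have oT: "ob ?T = tob Y X" using X Y by (simp add: tens_ob)
 \<comment> \<open>The map that \<open>f\<close> induces on the tensor product of \<open>Y\<close>
   and \<open>X\<close> over \<open>A\<close>.\<close>
 define F where "F = ?q * ac Y f * ts Y X"
 have [simp]: "F : M" "\<phi> : M" "\<phi>' : M" using X Y f P(1) P'(1) by (simp_all add: F_def)
 have "?q * ac Y f * bal Y X = ?q * (ra Y * ac Y (A f)) * ac Y (A (la X) * dl)" using X Y f by (simp add: bal_def assoc ra_comm eq_tail[OF ra_comm])
 also have "... = ?q * ac Y (la X * A f * A (la X) * dl)" using X Y f by (simp add: eq_tail[OF tq_balanced[OF Y X]] act_o assoc)
 also have "la X * A f * A (la X) * dl = f" using X f(4) by (simp add: eq_tail[OF f(3)[symmetric]] eq_tail[OF la_la[OF X]] assoc dl_section la_u)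
 finally have Fq: "F * ?q = ?q * ac Y f" by (simp add: F_def assoc ts_tq[OF Y X])
 have F1: "F * act (tob Y X) idb = F" using homD(3)[OF ts_hom[OF Y X]] by (simp add: F_def assoc)
 have F_la: "F * la ?T = la ?T * A F"
 proof (rule tq_cancel_A[OF Y X])
  have "(F * la ?T) * A ?q = (F * ?q) * la Y" using X Y by (simp add: assoc tens_la)
  also have "... = (?q * la Y) * A (ac Y f)" using Y f by (simp add: Fq assoc la_comm)
  also have "... = (la ?T * A F) * A ?q" using X Y f by (simp add: tens_la[symmetric] assoc A_o[symmetric] Fq)
  finally show "(F * la ?T) * A ?q = (la ?T * A F) * A ?q" .
  show "(F * la ?T) * A (act (tob Y X) idb) = F * la ?T" using la_one'[OF T] by (simp add: assoc oT)
  show "(la ?T * A F) * A (act (tob Y X) idb) = la ?T * A F" using X Y by (simp add: assoc A_o[symmetric] F1)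
 qed
 have Fx: "F * act (tob Y X) (Q x) = act (tob Y X) x * F" if x: "x : M" for x
 proof -
  have "F * act (tob Y X) (Q x) = ?q * ac Y f * ac Y (ac X (Q x)) * ts Y X" using homD(2)[OF ts_hom[OF Y X] Q[OF x]] X Y by (simp add: F_def assoc)
  also have "... = ?q * ac Y (f * ac X (Q x)) * ts Y X" using x X Y f(1) Q by (simp add: act_o assoc)
  also have "... = (?q * ac Y (ac X x)) * ac Y f * ts Y X" using x X Y f(1) by (simp add: f(2) act_o assoc)
  finally show ?thesis using x X Y by (simp add: tq_comm F_def assoc)
 qed
 \<comment> \<open>\<open>F\<close> is carried over to a module map of \<open>A\<close> by the
   isomorphism with the unit bimodule, and then evaluated at the unit of \<open>A\<close>.\<close>
 define t where "t = \<phi> * F * \<phi>' * u"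
 have tM [simp]: "t : M" by (simp add: t_def)
 have "t * Q x = A x * t" if x: "x : M" for x
 proof -
  have "t * Q x = \<phi> * F * (\<phi>' * A (Q x)) * u" using x Q by (simp add: t_def assoc u_comm)
  also have "... = \<phi> * (F * act (tob Y X) (Q x)) * \<phi>' * u" using P'(5)[of "Q x"] x Q by (simp add: oT assoc)
  also have "... = (\<phi> * ac ?T x) * F * \<phi>' * u" using x by (simp add: Fx oT assoc)
  finally show ?thesis using P(5)[OF x] by (simp add: t_def assoc)
 qed
 hence t: "t : Hom Q A" by (simp add: intertwiners_def)
 have "m * A t = (m * A \<phi>) * A F * A \<phi>' * A u" by (simp add: t_def A_o assoc)
 also have "... = \<phi> * (la ?T * A F) * A \<phi>' * A u" by (simp add: assoc eq_tail[OF P(3)])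
 also have "... = \<phi> * F * (la ?T * A \<phi>') * A u" by (simp add: F_la[symmetric] assoc)
 also have "... = \<phi> * F * \<phi>'" by (simp add: assoc eq_tail[OF P'(3)[symmetric]] m_unit_right)
 finally have "\<phi>' * (m * A t) * \<phi> = (\<phi>' * \<phi>) * F * (\<phi>' * \<phi>)" by (simp add: assoc)
 also have "... = F"
 proof -
  have "act (tob Y X) idb * F = F" using X Y by (simp add: F_def assoc[symmetric] tq_one)
  thus ?thesis by (simp add: \<phi>m(3) oT F1)
 qed
 finally have "F * ?q = (\<phi>' * (m * A t) * \<phi>) * ?q" by simp
 thus ?thesis using that[OF t] by (simp add: Fq assoc)
qed

lemma module_map_free: "N : M ==> N * m = l * A N ==> N = l * A (N * u)"
proof -
 assume N: "N : M" "N * m = l * A N"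
 have "l * A (N * u) = (N * m) * A u" using N by (simp add: A_o assoc)
 thus ?thesis by (simp add: assoc m_unit_right)
qed

text \<open>The adjunction between free left modules and underlying objects, in operator form;
  \<open>module_map_free\<close> is its other half.\<close>

lemma free_module_map:
 assumes l: "lmod (Some H) l" and t: "t : Hom Q H" and p: "!!x. x : M ==> Q x : M" shows "l * A t : Hom (A o Q) H" "(l * A t) * m = l * A (l * A t)" "(l * A t) * u = t"
proof -
 note L = lmodD[OF l] and T = HomD(1)[OF t] HomD(2)[OF t]
 have [simp]: "l : M" "t : M" using L T by auto
 have H: "H : End" using L(1) by (simp add: S_endoD)
 have tx: "(l * A t) * A (Q x) = H x * l * A t" if x: "x : M" for x
 proof -
  have "(l * A t) * A (Q x) = l * A (H x * t)" using x p[OF x] T(2)[OF x] by (simp add: assoc A_o[symmetric])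
  also have "... = (l * A (H x)) * A t" using x endo_in[OF H] by (simp add: A_o assoc)
  also have "l * A (H x) = H x * l" using L(5)[OF x] by simp
  finally show ?thesis by (simp add: assoc)
 qed
 show "(l * A t) * m = l * A (l * A t)"
 proof -
  have "(l * A t) * m = (l * m) * A (A t)" by (simp add: assoc m_comm)
  thus ?thesis by (simp add: L(3) A_o assoc)
 qed
 have "(l * A t) * u = (l * u) * t" by (simp add: assoc u_comm)
 thus "(l * A t) * u = t" using endo_id[OF H] by (simp add: L(4))
 show "l * A t : Hom (A o Q) H" using tx by (simp add: intertwiners_def assoc)
qed

lemma free_lmod: assumes "Q : S" shows "lmod (Some (A o Q)) m" using assms endo_in[OF S_endoD[OF assms]] endo_id[OF S_endoD[OF assms]]
 by (simp add: lmod_def homs_def m_comm m_assoc m_unit_left)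

end

context semisimple_algebra
begin

lemma invertible_hom_zero:
 assumes inv: "invertible_object BB X" and zero: "Hom Q A <= {0}" and Q: "!!x. x : M ==> Q x : M"
  and f: "f : M" "!!x. x : M ==> f * ac X (Q x) = ac X x * f" "f * la X = la X * A f" "f * ac X idb = f" shows "f = 0"
proof -
 obtain Y \<phi> \<phi>' \<psi> \<psi>' where b: "bim X" "bim Y" and i: "is_inverse BB (tens X Y) UU \<psi> \<psi>'" "is_inverse BB (tens Y X) UU \<phi> \<phi>'"
  using inv unfolding invertible_object_def isomorphic_def is_iso_def BB_simps by blast
 obtain t where "t : Hom Q A" "tq Y X * ac Y f = \<phi>' * m * A t * \<phi> * tq Y X" by (rule invertible_module_maps[OF b i(2) f Q])
 hence "tq Y X * ac Y f = 0" using zero by auto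
 thus ?thesis by (rule invertible_faithful[OF b i(1) f(1,3,4)])
qed

lemma invertible_End:
 assumes inv: "invertible_object BB X" and f: "f : homs (ob X) (ob X)" "f * la X = la X * A f" shows "EX c. f = scl c (ac X idb)"
proof -
 obtain Y \<phi> \<phi>' \<psi> \<psi>' where b: "bim X" "bim Y" and i: "is_inverse BB (tens X Y) UU \<psi> \<psi>'" "is_inverse BB (tens Y X) UU \<phi> \<phi>'"
  using inv unfolding invertible_object_def isomorphic_def is_iso_def BB_simps by blast
 have fM: "f : M" "f * ac X idb = f" using homD[OF f(1)] by auto
 have fx: "f * ac X (id x) = ac X x * f" if "x : M" for x using homD(2)[OF f(1) that] by simp
 obtain t where t: "t : Hom id A" "tq Y X * ac Y f = \<phi>' * m * A t * \<phi> * tq Y X"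
  by (rule invertible_module_maps[OF b i(2) fM(1), where Q = id]) (use fx f(2) fM(2) in \<open>simp_all add: id_def\<close>)
 obtain c where c: "t = scl c u" using t(1) unit_homs by auto
 \<comment> \<open>Subtracting the scalar read off from \<open>t\<close> leaves a module map that
   vanishes after tensoring with \<open>Y\<close>, so faithfulness applies.\<close>
 let ?f = "f - scl c (ac X idb)"
 have \<phi>: "\<phi>' * \<phi> = ac (tens Y X) idb" "\<phi>' : M" using i(2) b bmaps_in[OF UU_bim tens_bim[OF b(2,1)]] by (simp_all add: is_inverse_BB BB_Idm)
 have "tq Y X * ac Y f = scl c (tq Y X)" unfolding t(2) c using b \<phi>(2)
  by (simp add: A_scale scale_left scale_right eq_tail[OF m_unit_right] eq_tail[OF \<phi>(1)] tens_ob tq_one)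
 moreover have "tq Y X * ac Y (scl c (ac X idb)) = scl c (tq Y X)" using b by (simp add: act_scale scale_right tq_unit)
 moreover have "ac Y ?f = ac Y f - ac Y (scl c (ac X idb))" using b fM act_add[of "ob Y" ?f "scl c (ac X idb)"] by simp
 ultimately have "tq Y X * ac Y ?f = 0" by (simp add: diff_right)
 hence "?f = 0"
 proof (rule invertible_faithful[OF b i(1), rotated 3])
  have [simp]: "la X : M" "f : M" using b fM by auto
  show "?f * la X = la X * A ?f" using b fM f(2) by (simp add: diff_left diff_right scale_left scale_right A_scale la_one la_one' endo_diff[OF A_endo])
  show "?f * ac X idb = ?f" using b fM by (simp add: diff_left scale_left ac_ones)
 qed (use b fM in auto)
 thus ?thesis by auto
qed

lemma module_map_regular:
 assumes X: "lmod X l" and Y: "lmod Y l'" and T: "T : homs X Y" "T * l = l' * A T"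
 obtains G where "G : homs Y X" "G * l' = l * A G" "T * G * T = T"
proof -
 obtain g where g: "g : homs Y X" "T * g * T = T" by (rule homs_regular[OF lmodD(1)[OF X] lmodD(1)[OF Y] T(1)])
 have "T * avg_left l' l g * T = avg_left l l' (T * g * T)" by (rule avg_left_natural[symmetric, OF _ _ _ _ _ _ T(2) T(2)])
   (use lmodD(2)[OF X] lmodD(2)[OF Y] homD(1)[OF T(1)] homD(1)[OF g(1)] in auto)
 also have "... = T" using avg_left_fixed[OF X Y T] by (simp add: g(2))
 finally show ?thesis using that avg_left_hom[OF Y X g(1)] avg_left_module[OF Y X g(1)] by blast
qed

text \<open>For a regular inverse \<open>G\<close>, the composite \<open>T * G\<close> is a scalar
  by the assumption on the target, and \<open>T * G * T = T\<close> forces that scalar to be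
  1.\<close>

lemma module_map_section:
 assumes X: "lmod X l" and Y: "lmod Y l'" and T: "T : homs X Y" "T * l = l' * A T" "T ~= 0"
  and End: "!!f. f : homs Y Y ==> f * l' = l' * A f ==> EX c. f = scl c (act Y idb)"
 obtains G where "G : homs Y X" "G * l' = l * A G" "T * G = act Y idb"
proof -
 obtain G where G: "G : homs Y X" "G * l' = l * A G" "T * G * T = T" by (rule module_map_regular[OF X Y T(1,2)])
 have M: "T : M" "G : M" using homD(1) T G by auto
 have "(T * G) * l' = l' * A (T * G)" using M G(2) by (simp add: assoc A_o eq_tail[OF T(2)])
 then obtain c where c: "T * G = scl c (act Y idb)" using End[OF hom_o[OF T(1) G(1)]] by blast
 have "T = (T * G) * T" using G(3) by (simp add: assoc)
 also have "... = scl c T" using homD(4)[OF T(1)] by (simp add: c scale_left)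
 finally have "scl (1 - c) T = 0" by (simp add: op_space.scale_left_diff_distrib)
 hence "c = 1" using T(3) by simp
 thus ?thesis using that G c by simp
qed

end

section \<open>Noninvertibility\<close>

context subfactor_3G
begin

lemma rho_alpha: "x : M ==> \<rho> (\<alpha> h x) = \<alpha> (- h) (\<rho> x)" using alpha_rho[of x "- h"] by simp

text \<open>Indexes the isometries by the group elements instead of by positions in an
  enumeration.\<close>

lemma rho_square_basis:
 obtains v0 v where "v0 : Hom id (\<rho> o \<rho>)" "cadj v0 * v0 = idb"
  "ALL h. v h : Hom (\<alpha> h o \<rho>) (\<rho> o \<rho>) & cadj (v h) * v h = idb"
  "v0 * cadj v0 + (\<Sum>h\<in>UNIV. v h * cadj (v h)) = idb"
proof -
 obtain gs where gs: "distinct gs" "set gs = UNIV" "isum (\<rho> o \<rho>) (id # map (%g. \<alpha> g o \<rho>) gs)" using rho_square by blast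
 obtain s where s: "!!i. i < Suc (length gs) ==>
   s i : Hom ((id # map (%g. \<alpha> g o \<rho>) gs) ! i) (\<rho> o \<rho>) & cadj (s i) * s i = idb"
  "(\<Sum>i<Suc (length gs). s i * cadj (s i)) = idb" using gs(3) by (auto simp: isometric_sum_def)
 have b: "bij_betw ((!) gs) {..<length gs} UNIV" using bij_betw_nth[OF gs(1) refl gs(2)[symmetric]] .
 define f where "f = the_inv_into {..<length gs} ((!) gs)"
 have f: "f h < length gs" "gs ! f h = h" "i < length gs ==> f (gs ! i) = i" for h i
  using b bij_betwE[OF bij_betw_the_inv_into[OF b]] f_the_inv_into_f_bij_betw[OF b] by (auto simp: f_def bij_betw_def the_inv_into_f_f)
 have sf: "s (Suc (f h)) : Hom (\<alpha> h o \<rho>) (\<rho> o \<rho>)" "cadj (s (Suc (f h))) * s (Suc (f h)) = idb" for h using s(1)[of "Suc (f h)"] f(1,2)[of h] by auto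
 have "(\<Sum>h\<in>UNIV. s (Suc (f h)) * cadj (s (Suc (f h)))) = (\<Sum>i<length gs. s (Suc i) * cadj (s (Suc i)))"
  by (rule sum.reindex_bij_betw[OF b, symmetric, THEN trans]) (simp add: f(3))
 hence "s 0 * cadj (s 0) + (\<Sum>h\<in>UNIV. s (Suc (f h)) * cadj (s (Suc (f h)))) = idb" using s(2) unfolding sum.lessThan_Suc_shift by simp
 thus ?thesis using s(1)[of 0] sf by (intro that[of "s 0" "%h. s (Suc (f h))"]) auto
qed

end

context crossed_3G
begin

text \<open>Moves group elements to the left, where they are added, and powers of
  \<open>\<gamma>\<close> to the right.\<close>

lemmas normal_form = rho_alpha alpha_add[symmetric] Gamma_alpha Gamma_rho

lemma simple_hom_zero:
 assumes Q: "Q : simples" "Q' : simples" and t: "t : M" "!!x. x : M ==> t * Q (Ga k x) = Q' (Ga k x) * t"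
  and ne: "\<not> isum Q' [Q]" shows "t = 0"
proof (rule ccontr)
 have "t : Hom (Q o Ga k) (Q' o Ga k)" using t by (simp add: intertwiners_def)
 hence t': "t : Hom Q Q'" by (simp only: Hom_automorphism[OF Gamma_aut])
 assume "t ~= 0"
 thus False using irreducible_iso[OF _ simples_irreducible[OF Q(1)] _ simples_irreducible[OF Q(2)] t'] subsetD[OF simples_endo] Q ne by metis
qed

lemma alpha_rho_not: "\<not> isum (\<alpha> h o \<rho>) [\<alpha> h']" using unitary_symmetric[of "\<alpha> h o \<rho>" "\<alpha> h'"] alpha_not_rho by auto

text \<open>Schur's lemma inside one degree. It is stated pointwise, because the composites met
  below become simple objects only after rewriting their values with
  \<open>normal_form\<close>.\<close>

lemma hom_zero:
 assumes t: "t : M" shows "(!!x. x : M ==> t * \<alpha> h (Ga k x) = \<alpha> h' (Ga k x) * t) ==> h ~= h' ==> t = 0"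
  "(!!x. x : M ==> t * \<alpha> h (\<rho> (Ga k x)) = \<alpha> h' (\<rho> (Ga k x)) * t) ==> h ~= h' ==> t = 0"
  "(!!x. x : M ==> t * \<alpha> h (Ga k x) = \<alpha> h' (\<rho> (Ga k x)) * t) ==> t = 0"
  "(!!x. x : M ==> t * \<alpha> h (\<rho> (Ga k x)) = \<alpha> h' (Ga k x) * t) ==> t = 0"
 using simple_hom_zero[of "\<alpha> h" "\<alpha> h'", OF _ _ t] simple_hom_zero[of "\<alpha> h o \<rho>" "\<alpha> h' o \<rho>", OF _ _ t]
  simple_hom_zero[of "\<alpha> h" "\<alpha> h' o \<rho>", OF _ _ t] simple_hom_zero[of "\<alpha> h o \<rho>" "\<alpha> h'", OF _ _ t]
  alpha_inequiv[of h' h] alpha_rho_inequiv[of h' h] alpha_not_rho[of h' h] alpha_rho_not[of h' h] by (simp_all, metis+)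

lemma simple_hom_scalar:
 assumes "Q : simples" "t : M" "!!x. x : M ==> t * Q (Ga k x) = Q (Ga k x) * t" shows "EX c. t = scl c idb"
proof -
 have "t : Hom (Q o Ga k) (Q o Ga k)" using assms by (simp add: intertwiners_def)
 thus ?thesis using simples_irreducible[OF assms(1)] by (auto simp: Hom_automorphism[OF Gamma_aut] irreducible_endo_def)
qed

end

context dual_3G
begin

text \<open>\<open>Hom id A\<close> is spanned by \<open>u\<close>, so the isometry of the trivial
  summand can be replaced by the unit itself, with a correspondingly rescaled projection
  \<open>e\<close>.\<close>

lemma A_decomposition:
 obtains e w where "e : Hom A id" "w : Hom (\<alpha> g0 o \<rho>) A"
  "e * u = idb" "e * w = 0" "cadj w * w = idb" "u * e + w * cadj w = idb"
proof -
 obtain f :: "nat => 'h op" where f: "ALL i<2. f i : Hom ([id, \<alpha> g0 o \<rho>] ! i) A & cadj (f i) * f i = idb"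
  "(\<Sum>i<2. f i * cadj (f i)) = idb" using A_sum unfolding isometric_sum_def by (auto simp: numeral_2_eq_2)
 define s w where "s = f 0" and "w = f 1"
 have s: "s : Hom id A" "cadj s * s = idb" and w: "w : Hom (\<alpha> g0 o \<rho>) A" "cadj w * w = idb"
  and one: "s * cadj s + w * cadj w = idb" using f(1)[rule_format, of 0] f(1)[rule_format, of 1] f(2) by (simp_all add: s_def w_def numeral_2_eq_2)
 have [simp]: "s : M" "w : M" using s w HomD by auto
 obtain c where c: "s = scl c u" using s(1) unit by auto
 have s': "cadj s : Hom A id" by (rule Hom_cadj[OF _ even.A_endo s(1)]) simp
 have "w * cadj w * w = w" by (simp add: w(2))
 hence "s * cadj s * w = 0" using arg_cong[OF one, of "%y. y * w"] by (simp add: add_left assoc)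
 hence "cadj s * s * cadj s * w = 0" by simp
 hence sw: "cadj s * w = 0" by (simp add: eq_tail[OF s(2)])
 show ?thesis
 proof (rule that[of "scl c (cadj s)" w])
  show "scl c (cadj s) * u = idb" using s(2) by (subst (asm) (2) c) (simp add: scale_left scale_right)
  show "u * scl c (cadj s) + w * cadj w = idb" using one by (subst (asm) (1) c) (simp add: scale_left scale_right)
  show "scl c (cadj s) : Hom A id" by (rule Hom_scale[OF _ s']) simp
 qed (use w sw in \<open>simp_all add: scale_left\<close>)
qed

lemma simple_crossed: "k < 3 ==> Q : simples ==> Q o Ga k : crossed"
 using component_sub[of k] crossed_iff[of "Q o Ga k"] gideal_base[of "Q o Ga k" csimples] csimples_endo by (fastforce simp: component_def)

end

text \<open>Cramer's rule. If the determinant vanishes, the combinations with cofactors as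
  coefficients contradict the independence of \<open>p\<close> and \<open>q\<close>.\<close>

lemma (in factor) plane_spanned:
 fixes x y p q z :: "'h op"
 assumes "z = scl a x + scl b y" "p = scl a1 x + scl b1 y" "q = scl a2 x + scl b2 y"
  and indep: "!!c d. scl c p + scl d q = 0 ==> c = 0 & d = 0"
 obtains c d where "z = scl c p + scl d q"
proof (cases "a1 \<^bold>* b2 = a2 \<^bold>* b1")
 case True
 note op_space.scale_right_distrib [simp] op_space.scale_left_distrib [symmetric, simp]
 have "scl b2 p + scl (- b1) q = scl (a1 \<^bold>* b2 - a2 \<^bold>* b1) x" "scl a2 p + scl (- a1) q = scl (a2 \<^bold>* b1 - a1 \<^bold>* b2) y"
  by (simp_all add: assms(2,3) algebra_simps op_space.scale_left_diff_distrib)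
 hence "b2 = 0 & - b1 = 0" "a2 = 0 & - a1 = 0" using indep[of b2 "- b1"] indep[of a2 "- a1"] True by simp_all
 hence "p = 0" by (simp add: assms(2))
 thus ?thesis using indep[of 1 0] by simp
next
 case False
 define D where "D = a1 \<^bold>* b2 - a2 \<^bold>* b1"
 have D: "D ~= 0" using False by (simp add: D_def)
 have "(a \<^bold>* b2 - b \<^bold>* a2) \<^bold>* a1 + (a1 \<^bold>* b - b1 \<^bold>* a) \<^bold>* a2 = a \<^bold>* D" "(a \<^bold>* b2 - b \<^bold>* a2) \<^bold>* b1 + (a1 \<^bold>* b - b1 \<^bold>* a) \<^bold>* b2 = b \<^bold>* D"
  by (simp_all add: D_def algebra_simps)
 hence "(a \<^bold>* b2 - b \<^bold>* a2) / D \<^bold>* a1 + (a1 \<^bold>* b - b1 \<^bold>* a) / D \<^bold>* a2 = a" "(a \<^bold>* b2 - b \<^bold>* a2) / D \<^bold>* b1 + (a1 \<^bold>* b - b1 \<^bold>* a) / D \<^bold>* b2 = b"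
  using D by (simp_all add: add_divide_distrib[symmetric])
 moreover have "scl c p + scl d q = scl (c \<^bold>* a1 + d \<^bold>* a2) x + scl (c \<^bold>* b1 + d \<^bold>* b2) y" for c d
  by (simp add: assms(2,3) op_space.scale_right_distrib op_space.scale_left_distrib)
 ultimately show ?thesis by (intro that[of "(a \<^bold>* b2 - b \<^bold>* a2) / D" "(a1 \<^bold>* b - b1 \<^bold>* a) / D"]) (simp add: assms(1))
qed

lemma (in crossed_3G) theta_pow_zero: "(\<theta> ^^ k) h = 0 ==> h = 0"
proof -
 assume h: "(\<theta> ^^ k) h = 0"
 \<comment> \<open>The identity intertwines \<open>\<alpha> 0\<close> and
   \<open>\<alpha> (\<theta> 0)\<close> on the range of \<open>\<gamma>\<close>, so the indices
   agree.\<close>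
 have "\<theta> 0 = 0" using hom_zero(1)[of idb 0 1 "\<theta> 0"] gamma_alpha[of _ 0] by (auto simp: alpha_zero endo_in)
 hence "(\<theta> ^^ k) 0 = 0" by (induction k) simp_all
 moreover have "inj (\<theta> ^^ k)" using theta_cube by (intro inj_fn injI) metis
 ultimately show "h = 0" using h by (metis injD)
qed

text \<open>Only the constituent of \<open>\<rho> o \<rho>\<close> with index \<open>h - c\<close>
  becomes \<open>\<alpha> h \<rho>\<close> after the twist by \<open>\<alpha> c\<close>; the
  components of \<open>t\<close> in all others vanish by Schur's lemma.\<close>

lemma (in crossed_3G) rho_square_hom:
 assumes v0: "v0 : Hom id (\<rho> o \<rho>)" and v: "ALL h. v h : Hom (\<alpha> h o \<rho>) (\<rho> o \<rho>) & cadj (v h) * v h = idb"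
  and one: "v0 * cadj v0 + (\<Sum>h\<in>UNIV. v h * cadj (v h)) = idb"
  and t: "t : M" "!!x. x : M ==> t * \<alpha> h (\<rho> (Ga k x)) = \<alpha> c (\<rho> (\<rho> (Ga k x))) * t" shows "EX d. t = scl d (\<alpha> c (v (h - c)))"
proof -
 note ac = endo_o[OF alpha_endo]
 have e: "id : End" "\<rho> o \<rho> : End" "\<alpha> j o \<rho> : End" for j by simp_all
 have vM [simp]: "v0 : M" "v j : M" for j using v0 v HomD by blast+
 have x0: "cadj v0 * \<rho> (\<rho> x) = x * cadj v0" and xj: "cadj (v j) * \<rho> (\<rho> x) = \<alpha> j (\<rho> x) * cadj (v j)" if "x : M" for x j
  using HomD(2)[OF Hom_cadj[OF e(1,2) v0] that] HomD(2)[OF Hom_cadj[OF e(3,2) v[rule_format, THEN conjunct1]] that] by simp_all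
 have tz: "(\<alpha> c z * t) * \<alpha> h (\<rho> (Ga k x)) = \<alpha> c y * (\<alpha> c z * t)"
  if "z * \<rho> (\<rho> (Ga k x)) = y * z" "x : M" "z : M" "y : M" for x y z
 proof -
  have "(\<alpha> c z * t) * \<alpha> h (\<rho> (Ga k x)) = \<alpha> c (z * \<rho> (\<rho> (Ga k x))) * t" using that(2,3) t by (simp add: assoc ac)
  thus ?thesis using that(3,4) by (simp add: that(1) ac assoc)
 qed
 have \<alpha>sum: "\<alpha> c (\<Sum>j\<in>J. f j) = (\<Sum>j\<in>J. \<alpha> c (f j))" if "!!j. f j : M" for f and J :: "'g set"
  using that by (induction J rule: infinite_finite_induct) (simp_all add: endo_0[OF alpha_endo] endo_add[OF alpha_endo] M_sum)
 have "\<alpha> c (cadj v0) * t = 0" by (rule hom_zero(4)[of _ h k c]) (use tz x0 t(1) in simp_all)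
 moreover have "\<alpha> c (cadj (v j)) * t = 0" if "j ~= h - c" for j
  by (rule hom_zero(2)[of _ h k "c + j"]) (use tz xj t(1) that in \<open>auto simp: alpha_add\<close>)
 hence "(\<Sum>j\<in>UNIV. \<alpha> c (v j) * \<alpha> c (cadj (v j)) * t) = (\<Sum>j\<in>{h - c}. \<alpha> c (v j) * \<alpha> c (cadj (v j)) * t)"
  using finite_group by (intro sum.mono_neutral_right) auto
 moreover have "(\<alpha> c v0 * \<alpha> c (cadj v0) + (\<Sum>j\<in>UNIV. \<alpha> c (v j) * \<alpha> c (cadj (v j)))) = idb"
  using arg_cong[OF one, of "\<alpha> c"] by (simp add: endo_add[OF alpha_endo] \<alpha>sum ac endo_id M_sum)
 from arg_cong[OF this, of "%y. y * t"]
 have "\<alpha> c v0 * \<alpha> c (cadj v0) * t + (\<Sum>j\<in>UNIV. \<alpha> c (v j) * \<alpha> c (cadj (v j)) * t) = t" by (simp add: add_left compose_sum_left assoc)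
 ultimately have t': "t = \<alpha> c (v (h - c)) * \<alpha> c (cadj (v (h - c))) * t" by simp
 have "EX d. \<alpha> c (cadj (v (h - c))) * t = scl d idb"
  by (rule simple_hom_scalar[of "\<alpha> h o \<rho>" _ k]) (use tz[of "cadj (v (h - c))"] xj t(1) in \<open>auto simp: alpha_add[symmetric]\<close>)
 thus ?thesis using t' by (auto simp: scale_right)
qed

context dual_3G
begin

context
 fixes k :: nat and H l r
 assumes k: "0 < k" "k < 3" and X: "cr.bim (Some H, l, r)" and inv: "invertible_object cr.BB (Some H, l, r)"
  and two: "!!h :: 'g. h + h = 0"
begin

lemma minus_self: "- (h :: 'g) = h" "h - h' = h + (h' :: 'g)" using two[of h] two[of h'] by (simp_all add: eq_neg_iff_add_eq_0 minus_unique)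

lemma twist_g0: "(\<theta> ^^ k) g0 ~= g0" using theta_pow_fixed[of k g0 0] k g0 by auto

lemma X_lmod: "cr.lmod (Some H) l" using cr.bim_lmod[OF X] by simp

lemma X_endo: "H : End" using cr.lmodD(1)[OF X_lmod] by (simp add: cr.S_endoD)

lemma X_in [simp]: "l : M" "x : M ==> H x : M" using cr.lmodD(2)[OF X_lmod] endo_in[OF X_endo] by auto

text \<open>Left module endomorphisms of an invertible bimodule are scalars. Hence the module map
  induced by a constituent \<open>Q\<close> is a split epimorphism.\<close>

lemma free_section:
 assumes Q: "Q : crossed" and t: "t : Hom Q H" "t ~= 0"
 obtains G where "G : Hom H (A o Q)" "G * l = m * A G" "(l * A t) * G = idb"
proof -
 have e: "Q : End" by (rule cr.S_endoD[OF Q])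
 have o: "A o Q : crossed" "H : crossed" using Q cr.lmodD(1)[OF X_lmod] by simp_all
 note T = cr.free_module_map[OF X_lmod t(1) endo_in[OF e]]
 have TM: "t : M" using t(1) by (rule HomD)
 have T0: "l * A t ~= 0" using T(3) t(2) by auto
 have "EX c. f = scl c (act (Some H) idb)" if "f : cr.homs (Some H) (Some H)" "f * l = l * A f" for f using cr.invertible_End[OF inv, of f] that by simp
 then obtain G where "G : cr.homs (Some H) (Some (A o Q))" "G * l = m * A G" "(l * A t) * G = act (Some H) idb"
  using cr.module_map_section[OF cr.free_lmod[OF Q] X_lmod _ T(2) T0] T(1) o by (auto simp: cr.hom_Some)
 thus ?thesis using that o X_endo by (auto simp: cr.hom_Some endo_id)
qed

lemma no_automorphism:
 assumes t: "t : M" "!!x. x : M ==> t * \<alpha> h (Ga k x) = H x * t" shows "t = 0"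
proof (rule ccontr)
 assume t0: "t ~= 0"
 define Q where "Q = \<alpha> h o Ga k"
 have Q: "Q : crossed" "Q : End" "Q : Aut" using simple_crossed[OF k(2)] automorphism_comp[OF alpha_aut Gamma_aut] by (auto simp: Q_def)
 note [simp] = endo_in[OF Q(2)] t(1)
 have tQ: "t * Q x = H x * t" if "x : M" for x using t(2)[OF that] by (simp add: Q_def)
 have r [simp]: "r : M" and rc: "!!x. x : M ==> r * H (A x) = H x * r" and rr: "r * r = r * H m" and ru: "r * H u = idb"
  using cr.bimD[OF X] cr.ra_comm[OF X] cr.ra_ra[OF X] cr.ra_u[OF X] X_endo by (simp_all add: endo_id)
 obtain e w where i: "e : Hom A id" "w : Hom (\<alpha> g0 o \<rho>) A" and ew: "e * u = idb" "e * w = 0" "cadj w * w = idb" "u * e + w * cadj w = idb"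
  by (rule A_decomposition)
 have [simp]: "e : M" "w : M" and ex: "!!x. x : M ==> e * A x = x * e"
  and wx: "!!x. x : M ==> w * \<alpha> g0 (\<rho> x) = A x * w" using i by (auto simp: intertwiners_def)
 have "t : Hom Q H" using tQ by (simp add: intertwiners_def)
 then obtain G where G': "G : Hom H (A o Q)" "(l * A t) * G = idb" by (rule free_section[OF Q(1) _ t0])
 note G = HomD[OF G'(1), unfolded comp_apply] G'(2)
 note [simp] = G(1)
 \<comment> \<open>The right action of the summand \<open>\<alpha> g0 \<rho>\<close> of
   \<open>A\<close> on the constituent \<open>Q\<close>, lifted to the free module
   \<open>A Q\<close>. It vanishes, because its source is a constituent of neither summand of
   \<open>A Q\<close>.\<close>
 define q where "q = G * r * t * Q w"
 have [simp]: "q : M" by (simp add: q_def)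
 have qx: "q * Q (\<alpha> g0 (\<rho> x)) = A (Q x) * q" if x: "x : M" for x
 proof -
  have "Q w * Q (\<alpha> g0 (\<rho> x)) = Q (A x) * Q w" using x by (simp add: endo_o[OF Q(2), symmetric] wx)
  hence "q * Q (\<alpha> g0 (\<rho> x)) = G * r * (t * Q (A x)) * Q w" by (simp add: q_def assoc)
  also have "... = G * (r * H (A x)) * t * Q w" using x by (simp add: tQ assoc)
  also have "... = (G * H x) * r * t * Q w" using x by (simp add: rc assoc)
  finally show ?thesis using x by (simp add: G(2) q_def assoc)
 qed
 have QL: "Q (\<alpha> g0 (\<rho> x)) = \<alpha> (h + (\<theta> ^^ k) g0) (\<rho> (Ga k x))" if "x : M" for x using that by (simp add: Q_def normal_form)
 have "e * q = 0"
 proof (rule hom_zero(4)[of _ "h + (\<theta> ^^ k) g0" k h])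
  show "(e * q) * \<alpha> (h + (\<theta> ^^ k) g0) (\<rho> (Ga k x)) = \<alpha> h (Ga k x) * (e * q)" if x: "x : M" for x
  proof -
   have "(e * q) * \<alpha> (h + (\<theta> ^^ k) g0) (\<rho> (Ga k x)) = (e * A (Q x)) * q" using qx[OF x] x by (simp add: QL assoc)
   thus ?thesis using x by (simp add: ex Q_def assoc)
  qed
 qed simp
 moreover have "cadj w * q = 0"
 proof (rule hom_zero(2)[of _ "h + (\<theta> ^^ k) g0" k "g0 - h"])
  have w': "cadj w * A x = \<alpha> g0 (\<rho> x) * cadj w" if "x : M" for x using Hom_cadj[OF _ even.A_endo i(2)] that by (auto simp: intertwiners_def)
  show "(cadj w * q) * \<alpha> (h + (\<theta> ^^ k) g0) (\<rho> (Ga k x)) = \<alpha> (g0 - h) (\<rho> (Ga k x)) * (cadj w * q)" if x: "x : M" for x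
  proof -
   have "(cadj w * q) * \<alpha> (h + (\<theta> ^^ k) g0) (\<rho> (Ga k x)) = (cadj w * A (Q x)) * q" using qx[OF x] x by (simp add: QL assoc)
   thus ?thesis using x by (simp add: w' Q_def normal_form assoc)
  qed
  \<comment> \<open>As \<open>h + h = 0\<close>, equality would mean that the power of
    \<open>\<theta>\<close> fixes \<open>g0\<close>.\<close>
  show "h + (\<theta> ^^ k) g0 ~= g0 - h" using twist_g0 by (simp add: minus_self add.commute)
 qed simp
 ultimately have "q = 0" using arg_cong[OF ew(4), of "%y. y * q"] by (simp add: add_left assoc)
 moreover have "l * A t * G * y = y" for y :: "'h op" using arg_cong[OF G(3), of "%z. z * y"] by (simp add: assoc)
 hence "r * t * Q w = l * A t * q" by (simp add: q_def)
 ultimately have rtw: "r * t * Q w = 0" by simp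
 have "Q (u * e + w * cadj w) = idb" using Q(2) by (simp add: ew(4) endo_id)
 hence "Q u * Q e + Q w * Q (cadj w) = idb" using Q(2) by (simp add: endo_add endo_o)
 from arg_cong[OF this, of "%y. (r * t) * y"]
 have "r * t = r * (t * Q u) * Q e + (r * t * Q w) * Q (cadj w)" by (simp add: add_right assoc)
 also have "... = t * Q e" unfolding rtw using even.u_in by (simp add: tQ assoc eq_tail[OF ru])
 \<comment> \<open>On the constituent \<open>Q\<close> the algebra acts from the right through
   \<open>e\<close> alone. The associativity of this action now makes \<open>e\<close>
   multiplicative.\<close>
 finally have rt: "r * t = t * Q e" .
 have "t * Q (e * e) = (r * t) * Q e" using Q(2) by (simp add: rt endo_o assoc)
 also have "... = r * r * t" by (simp add: rt eq_tail[OF rt] assoc)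
 also have "... = r * t * Q m" by (simp add: eq_tail[OF rr] tQ assoc)
 also have "... = t * Q (e * m)" using Q(2) by (simp add: eq_tail[OF rt] endo_o assoc)
 finally have 1: "t * Q (e * e - e * m) = 0" using Q(2) by (simp add: endo_diff diff_right)
 have "cadj t * t : Hom Q Q" using tQ Hom_cadj[OF Q(2) X_endo, of t] by (intro Hom_o[of _ H]) (auto simp: intertwiners_def)
 then obtain c where c: "cadj t * t = scl c idb" using irreducible_scalar[OF automorphism_irreducible[OF Q(3)]] by blast
 have "c ~= 0" using cadj_self_eq_0[OF t(1)] t0 c by auto
 moreover have "scl c (Q (e * e - e * m)) = (cadj t * t) * Q (e * e - e * m)" by (simp add: c scale_left)
 hence "scl c (Q (e * e - e * m)) = 0" by (simp add: assoc 1)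
 ultimately have "Q (e * e - e * m) = Q 0" using Q(2) by (simp add: endo_0)
 moreover have "inj_on Q M" using Q(3) by (simp add: automorphisms_def bij_betw_def)
 ultimately have em: "e * m = e * e" by (auto dest!: inj_onD)
 \<comment> \<open>Maps from \<open>A\<close> to the unit object vanish on the summand
   \<open>\<alpha> g0 \<rho>\<close>, so the counit is a multiple of \<open>e\<close>.\<close>
 have "ep * w : Hom (\<alpha> g0 o \<rho>) id" by (rule Hom_o[OF epsilon(1) i(2)])
 hence "ep * w = 0" using simple_hom_zero[of "\<alpha> g0 o \<rho>" "\<alpha> 0" "ep * w" 0] alpha_rho_not alpha_not_rho by (auto simp: intertwiners_def alpha_zero)
 moreover have "ep * u : Hom id id" using unit by (intro Hom_o[OF epsilon(1)]) (metis op_scale_1 rangeI)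
 then obtain d where "ep * u = scl d idb" using center[of "ep * u"] by (auto simp: intertwiners_def)
 ultimately have d: "ep = scl d e" using arg_cong[OF ew(4), of "%y. ep * y"] by (simp add: add_right eq_tail scale_left)
 \<comment> \<open>With \<open>e\<close> multiplicative, the counit law factors the identity of
   \<open>A\<close> through the unit object, against the presence of the second summand
   \<open>w\<close>.\<close>
 have "idb = scl d (e * e * A dl)" using epsilon(3) by (simp add: d scale_left eq_tail[OF em] assoc)
 also have "e * A dl = dl * e" using ex delta(1) HomD by blast
 finally have "w = scl d (e * dl * e) * w" by simp
 hence "w = 0" by (simp add: scale_left ew(2) assoc)
 thus False using ew(3) by simp
qed

lemma not_homogeneous: "\<not> homogeneous k (Some H)"
proof
 assume hom: "homogeneous k (Some H)"
 have ac: "!!x y c. x : M ==> y : M ==> \<alpha> c (x * y) = \<alpha> c x * \<alpha> c y" by (rule endo_o[OF alpha_endo])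
 obtain h t where t: "t : Hom (\<alpha> h o \<rho> o Ga k) H" "t ~= 0"
 proof (rule ccontr)
  note witness = that
  assume "\<not> thesis"
  hence 0: "t = 0" if "t : Hom (\<alpha> h o \<rho> o Ga k) H" for h t using that witness by blast
  have zero: "x = 0" if "x : gideal M (component k) H H" for x using that
  proof (induction rule: gideal.induct)
   case (step x Q t a)
   obtain h where "Q = \<alpha> h o Ga k \<or> Q = \<alpha> h o \<rho> o Ga k" using step.hyps(2) by (auto simp: component_def)
   hence "t = 0" using step.hyps(3) 0[of t h] no_automorphism[of t h] by (auto simp: intertwiners_def)
   thus ?case using step.IH by simp
  qed simp
  have "(idb :: 'h op) = 0" using zero[of idb] hom X_endo by (simp add: homogeneous_def endo_id)
  thus False by simp
 qed
 \<comment> \<open>The product of \<open>\<alpha> g0 o \<rho>\<close> and \<open>Q\<close> agrees on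
   \<open>M\<close> with \<open>\<alpha> c o \<rho> o \<rho> o Ga k\<close>, so \<open>be\<close> is
   the only automorphism among the constituents of \<open>A Q\<close>.\<close>
 define Q c be where "Q = \<alpha> h o \<rho> o Ga k" and "c = g0 - h" and "be = \<alpha> c o Ga k"
 have Qx: "Q x = \<alpha> h (\<rho> (Ga k x))" and bex: "be x = \<alpha> c (Ga k x)" for x by (simp_all add: Q_def be_def)
 have Q: "Q : crossed" and be: "be : crossed" using simple_crossed[OF k(2)] by (auto simp: Q_def be_def)
 have e: "Q : End" "be : End" by (simp_all add: Q_def be_def)
 note [simp] = endo_in[OF e(1)] endo_in[OF e(2)]
 note t = t[folded Q_def]
 obtain z w where i: "z : Hom A id" "w : Hom (\<alpha> g0 o \<rho>) A" and zw: "z * u = idb" "z * w = 0"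
  "cadj w * w = idb" "u * z + w * cadj w = idb" by (rule A_decomposition)
 have i': "cadj w : Hom A (\<alpha> g0 o \<rho>)" by (rule Hom_cadj[OF _ even.A_endo i(2)]) simp
 have [simp]: "z : M" "w : M" "t : M" using i t HomD by blast+
 have zx: "z * A x = x * z" and wx: "w * \<alpha> g0 (\<rho> x) = A x * w" and w'x: "cadj w * A x = \<alpha> g0 (\<rho> x) * cadj w" if "x : M" for x
  using HomD(2)[OF i(1) that] HomD(2)[OF i(2) that] HomD(2)[OF i' that] by simp_all
 have split: "x = u * z * x + w * cadj w * x" for x :: "'h op" using arg_cong[OF zw(4), of "%y. y * x"] by (simp add: add_left assoc)
 obtain v0 v where v: "v0 : Hom id (\<rho> o \<rho>)" "cadj v0 * v0 = idb"
   "ALL h. v h : Hom (\<alpha> h o \<rho>) (\<rho> o \<rho>) & cadj (v h) * v h = idb"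
   "v0 * cadj v0 + (\<Sum>h\<in>UNIV. v h * cadj (v h)) = idb" by (rule rho_square_basis)
 have [simp]: "v0 : M" "v j : M" for j using v HomD by blast+
 have v0x: "v0 * x = \<rho> (\<rho> x) * v0" and vx: "v j * \<alpha> j (\<rho> x) = \<rho> (\<rho> x) * v j" if "x : M" for x j
  using HomD(2)[OF v(1) that] HomD(2)[OF v(3)[rule_format, THEN conjunct1] that] by simp_all
 have LQ: "\<alpha> g0 (\<rho> (Q x)) = \<alpha> c (\<rho> (\<rho> (Ga k x)))" if "x : M" for x using that by (simp add: Qx c_def normal_form)
 have Lbe: "\<alpha> g0 (\<rho> (be x)) = \<alpha> h (\<rho> (Ga k x))" if "x : M" for x using that by (simp add: bex c_def normal_form)
 \<comment> \<open>Isometries of simple constituents into \<open>A Q\<close>: \<open>y j\<close> for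
   \<open>\<alpha> (c + j) \<rho> \<gamma>^k\<close> and \<open>b\<close> for
   \<open>be\<close>.\<close>
 define y where "y j = w * \<alpha> c (v j)" for j
 define b where "b = w * \<alpha> c v0"
 have iso: "cadj x * x = idb ==> x : M ==> cadj (w * \<alpha> c x) * w * \<alpha> c x = idb" for x
  by (simp add: cadj_o endo_cadj[OF alpha_endo, symmetric] assoc eq_tail[OF zw(3)] ac[symmetric] endo_id[OF alpha_endo])
 have [simp]: "y j : M" "b : M" for j by (simp_all add: y_def b_def)
 have y0: "y j ~= 0" and b0: "b ~= 0" for j using iso[of "v j"] iso[of v0] v(2,3) by (auto simp: y_def b_def)
 have yx: "y j * \<alpha> (c + j) (\<rho> (Ga k x)) = A (Q x) * y j" if "x : M" for j x
 proof -
  have "y j * \<alpha> (c + j) (\<rho> (Ga k x)) = w * \<alpha> c (v j * \<alpha> j (\<rho> (Ga k x)))" using that by (simp add: y_def ac alpha_add assoc)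
  also have "... = (w * \<alpha> g0 (\<rho> (Q x))) * \<alpha> c (v j)" using that by (simp add: vx ac LQ assoc)
  finally show ?thesis using that by (simp add: wx y_def assoc)
 qed
 have bx: "b * be x = A (Q x) * b" if "x : M" for x
 proof -
  have "b * be x = w * \<alpha> c (v0 * Ga k x)" using that by (simp add: b_def bex ac assoc)
  also have "... = (w * \<alpha> g0 (\<rho> (Q x))) * \<alpha> c v0" using that by (simp add: v0x ac LQ assoc)
  finally show ?thesis using that by (simp add: wx b_def assoc)
 qed
 \<comment> \<open>\<open>Q\<close> occurs twice in \<open>A Q\<close>: once through the unit and
   once through the square of \<open>\<rho>\<close>. So the module endomorphisms of
   \<open>A Q\<close> form a plane.\<close>
 have plane: "EX a d. f = scl a u + scl d (y (h - c))" if f: "f : M" "!!x. x : M ==> f * Q x = A (Q x) * f" for f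
 proof -
  have "EX a. z * f = scl a idb" using f by (intro simple_hom_scalar[of "\<alpha> h o \<rho>" _ k]) (simp_all add: assoc eq_tail[OF zx] flip: Qx)
  moreover have "EX d. cadj w * f = scl d (\<alpha> c (v (h - c)))"
   using f by (intro rho_square_hom[OF v(1,3,4), of _ _ k]) (simp_all add: assoc eq_tail[OF w'x] LQ flip: Qx)
  ultimately obtain a d where "z * f = scl a idb" "cadj w * f = scl d (\<alpha> c (v (h - c)))" by blast
  hence "f = scl a u + scl d (y (h - c))" by (subst split[of f]) (simp add: scale_right y_def)
  thus ?thesis by blast
 qed
 note lQ = cr.free_lmod[OF Q] and lbe = cr.free_lmod[OF be]
 have obs: "A o Q : crossed" "A o be : crossed" using Q be by simp_all
 define T where "T = l * A t"
 note T = cr.free_module_map[OF X_lmod t(1) endo_in[OF e(1)], folded T_def]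
 have [simp]: "T : M" by (simp add: T_def)
 have Tx: "T * A (Q x) = H x * T" if "x : M" for x using HomD(2)[OF T(1) that] by simp
 obtain G where G: "G : Hom H (A o Q)" "G * l = m * A G" "T * G = idb" unfolding T_def by (rule free_section[OF Q t])
 have [simp]: "G : M" using G(1) by (rule HomD)
 have Gx: "G * H x = A (Q x) * G" if "x : M" for x using HomD(2)[OF G(1) that] by simp
 \<comment> \<open>Embeds the free module \<open>A be\<close> into \<open>A Q\<close>. A regular
   inverse is a left inverse, because maps from \<open>be\<close> to \<open>A be\<close> are
   multiples of the unit.\<close>
 define W where "W = m * A b"
 have "b : Hom be (A o Q)" using bx by (simp add: intertwiners_def)
 note W = cr.free_module_map[OF lQ this endo_in[OF e(2)], folded W_def]
 have [simp]: "W : M" by (simp add: W_def)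
 obtain V1 where V1: "V1 : Hom (A o Q) (A o be)" "V1 * m = m * A V1" "W * V1 * W = W" using cr.module_map_regular[OF lbe lQ _ W(2)] W(1) obs by (auto simp: cr.hom_Some)
 have [simp]: "V1 : M" using V1(1) by (rule HomD)
 define N where "N = V1 * W * u"
 have [simp]: "N : M" by (simp add: N_def)
 have N: "V1 * W = m * A N" using cr.module_map_free[of "V1 * W" m] by (simp add: N_def W(2) assoc eq_tail[OF V1(2)] cr.A_o)
 have Nx: "N * be x = A (be x) * N" if x: "x : M" for x using HomD(2)[OF Hom_o[OF V1(1) W(1)] x] x by (simp add: N_def assoc cr.u_comm) (simp add: assoc[symmetric])
 have "EX d. z * N = scl d idb" using Nx by (intro simple_hom_scalar[of "\<alpha> c" _ k]) (simp_all add: assoc eq_tail[OF zx] flip: bex)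
 moreover have "cadj w * N = 0" by (rule hom_zero(3)[of _ c k h]) (simp_all add: assoc eq_tail[OF w'x] Nx Lbe flip: bex)
 ultimately obtain d where "z * N = scl d idb" "cadj w * N = 0" by blast
 hence "N = scl d u" by (subst split[of N]) (simp add: scale_right)
 hence d: "V1 * W = scl d idb" by (simp add: N cr.A_scale scale_right cr.m_unit_right)
 have "W = scl d W" using V1(3) by (simp add: d scale_right)
 hence "scl (1 - d) W = 0" by (simp add: op_space.scale_left_diff_distrib)
 moreover have "W ~= 0" using W(3) b0 by auto
 ultimately have VW1: "V1 * W = idb" using d by simp
 \<comment> \<open>\<open>X\<close> contains no automorphism, so the map to \<open>X\<close> kills
   the free module on \<open>be\<close>.\<close>
 have TW: "T * W = 0"
 proof -
  have "T * b = 0" by (rule no_automorphism[of _ c]) (simp_all add: assoc bx eq_tail[OF Tx] flip: bex)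
  thus ?thesis using cr.module_map_free[of "T * W" l] by (simp add: W(2,3) assoc eq_tail[OF T(2)] cr.A_o)
 qed
 \<comment> \<open>The retraction is corrected to vanish on the image of \<open>G\<close>. Then
   \<open>P\<close> and \<open>E\<close> below are orthogonal idempotents, onto \<open>X\<close> and
   onto \<open>A be\<close>.\<close>
 define V where "V = V1 - V1 * G * T"
 have [simp]: "V : M" by (simp add: V_def)
 have VW: "V * W = idb" by (simp add: V_def diff_left assoc TW VW1)
 have VG: "V * G = 0" by (simp add: V_def diff_left assoc G(3))
 have GTm: "G * T * m = m * A G * A T" by (simp add: T(2) eq_tail[OF G(2)] assoc)
 have Vm: "V * m = m * A V" by (simp add: V_def diff_left diff_right endo_diff[OF even.A_endo] cr.A_o assoc V1(2) GTm eq_tail[OF V1(2)])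
 have Vx: "V * A (Q x) = A (be x) * V" if "x : M" for x using HomD(2)[OF V1(1) that] that
  by (simp add: V_def diff_left diff_right assoc Tx eq_tail[OF Gx] eq_tail[where S = V1 and T = "A (Q x)"])
 define P E where "P = G * T" and "E = W * V"
 have Wx: "W * A (be x) = A (Q x) * W" if "x : M" for x using HomD(2)[OF W(1) that] by simp
 have [simp]: "P : M" "E : M" by (simp_all add: P_def E_def)
 have Pm: "P * m = m * A P" and Em: "E * m = m * A E" by (simp_all add: P_def E_def cr.A_o assoc GTm Vm eq_tail[OF W(2)])
 have Pf: "P = m * A (P * u)" and Ef: "E = m * A (E * u)" using Pm Em by (simp_all add: cr.module_map_free[symmetric])
 have "EX a d. P * u = scl a u + scl d (y (h - c))" "EX a d. E * u = scl a u + scl d (y (h - c))"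
  by (rule plane; simp add: P_def E_def assoc cr.u_comm Tx Vx eq_tail[OF Tx] eq_tail[OF Vx] eq_tail[OF Gx] eq_tail[OF Wx])+
 then obtain a1 d1 a2 d2 where PE: "P * u = scl a1 u + scl d1 (y (h - c))" "E * u = scl a2 u + scl d2 (y (h - c))" by blast
 have lin: "m * A (scl a (P * u) + scl d (E * u)) = scl a P + scl d E" for a d by (simp add: endo_add[OF even.A_endo] cr.A_scale add_right scale_right flip: Pf Ef)
 \<comment> \<open>\<open>P\<close> and \<open>E\<close> are independent in a plane that contains
   the identity, so \<open>A Q\<close> has no further summand.\<close>
 obtain p q where "u = scl p (P * u) + scl q (E * u)"
 proof (rule plane_spanned[OF _ PE])
  show "u = scl 1 u + scl 0 (y (h - c))" by simp
  fix a d assume "scl a (P * u) + scl d (E * u) = 0"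
  hence 0: "scl a P + scl d E = 0" using lin[of a d] by simp
  have "T * (scl a P + scl d E) * G = scl a idb" by (simp add: P_def E_def add_left add_right scale_left scale_right assoc eq_tail[OF G(3)] eq_tail[OF TW] G(3))
  moreover have "V * (scl a P + scl d E) * W = scl d idb" by (simp add: P_def E_def add_left add_right scale_left scale_right assoc eq_tail[OF VG] eq_tail[OF VW] VW)
  ultimately show "a = 0 & d = 0" unfolding 0 by simp
 qed
 hence one: "idb = scl p P + scl q E" using lin[of p q] by (metis cr.m_unit_right)
 \<comment> \<open>Chosen so that \<open>\<alpha> h' \<rho> \<gamma>^k\<close> is
   \<open>Q \<alpha> g0\<close>.\<close>
 define h' where "h' = h - (\<theta> ^^ k) g0"
 have hh: "h' ~= h" using theta_pow_zero[of k g0] g0 by (auto simp: h'_def)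
 have Qh': "Q (\<alpha> g0 x) = \<alpha> h' (\<rho> (Ga k x))" if "x : M" for x using that by (simp add: Qx h'_def normal_form)
 define y' where "y' = y (h' - c)"
 have y': "y' * Q (\<alpha> g0 x) = A (Q x) * y'" if "x : M" for x using yx[OF that, of "h' - c"] that by (simp add: y'_def Qh')
 have [simp]: "y' : M" by (simp add: y'_def)
 define s where "s = T * y'"
 have [simp]: "s : M" by (simp add: s_def)
 have sx: "s * Q (\<alpha> g0 x) = H x * s" if "x : M" for x using that by (simp add: s_def assoc y' eq_tail[OF Tx])
 \<comment> \<open>The constituent \<open>y'\<close> cannot lie in \<open>A be\<close>, whose only
   constituent of this type has index \<open>h\<close>; so its component in \<open>X\<close> is
   nonzero.\<close>
 have s0: "s ~= 0"
 proof
  assume 0: "s = 0"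
  have "z * V * y' = 0" by (rule hom_zero(4)[of _ h' k c]) (simp_all add: assoc y' eq_tail[OF Vx] eq_tail[OF zx] flip: Qh' bex)
  moreover have "cadj w * V * y' = 0" by (rule hom_zero(2)[of _ h' k h]) (use hh in \<open>simp_all add: assoc y' eq_tail[OF Vx] eq_tail[OF w'x] Lbe flip: Qh'\<close>)
  ultimately have "V * y' = 0" using split[of "V * y'"] by simp
  hence "y' = 0" using arg_cong[OF one, of "%x. x * y'"] 0 by (simp add: P_def E_def s_def add_left scale_left assoc)
  thus False using y0 by (simp add: y'_def)
 qed
 \<comment> \<open>The nonzero module map from \<open>A Q \<alpha> g0\<close> to \<open>X\<close>
   induced by \<open>s\<close>. It will vanish on the summand \<open>X \<alpha> g0\<close> by
   invertibility, and on \<open>A be \<alpha> g0\<close> because \<open>X\<close> contains no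
   automorphism.\<close>
 define Z where "Z = l * A s"
 have "s : Hom (Q o \<alpha> g0) H" using sx by (simp add: intertwiners_def)
 note Z = cr.free_module_map[OF X_lmod this, folded Z_def]
 have Zm: "Z * m = l * A Z" and Zu: "Z * u = s" and Zx: "!!x. x : M ==> Z * A (Q (\<alpha> g0 x)) = H x * Z" using Z HomD(2)[OF Z(1)] by simp_all
 have [simp]: "Z : M" by (simp add: Z_def)
 have "f = 0" if "f : Hom (\<alpha> g0) A" for f
 proof -
  have [simp]: "f : M" and fx: "!!x. x : M ==> f * \<alpha> g0 x = A x * f" using that by (auto simp: intertwiners_def)
  have "z * f = 0" by (rule hom_zero(1)[of _ g0 0 0]) (use g0 in \<open>simp_all add: assoc fx eq_tail[OF zx] alpha_zero\<close>)
  moreover have "cadj w * f = 0" by (rule hom_zero(3)[of _ g0 0 g0]) (simp_all add: assoc fx eq_tail[OF w'x])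
  ultimately show ?thesis using split[of f] by simp
 qed
 hence "Hom (\<alpha> g0) A <= {0}" by blast
 hence ZG: "Z * G = 0" by (rule cr.invertible_hom_zero[OF inv])
   (simp_all add: X_endo endo_id assoc Gx eq_tail[OF Zx] G(2) cr.A_o eq_tail[OF Zm])
 have "Z * b = 0"
 proof (rule no_automorphism[of _ "c + (\<theta> ^^ k) g0"])
  show "(Z * b) * \<alpha> (c + (\<theta> ^^ k) g0) (Ga k x) = H x * Z * b" if x: "x : M" for x
  proof -
   have "\<alpha> (c + (\<theta> ^^ k) g0) (Ga k x) = be (\<alpha> g0 x)" using x by (simp add: bex normal_form)
   thus ?thesis using x by (simp add: assoc bx eq_tail[OF Zx])
  qed
 qed simp
 hence ZW: "Z * W = 0" using cr.module_map_free[of "Z * W" l] by (simp add: W(2,3) assoc eq_tail[OF Zm] cr.A_o)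
 have "Z = 0" using arg_cong[OF one, of "%x. Z * x"] by (simp add: P_def E_def add_right scale_right eq_tail[OF ZG] eq_tail[OF ZW])
 thus False using Zu s0 by simp
qed

end

end

lemma (in separable_algebra) invertible_nonzero: "\<not> invertible_object BB (None, l, r)"
proof
 assume "invertible_object BB (None, l, r)"
 then obtain Y \<psi> \<psi>' where X: "bim (None, l, r)" and Y: "bim Y" and i: "is_inverse BB (tens (None, l, r) Y) UU \<psi> \<psi>'"
  unfolding invertible_object_def isomorphic_def is_iso_def BB_simps by blast
 have \<psi>: "\<psi> : bmaps (tens (None, l, r) Y) UU" "\<psi> * \<psi>' = idb" using i by (simp_all add: is_inverse_BB BB_Idm)
 have "act (tob (None, l, r) Y) idb = 0" using tq_ts[OF X Y] tq_unit(2)[OF X Y] by simp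
 hence "\<psi> = 0" using bmapsD(6)[OF tens_bim[OF X Y] UU_bim \<psi>(1)] X Y by (simp add: tens_ob)
 thus False using \<psi>(2) by simp
qed

theorem (in dual_3G) noninvertible:
 assumes "!!h :: 'g. h + h = 0" "0 < k" "k < 3" "X : piece k" shows "\<not> invertible_object cr.BB X"
proof (cases X)
 case (fields X l r)
 show ?thesis
 proof (cases X)
  case None
  thus ?thesis using cr.invertible_nonzero by (simp add: fields)
 next
  case (Some H)
  thus ?thesis using not_homogeneous[of k H l r] assms by (auto simp: fields)
 qed
qed

theorem lemma3p31:
  fixes M :: "'h::complex_hilbert_space op set"
    and \<alpha> :: "bit \<times> bit \<Rightarrow> 'h op \<Rightarrow> 'h op"
    and \<rho> \<gamma> A :: "'h op \<Rightarrow> 'h op"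
    and \<theta> :: "bit \<times> bit \<Rightarrow> bit \<times> bit"
    and g :: "bit \<times> bit"
    and m u :: "'h op"
  assumes C: "subfactor_3G M \<alpha> \<rho>"
    and self_dual: "\<And>(\<beta> :: bit \<times> bit \<Rightarrow> 'h op \<Rightarrow> 'h op) \<sigma> B n v.
          \<lbrakk>subfactor_3G M \<beta> \<sigma>; q_system (even_part M \<beta> \<sigma>) (B, n, v); isometric_sum M B [id, \<sigma>]\<rbrakk>
          \<Longrightarrow> tensor_equivalent (bimodule_category (even_part M \<beta> \<sigma>) (Some B, n, v)) (even_part M \<beta> \<sigma>)"
    and theta: "bij \<theta>" "\<theta> 0 = 0" "\<And>h k. h \<noteq> 0 \<Longrightarrow> k \<noteq> 0 \<Longrightarrow> \<exists>i. (\<theta> ^^ i) h = k"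
    and gamma: "\<gamma> \<in> automorphisms M"
    and gamma_order: "\<exists>x\<in>M. \<gamma> x \<noteq> x" "\<And>x. x \<in> M \<Longrightarrow> \<gamma> (\<gamma> (\<gamma> x)) = x"
    and gamma_rho: "\<And>x. x \<in> M \<Longrightarrow> \<gamma> (\<rho> x) = \<rho> (\<gamma> x)"
    and gamma_alpha: "\<And>h x. x \<in> M \<Longrightarrow> \<gamma> (\<alpha> h x) = \<alpha> (\<theta> h) (\<gamma> x)"
    and g: "g \<noteq> 0"
    and A: "q_system (even_part M \<alpha> \<rho>) (A, m, u)" "isometric_sum M A [id, \<alpha> g \<circ> \<rho>]"
  shows "let C = even_part M \<alpha> \<rho>;
             C\<^sub>2 = crossed_product M \<alpha> \<rho> \<gamma>;
             C\<^sub>4 = bimodule_category C\<^sub>2 (Some A, m, u);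
             C\<^sub>4_component = bimodule_components C\<^sub>2 (Some A, m, u) (crossed_components M \<alpha> \<rho> \<gamma>)
         in graded_extension (integer_mod_group 3) C\<^sub>4 C\<^sub>4_component C \<and>
            (\<forall>k\<in>carrier (integer_mod_group 3) - {\<one>\<^bsub>integer_mod_group 3\<^esub>}.
               \<forall>X\<in>C\<^sub>4_component k. \<not> invertible_object C\<^sub>4 X)"
proof -
 interpret S: subfactor_3G M \<alpha> \<rho> by (rule C)
 have alg: "is_algebra S.even.CC (Some A, m, u)" using A(1) by (simp add: even_part_def)
 have eq: "tensor_equivalent (bimodule_category S.even.CC (Some A, m, u)) S.even.CC"
  using self_dual[OF S.subfactor_translate[OF A], unfolded S.even_part_translate, OF A] by (simp add: even_part_def)
 obtain dl where dl: "dl : S.Hom id (A o A)" "m * A dl = A m * dl" "m * dl = u" by (rule S.separability[OF alg eq])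
 interpret E: separable_algebra M S.evens A m u dl by (rule S.even_separable[OF alg dl])
 have L: "\<alpha> g o \<rho> : S.simples" by blast
 obtain L' ev et where d: "L' : S.evens" "S.dual_pair (\<alpha> g o \<rho>) L' ev et" using S.even_duals(1)[OF subsetD[OF S.simples_even L]] by blast
 have "t = 0" if "t : S.Hom id (\<alpha> g o \<rho>)" for t
 proof (rule ccontr)
  assume "t ~= 0"
  have t: "t : S.Hom (\<alpha> 0) (\<alpha> g o \<rho>)" using that by (simp add: intertwiners_def S.alpha_zero)
  obtain "isometric_sum M (\<alpha> g o \<rho>) [\<alpha> 0]" by (rule S.irreducible_iso[OF _ _ _ _ t \<open>t ~= 0\<close>]) (use S.simples_irreducible L in auto)
  then show False using S.alpha_not_rho S.unitary_symmetric[of "\<alpha> g o \<rho>" "\<alpha> 0"] by simp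
 qed
 then have zero: "S.Hom id (\<alpha> g o \<rho>) = {0}" by auto
 obtain ep where ep: "ep : S.Hom A id" "A ep * m * A dl = idb" "ep * m * A dl = idb"
  "S.Hom id A = range (%c. op_scale c u)" by (rule E.counit_exists[OF _ S.simples_irreducible[OF L] S.even.S_endoD[OF d(1)] d(2) zero A(2)]) simp
 \<comment> \<open>\<open>\<theta>\<close> acts transitively on the nonzero elements, and there are
   at least two of them.\<close>
 have theta_fixed: "h = 0" if h: "\<theta> h = h" for h
 proof (rule ccontr)
  assume "h ~= 0"
  moreover have "(\<theta> ^^ i) h = h" for i by (induction i) (simp_all add: h)
  ultimately have "k = h" if "k ~= 0" for k using theta(3)[of h k] that by auto
  from this[of "(1, 0)"] this[of "(0, 1)"] show False by (auto simp: zero_prod_def)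
 qed
 obtain v1 v2 where v: "cuntz_factor M v1 v2" by (rule S.cuntz_exists)
 interpret D: dual_3G M \<alpha> \<rho> \<gamma> \<theta> g v1 v2 A m u dl ep by (intro dual_3G.intro crossed_3G.intro crossed_3G_axioms.intro dual_3G_axioms.intro C v)
   (use gamma gamma_order gamma_rho gamma_alpha theta_fixed g alg A(2) dl ep in auto)
 have two: "h + h = 0" for h :: "bit \<times> bit" by (cases h) (simp add: zero_prod_def)
 have "\<not> invertible_object D.cr.BB X" if k: "k : carrier (integer_mod_group 3) - {\<one>\<^bsub>integer_mod_group 3\<^esub>}"
   and X: "X : bimodule_components D.cr.CC D.cr.AA (crossed_components M \<alpha> \<rho> \<gamma>) k" for k X
 proof (rule D.noninvertible[OF two])
  have k': "0 < nat k" "nat k < 3" "k = int (nat k)" using k by (auto simp: carrier_integer_mod_group one_integer_mod_group)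
  then show "0 < nat k" "nat k < 3" by blast+
  show "X : D.piece (nat k)" using X D.piece_eq[OF k'(2)] k'(3) by simp
 qed
 then show ?thesis using D.graded_extension[OF eq] by (simp add: Let_def crossed_product_def even_part_def)
qed

end
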